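(* Let $\alpha\in(0,2)$. Let $D=(a,b)\subset\mathbb{R}$ be a bounded open interval ($b-a<\infty$) when $d=1$, or let $D\subset\mathbb{R}^d$ be a bounded $C^{1,1}$ domain when $d\ge 2$. Define $$f_\alpha(t)=\begin{cases} t^{1/\alpha} & \text{if } \alpha\in(1,2),\\ t\ln(1/t) & \text{if } \alpha=1,\\ t & \text{if } \alpha\in(0,1).\end{cases}$$ Then $$\lim_{t\downarrow 0}\frac{|D|-\widetilde{Q}^{(\alpha)}_{D}(t)}{f_{\alpha}(t)}=\begin{cases}\frac{2}{\pi}\Gamma\left(1-\frac{1}{\alpha}\right)|\partial D|=\frac{2|\partial D|}{\sqrt{\pi}}\,\mathbb{E}\left[\left(S_{1}^{(\alpha/2)}\right)^{1/2}\right] & \text{if } 1<\alpha<2,\\[4pt] \frac{2}{\pi}|\partial D| & \text{if } \alpha=1,\\[4pt] \displaystyle\int_{0}^{\infty}\left(|D|-Q_{D}^{(2)}(u)\right)\frac{\alpha}{2\Gamma(1-\frac{\alpha}{2})}u^{-1-\frac{\alpha}{2}}\,du & \text{if } 0<\alpha<1.\end{cases}$$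
   Context: $|D|$ is the Lebesgue measure of $D$; $|\partial D|=2$ when $d=1$, and $|\partial D|$ is the surface measure of $\partial D$ when $d\ge2$. $W$ is a Brownian motion in $\mathbb{R}^d$ with generator $\Delta$ (not $\frac12\Delta$), and $\mathbb{P}_x$ is the law under which $W$ starts at $x$. $S^{(\alpha/2)}=(S^{(\alpha/2)}_t)_{t\ge0}$ is an $(\alpha/2)$-stable subordinator independent of $W$: a nondecreasing Lévy process with $S^{(\alpha/2)}_0=0$ and $\mathbb{E}[e^{-\lambda S^{(\alpha/2)}_t}]=e^{-t\lambda^{\alpha/2}}$ for $\lambda>0$, $t\ge0$. Let $\tau_D^{(2)}=\inf\{t>0: W_t\notin D\}$ be the first exit time of $W$ from $D$. The spectral heat content of $D$ for Brownian motion is $Q_D^{(2)}(t)=\int_D\mathbb{P}_x(\tau_D^{(2)}>t)\,dx$. Let $W^D$ be the Brownian motion $W$ killed upon exiting $D$; the subordinate killed Brownian motion is $Y^{D,(\alpha)}_t=W^D_{S^{(\alpha/2)}_t}$, and its spectral heat content is $$\widetilde{Q}^{(\alpha)}_D(t)=\int_D\mathbb{P}_x(Y^{D,(\alpha)}_t\in D)\,dx=\int_D\mathbb{P}_x\left(\tau_D^{(2)}>S^{(\alpha/2)}_t\right)dx .$$ An open set $D\subset\mathbb{R}^d$ ($d\ge2$) is a $C^{1,1}$ open set if there are $R_0>0$ and $\Lambda_0>0$ such that for every $z\in\partial D$ there exist a $C^{1,1}$ function $\psi=\psi_z:\mathbb{R}^{d-1}\to\mathbb{R}$ with $\psi(0)=0$,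 $\nabla\psi(0)=0$, $|\nabla\psi(x)-\nabla\psi(y)|\le\Lambda_0|x-y|$ for all $x,y$, and an orthonormal coordinate system $CS_z$, $y=(\tilde y,y_d)$ with $\tilde y=(y_1,\dots,y_{d-1})$, with origin at $z$, such that $B(z,R_0)\cap D=\{y=(\tilde y,y_d)\in B(0,R_0)\text{ in }CS_z: y_d>\psi(\tilde y)\}$. A domain is a connected open set. *)

theory Defs
  imports "HOL-Probability.Probability"
begin

section \<open>Processes\<close>

text \<open>Processes are functions of time and sample point; only times \<open>t \<ge> 0\<close> are relevant.\<close>

definition cadlag_path :: "(real \<Rightarrow> 'v::euclidean_space) \<Rightarrow> bool" where
  "cadlag_path p \<longleftrightarrow>
     (\<forall>t\<ge>0. (p \<longlongrightarrow> p t) (at_right t)) \<and> (\<forall>t>0. \<exists>l. (p \<longlongrightarrow> l) (at_left t))"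

definition levy_process :: "'a measure \<Rightarrow> (real \<Rightarrow> 'a \<Rightarrow> 'v::euclidean_space) \<Rightarrow> bool" where
  "levy_process M X \<longleftrightarrow>
     prob_space M \<and>
     (\<forall>t\<ge>0. X t \<in> borel_measurable M) \<and>
     (AE \<omega> in M. X 0 \<omega> = 0) \<and>
     (\<forall>n (t :: nat \<Rightarrow> real). 0 \<le> t 0 \<and> (\<forall>i<n. t i \<le> t (Suc i)) \<longrightarrow>
        prob_space.indep_vars M (\<lambda>_. borel) (\<lambda>i \<omega>. X (t (Suc i)) \<omega> - X (t i) \<omega>) {..<n}) \<and>
     (\<forall>s t. 0 \<le> s \<and> s \<le> t \<longrightarrow>
        distr M borel (\<lambda>\<omega>. X t \<omega> - X s \<omega>) = distr M borel (X (t - s))) \<and>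
     (AE \<omega> in M. cadlag_path (\<lambda>t. X t \<omega>))"

text \<open>
  Brownian motion started at \<open>x\<close> with generator the Laplacian (not half of it): the increment over
  a time span \<open>t\<close> has density \<open>(4 \<pi> t) powr (- d / 2) * exp (- |y|\<^sup>2 / (4 t))\<close>, i.e. covariance \<open>2t\<close> times the identity.
  All paths are continuous, so that exit times are measurable without completing the measure.
\<close>

definition brownian_motion ::
  "'a measure \<Rightarrow> 'v::euclidean_space \<Rightarrow> (real \<Rightarrow> 'a \<Rightarrow> 'v) \<Rightarrow> bool" where
  "brownian_motion M x W \<longleftrightarrow>
     levy_process M (\<lambda>t \<omega>. W t \<omega> - x) \<and>
     (\<forall>t>0. distributed M lborel (\<lambda>\<omega>. W t \<omega> - x)
        (\<lambda>y. ennreal ((4 * pi * t) powr (- real DIM('v) / 2) * exp (- (norm y)\<^sup>2 / (4 * t))))) \<and>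
     (\<forall>\<omega>\<in>space M. continuous_on {0..} (\<lambda>t. W t \<omega>))"

text \<open>
  \<open>S\<close> starts at 0 and is nondecreasing on the whole sample space, so that it is nonnegative
  everywhere and can serve as a random time.
\<close>

definition stable_subordinator :: "'a measure \<Rightarrow> real \<Rightarrow> (real \<Rightarrow> 'a \<Rightarrow> real) \<Rightarrow> bool" where
  "stable_subordinator M \<beta> S \<longleftrightarrow>
     levy_process M S \<and>
     (\<forall>\<omega>\<in>space M. S 0 \<omega> = 0 \<and> mono_on {0..} (\<lambda>t. S t \<omega>)) \<and>
     (\<forall>q>0. \<forall>t\<ge>0. (LINT \<omega>|M. exp (- q * S t \<omega>)) = exp (- t * q powr \<beta>))"

definition independent_processes ::
  "'a measure \<Rightarrow> (real \<Rightarrow> 'a \<Rightarrow> 'v::euclidean_space) \<Rightarrow> (real \<Rightarrow> 'a \<Rightarrow> 'w::euclidean_space) \<Rightarrow> bool"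
  where
  "independent_processes M X Y \<longleftrightarrow>
     prob_space.indep_set M
       (sets (vimage_algebra (space M) (\<lambda>\<omega>. \<lambda>t\<in>{0..}. X t \<omega>) (\<Pi>\<^sub>M t\<in>{0..}. borel)))
       (sets (vimage_algebra (space M) (\<lambda>\<omega>. \<lambda>t\<in>{0..}. Y t \<omega>) (\<Pi>\<^sub>M t\<in>{0..}. borel)))"

section \<open>Killing, subordination and spectral heat content\<close>

definition exit_time :: "'v set \<Rightarrow> (real \<Rightarrow> 'a \<Rightarrow> 'v) \<Rightarrow> 'a \<Rightarrow> ereal" where
  "exit_time D W \<omega> = Inf (ereal ` {t. t > 0 \<and> W t \<omega> \<notin> D})"

text \<open>\<open>None\<close> is the cemetery state.\<close>

definition killed :: "'v set \<Rightarrow> (real \<Rightarrow> 'a \<Rightarrow> 'v) \<Rightarrow> real \<Rightarrow> 'a \<Rightarrow> 'v option" where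
  "killed D W t \<omega> = (if ereal t < exit_time D W \<omega> then Some (W t \<omega>) else None)"

definition subordinate :: "(real \<Rightarrow> 'a \<Rightarrow> 'b) \<Rightarrow> (real \<Rightarrow> 'a \<Rightarrow> real) \<Rightarrow> real \<Rightarrow> 'a \<Rightarrow> 'b" where
  "subordinate X S t \<omega> = X (S t \<omega>) \<omega>"

text \<open>\<open>P x\<close> is the law under which \<open>W\<close> starts at \<open>x\<close>.\<close>

definition heat_content ::
  "('v::euclidean_space \<Rightarrow> 'a measure) \<Rightarrow> (real \<Rightarrow> 'a \<Rightarrow> 'v) \<Rightarrow> 'v set \<Rightarrow> real \<Rightarrow> real" where
  "heat_content P W D t =
     (LINT x:D|lborel. measure (P x) {\<omega> \<in> space (P x). exit_time D W \<omega> > ereal t})"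

definition subordinate_heat_content ::
  "('v::euclidean_space \<Rightarrow> 'a measure) \<Rightarrow> (real \<Rightarrow> 'a \<Rightarrow> 'v) \<Rightarrow> (real \<Rightarrow> 'a \<Rightarrow> real) \<Rightarrow>
     'v set \<Rightarrow> real \<Rightarrow> real" where
  "subordinate_heat_content P W S D t =
     (LINT x:D|lborel. measure (P x)
        {\<omega> \<in> space (P x). subordinate (killed D W) S t \<omega> \<in> Some ` D})"

section \<open>Boundary regularity and surface measure\<close>

text \<open>
  An orthonormal coordinate system with origin \<open>z\<close> enters only through the unit vector \<open>\<nu>\<close> of its
  last axis: the other axes identify \<open>(d - 1)\<close>-space isometrically with the hyperplane orthogonal to \<open>\<nu>\<close>, on
  which \<open>\<psi>\<close> lives (its values elsewhere are irrelevant), and a rotation of these axes affects none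
  of the conditions. The gradient \<open>G\<close> of \<open>\<psi>\<close> takes values in that hyperplane.
\<close>

definition C11_chart ::
  "'v::euclidean_space set \<Rightarrow> real \<Rightarrow> real \<Rightarrow> 'v \<Rightarrow> 'v \<Rightarrow> ('v \<Rightarrow> real) \<Rightarrow> ('v \<Rightarrow> 'v) \<Rightarrow> bool" where
  "C11_chart D R \<Lambda> z \<nu> \<psi> G \<longleftrightarrow>
     (let H = {v. v \<bullet> \<nu> = 0} in
      norm \<nu> = 1 \<and>
      (\<forall>x\<in>H. G x \<in> H \<and> (\<psi> has_derivative (\<lambda>h. G x \<bullet> h)) (at x within H)) \<and>
      \<psi> 0 = 0 \<and> G 0 = 0 \<and>
      (\<forall>x\<in>H. \<forall>y\<in>H. norm (G x - G y) \<le> \<Lambda> * norm (x - y)) \<and>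
      ball z R \<inter> D =
        {y \<in> ball z R. (y - z) \<bullet> \<nu> > \<psi> ((y - z) - ((y - z) \<bullet> \<nu>) *\<^sub>R \<nu>)})"

definition C11_open :: "'v::euclidean_space set \<Rightarrow> bool" where
  "C11_open D \<longleftrightarrow> open D \<and>
     (\<exists>R>0. \<exists>\<Lambda>>0. \<forall>z\<in>frontier D. \<exists>\<nu> \<psi> G. C11_chart D R \<Lambda> z \<nu> \<psi> G)"

text \<open>
  The surface measure is the \<open>(d - 1)\<close>-dimensional Hausdorff measure, normalised (by the volume of
  the ball of given diameter) so as to agree with Lebesgue measure on \<open>(d - 1)\<close>-dimensional planes.
  The empty set is singled out only for the sake of \<open>k = 0\<close>.
\<close>

definition hausdorff_pre :: "nat \<Rightarrow> real \<Rightarrow> 'v::metric_space set \<Rightarrow> ennreal" where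
  "hausdorff_pre k \<delta> A =
     Inf {(\<Sum>n. if U n = {} then 0
                else ennreal (unit_ball_vol (real k) * (diameter (U n) / 2) ^ k)) | U :: nat \<Rightarrow> 'v set.
          A \<subseteq> (\<Union>n. U n) \<and> (\<forall>n. bounded (U n) \<and> diameter (U n) \<le> \<delta>)}"

definition hausdorff_measure :: "nat \<Rightarrow> 'v::metric_space set \<Rightarrow> ennreal" where
  "hausdorff_measure k A = (SUP \<delta>\<in>{0<..}. hausdorff_pre k \<delta> A)"

definition boundary_measure :: "'v::euclidean_space set \<Rightarrow> real" where
  "boundary_measure D =
     (if DIM('v) = 1 then 2 else enn2real (hausdorff_measure (DIM('v) - 1) (frontier D)))"

section \<open>The rate function\<close>

definition rate :: "real \<Rightarrow> real \<Rightarrow> real" where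
  "rate \<alpha> t = (if \<alpha> > 1 then t powr (1 / \<alpha>) else if \<alpha> = 1 then t * ln (1 / t) else t)"

end

theory Submission
  imports Defs
begin

text \<open>
  Write \<open>H u\<close> for the heat lost by the killed Brownian motion up to time \<open>u\<close>, that is, for the
  integral over starting points \<open>y\<close> in \<open>D\<close> of the probability that \<open>W\<close> leaves \<open>D\<close> by time \<open>u\<close>.
  Then \<open>|D| - Q u = H u\<close>, and since \<open>W\<close> and \<open>S\<close> are independent, the heat lost by the subordinate
  killed motion is the average of \<open>H\<close> under the law of \<open>S t\<close>. So the theorem has two halves: the
  behaviour of \<open>H\<close> near 0, and the effect of averaging a function of this kind over stable laws.

  The first half is \<open>H u / sqrt u \<longlongrightarrow> 2 |\<partial>D| / sqrt pi\<close>. Over a short time, a Brownian path that starts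
  at depth \<open>\<delta>\<close> below the boundary leaves \<open>D\<close> essentially when its component along the outward normal
  exceeds \<open>\<delta>\<close>. Balls of a fixed radius that touch the boundary from inside and from outside make this
  precise: outside an event of probability \<open>O(u)\<close>, the exact threshold differs from \<open>\<delta>\<close> by
  \<open>O(u powr (3/4))\<close>, which is small compared with \<open>sqrt u\<close>. By the reflection principle the maximum of
  a component has the law of \<open>|Z|\<close> for a centred Gaussian \<open>Z\<close> of variance \<open>2 u\<close>, and Fubini turns
  \<open>H u\<close> into the mean of the volume of the collar of width \<open>|Z|\<close>. Collars of width \<open>r\<close> have volume
  \<open>r |\<partial>D| + o(r)\<close>, and \<open>|Z|\<close> has mean \<open>2 sqrt u / sqrt pi\<close>. See \<open>exit_bounds\<close>, \<open>layer_swap\<close> and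
  \<open>exit_mass_limit\<close>.

  The volume of collars is compared with the surface measure, which is a Hausdorff measure, by
  cutting the boundary into small pieces. Over a small piece, the collar is an almost isometric copy of the
  product of the orthogonal projection of the piece to its tangent plane with an interval. What
  remains is that on Euclidean space the Hausdorff measure of full dimension is Lebesgue measure:
  covering theorems of Vitali give one inequality, the isodiametric inequality gives the other.

  In the second half, a function that behaves like \<open>c * sqrt s\<close> near 0 is averaged over laws that are
  known through their Laplace transforms \<open>exp (- t * q powr \<beta>)\<close>, with \<open>\<beta> = \<alpha> / 2\<close>. For
  \<open>\<beta> \<ge> 1/2\<close> it is enough to average one bounded function with square-root growth at 0, and the function
  \<open>cut_root\<close>, a mixture of the functions \<open>1 - exp (- q * s)\<close>, has an average that can be computed from the
  Laplace transform; all other contributions are \<open>O(t)\<close> and hence negligible against the rate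
  (\<open>subordinated_limit_root\<close>). For \<open>\<beta> < 1/2\<close> the root is integrable near 0 against the Levy measure,
  and the averages divided by \<open>t\<close> converge to the integral of \<open>H\<close> against that measure, because the
  laws divided by \<open>t\<close> do (\<open>subordinated_limit_levy\<close>).
\<close>

section \<open>The isodiametric inequality\<close>

definition box_family :: "'a::euclidean_space set set \<Rightarrow> bool" where
  "box_family \<A> \<longleftrightarrow> finite \<A> \<and> (\<forall>S\<in>\<A>. \<exists>a b. S = cbox a b) \<and>
     pairwise (\<lambda>S T. interior S \<inter> interior T = {}) \<A>"

lemma box_family_compact: "box_family \<A> \<Longrightarrow> compact (\<Union>\<A>)"
  unfolding box_family_def by (intro compact_Union) auto

lemma box_family_mono: "box_family \<A> \<Longrightarrow> \<B> \<subseteq> \<A> \<Longrightarrow> box_family \<B>"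
  unfolding box_family_def using finite_subset[of \<B> \<A>] pairwise_subset[of _ \<A> \<B>] by auto

lemma box_family_cut:
  fixes \<A> :: "'a::euclidean_space set set"
  assumes "box_family \<A>" "i \<in> Basis"
  shows "box_family ((\<lambda>S. S \<inter> {x. x \<bullet> i \<le> c}) ` \<A>)" "box_family ((\<lambda>S. S \<inter> {x. c \<le> x \<bullet> i}) ` \<A>)"
proof -
  have *: "box_family ((\<lambda>S. S \<inter> H) ` \<A>)"
    if "\<And>a b. \<exists>u v. cbox a b \<inter> H = cbox u v" for H :: "'a set"
    unfolding box_family_def
  proof (intro conjI ballI)
    show "finite ((\<lambda>S. S \<inter> H) ` \<A>)" using assms(1) unfolding box_family_def by auto
    fix S assume "S \<in> (\<lambda>S. S \<inter> H) ` \<A>"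
    then obtain T where T: "T \<in> \<A>" "S = T \<inter> H" by auto
    moreover obtain a b where "T = cbox a b" using T(1) assms(1) unfolding box_family_def by auto
    ultimately show "\<exists>a b. S = cbox a b" using that[of a b] by auto
  next
    show "pairwise (\<lambda>S T. interior S \<inter> interior T = {}) ((\<lambda>S. S \<inter> H) ` \<A>)"
    proof (clarsimp simp: pairwise_def)
      fix S T assume "S \<in> \<A>" "T \<in> \<A>" "S \<inter> H \<noteq> T \<inter> H"
      then have "interior S \<inter> interior T = {}"
        using assms(1) unfolding box_family_def pairwise_def by (metis (no_types))
      then show "interior S \<inter> interior H \<inter> (interior T \<inter> interior H) = {}" by blast
    qed
  qed
  show "box_family ((\<lambda>S. S \<inter> {x. x \<bullet> i \<le> c}) ` \<A>)"
    by (rule *, intro exI, rule interval_split(1)[OF assms(2)])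
  show "box_family ((\<lambda>S. S \<inter> {x. c \<le> x \<bullet> i}) ` \<A>)"
    by (rule *, intro exI, rule interval_split(2)[OF assms(2)])
qed

lemma negligible_basis_hyperplane: "i \<in> Basis \<Longrightarrow> negligible {x::'a::euclidean_space. x \<bullet> i = c}"
  using negligible_hyperplane[of i c] by (auto simp: inner_commute nonzero_Basis)

lemma continuous_measure_halfspace:
  fixes S :: "'a::euclidean_space set"
  assumes S: "S \<in> lmeasurable" and i: "i \<in> Basis"
  shows "continuous_on UNIV (\<lambda>c. measure lebesgue (S \<inter> {x. x \<bullet> i \<le> c}))"
proof (rule continuous_on_sequentiallyI)
  fix u :: "nat \<Rightarrow> real" and c assume u: "u \<longlonglongrightarrow> c"
  have m: "S \<inter> {x. x \<bullet> i \<le> c} \<in> lmeasurable" for c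
    using S by (intro fmeasurable_Int_fmeasurable) (auto intro!: borel_closed closed_halfspace_component_le)
  have eq: "measure lebesgue (S \<inter> {x. x \<bullet> i \<le> c}) = (LINT x|lebesgue. indicat_real (S \<inter> {x. x \<bullet> i \<le> c}) x)" for c
    using m[of c] by (simp add: fmeasurable_def)
  have ae: "AE x in lebesgue. x \<notin> {x. x \<bullet> i = c}"
    using negligible_basis_hyperplane[OF i, of c] by (intro AE_not_in) (simp add: negligible_iff_null_sets)
  show "(\<lambda>n. measure lebesgue (S \<inter> {x. x \<bullet> i \<le> u n})) \<longlonglongrightarrow> measure lebesgue (S \<inter> {x. x \<bullet> i \<le> c})"
    unfolding eq
  proof (rule integral_dominated_convergence[where w="indicator S"])
    show "AE x in lebesgue. (\<lambda>n. indicat_real (S \<inter> {x. x \<bullet> i \<le> u n}) x) \<longlonglongrightarrow> indicat_real (S \<inter> {x. x \<bullet> i \<le> c}) x"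
      using ae
    proof eventually_elim
      case (elim x)
      have "eventually (\<lambda>n. indicat_real (S \<inter> {x. x \<bullet> i \<le> u n}) x = indicat_real (S \<inter> {x. x \<bullet> i \<le> c}) x) sequentially"
      proof (cases "x \<bullet> i < c")
        case True
        from order_tendstoD(1)[OF u this] show ?thesis
          by eventually_elim (use True in \<open>auto simp: indicator_def\<close>)
      next
        case False
        then have "c < x \<bullet> i" using elim by auto
        from order_tendstoD(2)[OF u this] show ?thesis
          by eventually_elim (use False elim in \<open>auto simp: indicator_def\<close>)
      qed
      then show ?case by (rule tendsto_eventually)
    qed
  qed (use S m in \<open>auto simp: indicator_def fmeasurable_def integrable_indicator_iff intro!: borel_measurable_indicator\<close>)
qed

text \<open>
  The measure of the part below a hyperplane is continuous in its level, so every proportion is attained.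
\<close>

lemma bisect_measure:
  fixes S :: "'a::euclidean_space set"
  assumes S: "compact S" and i: "i \<in> Basis" and \<theta>: "0 \<le> \<theta>" "\<theta> \<le> 1"
  obtains c where "measure lebesgue (S \<inter> {x. x \<bullet> i \<le> c}) = \<theta> * measure lebesgue S"
proof -
  obtain L where L: "\<And>x. x \<in> S \<Longrightarrow> norm x \<le> L"
    using compact_imp_bounded[OF S] by (auto simp: bounded_iff)
  define M where "M = \<bar>L\<bar> + 1"
  have M: "\<bar>x \<bullet> i\<bar> < M" if "x \<in> S" for x
    using Basis_le_norm[OF i, of x] L[OF that] unfolding M_def by linarith
  let ?f = "\<lambda>c. measure lebesgue (S \<inter> {x. x \<bullet> i \<le> c})"
  have 0: "S \<inter> {x. x \<bullet> i \<le> - M} = {}" using M by fastforce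
  have 1: "S \<inter> {x. x \<bullet> i \<le> M} = S" using M by fastforce
  have "\<exists>c. - M \<le> c \<and> c \<le> M \<and> ?f c = \<theta> * measure lebesgue S"
  proof (rule IVT')
    show "?f (- M) \<le> \<theta> * measure lebesgue S" using 0 \<theta> by simp
    show "\<theta> * measure lebesgue S \<le> ?f M" using 1 \<theta> by (simp add: mult_left_le_one_le)
    show "- M \<le> M" by (simp add: M_def)
    show "continuous_on {- M..M} ?f"
      using continuous_measure_halfspace[OF lmeasurable_compact[OF S] i] continuous_on_subset by blast
  qed
  then show ?thesis using that by blast
qed

text \<open>
  For boxes the sumset is the box with added side lengths, and
  \<open>2 sqrt (x y) \<le> x + y\<close> applies in every direction.
\<close>

lemma measure_sumset_cbox:
  fixes a b c d :: "'a::euclidean_space"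
  shows "2 ^ DIM('a) * sqrt (measure lebesgue (cbox a b) * measure lebesgue (cbox c d))
     \<le> measure lebesgue {x + y | x y. x \<in> cbox a b \<and> y \<in> cbox c d}"
proof (cases "cbox a b = {} \<or> cbox c d = {}")
  case True then show ?thesis by auto
next
  case False
  then have ab: "\<And>i. i \<in> Basis \<Longrightarrow> a \<bullet> i \<le> b \<bullet> i" and cd: "\<And>i. i \<in> Basis \<Longrightarrow> c \<bullet> i \<le> d \<bullet> i"
    by (auto simp: box_ne_empty)
  have sub: "cbox (a + c) (b + d) \<subseteq> {x + y | x y. x \<in> cbox a b \<and> y \<in> cbox c d}"
  proof
    fix z assume z: "z \<in> cbox (a + c) (b + d)"
    define x where "x = (\<Sum>i\<in>Basis. max (a \<bullet> i) (z \<bullet> i - d \<bullet> i) *\<^sub>R i)"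
    have xi: "x \<bullet> i = max (a \<bullet> i) (z \<bullet> i - d \<bullet> i)" if "i \<in> Basis" for i
      using that unfolding x_def by simp
    have zi: "a \<bullet> i + c \<bullet> i \<le> z \<bullet> i" "z \<bullet> i \<le> b \<bullet> i + d \<bullet> i" if "i \<in> Basis" for i
      using z that by (auto simp: mem_box inner_add_left)
    have "x \<in> cbox a b" unfolding mem_box
    proof
      fix i :: 'a assume i: "i \<in> Basis"
      show "a \<bullet> i \<le> x \<bullet> i \<and> x \<bullet> i \<le> b \<bullet> i" unfolding xi[OF i] using zi[OF i] ab[OF i] by (simp add: max_def)
    qed
    moreover have "z - x \<in> cbox c d" unfolding mem_box
    proof
      fix i :: 'a assume i: "i \<in> Basis"
      show "c \<bullet> i \<le> (z - x) \<bullet> i \<and> (z - x) \<bullet> i \<le> d \<bullet> i"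
        unfolding inner_diff_left xi[OF i] using zi[OF i] cd[OF i] by (simp add: max_def)
    qed
    moreover have "z = x + (z - x)" by simp
    ultimately show "z \<in> {x + y | x y. x \<in> cbox a b \<and> y \<in> cbox c d}" by blast
  qed
  have s: "sqrt (\<Prod>i\<in>F. f i) = (\<Prod>i\<in>F. sqrt (f i))" if "finite F" for f :: "'a \<Rightarrow> real" and F
    using that by induction (auto simp: real_sqrt_mult)
  have ne: "cbox (a + c) (b + d) \<noteq> {}"
    using ab cd by (auto simp: box_ne_empty inner_add_left intro: add_mono)
  have "2 ^ DIM('a) * sqrt (measure lebesgue (cbox a b) * measure lebesgue (cbox c d))
      = (\<Prod>i\<in>(Basis::'a set). 2 * sqrt ((b \<bullet> i - a \<bullet> i) * (d \<bullet> i - c \<bullet> i)))"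
    using False by (simp add: content_cbox' prod.distrib[symmetric] s) (simp add: prod.distrib)
  also have "\<dots> \<le> (\<Prod>i\<in>(Basis::'a set). (b + d) \<bullet> i - (a + c) \<bullet> i)"
  proof (intro prod_mono conjI)
    fix i :: 'a assume i: "i \<in> Basis"
    show "0 \<le> 2 * sqrt ((b \<bullet> i - a \<bullet> i) * (d \<bullet> i - c \<bullet> i))" using ab[OF i] cd[OF i] by simp
    show "2 * sqrt ((b \<bullet> i - a \<bullet> i) * (d \<bullet> i - c \<bullet> i)) \<le> (b + d) \<bullet> i - (a + c) \<bullet> i"
      using arith_geo_mean_sqrt[of "b \<bullet> i - a \<bullet> i" "d \<bullet> i - c \<bullet> i"] ab[OF i] cd[OF i]
      by (simp add: inner_add_left)
  qed
  also have "\<dots> = measure lebesgue (cbox (a + c) (b + d))" using ne by (simp add: content_cbox')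
  also have "\<dots> \<le> measure lebesgue {x + y | x y. x \<in> cbox a b \<and> y \<in> cbox c d}"
    by (intro measure_mono_fmeasurable sub) (auto intro!: lmeasurable_compact compact_sums compact_imp_closed borel_closed)
  finally show ?thesis .
qed

text \<open>
  The Brunn-Minkowski inequality for the midpoint, in its multiplicative form: the measure of the set of
  midpoints is at least the geometric mean of the measures.
\<close>

definition midpoint_bm :: "'a::euclidean_space set \<Rightarrow> 'a set \<Rightarrow> bool" where
  "midpoint_bm A B \<longleftrightarrow> 2 ^ DIM('a) * sqrt (measure lebesgue A * measure lebesgue B)
     \<le> measure lebesgue {x + y | x y. x \<in> A \<and> y \<in> B}"

lemma midpoint_bm_commute: "midpoint_bm A B \<longleftrightarrow> midpoint_bm B A"
proof -
  have "{x + y | x y. x \<in> A \<and> y \<in> B} = {x + y | x y. x \<in> B \<and> y \<in> A}"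
    by (auto; metis add.commute)
  then show ?thesis unfolding midpoint_bm_def by (simp add: mult.commute)
qed

text \<open>
  The sumset of the lower parts and that of the upper parts lie on different sides of the level
  \<open>c + c'\<close>, so their measures add up. As both sets are split in the same proportion
  \<open>\<theta>\<close>, so are the geometric means. The bound \<open>m\<close> stands for the sum of the
  measures of the parts of \<open>A\<close>.
\<close>

lemma midpoint_bm_glue:
  fixes A B A1 A2 B1 B2 :: "'a::euclidean_space set"
  assumes comp: "compact A" "compact B" "compact A1" "compact A2" "compact B1" "compact B2"
    and sub: "A1 \<subseteq> A" "A2 \<subseteq> A" "B1 \<subseteq> B" "B2 \<subseteq> B"
    and i: "i \<in> Basis"
    and sep: "\<And>x. x \<in> A1 \<Longrightarrow> x \<bullet> i \<le> c" "\<And>x. x \<in> A2 \<Longrightarrow> c \<le> x \<bullet> i"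
      "\<And>x. x \<in> B1 \<Longrightarrow> x \<bullet> i \<le> c'" "\<And>x. x \<in> B2 \<Longrightarrow> c' \<le> x \<bullet> i"
    and A: "measure lebesgue A \<le> m" "measure lebesgue A1 = \<theta> * m" "measure lebesgue A2 = (1 - \<theta>) * m"
    and B: "\<theta> * measure lebesgue B \<le> measure lebesgue B1" "(1 - \<theta>) * measure lebesgue B \<le> measure lebesgue B2"
    and \<theta>: "0 \<le> \<theta>" "\<theta> \<le> 1"
    and bm: "midpoint_bm A1 B1" "midpoint_bm A2 B2"
  shows "midpoint_bm A B"
proof -
  let ?S = "\<lambda>A B. {x + y | x y. x \<in> A \<and> y \<in> (B::'a set)}"
  let ?\<mu> = "measure lebesgue :: 'a set \<Rightarrow> real"
  have cS: "?S A B \<in> lmeasurable" "?S A1 B1 \<in> lmeasurable" "?S A2 B2 \<in> lmeasurable"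
    using comp by (auto intro!: lmeasurable_compact compact_sums)
  have m0: "0 \<le> m" using A(1) measure_nonneg[of lebesgue A] by linarith
  have "?S A1 B1 \<inter> ?S A2 B2 \<subseteq> {x. x \<bullet> i = c + c'}"
  proof clarify
    fix x1 y1 x2 y2 assume "x1 + y1 = x2 + y2" "x1 \<in> A1" "y1 \<in> B1" "x2 \<in> A2" "y2 \<in> B2"
    then show "(x1 + y1) \<bullet> i = c + c'"
      using sep(1)[of x1] sep(2)[of x2] sep(3)[of y1] sep(4)[of y2]
      by (smt (verit) inner_add_left)
  qed
  then have "negligible (?S A1 B1 \<inter> ?S A2 B2)"
    using negligible_basis_hyperplane[OF i] negligible_subset by blast
  then have un: "?\<mu> (?S A1 B1 \<union> ?S A2 B2) = ?\<mu> (?S A1 B1) + ?\<mu> (?S A2 B2)"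
    using measure_Un3[OF cS(2,3)] by (simp add: negligible_imp_measure0)
  have 1: "\<theta> * sqrt (?\<mu> A * ?\<mu> B) \<le> sqrt (?\<mu> A1 * ?\<mu> B1)"
  proof -
    have "\<theta> * sqrt (?\<mu> A * ?\<mu> B) = sqrt ((\<theta> * ?\<mu> A) * (\<theta> * ?\<mu> B))"
      using \<theta> by (simp add: real_sqrt_mult)
    also have "\<dots> \<le> sqrt (?\<mu> A1 * ?\<mu> B1)"
      unfolding A(2) using A(1) B(1) \<theta> m0 by (intro real_sqrt_le_mono mult_mono) auto
    finally show ?thesis .
  qed
  have 2: "(1 - \<theta>) * sqrt (?\<mu> A * ?\<mu> B) \<le> sqrt (?\<mu> A2 * ?\<mu> B2)"
  proof -
    have "(1 - \<theta>) * sqrt (?\<mu> A * ?\<mu> B) = sqrt (((1 - \<theta>) * ?\<mu> A) * ((1 - \<theta>) * ?\<mu> B))"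
      using \<theta> by (simp add: real_sqrt_mult)
    also have "\<dots> \<le> sqrt (?\<mu> A2 * ?\<mu> B2)"
      unfolding A(3) using A(1) B(2) \<theta> m0 by (intro real_sqrt_le_mono mult_mono) auto
    finally show ?thesis .
  qed
  have "2 ^ DIM('a) * sqrt (?\<mu> A * ?\<mu> B)
      = 2 ^ DIM('a) * (\<theta> * sqrt (?\<mu> A * ?\<mu> B)) + 2 ^ DIM('a) * ((1 - \<theta>) * sqrt (?\<mu> A * ?\<mu> B))"
    by (simp add: algebra_simps)
  also have "\<dots> \<le> 2 ^ DIM('a) * sqrt (?\<mu> A1 * ?\<mu> B1) + 2 ^ DIM('a) * sqrt (?\<mu> A2 * ?\<mu> B2)"
    using 1 2 by (intro add_mono mult_left_mono) auto
  also have "\<dots> \<le> ?\<mu> (?S A1 B1) + ?\<mu> (?S A2 B2)" using bm unfolding midpoint_bm_def by linarith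
  also have "\<dots> = ?\<mu> (?S A1 B1 \<union> ?S A2 B2)" using un by simp
  also have "\<dots> \<le> ?\<mu> (?S A B)"
    using sub cS by (intro measure_mono_fmeasurable) (blast, auto)
  finally show ?thesis unfolding midpoint_bm_def .
qed

text \<open>
  The argument of Hadwiger and Ohmann: two boxes with disjoint interiors are separated by a coordinate
  hyperplane, so on either side of it one box of the first family disappears. The second family is cut by a
  parallel hyperplane in the same proportion, and induction applies on both sides.
\<close>

lemma midpoint_bm_split_step:
  fixes \<A> \<B> :: "'a::euclidean_space set set"
  assumes fam: "box_family \<A>" "box_family \<B>" and two: "2 \<le> card \<A>"
    and IH: "\<And>(\<A>'::'a set set) (\<B>'::'a set set). box_family \<A>' \<Longrightarrow> box_family \<B>' \<Longrightarrow> card \<A>' < card \<A> \<Longrightarrow>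
         card \<B>' \<le> card \<B> \<Longrightarrow> midpoint_bm (\<Union>\<A>') (\<Union>\<B>')"
  shows "midpoint_bm (\<Union>\<A>) (\<Union>\<B>)"
proof (cases "\<exists>S\<in>\<A>. negligible S")
  case True
  then obtain S where S: "S \<in> \<A>" "negligible S" by blast
  have fin: "finite \<A>" using fam(1) unfolding box_family_def by blast
  have "\<Union>\<A> - \<Union>(\<A> - {S}) \<union> (\<Union>(\<A> - {S}) - \<Union>\<A>) \<subseteq> S" by auto
  then have eq: "measure lebesgue (\<Union>(\<A> - {S})) = measure lebesgue (\<Union>\<A>)"
    using S(2) box_family_compact[OF fam(1)]
    by (intro measure_negligible_symdiff) (auto intro: lmeasurable_compact negligible_subset)
  have f': "box_family (\<A> - {S})" by (rule box_family_mono[OF fam(1) Diff_subset])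
  have "midpoint_bm (\<Union>(\<A> - {S})) (\<Union>\<B>)"
    using card_Diff1_less[OF fin S(1)] by (intro IH f' fam(2)) auto
  moreover have "measure lebesgue {x + y | x y. x \<in> \<Union>(\<A> - {S}) \<and> y \<in> \<Union>\<B>}
     \<le> measure lebesgue {x + y | x y. x \<in> \<Union>\<A> \<and> y \<in> \<Union>\<B>}"
    using box_family_compact[OF fam(1)] box_family_compact[OF f'] box_family_compact[OF fam(2)]
    by (intro measure_mono_fmeasurable fmeasurableD lmeasurable_compact compact_sums) auto
  ultimately show ?thesis unfolding midpoint_bm_def eq by linarith
next
  case False
  have fin: "finite \<A>" "finite \<B>" using fam unfolding box_family_def by blast+
  obtain S T where ST: "S \<in> \<A>" "T \<in> \<A>" "S \<noteq> T"
    using two by (metis card_le_Suc0_iff_eq fin(1) not_less_eq_eq numeral_2_eq_2)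
  obtain a b c d where bx: "S = cbox a b" "T = cbox c d"
    using ST fam(1) unfolding box_family_def by metis
  have "interior S \<inter> interior T = {}" using ST fam(1) unfolding box_family_def pairwise_def by blast
  then have "box a b \<inter> box c d = {}" using bx by simp
  moreover have "box a b \<noteq> {}" "box c d \<noteq> {}"
    using False ST bx negligible_interval by blast+
  ultimately obtain i where i: "i \<in> Basis" and dis: "b \<bullet> i \<le> c \<bullet> i \<or> d \<bullet> i \<le> a \<bullet> i"
    unfolding disjoint_interval(4) box_ne_empty(2) by fastforce
  have "\<exists>S T c. S \<in> \<A> \<and> T \<in> \<A> \<and> S \<noteq> T \<and> (\<forall>x\<in>S. x \<bullet> i \<le> c) \<and> (\<forall>x\<in>T. c \<le> x \<bullet> i)"
    using dis
  proof
    assume "b \<bullet> i \<le> c \<bullet> i"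
    then have "\<forall>x\<in>S. x \<bullet> i \<le> c \<bullet> i" "\<forall>x\<in>T. c \<bullet> i \<le> x \<bullet> i"
      using bx i by (auto simp: mem_box dest!: bspec[of Basis _ i])
    then show ?thesis using ST by blast
  next
    assume "d \<bullet> i \<le> a \<bullet> i"
    then have "\<forall>x\<in>T. x \<bullet> i \<le> a \<bullet> i" "\<forall>x\<in>S. a \<bullet> i \<le> x \<bullet> i"
      using bx i by (auto simp: mem_box dest!: bspec[of Basis _ i])
    then show ?thesis using ST by metis
  qed
  then obtain S1 S2 c where SS: "S1 \<in> \<A>" "S2 \<in> \<A>" "S1 \<noteq> S2"
    and S1: "\<And>x. x \<in> S1 \<Longrightarrow> x \<bullet> i \<le> c" and S2: "\<And>x. x \<in> S2 \<Longrightarrow> c \<le> x \<bullet> i" by blast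
  \<comment> \<open>Dropping the box on the wrong side loses only a null set and makes the family smaller.\<close>
  define A1 where "A1 = (\<lambda>S. S \<inter> {x. x \<bullet> i \<le> c}) ` (\<A> - {S2})"
  define A2 where "A2 = (\<lambda>S. S \<inter> {x. c \<le> x \<bullet> i}) ` (\<A> - {S1})"
  let ?\<mu> = "measure lebesgue :: 'a set \<Rightarrow> real"
  define m where "m = ?\<mu> (\<Union>A1) + ?\<mu> (\<Union>A2)"
  have fA: "box_family A1" "box_family A2" unfolding A1_def A2_def
    using fam(1) i box_family_cut box_family_mono[of \<A>] by (metis Diff_subset)+
  have cA: "card A1 < card \<A>" "card A2 < card \<A>"
    unfolding A1_def A2_def using SS fin card_image_le[of "\<A> - {S2}"] card_image_le[of "\<A> - {S1}"]
    by (meson card_Diff1_less finite_Diff le_less_trans)+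
  have lA: "\<Union>A1 \<in> lmeasurable" "\<Union>A2 \<in> lmeasurable" "\<Union>\<A> \<in> lmeasurable"
    using fA fam(1) by (auto intro: lmeasurable_compact box_family_compact)
  have hyp: "negligible {x::'a. x \<bullet> i = c}" using i by (rule negligible_basis_hyperplane)
  have cov: "\<Union>\<A> \<subseteq> (\<Union>A1 \<union> \<Union>A2) \<union> {x. x \<bullet> i = c}"
  proof
    fix x assume "x \<in> \<Union>\<A>"
    then obtain S where x: "x \<in> S" "S \<in> \<A>" by blast
    consider "x \<bullet> i < c" | "c < x \<bullet> i" | "x \<bullet> i = c" by linarith
    then show "x \<in> (\<Union>A1 \<union> \<Union>A2) \<union> {x. x \<bullet> i = c}"
    proof cases
      case 1
      then have "S \<noteq> S2" using S2[of x] x by auto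
      then have "x \<in> \<Union>A1" using 1 x unfolding A1_def by auto
      then show ?thesis by blast
    next
      case 2
      then have "S \<noteq> S1" using S1[of x] x by auto
      then have "x \<in> \<Union>A2" using 2 x unfolding A2_def by auto
      then show ?thesis by blast
    qed auto
  qed
  have mA: "?\<mu> (\<Union>\<A>) \<le> m"
  proof -
    have hl: "{x::'a. x \<bullet> i = c} \<in> lmeasurable" using hyp by (rule negligible_imp_measurable)
    have "?\<mu> (\<Union>\<A>) \<le> ?\<mu> ((\<Union>A1 \<union> \<Union>A2) \<union> {x. x \<bullet> i = c})"
      using cov lA hl by (intro measure_mono_fmeasurable) (auto intro: fmeasurable.Un)
    also have "\<dots> \<le> ?\<mu> (\<Union>A1 \<union> \<Union>A2) + ?\<mu> {x. x \<bullet> i = c}"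
      using lA hl by (intro measure_Un_le) auto
    also have "\<dots> \<le> m" unfolding m_def negligible_imp_measure0[OF hyp]
      using measure_Un_le[OF fmeasurableD[OF lA(1)] fmeasurableD[OF lA(2)]] by linarith
    finally show ?thesis .
  qed
  show ?thesis
  proof (cases "?\<mu> (\<Union>\<A>) = 0")
    case True
    then show ?thesis unfolding midpoint_bm_def by simp
  next
    case False
    then have m: "m > 0" using mA measure_nonneg[of lebesgue "\<Union>\<A>"] by linarith
    \<comment> \<open>The common proportion in which both families are split.\<close>
    define \<theta> where "\<theta> = ?\<mu> (\<Union>A1) / m"
    have \<theta>: "0 \<le> \<theta>" "\<theta> \<le> 1" using m unfolding \<theta>_def m_def by auto
    obtain c' where c': "?\<mu> (\<Union>\<B> \<inter> {x. x \<bullet> i \<le> c'}) = \<theta> * ?\<mu> (\<Union>\<B>)"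
      using bisect_measure[OF box_family_compact[OF fam(2)] i \<theta>] .
    define B1 where "B1 = (\<lambda>S. S \<inter> {x. x \<bullet> i \<le> c'}) ` \<B>"
    define B2 where "B2 = (\<lambda>S. S \<inter> {x. c' \<le> x \<bullet> i}) ` \<B>"
    have fB: "box_family B1" "box_family B2" unfolding B1_def B2_def using fam(2) i box_family_cut by blast+
    have cB: "card B1 \<le> card \<B>" "card B2 \<le> card \<B>" unfolding B1_def B2_def using fin by (auto intro: card_image_le)
    have uB: "\<Union>B1 = \<Union>\<B> \<inter> {x. x \<bullet> i \<le> c'}" "\<Union>B2 = \<Union>\<B> \<inter> {x. c' \<le> x \<bullet> i}"
      unfolding B1_def B2_def by auto
    have lB: "\<Union>B1 \<in> lmeasurable" "\<Union>B2 \<in> lmeasurable" "\<Union>\<B> \<in> lmeasurable"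
      using fB fam(2) by (auto intro: lmeasurable_compact box_family_compact)
    have "?\<mu> (\<Union>\<B>) \<le> ?\<mu> (\<Union>B1 \<union> \<Union>B2)"
      using lB unfolding uB by (intro measure_mono_fmeasurable) (auto intro: fmeasurable.Un)
    also have "\<dots> \<le> ?\<mu> (\<Union>B1) + ?\<mu> (\<Union>B2)" using lB by (intro measure_Un_le) auto
    finally have B2: "(1 - \<theta>) * ?\<mu> (\<Union>\<B>) \<le> ?\<mu> (\<Union>B2)" using c' uB by (simp add: algebra_simps)
    show ?thesis
    proof (rule midpoint_bm_glue[where ?A1.0="\<Union>A1" and ?A2.0="\<Union>A2" and ?B1.0="\<Union>B1" and ?B2.0="\<Union>B2" and c=c and c'=c' and i=i and m=m and \<theta>=\<theta>])
      show "midpoint_bm (\<Union>A1) (\<Union>B1)" "midpoint_bm (\<Union>A2) (\<Union>B2)"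
        by (intro IH fA fB cA cB)+
      show "?\<mu> (\<Union>A1) = \<theta> * m" using m by (simp add: \<theta>_def)
      show "?\<mu> (\<Union>A2) = (1 - \<theta>) * m" using m by (simp add: \<theta>_def m_def field_simps)
      show "compact (\<Union>\<A>)" "compact (\<Union>\<B>)" "compact (\<Union>A1)" "compact (\<Union>A2)"
        "compact (\<Union>B1)" "compact (\<Union>B2)"
        by (intro box_family_compact fam fA fB)+
      show "\<Union>A1 \<subseteq> \<Union>\<A>" "\<Union>A2 \<subseteq> \<Union>\<A>" unfolding A1_def A2_def by auto
      show "x \<bullet> i \<le> c" if "x \<in> \<Union>A1" for x using that unfolding A1_def by auto
      show "c \<le> x \<bullet> i" if "x \<in> \<Union>A2" for x using that unfolding A2_def by auto
    qed (use i \<theta> mA c' uB B2 in auto)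
  qed
qed

lemma midpoint_bm_box_families:
  fixes \<A> \<B> :: "'a::euclidean_space set set"
  assumes "box_family \<A>" "box_family \<B>"
  shows "midpoint_bm (\<Union>\<A>) (\<Union>\<B>)"
  using assms
proof (induction "card \<A> + card \<B>" arbitrary: \<A> \<B> rule: less_induct)
  case less
  have fin: "finite \<A>" "finite \<B>" using less.prems unfolding box_family_def by blast+
  consider "2 \<le> card \<A>" | "2 \<le> card \<B>" | "card \<A> \<le> 1" "card \<B> \<le> 1" by linarith
  then show ?case
  proof cases
    case 1
    show ?thesis
    proof (rule midpoint_bm_split_step[OF less.prems 1])
      fix \<A>' \<B>' :: "'a set set"
      assume "box_family \<A>'" "box_family \<B>'" "card \<A>' < card \<A>" "card \<B>' \<le> card \<B>"
      then show "midpoint_bm (\<Union>\<A>') (\<Union>\<B>')" by (intro less.hyps) auto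
    qed
  next
    case 2
    have "midpoint_bm (\<Union>\<B>) (\<Union>\<A>)"
    proof (rule midpoint_bm_split_step[OF less.prems(2,1) 2])
      fix \<A>' \<B>' :: "'a set set"
      assume "box_family \<A>'" "box_family \<B>'" "card \<A>' < card \<B>" "card \<B>' \<le> card \<A>"
      then show "midpoint_bm (\<Union>\<A>') (\<Union>\<B>')" by (intro less.hyps) auto
    qed
    then show ?thesis by (simp add: midpoint_bm_commute)
  next
    case 3
    show ?thesis
    proof (cases "\<A> = {} \<or> \<B> = {}")
      case True then show ?thesis unfolding midpoint_bm_def by auto
    next
      case False
      then have "card \<A> = 1" "card \<B> = 1" using 3 fin by (metis card_0_eq le_antisym less_one not_le)+
      then obtain A B where AB: "\<A> = {A}" "\<B> = {B}" by (meson card_1_singletonE)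
      have "\<exists>a b. A = cbox a b" "\<exists>c d. B = cbox c d"
        using less.prems AB unfolding box_family_def by auto
      then obtain a b c d where "A = cbox a b" "B = cbox c d" by blast
      then show ?thesis using measure_sumset_cbox[of a b c d] AB unfolding midpoint_bm_def by simp
    qed
  qed
qed

lemma measure_uminus_image: "measure lebesgue (uminus ` S) = measure lebesgue (S::'a::euclidean_space set)"
  using measure_lebesgue_affine[of "-1" 0 S] by simp

lemma box_family_uminus:
  assumes "box_family \<A>"
  shows "box_family ((`) uminus ` \<A>)"
  unfolding box_family_def
proof (intro conjI ballI)
  show "finite ((`) uminus ` \<A>)" using assms unfolding box_family_def by blast
  show "\<exists>a b. S = cbox a b" if S: "S \<in> (`) uminus ` \<A>" for S
  proof -
    obtain T where T: "T \<in> \<A>" "S = uminus ` T" using S by auto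
    moreover obtain a b where "T = cbox a b" using T(1) assms unfolding box_family_def by auto
    ultimately have "S = uminus ` cbox a b" by simp
    then have "S = cbox (- b) (- a)"
      by simp
    then show ?thesis by blast
  qed
  show "pairwise (\<lambda>S T. interior S \<inter> interior T = {}) ((`) uminus ` \<A>)"
    unfolding pairwise_def
  proof (clarsimp)
    fix S T assume "S \<in> \<A>" "T \<in> \<A>" "uminus ` S \<noteq> uminus ` T"
    then have "interior S \<inter> interior T = {}" using assms unfolding box_family_def pairwise_def by (metis (no_types))
    then show "interior (uminus ` S) \<inter> interior (uminus ` T) = {}"
      by (auto simp: interior_negations)
  qed
qed

text \<open>
  The sum of the set and its reflection consists of differences, so it lies in the ball of radius
  \<open>2 * r\<close>, while its measure is at least \<open>2 ^ d\<close> times that of the set. This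
  replaces Steiner symmetrisation in the proof of the isodiametric inequality.
\<close>

lemma measure_box_family_le_ball:
  fixes \<A> :: "'a::euclidean_space set set"
  assumes fam: "box_family \<A>" and diam: "\<And>x y. x \<in> \<Union>\<A> \<Longrightarrow> y \<in> \<Union>\<A> \<Longrightarrow> norm (x - y) \<le> 2 * r" and r: "r \<ge> 0"
  shows "measure lebesgue (\<Union>\<A>) \<le> unit_ball_vol (DIM('a)) * r ^ DIM('a)"
proof -
  let ?A = "\<Union>\<A>"
  have m: "\<Union>((`) uminus ` \<A>) = uminus ` ?A" by auto
  have "midpoint_bm ?A (\<Union>((`) uminus ` \<A>))"
    by (intro midpoint_bm_box_families fam box_family_uminus)
  then have "2 ^ DIM('a) * measure lebesgue ?A \<le> measure lebesgue {x + y | x y. x \<in> ?A \<and> y \<in> uminus ` ?A}"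
    unfolding midpoint_bm_def m by (simp add: measure_uminus_image real_sqrt_mult_self)
  also have "\<dots> \<le> measure lebesgue (cball (0::'a) (2 * r))"
  proof (rule measure_mono_fmeasurable)
    show "{x + y | x y. x \<in> ?A \<and> y \<in> uminus ` ?A} \<subseteq> cball 0 (2 * r)"
      using diam by force
    have "compact {x + y | x y. x \<in> ?A \<and> y \<in> uminus ` ?A}"
      using box_family_compact[OF fam] by (intro compact_sums compact_negations)
    then show "{x + y | x y. x \<in> ?A \<and> y \<in> uminus ` ?A} \<in> sets lebesgue"
      by (intro fmeasurableD lmeasurable_compact)
  qed auto
  also have "\<dots> = 2 ^ DIM('a) * (unit_ball_vol (DIM('a)) * r ^ DIM('a))"
    using r by (simp add: content_cball power_mult_distrib)
  finally show ?thesis by simp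
qed

lemma measure_le_countable_Union:
  assumes "S \<in> lmeasurable" "countable \<D>" "S \<subseteq> \<Union>\<D>" "\<And>K. K \<in> \<D> \<Longrightarrow> K \<in> lmeasurable"
    and fin: "\<And>\<F>. finite \<F> \<Longrightarrow> \<F> \<subseteq> \<D> \<Longrightarrow> measure lebesgue (\<Union>\<F>) \<le> B"
  shows "measure lebesgue (S::'a::euclidean_space set) \<le> B"
proof -
  have bound: "measure lebesgue (\<Union>K\<in>\<F>. K) \<le> B" if "\<F> \<subseteq> \<D>" "finite \<F>" for \<F>
    using fin[OF that(2,1)] by simp
  have "\<Union>\<D> \<in> lmeasurable"
    using fmeasurable_UN_bound[OF assms(2) assms(4) bound] by simp
  moreover have "measure lebesgue (\<Union>\<D>) \<le> B"
    using measure_UN_bound[OF assms(2) assms(4) bound] by simp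
  moreover have "measure lebesgue S \<le> measure lebesgue (\<Union>\<D>)"
    by (rule measure_mono_fmeasurable[OF assms(3) fmeasurableD[OF assms(1)] calculation(1)])
  ultimately show ?thesis by linarith
qed

text \<open>
  A bounded measurable set is covered, up to an arbitrarily small increase of the diameter, by countably
  many boxes with disjoint interiors.
\<close>

theorem isodiametric:
  fixes S :: "'a::euclidean_space set"
  assumes "bounded S" and S: "S \<in> lmeasurable"
  shows "measure lebesgue S \<le> unit_ball_vol (DIM('a)) * (diameter S / 2) ^ DIM('a)"
proof -
  let ?\<omega> = "unit_ball_vol (real DIM('a))"
  have d0: "0 \<le> diameter S" using assms(1) by (rule diameter_ge_0)
  have main: "measure lebesgue S \<le> ?\<omega> * (diameter S / 2 + e) ^ DIM('a)" if e: "e > 0" for e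
  proof -
    obtain L where L: "S \<subseteq> box (- L) (L::'a)" using bounded_subset_box_symmetric[OF assms(1)] by blast
    show ?thesis
    proof (cases "S = {}")
      case True then show ?thesis using d0 e by simp
    next
      case False
      then have ne: "box (- L) L \<noteq> {}" using L by blast
      have sub: "S \<subseteq> cbox (- L) L" using L box_subset_cbox by blast
      have g: "gauge (\<lambda>x::'a. ball x e)" using e by (rule gauge_ball)
      obtain \<D> where D: "countable \<D>" "\<And>K. K \<in> \<D> \<Longrightarrow> interior K \<noteq> {} \<and> (\<exists>c d. K = cbox c d)"
        "pairwise (\<lambda>A B. interior A \<inter> interior B = {}) \<D>"
        "\<And>K. K \<in> \<D> \<Longrightarrow> \<exists>x \<in> S \<inter> K. K \<subseteq> ball x e" "S \<subseteq> \<Union>\<D>"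
        using covering_lemma[OF sub ne g] by metis
      show ?thesis
      proof (rule measure_le_countable_Union[OF S D(1,5)])
        show "K \<in> lmeasurable" if "K \<in> \<D>" for K using D(2)[OF that] by auto
        fix \<F> assume F: "finite \<F>" "\<F> \<subseteq> \<D>"
        show "measure lebesgue (\<Union>\<F>) \<le> ?\<omega> * (diameter S / 2 + e) ^ DIM('a)"
        proof (rule measure_box_family_le_ball)
          show "box_family \<F>" unfolding box_family_def using F D(2) pairwise_subset[OF D(3) F(2)] by auto
          fix x y assume "x \<in> \<Union>\<F>" "y \<in> \<Union>\<F>"
          then obtain K K' where K: "x \<in> K" "K \<in> \<D>" "y \<in> K'" "K' \<in> \<D>" using F by blast
          obtain x' y' where "x' \<in> S" "y' \<in> S" and xy: "dist x' x < e" "dist y' y < e"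
            using D(4)[OF K(2)] D(4)[OF K(4)] K by (metis Int_iff mem_ball subsetD)
          then have "dist x' y' \<le> diameter S" using diameter_bounded_bound assms(1) by blast
          moreover have "dist x y \<le> dist x' x + dist x' y' + dist y' y"
            by (smt (verit) dist_commute dist_triangle)
          ultimately show "norm (x - y) \<le> 2 * (diameter S / 2 + e)"
            using xy by (simp add: dist_norm)
        qed (use d0 e in auto)
      qed
    qed
  qed
  have "((\<lambda>e. ?\<omega> * (diameter S / 2 + e) ^ DIM('a)) \<longlongrightarrow> ?\<omega> * (diameter S / 2 + 0) ^ DIM('a)) (at_right 0)"
    by (intro tendsto_intros)
  moreover have "\<forall>\<^sub>F e in at_right 0. measure lebesgue S \<le> ?\<omega> * (diameter S / 2 + e) ^ DIM('a)"
    using eventually_at_right_less[of "0::real"] by (rule eventually_mono) (rule main)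
  ultimately have "measure lebesgue S \<le> ?\<omega> * (diameter S / 2 + 0) ^ DIM('a)"
    by (rule tendsto_lowerbound) simp
  then show ?thesis by simp
qed


section \<open>Hausdorff measure\<close>

definition hausdorff_weight :: "nat \<Rightarrow> 'v::metric_space set \<Rightarrow> ennreal" where
  "hausdorff_weight k U = (if U = {} then 0 else ennreal (unit_ball_vol (real k) * (diameter U / 2) ^ k))"

lemma hausdorff_pre_alt:
  "hausdorff_pre k \<delta> A = Inf {(\<Sum>n. hausdorff_weight k (U n)) | U :: nat \<Rightarrow> 'v::metric_space set.
     A \<subseteq> (\<Union>n. U n) \<and> (\<forall>n. bounded (U n) \<and> diameter (U n) \<le> \<delta>)}"
  unfolding hausdorff_pre_def hausdorff_weight_def ..

lemma hausdorff_pre_le: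
  assumes "A \<subseteq> (\<Union>n. U n)" "\<And>n. bounded (U n)" "\<And>n. diameter (U n) \<le> \<delta>"
  shows "hausdorff_pre k \<delta> A \<le> (\<Sum>n. hausdorff_weight k (U n))"
  unfolding hausdorff_pre_alt using assms by (intro Inf_lower) auto

lemma hausdorff_pre_geI:
  assumes "\<And>U. A \<subseteq> (\<Union>n. U n) \<Longrightarrow> (\<And>n. bounded (U n)) \<Longrightarrow> (\<And>n. diameter (U n) \<le> \<delta>)
    \<Longrightarrow> C \<le> (\<Sum>n. hausdorff_weight k (U n))"
  shows "C \<le> hausdorff_pre k \<delta> A"
  unfolding hausdorff_pre_alt
proof (rule Inf_greatest)
  fix x assume "x \<in> {(\<Sum>n. hausdorff_weight k (U n)) | U. A \<subseteq> (\<Union>n. U n) \<and> (\<forall>n. bounded (U n) \<and> diameter (U n) \<le> \<delta>)}"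
  then obtain U where "x = (\<Sum>n. hausdorff_weight k (U n))" "A \<subseteq> (\<Union>n. U n)"
    "\<And>n. bounded (U n)" "\<And>n. diameter (U n) \<le> \<delta>" by auto
  then show "C \<le> x" using assms[of U] by simp
qed

lemma hausdorff_pre_geI_mult:
  assumes c: "0 < c"
    and "\<And>U. A \<subseteq> (\<Union>n. U n) \<Longrightarrow> (\<And>n. bounded (U n)) \<Longrightarrow> (\<And>n. diameter (U n) \<le> \<delta>)
    \<Longrightarrow> C \<le> ennreal c * (\<Sum>n. hausdorff_weight k (U n))"
  shows "C \<le> ennreal c * hausdorff_pre k \<delta> A"
proof -
  have "C / ennreal c \<le> hausdorff_pre k \<delta> A"
    by (intro hausdorff_pre_geI divide_le_posI_ennreal assms) (use c in auto)
  then have "ennreal c * (C / ennreal c) \<le> ennreal c * hausdorff_pre k \<delta> A"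
    by (rule mult_left_mono) simp
  moreover have "ennreal c * (C / ennreal c) = C"
    using c mult_divide_eq_ennreal[of "ennreal c" C] by (simp add: ennreal_times_divide mult.commute)
  ultimately show ?thesis by simp
qed

lemma hausdorff_pre_less_cover:
  assumes "hausdorff_pre k \<delta> A < C"
  shows "\<exists>U::nat \<Rightarrow> _. A \<subseteq> (\<Union>n. U n) \<and> (\<forall>n. bounded (U n) \<and> diameter (U n) \<le> \<delta>) \<and>
    (\<Sum>n. hausdorff_weight k (U n)) < C"
  using assms unfolding hausdorff_pre_alt Inf_less_iff by auto

lemma hausdorff_pre_le_measure: "0 < \<delta> \<Longrightarrow> hausdorff_pre k \<delta> A \<le> hausdorff_measure k A"
  unfolding hausdorff_measure_def by (rule SUP_upper) auto

lemma hausdorff_measure_leI: "(\<And>\<delta>. 0 < \<delta> \<Longrightarrow> hausdorff_pre k \<delta> A \<le> C) \<Longrightarrow> hausdorff_measure k A \<le> C"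
  unfolding hausdorff_measure_def by (rule SUP_least) auto

lemma hausdorff_pre_empty: "0 \<le> \<delta> \<Longrightarrow> hausdorff_pre k \<delta> {} = 0"
  using hausdorff_pre_le[of "{}" "\<lambda>_. {}" \<delta> k] by (simp add: hausdorff_weight_def)

lemma hausdorff_pre_single:
  assumes "bounded A" "diameter A \<le> \<delta>" "0 \<le> \<delta>"
  shows "hausdorff_pre k \<delta> A \<le> hausdorff_weight k A"
proof -
  let ?U = "\<lambda>n::nat. if n = 0 then A else {}"
  have "hausdorff_pre k \<delta> A \<le> (\<Sum>n. hausdorff_weight k (?U n))"
    using assms by (intro hausdorff_pre_le) (auto split: if_splits)
  also have "\<dots> = (\<Sum>n\<in>{0}. hausdorff_weight k (?U n))"
    by (intro suminf_finite) (auto simp: hausdorff_weight_def)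
  finally show ?thesis by simp
qed

lemma hausdorff_pre_UN_le:
  assumes "0 \<le> \<delta>"
  shows "hausdorff_pre k \<delta> (\<Union>n. A n) \<le> (\<Sum>n. hausdorff_pre k \<delta> (A n))"
proof (rule ennreal_le_epsilon)
  fix e :: real assume e: "0 < e" and fin: "(\<Sum>n. hausdorff_pre k \<delta> (A n)) < top"
  have "\<exists>U. A n \<subseteq> (\<Union>m. U m) \<and> (\<forall>m. bounded (U m) \<and> diameter (U m) \<le> \<delta>) \<and>
     (\<Sum>m. hausdorff_weight k (U m)) \<le> hausdorff_pre k \<delta> (A n) + ennreal (e * (1/2) ^ Suc n)" for n
  proof -
    have "hausdorff_pre k \<delta> (A n) < top"
      using fin by (metis ennreal_suminf_lessD)
    then have "hausdorff_pre k \<delta> (A n) < hausdorff_pre k \<delta> (A n) + ennreal (e * (1/2) ^ Suc n)"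
      using e by (simp add: ennreal_add_left_cancel_less[of _ 0, simplified] less_top)
    then obtain U where U: "A n \<subseteq> (\<Union>m. U m) \<and> (\<forall>m. bounded (U m) \<and> diameter (U m) \<le> \<delta>) \<and>
       (\<Sum>m. hausdorff_weight k (U m)) < hausdorff_pre k \<delta> (A n) + ennreal (e * (1/2) ^ Suc n)"
      by (rule exE[OF hausdorff_pre_less_cover])
    show ?thesis
      by (rule exI[of _ U]) (intro conjI conjunct1[OF U] conjunct1[OF conjunct2[OF U]]
          less_imp_le[OF conjunct2[OF conjunct2[OF U]]])
  qed
  from choice[OF allI[OF this]] obtain U where
    U': "\<forall>n. A n \<subseteq> (\<Union>m. U n m) \<and> (\<forall>m. bounded (U n m) \<and> diameter (U n m) \<le> \<delta>) \<and>
     (\<Sum>m. hausdorff_weight k (U n m)) \<le> hausdorff_pre k \<delta> (A n) + ennreal (e * (1/2) ^ Suc n)" by (rule exE)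
  have U: "\<And>n. A n \<subseteq> (\<Union>m. U n m)" "\<And>n m. bounded (U n m)" "\<And>n m. diameter (U n m) \<le> \<delta>"
     "\<And>n. (\<Sum>m. hausdorff_weight k (U n m)) \<le> hausdorff_pre k \<delta> (A n) + ennreal (e * (1/2) ^ Suc n)"
    using U' by simp_all
  let ?V = "\<lambda>i. (case_prod U) (prod_decode i)"
  have 1: "hausdorff_pre k \<delta> (\<Union>n. A n) \<le> (\<Sum>i. hausdorff_weight k (?V i))"
  proof (rule hausdorff_pre_le)
    show "(\<Union>n. A n) \<subseteq> (\<Union>i. ?V i)"
    proof
      fix x assume "x \<in> (\<Union>n. A n)"
      then obtain n m where "x \<in> U n m" using U(1) by blast
      then have "x \<in> ?V (prod_encode (n, m))" by simp
      then show "x \<in> (\<Union>i. ?V i)" by (rule UN_I[OF UNIV_I])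
    qed
  qed (use U in \<open>auto split: prod.splits\<close>)
  have 2: "(\<Sum>i. hausdorff_weight k (?V i)) = (\<Sum>n. \<Sum>m. hausdorff_weight k (U n m))"
    by (rule suminf_ennreal_2dimen[where f="\<lambda>p. hausdorff_weight k (case_prod U p)"]) simp
  have 3: "(\<Sum>n. \<Sum>m. hausdorff_weight k (U n m)) \<le> (\<Sum>n. hausdorff_pre k \<delta> (A n) + ennreal (e * (1/2) ^ Suc n))"
    by (intro suminf_le U) auto
  have 4: "(\<Sum>n. hausdorff_pre k \<delta> (A n) + ennreal (e * (1/2) ^ Suc n))
      = (\<Sum>n. hausdorff_pre k \<delta> (A n)) + (\<Sum>n. ennreal (e * (1/2) ^ Suc n))"
    by (rule suminf_add[symmetric]) auto
  have 5: "(\<Sum>n. ennreal (e * (1/2) ^ Suc n)) = ennreal e"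
    using e sums_mult[OF power_half_series, of e] by (intro suminf_ennreal_eq) auto
  show "hausdorff_pre k \<delta> (\<Union>n. A n) \<le> (\<Sum>n. hausdorff_pre k \<delta> (A n)) + ennreal e"
    using order_trans[OF 1 order_trans[OF eq_refl[OF 2] 3]] unfolding 4 5 .
qed

lemma hausdorff_pre_mono: "A \<subseteq> B \<Longrightarrow> hausdorff_pre k \<delta> A \<le> hausdorff_pre k \<delta> B"
  by (rule hausdorff_pre_geI) (auto intro!: hausdorff_pre_le)

lemma hausdorff_measure_UN_le: "hausdorff_measure k (\<Union>n. A n) \<le> (\<Sum>n. hausdorff_measure k (A n))"
proof (rule hausdorff_measure_leI)
  fix \<delta> :: real assume "0 < \<delta>"
  then have "hausdorff_pre k \<delta> (\<Union>n. A n) \<le> (\<Sum>n. hausdorff_pre k \<delta> (A n))"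
    by (intro hausdorff_pre_UN_le) simp
  also have "\<dots> \<le> (\<Sum>n. hausdorff_measure k (A n))"
    using \<open>0 < \<delta>\<close> by (intro suminf_le hausdorff_pre_le_measure) auto
  finally show "hausdorff_pre k \<delta> (\<Union>n. A n) \<le> (\<Sum>n. hausdorff_measure k (A n))" .
qed

lemma hausdorff_measure_empty [simp]: "hausdorff_measure k {} = 0"
  using hausdorff_measure_leI[of k "{}" 0] by (simp add: hausdorff_pre_empty)

text \<open>
  Both sets are images of a common index set, so that the hypothesis can express a Lipschitz map
  \<open>f i \<mapsto> g i\<close> without choosing it. A cover of \<open>f ` I\<close> by sets of
  diameter \<open>\<delta> / L\<close> induces a cover of \<open>g ` I\<close> by sets of diameter
  \<open>\<delta>\<close>.
\<close>

lemma hausdorff_measure_Lipschitz: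
  fixes f :: "'i \<Rightarrow> 'a::metric_space" and g :: "'i \<Rightarrow> 'b::metric_space"
  assumes L: "L > 0" and lip: "\<And>i j. i \<in> I \<Longrightarrow> j \<in> I \<Longrightarrow> dist (g i) (g j) \<le> L * dist (f i) (f j)"
  shows "hausdorff_measure k (g ` I) \<le> ennreal (L ^ k) * hausdorff_measure k (f ` I)"
proof (rule hausdorff_measure_leI)
  fix \<delta> :: real assume \<delta>: "0 < \<delta>"
  have "hausdorff_pre k \<delta> (g ` I) \<le> ennreal (L ^ k) * hausdorff_pre k (\<delta> / L) (f ` I)"
  proof (rule hausdorff_pre_geI_mult)
    show "0 < L ^ k" using L by simp
    fix U :: "nat \<Rightarrow> 'a set"
    assume U: "f ` I \<subseteq> (\<Union>n. U n)" "\<And>n. bounded (U n)" "\<And>n. diameter (U n) \<le> \<delta> / L"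
    define V where "V n = g ` {i\<in>I. f i \<in> U n}" for n
    have dV: "dist x y \<le> L * diameter (U n)" if xy: "x \<in> V n" "y \<in> V n" for x y n
    proof -
      obtain i j where ij: "i \<in> I" "f i \<in> U n" "x = g i" "j \<in> I" "f j \<in> U n" "y = g j"
        using xy unfolding V_def by auto
      have "dist x y \<le> L * dist (f i) (f j)" using ij lip by simp
      also have "\<dots> \<le> L * diameter (U n)"
        using L ij U(2) by (intro mult_left_mono diameter_bounded_bound) auto
      finally show ?thesis .
    qed
    have bV: "bounded (V n)" for n
    proof (cases "V n = {}")
      case False
      then obtain x where "x \<in> V n" by auto
      then show ?thesis unfolding bounded_def using dV by blast
    qed auto
    have diamV: "diameter (V n) \<le> L * diameter (U n)" for n
    proof (cases "V n = {}")
      case True then show ?thesis using L diameter_ge_0[OF U(2)] by simp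
    next
      case False
      then have "(SUP (x,y)\<in>V n \<times> V n. dist x y) \<le> L * diameter (U n)"
        by (intro cSUP_least) (use dV in auto)
      then show ?thesis using False by (simp add: diameter_def[of "V n"])
    qed
    have w: "hausdorff_weight k (V n) \<le> ennreal (L ^ k) * hausdorff_weight k (U n)" for n
    proof (cases "V n = {}")
      case False
      then have "U n \<noteq> {}" unfolding V_def by auto
      have "unit_ball_vol k * (diameter (V n) / 2) ^ k \<le> unit_ball_vol k * (L * diameter (U n) / 2) ^ k"
        using diamV[of n] diameter_ge_0[OF bV] by (intro mult_left_mono power_mono) auto
      also have "\<dots> = L ^ k * (unit_ball_vol k * (diameter (U n) / 2) ^ k)"
        by (simp add: power_mult_distrib power_divide)
      finally have "ennreal (unit_ball_vol k * (diameter (V n) / 2) ^ k)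
          \<le> ennreal (L ^ k * (unit_ball_vol k * (diameter (U n) / 2) ^ k))"
        by (rule ennreal_leI)
      also have "\<dots> = ennreal (L ^ k) * ennreal (unit_ball_vol k * (diameter (U n) / 2) ^ k)"
        using L diameter_ge_0[OF U(2)] by (intro ennreal_mult) auto
      finally show ?thesis using False \<open>U n \<noteq> {}\<close> unfolding hausdorff_weight_def by simp
    qed (simp add: hausdorff_weight_def)
    have "hausdorff_pre k \<delta> (g ` I) \<le> (\<Sum>n. hausdorff_weight k (V n))"
    proof (rule hausdorff_pre_le[OF _ bV])
      show "g ` I \<subseteq> (\<Union>n. V n)"
      proof
        fix y assume "y \<in> g ` I"
        then obtain i where i: "i \<in> I" "y = g i" by auto
        then obtain n where "f i \<in> U n" using U(1) by blast
        then have "y \<in> V n" unfolding V_def using i by simp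
        then show "y \<in> (\<Union>n. V n)" by (rule UN_I[OF UNIV_I])
      qed
      show "diameter (V n) \<le> \<delta>" for n
        using diamV[of n] U(3)[of n] L by (simp add: field_simps)
    qed
    also have "\<dots> \<le> (\<Sum>n. ennreal (L ^ k) * hausdorff_weight k (U n))"
      by (intro suminf_le w) auto
    also have "\<dots> = ennreal (L ^ k) * (\<Sum>n. hausdorff_weight k (U n))" by simp
    finally show "hausdorff_pre k \<delta> (g ` I) \<le> ennreal (L ^ k) * (\<Sum>n. hausdorff_weight k (U n))" .
  qed
  also have "\<dots> \<le> ennreal (L ^ k) * hausdorff_measure k (f ` I)"
    using L \<delta> by (intro mult_left_mono hausdorff_pre_le_measure) auto
  finally show "hausdorff_pre k \<delta> (g ` I) \<le> ennreal (L ^ k) * hausdorff_measure k (f ` I)" .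
qed

text \<open>
  The isodiametric inequality; passing to the closure makes the set measurable and keeps the diameter.
\<close>

lemma emeasure_closure_le_weight:
  fixes U :: "'a::euclidean_space set"
  assumes "bounded U"
  shows "emeasure lborel (closure U) \<le> hausdorff_weight (DIM('a)) U"
proof (cases "U = {}")
  case False
  have c: "compact (closure U)" using assms by simp
  have "measure lebesgue (closure U) \<le> unit_ball_vol (DIM('a)) * (diameter U / 2) ^ DIM('a)"
    using isodiametric[of "closure U"] assms c by (simp add: bounded_closure diameter_closure lmeasurable_compact del: measure_completion)
  moreover have "emeasure lborel (closure U) = ennreal (measure lborel (closure U))"
    using emeasure_compact_finite[OF c] by (intro emeasure_eq_ennreal_measure) auto
  ultimately show ?thesis using False unfolding hausdorff_weight_def
    by (simp add: ennreal_leI)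
qed (simp add: hausdorff_weight_def)

lemma emeasure_le_hausdorff:
  fixes A :: "'a::euclidean_space set"
  assumes "A \<in> sets borel"
  shows "emeasure lborel A \<le> hausdorff_measure (DIM('a)) A"
proof -
  have "emeasure lborel A \<le> hausdorff_pre (DIM('a)) 1 A"
  proof (rule hausdorff_pre_geI)
    fix U :: "nat \<Rightarrow> 'a set"
    assume U: "A \<subseteq> (\<Union>n. U n)" "\<And>n. bounded (U n)"
    have "emeasure lborel A \<le> emeasure lborel (\<Union>n. closure (U n))"
    proof (rule emeasure_mono)
      show "A \<subseteq> (\<Union>n. closure (U n))"
        by (rule order_trans[OF U(1)]) (intro UN_mono closure_subset order_refl)
    qed simp
    also have "\<dots> \<le> (\<Sum>n. emeasure lborel (closure (U n)))"
      by (rule emeasure_subadditive_countably) auto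
    also have "\<dots> \<le> (\<Sum>n. hausdorff_weight (DIM('a)) (U n))"
      by (intro suminf_le emeasure_closure_le_weight U) auto
    finally show "emeasure lborel A \<le> (\<Sum>n. hausdorff_weight (DIM('a)) (U n))" .
  qed
  also have "\<dots> \<le> hausdorff_measure (DIM('a)) A" by (rule hausdorff_pre_le_measure) simp
  finally show ?thesis .
qed

lemma hausdorff_weight_cball:
  fixes x :: "'a::euclidean_space"
  assumes "0 \<le> r"
  shows "hausdorff_weight (DIM('a)) (cball x r) = emeasure lborel (cball x r)"
  using assms unfolding hausdorff_weight_def by (simp add: emeasure_cball)

lemma hausdorff_pre_UN_countable_le:
  assumes \<delta>: "0 \<le> \<delta>" and C: "countable C"
  shows "hausdorff_pre k \<delta> (\<Union>i\<in>C. A i) \<le> (\<integral>\<^sup>+i. hausdorff_pre k \<delta> (A i) \<partial>count_space C)"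
proof -
  let ?g = "to_nat_on C" and ?h = "from_nat_into C"
  define B where "B n = (if n \<in> ?g ` C then A (?h n) else {})" for n
  have inv: "?h (?g i) = i" if "i \<in> C" for i using C that by simp
  have UN: "(\<Union>i\<in>C. A i) \<subseteq> (\<Union>n. B n)"
  proof
    fix x assume "x \<in> (\<Union>i\<in>C. A i)"
    then obtain i where "i \<in> C" "x \<in> A i" by blast
    then have "x \<in> B (?g i)" unfolding B_def by (simp add: inv)
    then show "x \<in> (\<Union>n. B n)" by blast
  qed
  have "hausdorff_pre k \<delta> (\<Union>i\<in>C. A i) \<le> hausdorff_pre k \<delta> (\<Union>n. B n)"
    by (rule hausdorff_pre_mono[OF UN])
  also have "\<dots> \<le> (\<Sum>n. hausdorff_pre k \<delta> (B n))"
    by (rule hausdorff_pre_UN_le[OF \<delta>])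
  also have "\<dots> = (\<integral>\<^sup>+n. hausdorff_pre k \<delta> (B n) \<partial>count_space UNIV)"
    by (simp add: nn_integral_count_space_nat)
  also have "\<dots> = (\<integral>\<^sup>+n. hausdorff_pre k \<delta> (A (?h n)) * indicator (?g ` C) n \<partial>count_space UNIV)"
    by (intro nn_integral_cong) (auto simp: B_def hausdorff_pre_empty[OF \<delta>])
  also have "\<dots> = (\<integral>\<^sup>+n. hausdorff_pre k \<delta> (A (?h n)) \<partial>count_space (?g ` C))"
    by (cases "?g ` C = UNIV") (simp_all add: nn_integral_count_space_indicator)
  also have "\<dots> = (\<integral>\<^sup>+i. hausdorff_pre k \<delta> (A (?h (?g i))) \<partial>count_space C)"
    using C by (intro nn_integral_bij_count_space[symmetric]) (auto simp: bij_betw_def)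
  also have "\<dots> = (\<integral>\<^sup>+i. hausdorff_pre k \<delta> (A i) \<partial>count_space C)"
    by (intro nn_integral_cong) (simp add: inv)
  finally show ?thesis .
qed

lemma emeasure_disjoint_cballs_le:
  fixes a :: "'i \<Rightarrow> 'a::euclidean_space"
  assumes "countable C" "pairwise (\<lambda>i j. disjnt (cball (a i) (r i)) (cball (a j) (r j))) C"
    "\<And>i. i \<in> C \<Longrightarrow> cball (a i) (r i) \<subseteq> T" "T \<in> sets borel"
  shows "(\<integral>\<^sup>+i. emeasure lborel (cball (a i) (r i)) \<partial>count_space C) \<le> emeasure lborel T"
proof -
  have "disjoint_family_on (\<lambda>i. cball (a i) (r i)) C"
    using assms(2) unfolding disjoint_family_on_def pairwise_def disjnt_def by auto
  then have "(\<integral>\<^sup>+i. emeasure lborel (cball (a i) (r i)) \<partial>count_space C) = emeasure lborel (\<Union>i\<in>C. cball (a i) (r i))"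
    using assms(1) by (intro emeasure_UN_countable[symmetric]) auto
  also have "\<dots> \<le> emeasure lborel T" using assms(3,4) by (intro emeasure_mono) auto
  finally show ?thesis .
qed

text \<open>
  A null set is covered by small balls inside an open set of small measure. A disjoint subfamily, with radii
  enlarged five times, still covers it.
\<close>

lemma hausdorff_pre_negligible:
  fixes N :: "'a::euclidean_space set"
  assumes N: "negligible N" and \<delta>: "0 < \<delta>"
  shows "hausdorff_pre (DIM('a)) \<delta> N = 0"
proof -
  let ?d = "DIM('a)"
  have "hausdorff_pre ?d \<delta> N \<le> 0 + ennreal e" if e: "0 < e" for e :: real
  proof -
    \<comment> \<open>The factor compensates the fivefold enlargement of the disjoint balls.\<close>
    define e' where "e' = e / 5 ^ ?d"
    have e': "e' > 0" using e unfolding e'_def by simp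
    have Nl: "N \<in> sets lebesgue" using N by (rule negligible_imp_sets)
    obtain T where T: "open T" "N \<subseteq> T" "T - N \<in> lmeasurable" "emeasure lebesgue (T - N) < ennreal e'"
      using sets_lebesgue_outer_open[OF Nl e'] by metis
    have "emeasure lebesgue T \<le> emeasure lebesgue (T - N) + emeasure lebesgue N"
      using emeasure_subadditive[of "T - N" lebesgue N] T Nl by (simp add: Un_absorb2 fmeasurableD del: emeasure_completion)
    also have "emeasure lebesgue N = 0"
      using N by (simp add: negligible_iff_null_sets null_setsD1 del: emeasure_completion)
    finally have mT: "emeasure lborel T \<le> ennreal e'" using T by simp
    have "\<exists>r. 0 < r \<and> r \<le> \<delta> / 10 \<and> cball x r \<subseteq> T" if x: "x \<in> N" for x
    proof -
      obtain r where "0 < r" "cball x r \<subseteq> T" using T x open_contains_cball by blast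
      then show ?thesis using \<delta> by (intro exI[of _ "min r (\<delta> / 10)"]) auto
    qed
    then obtain r where r: "\<And>x. x \<in> N \<Longrightarrow> 0 < r x" "\<And>x. x \<in> N \<Longrightarrow> r x \<le> \<delta> / 10" "\<And>x. x \<in> N \<Longrightarrow> cball x (r x) \<subseteq> T"
      by metis
    have "N \<subseteq> (\<Union>x\<in>N. cball x (r x))" using r(1) by (force simp: less_imp_le)
    then obtain C where C: "countable C" "C \<subseteq> N" "pairwise (\<lambda>i j. disjnt (cball i (r i)) (cball j (r j))) C"
       "N \<subseteq> (\<Union>i\<in>C. cball i (5 * r i))"
      by (rule Vitali_covering_lemma_cballs[where a="\<lambda>x. x" and r=r and B="\<delta> / 10"]) (use r in auto)
    have "hausdorff_pre ?d \<delta> N \<le> hausdorff_pre ?d \<delta> (\<Union>i\<in>C. cball i (5 * r i))"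
      by (rule hausdorff_pre_mono[OF C(4)])
    also have "\<dots> \<le> (\<integral>\<^sup>+i. hausdorff_pre ?d \<delta> (cball i (5 * r i)) \<partial>count_space C)"
      using \<delta> by (intro hausdorff_pre_UN_countable_le C) auto
    also have "\<dots> \<le> (\<integral>\<^sup>+i. ennreal (5 ^ ?d) * emeasure lborel (cball i (r i)) \<partial>count_space C)"
    proof (rule nn_integral_mono)
      fix i assume "i \<in> space (count_space C)"
      then have i: "i \<in> N" using C(2) by auto
      have "hausdorff_pre ?d \<delta> (cball i (5 * r i)) \<le> hausdorff_weight ?d (cball i (5 * r i))"
        using r(1,2)[OF i] \<delta> by (intro hausdorff_pre_single) auto
      also have "\<dots> = emeasure lborel (cball i (5 * r i))"
        using r(1)[OF i] by (intro hausdorff_weight_cball) auto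
      also have "\<dots> = ennreal (5 ^ ?d) * emeasure lborel (cball i (r i))"
        using r(1)[OF i] by (simp add: emeasure_cball ennreal_mult'[symmetric] power_mult_distrib mult_ac)
      finally show "hausdorff_pre ?d \<delta> (cball i (5 * r i)) \<le> ennreal (5 ^ ?d) * emeasure lborel (cball i (r i))" .
    qed
    also have "\<dots> = ennreal (5 ^ ?d) * (\<integral>\<^sup>+i. emeasure lborel (cball i (r i)) \<partial>count_space C)"
      by (rule nn_integral_cmult) auto
    also have "\<dots> \<le> ennreal (5 ^ ?d) * ennreal e'"
      using emeasure_disjoint_cballs_le[OF C(1,3), of T] C(2) r(3) T(1) mT
      by (intro mult_left_mono) (auto intro: order_trans)
    also have "\<dots> = ennreal e" using e unfolding e'_def by (simp add: ennreal_mult'[symmetric])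
    finally show ?thesis by simp
  qed
  then have "hausdorff_pre ?d \<delta> N \<le> 0" by (rule ennreal_le_epsilon)
  then show ?thesis by simp
qed

text \<open>
  The Vitali covering theorem fills an open neighbourhood of almost the same measure by disjoint small
  balls, up to a null set, and on balls the weight is the Lebesgue measure.
\<close>

lemma hausdorff_le_emeasure:
  fixes A :: "'a::euclidean_space set"
  assumes A: "A \<in> sets borel"
  shows "hausdorff_measure (DIM('a)) A \<le> emeasure lborel A"
proof (rule hausdorff_measure_leI)
  let ?d = "DIM('a)"
  fix \<delta> :: real assume \<delta>: "0 < \<delta>"
  show "hausdorff_pre ?d \<delta> A \<le> emeasure lborel A"
  proof (rule ennreal_le_epsilon)
    fix e :: real assume e: "0 < e"
    have Al: "A \<in> sets lebesgue" using A by simp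
    obtain T where T: "open T" "A \<subseteq> T" "T - A \<in> lmeasurable" "emeasure lebesgue (T - A) < ennreal e"
      using sets_lebesgue_outer_open[OF Al e] by metis
    have "emeasure lebesgue T \<le> emeasure lebesgue (T - A) + emeasure lebesgue A"
      using emeasure_subadditive[of "T - A" lebesgue A] T Al by (simp add: Un_absorb2 fmeasurableD del: emeasure_completion)
    also have "\<dots> \<le> ennreal e + emeasure lebesgue A" using T(4) by (intro add_right_mono) simp
    finally have mT: "emeasure lborel T \<le> emeasure lborel A + ennreal e" using T A by (simp add: add.commute)
    define K where "K = {i. 0 < snd i \<and> snd i \<le> \<delta> / 2 \<and> cball (fst i) (snd i) \<subseteq> T}"
    have ex: "\<exists>i. i \<in> K \<and> x \<in> cball (fst i) (snd i) \<and> snd i < t" if x: "x \<in> T" "0 < t" for x t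
    proof -
      obtain r where "0 < r" "cball x r \<subseteq> T" using T x open_contains_cball by blast
      then show ?thesis using \<delta> x unfolding K_def
        by (intro exI[of _ "(x, min (min r (\<delta> / 2)) (t / 2))"]) auto
    qed
    obtain C where C: "countable C" "C \<subseteq> K"
      "pairwise (\<lambda>i j. disjnt (cball (fst i) (snd i)) (cball (fst j) (snd j))) C"
      "negligible (T - (\<Union>i\<in>C. cball (fst i) (snd i)))"
      by (rule Vitali_covering_theorem_cballs[of K snd T fst]) (use ex in \<open>auto simp: K_def\<close>)
    let ?B = "\<Union>i\<in>C. cball (fst i) (snd i)"
    have "hausdorff_pre ?d \<delta> A \<le> hausdorff_pre ?d \<delta> (\<Union>n::nat. if n = 0 then ?B else if n = 1 then T - ?B else {})"
      using T(2) by (intro hausdorff_pre_mono) (auto split: if_splits)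
    also have "\<dots> \<le> (\<Sum>n::nat. hausdorff_pre ?d \<delta> (if n = 0 then ?B else if n = 1 then T - ?B else {}))"
      using \<delta> by (intro hausdorff_pre_UN_le) simp
    also have "\<dots> = (\<Sum>n\<in>{0::nat}. hausdorff_pre ?d \<delta> (if n = 0 then ?B else if n = 1 then T - ?B else {}))"
      using \<delta> C(4) by (intro suminf_finite) (auto simp: hausdorff_pre_negligible hausdorff_pre_empty)
    also have "\<dots> = hausdorff_pre ?d \<delta> ?B" by simp
    also have "\<dots> \<le> (\<integral>\<^sup>+i. hausdorff_pre ?d \<delta> (cball (fst i) (snd i)) \<partial>count_space C)"
      using \<delta> by (intro hausdorff_pre_UN_countable_le C) auto
    also have "\<dots> \<le> (\<integral>\<^sup>+i. emeasure lborel (cball (fst i) (snd i)) \<partial>count_space C)"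
    proof (rule nn_integral_mono)
      fix i assume "i \<in> space (count_space C)"
      then have i: "0 < snd i" "snd i \<le> \<delta> / 2" using C(2) unfolding K_def by auto
      then have "hausdorff_pre ?d \<delta> (cball (fst i) (snd i)) \<le> hausdorff_weight ?d (cball (fst i) (snd i))"
        using \<delta> by (intro hausdorff_pre_single) auto
      then show "hausdorff_pre ?d \<delta> (cball (fst i) (snd i)) \<le> emeasure lborel (cball (fst i) (snd i))"
        using i by (simp add: hausdorff_weight_cball)
    qed
    also have "\<dots> \<le> emeasure lborel T"
    proof (rule emeasure_disjoint_cballs_le[OF C(1,3)])
      show "cball (fst i) (snd i) \<subseteq> T" if "i \<in> C" for i using C(2) that unfolding K_def by blast
    qed (use T(1) in simp)
    finally show "hausdorff_pre ?d \<delta> A \<le> emeasure lborel A + ennreal e" using mT by simp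
  qed
qed

theorem hausdorff_measure_eq_lborel:
  fixes A :: "'a::euclidean_space set"
  assumes "A \<in> sets borel"
  shows "hausdorff_measure (DIM('a)) A = emeasure lborel A"
  using emeasure_le_hausdorff[OF assms] hausdorff_le_emeasure[OF assms] by (rule antisym[rotated])

lemma emeasure_Lipschitz_image:
  fixes f :: "'i \<Rightarrow> 'a::euclidean_space" and g :: "'i \<Rightarrow> 'b::euclidean_space"
  assumes "DIM('a) = DIM('b)" "f ` I \<in> sets borel" "g ` I \<in> sets borel" "L > 0"
    and "\<And>i j. i \<in> I \<Longrightarrow> j \<in> I \<Longrightarrow> dist (g i) (g j) \<le> L * dist (f i) (f j)"
  shows "emeasure lborel (g ` I) \<le> ennreal (L ^ DIM('b)) * emeasure lborel (f ` I)"
proof -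
  have "hausdorff_measure (DIM('b)) (g ` I) \<le> ennreal (L ^ DIM('b)) * hausdorff_measure (DIM('b)) (f ` I)"
    by (rule hausdorff_measure_Lipschitz[OF assms(4)]) (rule assms(5))
  then show ?thesis
    using hausdorff_measure_eq_lborel[OF assms(2)] hausdorff_measure_eq_lborel[OF assms(3)] assms(1) by simp
qed


section \<open>Collars of domains with two-sided tangent balls\<close>

text \<open>
  Otherwise the point that divides the segment between the centres in the ratio of the radii lies in both
  balls.
\<close>

lemma disjoint_balls_dist:
  fixes a b :: "'a::real_normed_vector"
  assumes "ball a r \<inter> ball b s = {}" "0 < r" "0 < s"
  shows "r + s \<le> dist a b"
proof (rule ccontr)
  assume "\<not> r + s \<le> dist a b"
  then have lt: "norm (b - a) < r + s" by (simp add: dist_norm norm_minus_commute)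
  let ?c = "a + (r / (r + s)) *\<^sub>R (b - a)"
  have rs: "0 < r + s" using assms by simp
  have "dist a ?c = r / (r + s) * norm (b - a)" using assms by (simp add: dist_norm)
  also have "\<dots> < r" using mult_strict_left_mono[OF lt assms(2)] rs by (simp add: pos_divide_less_eq)
  finally have 1: "?c \<in> ball a r" by simp
  have "b - ?c = (1 - r / (r + s)) *\<^sub>R (b - a)" by (simp add: algebra_simps)
  also have "1 - r / (r + s) = s / (r + s)" using rs by (simp add: field_simps)
  finally have "b - ?c = (s / (r + s)) *\<^sub>R (b - a)" .
  then have "dist b ?c = s / (r + s) * norm (b - a)" using assms by (simp add: dist_norm)
  also have "\<dots> < s" using mult_strict_left_mono[OF lt assms(3)] rs by (simp add: pos_divide_less_eq)
  finally have 2: "?c \<in> ball b s" by simp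
  show False using 1 2 assms(1) by blast
qed

lemma norm_diff_unit_sq:
  fixes n w :: "'a::real_inner"
  assumes "n \<bullet> n = 1"
  shows "(norm (w - c *\<^sub>R n))\<^sup>2 = (norm w)\<^sup>2 - 2 * c * (w \<bullet> n) + c\<^sup>2"
  unfolding power2_norm_eq_inner
  by (simp add: inner_diff_left inner_diff_right inner_commute[of n w] assms power2_eq_square algebra_simps)

text \<open>
  The form in which the smoothness of the boundary enters all estimates: at each boundary point
  \<open>p\<close>, balls of radius \<open>R\<close> touch the boundary from inside and from outside, with
  inward unit normal \<open>\<nu> p\<close>.
\<close>

locale tangent_balls =
  fixes D :: "'v::euclidean_space set" and R :: real and \<nu> :: "'v \<Rightarrow> 'v"
  assumes R: "0 < R" and open_D: "open D" and bounded_D: "bounded D"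
    and unit: "p \<in> frontier D \<Longrightarrow> norm (\<nu> p) = 1"
    and inner_ball: "p \<in> frontier D \<Longrightarrow> ball (p + R *\<^sub>R \<nu> p) R \<subseteq> D"
    and outer_ball: "p \<in> frontier D \<Longrightarrow> ball (p - R *\<^sub>R \<nu> p) R \<inter> D = {}"
begin

definition depth :: "'v \<Rightarrow> real" where "depth x = infdist x (- D)"

definition collar :: "real \<Rightarrow> 'v set" where "collar r = {x \<in> D. depth x < r}"

text \<open>
  The normal coordinates of the collar: \<open>bump (p, s)\<close> is the point at depth \<open>s\<close>
  below \<open>p\<close>.
\<close>

definition bump :: "'v \<times> real \<Rightarrow> 'v" where "bump = (\<lambda>(p, s). p + s *\<^sub>R \<nu> p)"

text \<open>
  The orthogonal projection to the tangent plane at \<open>z\<close>, followed by an identification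
  \<open>f\<close> of this plane with a Euclidean space whose dimension is smaller by one.
\<close>

definition shadow :: "'v \<Rightarrow> ('v \<Rightarrow> 'h) \<Rightarrow> 'v \<Rightarrow> 'h" where
  "shadow z f p = f (p - (p \<bullet> \<nu> z) *\<^sub>R \<nu> z)"

definition flat :: "'v \<Rightarrow> ('v \<Rightarrow> 'h) \<Rightarrow> 'v \<times> real \<Rightarrow> 'h \<times> real" where
  "flat z f = (\<lambda>(p, s). (shadow z f p, s))"

definition tangent_isometry :: "'v \<Rightarrow> ('v \<Rightarrow> 'h::euclidean_space) \<Rightarrow> bool" where
  "tangent_isometry z f \<longleftrightarrow> linear f \<and> (\<forall>w. w \<bullet> \<nu> z = 0 \<longrightarrow> norm (f w) = norm w)"

lemma normal_self: "p \<in> frontier D \<Longrightarrow> \<nu> p \<bullet> \<nu> p = 1"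
  by (simp add: dot_square_norm unit)

lemma frontier_not_in: "p \<in> frontier D \<Longrightarrow> p \<notin> D"
  using open_D by (simp add: frontier_def interior_open)

lemma frontier_not_in_ball:
  assumes "q \<in> frontier D" "ball c r \<inter> D = {} \<or> ball c r \<subseteq> D"
  shows "r \<le> dist c q"
proof -
  have "q \<notin> ball c r" using assms(2)
  proof
    assume "ball c r \<inter> D = {}"
    then have "ball c r \<inter> closure D = {}" by (simp add: open_Int_closure_eq_empty)
    then show ?thesis using assms(1) by (auto simp: frontier_def)
  next
    assume "ball c r \<subseteq> D" then show ?thesis using frontier_not_in[OF assms(1)] by blast
  qed
  then show ?thesis by simp
qed

text \<open>
  The inner ball at one point and the outer ball at the other are disjoint, which bounds the distance of
  their centres from below. Adding the two inequalities obtained in this way cancels the linear terms.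
\<close>

lemma normal_Lipschitz:
  assumes "p \<in> frontier D" "q \<in> frontier D"
  shows "R * norm (\<nu> p - \<nu> q) \<le> norm (p - q)"
proof -
  have d: "2 * R \<le> norm ((p - q) + R *\<^sub>R (\<nu> p + \<nu> q))" if "p \<in> frontier D" "q \<in> frontier D" for p q
  proof -
    have "ball (p + R *\<^sub>R \<nu> p) R \<inter> ball (q - R *\<^sub>R \<nu> q) R = {}"
      using inner_ball[OF that(1)] outer_ball[OF that(2)] by blast
    from disjoint_balls_dist[OF this R R] show ?thesis by (simp add: dist_norm algebra_simps)
  qed
  have e: "4 * R\<^sup>2 \<le> (p - q) \<bullet> (p - q) + 2 * R * ((p - q) \<bullet> (\<nu> p + \<nu> q)) + R\<^sup>2 * (2 + 2 * (\<nu> p \<bullet> \<nu> q))"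
    if "p \<in> frontier D" "q \<in> frontier D" for p q
  proof -
    have "(2 * R)\<^sup>2 \<le> (norm ((p - q) + R *\<^sub>R (\<nu> p + \<nu> q)))\<^sup>2"
      using d[OF that] R by (intro power_mono) auto
    also have "\<dots> = (p - q) \<bullet> (p - q) + 2 * R * ((p - q) \<bullet> (\<nu> p + \<nu> q)) + R\<^sup>2 * ((\<nu> p + \<nu> q) \<bullet> (\<nu> p + \<nu> q))"
      by (simp only: power2_norm_eq_inner inner_add_left inner_add_right inner_scaleR_left inner_scaleR_right)
        (simp add: inner_commute power2_eq_square algebra_simps)
    also have "(\<nu> p + \<nu> q) \<bullet> (\<nu> p + \<nu> q) = 2 + 2 * (\<nu> p \<bullet> \<nu> q)"
      using that by (simp add: inner_add_left inner_add_right normal_self inner_commute)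
    finally show ?thesis by (simp add: power_mult_distrib)
  qed
  have "(R * norm (\<nu> p - \<nu> q))\<^sup>2 = R\<^sup>2 * (2 - 2 * (\<nu> p \<bullet> \<nu> q))"
    using assms by (simp add: power_mult_distrib power2_norm_eq_inner inner_diff_left inner_diff_right normal_self inner_commute)
  also have "\<dots> \<le> (norm (p - q))\<^sup>2"
    using e[OF assms] e[OF assms(2,1)]
    by (simp add: power2_norm_eq_inner inner_diff_left inner_diff_right inner_add_right inner_commute algebra_simps)
  finally show ?thesis by (rule power2_le_imp_le) simp
qed

text \<open>
  Since \<open>q\<close> lies in neither of the two balls at \<open>p\<close>, the boundary departs from the
  tangent plane at most quadratically.
\<close>

lemma tangency:
  assumes "p \<in> frontier D" "q \<in> frontier D"
  shows "2 * R * \<bar>(q - p) \<bullet> \<nu> p\<bar> \<le> (norm (q - p))\<^sup>2"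
proof -
  have d: "R\<^sup>2 \<le> (norm (q - p - c *\<^sub>R \<nu> p))\<^sup>2" if c: "c = R \<or> c = - R" for c
  proof -
    have "R \<le> dist (p + c *\<^sub>R \<nu> p) q"
      using c inner_ball[OF assms(1)] outer_ball[OF assms(1)] by (intro frontier_not_in_ball[OF assms(2)]) auto
    then have "R \<le> norm (q - p - c *\<^sub>R \<nu> p)" by (simp add: dist_norm norm_minus_commute algebra_simps)
    then show ?thesis using R by (intro power_mono) auto
  qed
  have ex: "(norm (q - p - c *\<^sub>R \<nu> p))\<^sup>2 = (norm (q - p))\<^sup>2 - 2 * c * ((q - p) \<bullet> \<nu> p) + c\<^sup>2" for c
    by (rule norm_diff_unit_sq[OF normal_self[OF assms(1)]])
  show ?thesis using d[of R, unfolded ex] d[of "- R", unfolded ex] by (simp add: abs_if)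
qed

lemma nonempty_compl: "- D \<noteq> {}"
  using bounded_D not_bounded_UNIV by (metis Compl_empty_eq double_compl)

lemma closed_compl: "closed (- D)" using open_D by (simp add: closed_def)

lemma depth_nonneg: "0 \<le> depth x" unfolding depth_def by (rule infdist_nonneg)

text \<open>
  The ball around \<open>x\<close> that reaches the boundary at \<open>p\<close> lies in \<open>D\<close>
  and so is disjoint from the outer ball at \<open>p\<close>; hence its centre lies on the normal at
  \<open>p\<close>.
\<close>

lemma nearest_frontier_point:
  assumes x: "x \<in> D"
  obtains p where "p \<in> frontier D" "x = p + depth x *\<^sub>R \<nu> p" "0 < depth x"
proof -
  obtain p where p: "p \<in> - D" "infdist x (- D) = dist x p"
    using infdist_attains_inf[OF closed_compl nonempty_compl] by metis
  let ?r = "dist x p"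
  have r: "0 < ?r" using p x by auto
  have sub: "ball x ?r \<subseteq> D"
  proof
    fix y assume y: "y \<in> ball x ?r"
    show "y \<in> D"
    proof (rule ccontr)
      assume "y \<notin> D"
      then have "infdist x (- D) \<le> dist x y" by (intro infdist_le) auto
      then show False using y p by simp
    qed
  qed
  have "p \<in> closure (ball x ?r)" using r by simp
  then have "p \<in> closure D" using closure_mono[OF sub] by blast
  then have fr: "p \<in> frontier D" using p open_D by (simp add: frontier_def interior_open)
  have "ball x ?r \<inter> ball (p - R *\<^sub>R \<nu> p) R = {}" using sub outer_ball[OF fr] by blast
  from disjoint_balls_dist[OF this r R]
  have "?r + R \<le> norm (x - p + R *\<^sub>R \<nu> p)" by (simp add: dist_norm algebra_simps)
  then have "(?r + R)\<^sup>2 \<le> (norm (x - p + R *\<^sub>R \<nu> p))\<^sup>2" using r R by (intro power_mono) auto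
  also have "\<dots> = ?r\<^sup>2 + 2 * R * ((x - p) \<bullet> \<nu> p) + R\<^sup>2"
    using norm_diff_unit_sq[OF normal_self[OF fr], of "x - p" "- R"] by (simp add: dist_norm)
  finally have "2 * R * ?r \<le> 2 * R * ((x - p) \<bullet> \<nu> p)" by (simp add: power2_eq_square algebra_simps)
  then have ge: "?r \<le> (x - p) \<bullet> \<nu> p" using R by (simp only: mult_le_cancel_left_pos[of "2 * R"])
  have "(norm (x - p - ?r *\<^sub>R \<nu> p))\<^sup>2 = ?r\<^sup>2 - 2 * ?r * ((x - p) \<bullet> \<nu> p) + ?r\<^sup>2"
    using norm_diff_unit_sq[OF normal_self[OF fr], of "x - p" ?r] by (simp add: dist_norm)
  also have "\<dots> \<le> 0" using mult_left_mono[OF ge, of ?r] r by (simp add: power2_eq_square)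
  finally have "x - p - ?r *\<^sub>R \<nu> p = 0" by simp
  then have "x = p + depth x *\<^sub>R \<nu> p" unfolding depth_def p(2) by (simp add: algebra_simps)
  then show ?thesis using that fr r p unfolding depth_def by simp
qed

text \<open>
  The ball around \<open>p + s *\<^sub>R \<nu> p\<close> of radius \<open>s < R\<close> lies inside
  the inner ball at \<open>p\<close> and meets its boundary sphere only in \<open>p\<close>.
\<close>

lemma nearest_unique:
  assumes p: "p \<in> frontier D" and q: "q \<in> frontier D" and s: "0 < s" "s < R"
    and d: "dist (p + s *\<^sub>R \<nu> p) q \<le> s"
  shows "q = p"
proof -
  let ?w = "q - p"
  have ex: "(norm (?w - c *\<^sub>R \<nu> p))\<^sup>2 = (norm ?w)\<^sup>2 - 2 * c * (?w \<bullet> \<nu> p) + c\<^sup>2" for c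
    by (rule norm_diff_unit_sq[OF normal_self[OF p]])
  have "norm (?w - s *\<^sub>R \<nu> p) \<le> s" using d by (simp add: dist_norm norm_minus_commute algebra_simps)
  then have "(norm (?w - s *\<^sub>R \<nu> p))\<^sup>2 \<le> s\<^sup>2" using s by (intro power_mono) auto
  then have 1: "(norm ?w)\<^sup>2 \<le> 2 * s * (?w \<bullet> \<nu> p)" unfolding ex by simp
  have 2: "2 * R * \<bar>?w \<bullet> \<nu> p\<bar> \<le> (norm ?w)\<^sup>2" by (rule tangency[OF p q])
  have nn: "0 \<le> ?w \<bullet> \<nu> p"
    using order_trans[OF zero_le_power2 1] s by (simp add: zero_le_mult_iff)
  then have "R * (?w \<bullet> \<nu> p) \<le> s * (?w \<bullet> \<nu> p)" using 1 2 by simp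
  then have "?w \<bullet> \<nu> p \<le> 0" using s nn by (metis mult_le_cancel_right not_less)
  then have "(norm ?w)\<^sup>2 \<le> 0" using 1 nn by simp
  then show ?thesis by simp
qed

lemma collar_point:
  assumes p: "p \<in> frontier D" and s: "0 < s" "s < R"
  shows "p + s *\<^sub>R \<nu> p \<in> D" "depth (p + s *\<^sub>R \<nu> p) = s"
proof -
  let ?x = "p + s *\<^sub>R \<nu> p"
  have "dist (p + R *\<^sub>R \<nu> p) ?x = norm ((R - s) *\<^sub>R \<nu> p)" by (simp add: dist_norm algebra_simps)
  also have "\<dots> < R" using unit[OF p] s by simp
  finally show xD: "?x \<in> D" using inner_ball[OF p] by (auto simp: subset_iff)
  have dx: "dist ?x p = s" using unit[OF p] s by (simp add: dist_norm)
  have le: "depth ?x \<le> s" unfolding depth_def using infdist_le[of p "- D" ?x] frontier_not_in[OF p] dx by simp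
  obtain q where q: "q \<in> frontier D" "?x = q + depth ?x *\<^sub>R \<nu> q" "0 < depth ?x"
    using nearest_frontier_point[OF xD] by metis
  have dq: "dist ?x q = depth ?x" by (subst q(2)) (use unit[OF q(1)] q(3) in \<open>simp add: dist_norm\<close>)
  have "q = p" using nearest_unique[OF p q(1) s] dq le by simp
  then show "depth ?x = s" using dq dx by simp
qed

lemma normal_near:
  assumes "p \<in> frontier D" "q \<in> frontier D" "dist p q \<le> e"
  shows "norm (\<nu> p - \<nu> q) \<le> e / R"
proof -
  have "R * norm (\<nu> p - \<nu> q) \<le> e" using normal_Lipschitz[OF assms(1,2)] assms(3) by (simp add: dist_norm)
  then show ?thesis using R by (simp add: field_simps)
qed

lemma shadow_diff:
  assumes "tangent_isometry z f"
  shows "shadow z f p - shadow z f q = f ((p - q) - ((p - q) \<bullet> \<nu> z) *\<^sub>R \<nu> z)"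
proof -
  have "linear f" using assms unfolding tangent_isometry_def by simp
  then show ?thesis unfolding shadow_def
    by (simp add: linear_diff[symmetric] algebra_simps)
qed

text \<open>
  The difference of \<open>p + s *\<^sub>R \<nu> p\<close> and
  \<open>q + t *\<^sub>R \<nu> q\<close> is the tangential part of \<open>p - q\<close> plus
  \<open>(s - t) *\<^sub>R \<nu> z\<close>, up to three errors: the normal part of
  \<open>p - q\<close>, which is small by tangency, and the two terms caused by replacing
  \<open>\<nu> p\<close> and \<open>\<nu> q\<close> by \<open>\<nu> z\<close>, which are small because
  the normal is Lipschitz. All are at most a multiple of \<open>(\<epsilon> + r) / R\<close> times the
  distance in the product.
\<close>

lemma near_isometry:
  fixes f :: "'v \<Rightarrow> 'h::euclidean_space"
  assumes z: "z \<in> frontier D" and f: "tangent_isometry z f"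
    and \<epsilon>: "0 \<le> \<epsilon>" "4 * \<epsilon> \<le> R" and \<eta>: "5 * \<epsilon> + 2 * r \<le> \<eta> * R"
    and i: "i \<in> (frontier D \<inter> cball z \<epsilon>) \<times> {0..r}" and j: "j \<in> (frontier D \<inter> cball z \<epsilon>) \<times> {0..r}"
  shows "\<bar>dist (bump i) (bump j) - dist (flat z f i) (flat z f j)\<bar> \<le> \<eta> * dist (flat z f i) (flat z f j)"
proof -
  obtain p s where ps: "i = (p, s)" by (cases i)
  obtain q t where qt: "j = (q, t)" by (cases j)
  have p: "p \<in> frontier D" "dist z p \<le> \<epsilon>" and s: "0 \<le> s" "s \<le> r" using i ps by auto
  have q: "q \<in> frontier D" "dist z q \<le> \<epsilon>" and t: "0 \<le> t" "t \<le> r" using j qt by auto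
  let ?n = "\<nu> z"
  define w where "w = p - q"
  define b where "b = w \<bullet> ?n"
  define P where "P = w - b *\<^sub>R ?n"
  define a where "a = norm P"
  define \<Delta> where "\<Delta> = dist (flat z f i) (flat z f j)"
  have nn: "?n \<bullet> ?n = 1" by (rule normal_self[OF z])
  have Pn: "P \<bullet> ?n = 0" unfolding P_def b_def by (simp add: inner_diff_left nn)
  have fP: "norm (f P) = a" using f Pn unfolding tangent_isometry_def a_def by blast
  have "\<Delta> = norm (f P, s - t)"
    unfolding \<Delta>_def dist_norm flat_def ps qt by (simp add: shadow_diff[OF f] P_def b_def w_def)
  then have \<Delta>: "\<Delta> = sqrt (a\<^sup>2 + (s - t)\<^sup>2)" by (simp add: norm_Pair fP)
  have a\<Delta>: "a \<le> \<Delta>" "\<bar>s - t\<bar> \<le> \<Delta>" "0 \<le> a" unfolding \<Delta> a_def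
    using real_sqrt_sum_squares_ge1[of "norm P" "s - t"] real_sqrt_sum_squares_ge1[of "s - t" "norm P"]
     real_le_rsqrt[of "\<bar>s - t\<bar>" "(norm P)\<^sup>2 + (s - t)\<^sup>2"] by auto
  have w2: "norm w \<le> 2 * \<epsilon>" unfolding w_def using p(2) q(2) dist_triangle[of p q z]
    by (simp add: dist_norm norm_minus_commute)
  have nb: "norm (\<nu> p - ?n) \<le> \<epsilon> / R" using normal_near[OF p(1) z] p(2) by (simp add: dist_commute)
  have pq: "norm (\<nu> p - \<nu> q) \<le> norm w / R" using normal_near[OF p(1) q(1), of "norm w"] by (simp add: w_def dist_norm)
  have "\<bar>w \<bullet> \<nu> p\<bar> \<le> (norm w)\<^sup>2 / (2 * R)"
    using tangency[OF p(1) q(1)] R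
    by (simp add: w_def field_simps norm_minus_commute inner_diff_left abs_minus_commute)
  also have "\<dots> \<le> norm w * (2 * \<epsilon>) / (2 * R)"
    unfolding power2_eq_square using w2 R by (intro divide_right_mono mult_left_mono) auto
  also have "\<dots> = \<epsilon> / R * norm w" by simp
  finally have b1: "\<bar>w \<bullet> \<nu> p\<bar> \<le> \<epsilon> / R * norm w" .
  have "\<bar>w \<bullet> (?n - \<nu> p)\<bar> \<le> norm w * norm (?n - \<nu> p)" by (rule Cauchy_Schwarz_ineq2)
  also have "\<dots> \<le> norm w * (\<epsilon> / R)" using nb by (intro mult_left_mono) (auto simp: norm_minus_commute)
  finally have b2: "\<bar>w \<bullet> (?n - \<nu> p)\<bar> \<le> \<epsilon> / R * norm w" by (simp add: mult.commute)
  have "b = w \<bullet> \<nu> p + w \<bullet> (?n - \<nu> p)" unfolding b_def by (simp add: inner_diff_right)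
  then have b: "\<bar>b\<bar> \<le> 2 * \<epsilon> / R * norm w" using b1 b2 by simp
  have "2 * \<epsilon> / R \<le> 1 / 2" using \<epsilon> R by (simp add: field_simps)
  then have "2 * \<epsilon> / R * norm w \<le> 1 / 2 * norm w" by (rule mult_right_mono) simp
  moreover have "norm w \<le> a + \<bar>b\<bar>"
  proof -
    have "w = P + b *\<^sub>R ?n" unfolding P_def by simp
    then show ?thesis unfolding a_def using norm_triangle_ineq[of P "b *\<^sub>R ?n"] unit[OF z] by simp
  qed
  ultimately have wa: "norm w \<le> 2 * a" using b by linarith
  define E where "E = b *\<^sub>R ?n + (s - t) *\<^sub>R (\<nu> p - ?n) + t *\<^sub>R (\<nu> p - \<nu> q)"
  define Y where "Y = P + (s - t) *\<^sub>R ?n"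
  have X: "bump i - bump j = Y + E"
    unfolding bump_def ps qt Y_def E_def P_def w_def by (simp add: algebra_simps)
  have "(norm Y)\<^sup>2 = a\<^sup>2 + (s - t)\<^sup>2"
    using norm_diff_unit_sq[OF nn, of P "t - s"] Pn unfolding Y_def a_def
    by (simp add: scaleR_diff_left power2_commute algebra_simps)
  then have Y: "norm Y = \<Delta>" unfolding \<Delta> by (metis norm_ge_zero real_sqrt_unique)
  have "norm E \<le> \<bar>b\<bar> + \<bar>s - t\<bar> * norm (\<nu> p - ?n) + \<bar>t\<bar> * norm (\<nu> p - \<nu> q)"
    unfolding E_def using unit[OF z]
    by (intro order_trans[OF norm_triangle_ineq] add_mono) auto
  also have "\<dots> \<le> 2 * \<epsilon> / R * norm w + \<bar>s - t\<bar> * (\<epsilon> / R) + r * (norm w / R)"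
    using b nb pq t by (intro add_mono mult_mono) auto
  also have "\<dots> = (2 * \<epsilon> / R + r / R) * norm w + \<bar>s - t\<bar> * (\<epsilon> / R)"
    by (simp add: algebra_simps)
  also have "\<dots> \<le> (2 * \<epsilon> / R + r / R) * (2 * \<Delta>) + \<Delta> * (\<epsilon> / R)"
    using wa a\<Delta> \<epsilon> R s by (intro add_mono mult_mono) auto
  also have "\<dots> = (5 * \<epsilon> + 2 * r) / R * \<Delta>" using R by (simp add: field_simps)
  also have "\<dots> \<le> \<eta> * \<Delta>" using \<eta> R a\<Delta> by (intro mult_right_mono) (auto simp: field_simps)
  finally have E: "norm E \<le> \<eta> * \<Delta>" .
  have "\<bar>norm (Y + E) - norm Y\<bar> \<le> norm E" using norm_triangle_ineq3[of "Y + E" Y] by simp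
  then show ?thesis unfolding \<Delta>_def[symmetric] using E X Y by (simp add: dist_norm)
qed

lemma tangent_isometry_exists:
  assumes "DIM('h::euclidean_space) + 1 = DIM('v)" and z: "z \<in> frontier D"
  obtains f :: "'v \<Rightarrow> 'h::euclidean_space" where "tangent_isometry z f"
proof -
  have n0: "\<nu> z \<noteq> 0" using unit[OF z] by auto
  have "dim {w. \<nu> z \<bullet> w = 0} \<le> dim (UNIV :: 'h set)"
    using dim_hyperplane[OF n0] assms(1) by simp
  then obtain f :: "'v \<Rightarrow> 'h" where "linear f" "\<And>w. w \<in> {w. \<nu> z \<bullet> w = 0} \<Longrightarrow> norm (f w) = norm w"
    using isometry_subset_subspace[OF subspace_hyperplane subspace_UNIV] by metis
  then show ?thesis using that[of f] unfolding tangent_isometry_def by (simp add: inner_commute)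
qed

lemma continuous_on_normal: "continuous_on (frontier D) \<nu>"
proof -
  have "(1 / R)-lipschitz_on (frontier D) \<nu>"
    using normal_Lipschitz R by (intro lipschitz_onI) (auto simp: dist_norm field_simps)
  then show ?thesis by (rule lipschitz_on_continuous_on)
qed

lemma compact_bump_image:
  assumes "compact E" "E \<subseteq> frontier D" "compact J"
  shows "compact (bump ` (E \<times> J))"
proof (rule compact_continuous_image)
  have "continuous_on (E \<times> J) (\<lambda>x. \<nu> (fst x))"
    by (rule continuous_on_compose2[OF continuous_on_normal continuous_on_fst[OF continuous_on_id]]) (use assms(2) in auto)
  then show "continuous_on (E \<times> J) bump" unfolding bump_def case_prod_beta
    by (intro continuous_intros)
qed (use assms in \<open>auto intro: compact_Times\<close>)

lemma compact_shadow_image: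
  assumes "compact E" "tangent_isometry z (f :: 'v \<Rightarrow> 'h::euclidean_space)"
  shows "compact (shadow z f ` E)"
proof (rule compact_continuous_image)
  have "linear f" using assms unfolding tangent_isometry_def by simp
  then show "continuous_on E (shadow z f)" unfolding shadow_def
    by (intro linear_continuous_on_compose[OF _ \<open>linear f\<close>] continuous_intros)
qed fact

text \<open>
  Consequences of the almost isometry for measures: both its Lipschitz constant \<open>1 + \<eta>\<close>
  and that of its inverse, \<open>1 / (1 - \<eta>)\<close>, compare the layer between depths
  \<open>u\<close> and \<open>v\<close> with a product set. The piece \<open>E\<close> is a countable union
  of compact sets to ensure that the images are Borel.
\<close>

lemma collar_piece:
  fixes f :: "'v \<Rightarrow> 'h::euclidean_space"
  assumes dim: "DIM('h) + 1 = DIM('v)" and z: "z \<in> frontier D" and f: "tangent_isometry z f"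
    and \<epsilon>: "0 \<le> \<epsilon>" "4 * \<epsilon> \<le> R" and \<eta>: "5 * \<epsilon> + 2 * r \<le> \<eta> * R" "0 \<le> \<eta>" "\<eta> < 1"
    and E: "E \<subseteq> frontier D \<inter> cball z \<epsilon>" "E = (\<Union>n::nat. K n)" "\<And>n. compact (K n)"
    and uv: "0 \<le> u" "u \<le> v" "v \<le> r"
  shows "bump ` (E \<times> {u..v}) \<in> sets borel"
    and "emeasure lborel (bump ` (E \<times> {u..v})) \<le> ennreal ((1 + \<eta>) ^ DIM('v) * (v - u)) * emeasure lborel (shadow z f ` E)"
    and "ennreal (v - u) * emeasure lborel (shadow z f ` E) \<le> ennreal ((1 / (1 - \<eta>)) ^ DIM('v)) * emeasure lborel (bump ` (E \<times> {u..v}))"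
    and "hausdorff_measure k E \<le> ennreal ((1 + \<eta>) ^ k) * hausdorff_measure k (shadow z f ` E)"
    and "shadow z f ` E \<in> sets borel"
proof -
  let ?I = "E \<times> {u..v}"
  have "bump ` ?I = (\<Union>n. bump ` (K n \<times> {u..v}))" unfolding E(2) by blast
  moreover have "bump ` (K n \<times> {u..v}) \<in> sets borel" for n
    using E by (intro borel_compact compact_bump_image) auto
  ultimately show bb: "bump ` ?I \<in> sets borel" by simp
  have "shadow z f ` E = (\<Union>n. shadow z f ` K n)" unfolding E(2) by blast
  moreover have "shadow z f ` K n \<in> sets borel" for n
    using E f by (intro borel_compact compact_shadow_image) auto
  ultimately show sb: "shadow z f ` E \<in> sets borel" by simp
  have fl: "flat z f ` ?I = shadow z f ` E \<times> {u..v}"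
    unfolding flat_def by (auto simp: image_iff)
  have fb: "flat z f ` ?I \<in> sets borel" unfolding fl using sb by (intro borel_Times) auto
  have em: "emeasure lborel (flat z f ` ?I) = emeasure lborel (shadow z f ` E) * ennreal (v - u)"
    unfolding fl lborel_prod[symmetric] using sb uv by (subst lborel.emeasure_pair_measure_Times) auto
  have iso: "\<bar>dist (bump i) (bump j) - dist (flat z f i) (flat z f j)\<bar> \<le> \<eta> * dist (flat z f i) (flat z f j)"
    if "i \<in> ?I" "j \<in> ?I" for i j
    by (rule near_isometry[OF z f \<epsilon> \<eta>(1)]) (use that E(1) uv in auto)
  have up: "dist (bump i) (bump j) \<le> (1 + \<eta>) * dist (flat z f i) (flat z f j)" if "i \<in> ?I" "j \<in> ?I" for i j
    using iso[OF that] by (simp add: algebra_simps)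
  have lo: "dist (flat z f i) (flat z f j) \<le> (1 / (1 - \<eta>)) * dist (bump i) (bump j)" if "i \<in> ?I" "j \<in> ?I" for i j
    using iso[OF that] \<eta> by (simp add: field_simps abs_le_iff)
  have dims: "DIM('h \<times> real) = DIM('v)" using dim by simp
  have "emeasure lborel (bump ` ?I) \<le> ennreal ((1 + \<eta>) ^ DIM('v)) * emeasure lborel (flat z f ` ?I)"
    by (rule emeasure_Lipschitz_image[OF dims fb bb _ up]) (use \<eta> in auto)
  also have "\<dots> = ennreal ((1 + \<eta>) ^ DIM('v) * (v - u)) * emeasure lborel (shadow z f ` E)"
    unfolding em using \<eta> uv by (simp add: ennreal_mult mult_ac)
  finally show "emeasure lborel (bump ` ?I) \<le> ennreal ((1 + \<eta>) ^ DIM('v) * (v - u)) * emeasure lborel (shadow z f ` E)" .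
  have "emeasure lborel (flat z f ` ?I) \<le> ennreal ((1 / (1 - \<eta>)) ^ DIM('h \<times> real)) * emeasure lborel (bump ` ?I)"
    by (rule emeasure_Lipschitz_image[OF dims[symmetric] bb fb _ lo]) (use \<eta> in auto)
  then show "ennreal (v - u) * emeasure lborel (shadow z f ` E) \<le> ennreal ((1 / (1 - \<eta>)) ^ DIM('v)) * emeasure lborel (bump ` ?I)"
    unfolding em dims by (simp add: mult.commute)
  have "hausdorff_measure k ((\<lambda>p. p) ` E) \<le> ennreal ((1 + \<eta>) ^ k) * hausdorff_measure k (shadow z f ` E)"
  proof (rule hausdorff_measure_Lipschitz)
    fix p q assume pq: "p \<in> E" "q \<in> E"
    have "\<bar>dist (bump (p, 0)) (bump (q, 0)) - dist (flat z f (p, 0)) (flat z f (q, 0))\<bar> \<le> \<eta> * dist (flat z f (p, 0)) (flat z f (q, 0))"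
      by (rule near_isometry[OF z f \<epsilon> \<eta>(1)]) (use pq E(1) uv in auto)
    then show "dist p q \<le> (1 + \<eta>) * dist (shadow z f p) (shadow z f q)"
      by (simp add: bump_def flat_def dist_Pair_Pair algebra_simps)
  qed (use \<eta> in simp)
  then show "hausdorff_measure k E \<le> ennreal ((1 + \<eta>) ^ k) * hausdorff_measure k (shadow z f ` E)" by simp
qed

lemma continuous_depth: "continuous_on S depth"
  unfolding depth_def by (intro continuous_intros)

lemma borel_collar: "collar r \<in> sets borel"
proof -
  have "open (D \<inter> {x. depth x < r})"
    using open_D continuous_depth by (intro open_Int open_Collect_less continuous_on_const) auto
  then show ?thesis unfolding collar_def by (simp add: Collect_conj_eq[symmetric] Int_def)
qed

lemma finite_measure_collar: "emeasure lborel (collar r) < \<infinity>"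
proof -
  have "emeasure lborel (collar r) \<le> emeasure lborel (closure D)"
    unfolding collar_def using closure_subset by (intro emeasure_mono) auto
  also have "\<dots> < \<infinity>" using bounded_D by (intro emeasure_compact_finite) simp
  finally show ?thesis .
qed

lemma compact_frontier_D: "compact (frontier D)"
  using bounded_D by (rule compact_frontier_bounded)

text \<open>
  For any cover of the boundary by small sets \<open>U n\<close>, the layer over \<open>U n\<close> has
  volume at most about \<open>r\<close> times the area of the shadow of \<open>U n\<close>, and this area
  is at most the weight of \<open>U n\<close> by the isodiametric inequality.
\<close>

lemma collar_le_hausdorff:
  assumes dim: "DIM('h::euclidean_space) + 1 = DIM('v)" and \<eta>: "0 < \<eta>" "\<eta> < 1"
  shows "\<exists>r0>0. \<forall>r. 0 < r \<and> r < r0 \<longrightarrow>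
     emeasure lborel (collar r) \<le> ennreal ((1 + \<eta>) ^ DIM('v) * r) * hausdorff_measure (DIM('h)) (frontier D)"
    (is "\<exists>r0>0. \<forall>r. 0 < r \<and> r < r0 \<longrightarrow> ?P r")
proof -
  define \<epsilon> where "\<epsilon> = min (R / 4) (\<eta> * R / 10)"
  have \<epsilon>: "0 < \<epsilon>" "4 * \<epsilon> \<le> R" "5 * \<epsilon> \<le> \<eta> * R / 2" unfolding \<epsilon>_def using R \<eta> by auto
  let ?k = "DIM('h)"
  have "emeasure lborel (collar r) \<le> ennreal ((1 + \<eta>) ^ DIM('v) * r) * hausdorff_measure ?k (frontier D)"
    if r: "0 < r" "r < \<eta> * R / 4" for r
  proof -
    have \<eta>R: "5 * \<epsilon> + 2 * r \<le> \<eta> * R" using \<epsilon> r by linarith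
    have c: "0 < (1 + \<eta>) ^ DIM('v) * r" using \<eta> r by simp
    have "emeasure lborel (collar r) \<le> ennreal ((1 + \<eta>) ^ DIM('v) * r) * hausdorff_pre ?k \<epsilon> (frontier D)"
    proof (rule hausdorff_pre_geI_mult[OF c])
      fix U :: "nat \<Rightarrow> 'v set"
      assume U: "frontier D \<subseteq> (\<Union>n. U n)" "\<And>n. bounded (U n)" "\<And>n. diameter (U n) \<le> \<epsilon>"
      define C where "C n = closure (U n) \<inter> frontier D" for n
      have compC: "compact (C n)" for n unfolding C_def
        using U(2) compact_frontier_D by (intro compact_Int) auto
      have subC: "C n \<subseteq> frontier D" for n unfolding C_def by auto
      let ?F = "\<lambda>n. bump ` (C n \<times> {0..r})"
      have Fb: "?F n \<in> sets borel" for n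
        by (intro borel_compact compact_bump_image compC subC) auto
      have piece: "emeasure lborel (?F n) \<le> ennreal ((1 + \<eta>) ^ DIM('v) * r) * hausdorff_weight ?k (U n)" for n
      proof (cases "C n = {}")
        case False
        then obtain z where zC: "z \<in> C n" by blast
        then have z: "z \<in> frontier D" using subC by blast
        obtain f :: "'v \<Rightarrow> 'h" where f: "tangent_isometry z f" using tangent_isometry_exists[OF dim z] .
        have bC: "bounded (closure (U n))" "diameter (closure (U n)) = diameter (U n)"
          using U(2) by (auto simp: bounded_closure diameter_closure)
        have dC: "dist p q \<le> diameter (U n)" if "p \<in> C n" "q \<in> C n" for p q
          using diameter_bounded_bound[OF bC(1), of p q] that bC(2) unfolding C_def by auto
        have sub: "C n \<subseteq> frontier D \<inter> cball z \<epsilon>"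
          using subC dC[OF zC] U(3)[of n] by force
        have "emeasure lborel (?F n) \<le> ennreal ((1 + \<eta>) ^ DIM('v) * (r - 0)) * emeasure lborel (shadow z f ` C n)"
          by (rule collar_piece(2)[OF dim z f _ \<epsilon>(2) \<eta>R _ \<eta>(2) sub, where K="\<lambda>_. C n"])
            (use \<epsilon> \<eta> r compC in auto)
        also have "\<dots> \<le> ennreal ((1 + \<eta>) ^ DIM('v) * (r - 0)) * hausdorff_weight ?k (U n)"
        proof (rule mult_left_mono)
          have cs: "compact (shadow z f ` C n)" by (rule compact_shadow_image[OF compC f])
          have ds: "diameter (shadow z f ` C n) \<le> diameter (U n)"
          proof (rule diameter_le)
            fix x y assume "x \<in> shadow z f ` C n" "y \<in> shadow z f ` C n"
            then obtain p q where pq: "p \<in> C n" "x = shadow z f p" "q \<in> C n" "y = shadow z f q" by auto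
            let ?w = "p - q"
            have n1: "\<nu> z \<bullet> \<nu> z = 1" by (rule normal_self[OF z])
            have "norm (x - y) = norm (?w - (?w \<bullet> \<nu> z) *\<^sub>R \<nu> z)"
              using f unfolding pq shadow_diff[OF f] tangent_isometry_def
              by (simp add: inner_diff_left n1)
            also have "\<dots> \<le> norm ?w"
            proof (rule power2_le_imp_le)
              show "(norm (?w - (?w \<bullet> \<nu> z) *\<^sub>R \<nu> z))\<^sup>2 \<le> (norm ?w)\<^sup>2"
                unfolding norm_diff_unit_sq[OF n1] by (simp add: power2_eq_square)
            qed simp
            also have "\<dots> \<le> diameter (U n)" using dC[OF pq(1,3)] by (simp add: dist_norm)
            finally show "norm (x - y) \<le> diameter (U n)" .
          qed (use zC in auto)
          have "U n \<noteq> {}" using zC unfolding C_def by auto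
          have "emeasure lborel (shadow z f ` C n) \<le> hausdorff_weight ?k (shadow z f ` C n)"
            using emeasure_closure_le_weight[OF compact_imp_bounded[OF cs]] compact_imp_closed[OF cs] by simp
          also have "\<dots> \<le> hausdorff_weight ?k (U n)"
            unfolding hausdorff_weight_def using \<open>U n \<noteq> {}\<close> ds diameter_ge_0[OF compact_imp_bounded[OF cs]]
            by (auto intro!: ennreal_leI mult_left_mono power_mono)
          finally show "emeasure lborel (shadow z f ` C n) \<le> hausdorff_weight ?k (U n)" .
        qed simp
        finally show ?thesis by simp
      qed simp
      have "collar r \<subseteq> (\<Union>n. ?F n)"
      proof
        fix x assume x: "x \<in> collar r"
        then obtain p where p: "p \<in> frontier D" "x = p + depth x *\<^sub>R \<nu> p" "0 < depth x" "depth x < r"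
          using nearest_frontier_point unfolding collar_def by blast
        then obtain n where "p \<in> U n" using U(1) by blast
        then have "p \<in> C n" using p(1) closure_subset unfolding C_def by auto
        then have "x \<in> ?F n" using p by (intro image_eqI[of _ _ "(p, depth x)"]) (auto simp: bump_def)
        then show "x \<in> (\<Union>n. ?F n)" by (rule UN_I[OF UNIV_I])
      qed
      then have "emeasure lborel (collar r) \<le> emeasure lborel (\<Union>n. ?F n)"
        using Fb by (intro emeasure_mono) auto
      also have "\<dots> \<le> (\<Sum>n. emeasure lborel (?F n))"
        using Fb by (intro emeasure_subadditive_countably) auto
      also have "\<dots> \<le> (\<Sum>n. ennreal ((1 + \<eta>) ^ DIM('v) * r) * hausdorff_weight ?k (U n))"
        by (intro suminf_le piece) auto
      also have "\<dots> = ennreal ((1 + \<eta>) ^ DIM('v) * r) * (\<Sum>n. hausdorff_weight ?k (U n))" by simp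
      finally show "emeasure lborel (collar r) \<le> ennreal ((1 + \<eta>) ^ DIM('v) * r) * (\<Sum>n. hausdorff_weight ?k (U n))" .
    qed
    also have "\<dots> \<le> ennreal ((1 + \<eta>) ^ DIM('v) * r) * hausdorff_measure ?k (frontier D)"
      using \<epsilon> by (intro mult_left_mono hausdorff_pre_le_measure) auto
    finally show ?thesis .
  qed
  then have "\<forall>r. 0 < r \<and> r < \<eta> * R / 4 \<longrightarrow> ?P r" by simp
  moreover have "0 < \<eta> * R / 4" using \<eta> R by simp
  ultimately show ?thesis by (intro exI[of _ "\<eta> * R / 4"] conjI)
qed

text \<open>
  Differences of closed balls of radius \<open>\<epsilon>\<close> around finitely many boundary points; a
  relatively open subset of a compact set is a countable union of compact sets.
\<close>

lemma frontier_small_partition: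
  assumes "0 < \<epsilon>" "frontier D \<noteq> {}"
  obtains z :: "nat \<Rightarrow> 'v" and E :: "nat \<Rightarrow> 'v set" where
    "\<And>j. z j \<in> frontier D" "\<And>j. E j \<subseteq> frontier D \<inter> cball (z j) \<epsilon>"
    "disjoint_family E" "frontier D = (\<Union>j. E j)"
    "\<And>j. \<exists>K::nat \<Rightarrow> 'v set. E j = (\<Union>n. K n) \<and> (\<forall>n. compact (K n))"
proof -
  have "frontier D \<subseteq> (\<Union>z\<in>frontier D. ball z \<epsilon>)" using assms(1) by auto
  then obtain Z where Z: "Z \<subseteq> frontier D" "finite Z" "frontier D \<subseteq> (\<Union>z\<in>Z. ball z \<epsilon>)"
    by (rule compactE_image[OF compact_frontier_D, rotated]) auto
  then have Zne: "Z \<noteq> {}" using assms(2) by auto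
  define z where "z = from_nat_into Z"
  have zZ: "range z = Z" unfolding z_def using Zne Z(2) by (simp add: range_from_nat_into countable_finite)
  define E where "E j = (frontier D \<inter> cball (z j) \<epsilon>) - (\<Union>i<j. cball (z i) \<epsilon>)" for j
  have 5: "\<exists>K::nat \<Rightarrow> 'v set. E j = (\<Union>n. K n) \<and> (\<forall>n. compact (K n))" for j
  proof -
    have "open (- (\<Union>i<j. cball (z i) \<epsilon>))" by (intro open_Compl closed_UN) auto
    then obtain C :: "nat \<Rightarrow> 'v set" where C: "\<And>n. compact (C n)" "\<Union>(range C) = - (\<Union>i<j. cball (z i) \<epsilon>)"
      using open_Union_compact_subsets by metis
    have "E j = (\<Union>n. (frontier D \<inter> cball (z j) \<epsilon>) \<inter> C n)" unfolding E_def using C(2) by blast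
    moreover have "compact ((frontier D \<inter> cball (z j) \<epsilon>) \<inter> C n)" for n
      using compact_frontier_D C(1) by (intro compact_Int) auto
    ultimately show ?thesis by (intro exI[of _ "\<lambda>n. (frontier D \<inter> cball (z j) \<epsilon>) \<inter> C n"]) blast
  qed
  have 3: "disjoint_family E"
  proof -
    have lt: "E i \<inter> E j = {}" if "i < j" for i j using that unfolding E_def by auto
    have "E i \<inter> E j = {}" if "i \<noteq> j" for i j
    proof (cases "i < j")
      case False
      then show ?thesis using lt[of j i] that by (simp add: Int_commute)
    qed (rule lt)
    then show ?thesis unfolding disjoint_family_on_def by simp
  qed
  have 4: "frontier D = (\<Union>j. E j)"
  proof
    show "frontier D \<subseteq> (\<Union>j. E j)"
    proof
      fix p assume p: "p \<in> frontier D"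
      then obtain y where y: "y \<in> Z" "p \<in> ball y \<epsilon>" using Z(3) by blast
      then obtain j where "y = z j" using zZ by blast
      then have "p \<in> cball (z j) \<epsilon>" using y by simp
      define n where "n = (LEAST j. p \<in> cball (z j) \<epsilon>)"
      have "p \<in> cball (z n) \<epsilon>" unfolding n_def by (rule LeastI) fact
      moreover have "p \<notin> cball (z i) \<epsilon>" if "i < n" for i
        using not_less_Least that unfolding n_def by blast
      ultimately have "p \<in> E n" unfolding E_def using p by simp
      then show "p \<in> (\<Union>j. E j)" by (rule UN_I[OF UNIV_I])
    qed
    show "(\<Union>j. E j) \<subseteq> frontier D" unfolding E_def by blast
  qed
  have 1: "z j \<in> frontier D" for j using zZ Z(1) by blast
  have 2: "E j \<subseteq> frontier D \<inter> cball (z j) \<epsilon>" for j unfolding E_def by auto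
  show ?thesis by (rule that[OF 1 2 3 4 5])
qed

text \<open>
  The layers over disjoint pieces of the boundary are disjoint and lie in the collar, because nearest points
  are unique. On a shadow, Hausdorff measure is Lebesgue measure.
\<close>

lemma hausdorff_le_collar:
  assumes dim: "DIM('h::euclidean_space) + 1 = DIM('v)" and \<eta>: "0 < \<eta>" "\<eta> < 1 / 2"
  shows "\<exists>r0>0. \<forall>r. 0 < r \<and> r < r0 \<longrightarrow>
     ennreal ((1 - 2 * \<eta>) * r) * hausdorff_measure (DIM('h)) (frontier D)
       \<le> ennreal ((1 + \<eta>) ^ DIM('h) * (1 / (1 - \<eta>)) ^ DIM('v)) * emeasure lborel (collar r)"
    (is "\<exists>r0>0. \<forall>r. 0 < r \<and> r < r0 \<longrightarrow> ?P r")
proof (cases "frontier D = {}")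
  case True
  then show ?thesis by (intro exI[of _ 1]) simp
next
  case False
  define \<epsilon> where "\<epsilon> = min (R / 4) (\<eta> * R / 10)"
  have \<epsilon>: "0 < \<epsilon>" "4 * \<epsilon> \<le> R" "5 * \<epsilon> \<le> \<eta> * R / 2" unfolding \<epsilon>_def using R \<eta> by auto
  let ?k = "DIM('h)"
  obtain z E where z: "\<And>j. z j \<in> frontier D" and E: "\<And>j. E j \<subseteq> frontier D \<inter> cball (z j) \<epsilon>"
    "disjoint_family E" "frontier D = (\<Union>j::nat. E j)"
    "\<And>j. \<exists>K::nat \<Rightarrow> 'v set. E j = (\<Union>n. K n) \<and> (\<forall>n. compact (K n))"
    using frontier_small_partition[OF \<epsilon>(1) False] by blast
  have "\<exists>f :: 'v \<Rightarrow> 'h. tangent_isometry (z j) f" for j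
    using tangent_isometry_exists[OF dim z] by blast
  then obtain f :: "nat \<Rightarrow> 'v \<Rightarrow> 'h" where f: "\<And>j. tangent_isometry (z j) (f j)" by metis
  have "ennreal ((1 - 2 * \<eta>) * r) * hausdorff_measure ?k (frontier D)
       \<le> ennreal ((1 + \<eta>) ^ ?k * (1 / (1 - \<eta>)) ^ DIM('v)) * emeasure lborel (collar r)"
    if r: "0 < r" "r < \<eta> * R / 4" for r
  proof -
    have \<eta>R: "5 * \<epsilon> + 2 * r \<le> \<eta> * R" using \<epsilon> r by linarith
    have "\<eta> * R \<le> 1 * R" using \<eta> R by (intro mult_right_mono) auto
    then have rR: "r < R" using r R by linarith
    \<comment> \<open>Depths 0 and \<open>r\<close> do not belong to the collar; the layer in between loses only the fraction \<open>2 * \<eta>\<close>.\<close>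
    let ?u = "\<eta> * r" and ?v = "(1 - \<eta>) * r"
    have uv: "0 < ?u" "?u \<le> ?v" "?v < r" using \<eta> r by (auto intro!: mult_right_mono)
    let ?F = "\<lambda>j. bump ` (E j \<times> {?u..?v})"
    let ?Q = "\<lambda>j. shadow (z j) (f j) ` E j"
    have P: "?F j \<in> sets borel
        \<and> ennreal (?v - ?u) * emeasure lborel (?Q j) \<le> ennreal ((1 / (1 - \<eta>)) ^ DIM('v)) * emeasure lborel (?F j)
        \<and> hausdorff_measure ?k (E j) \<le> ennreal ((1 + \<eta>) ^ ?k) * emeasure lborel (?Q j)" for j
    proof -
      obtain K where K: "E j = (\<Union>n. K n)" "\<And>n::nat. compact (K n)" using E(4)[of j] by blast
      note cp = collar_piece[OF dim z f _ \<epsilon>(2) \<eta>R _ _ E(1) K, of ?u ?v]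
      have h: "0 \<le> \<epsilon>" "0 \<le> \<eta>" "\<eta> < 1" "0 \<le> ?u" "?v \<le> r" using \<epsilon> \<eta> uv by auto
      show ?thesis
        using cp(1,3)[OF h(1-4) uv(2) h(5)] cp(4)[OF h(1-4) uv(2) h(5), of ?k]
          hausdorff_measure_eq_lborel[OF cp(5)[OF h(1-4) uv(2) h(5)]] by simp
    qed
    have disj: "disjoint_family ?F"
      unfolding disjoint_family_on_def
    proof (intro ballI impI)
      fix i j :: nat assume "i \<noteq> j"
      show "?F i \<inter> ?F j = {}"
      proof (rule ccontr)
        assume "?F i \<inter> ?F j \<noteq> {}"
        then obtain x where x: "x \<in> ?F i" "x \<in> ?F j" by blast
        from x(1) obtain p s where p: "p \<in> E i" "s \<in> {?u..?v}" "x = p + s *\<^sub>R \<nu> p"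
          unfolding bump_def by (auto simp: image_iff)
        from x(2) obtain q t where q: "q \<in> E j" "t \<in> {?u..?v}" "x = q + t *\<^sub>R \<nu> q"
          unfolding bump_def by (auto simp: image_iff)
        have eq: "p + s *\<^sub>R \<nu> p = q + t *\<^sub>R \<nu> q" using p(3) q(3) by simp
        have pq: "p \<in> frontier D" "q \<in> frontier D" using p q E(1) by auto
        have st: "0 < s" "s < R" "0 < t" "t < R" using p q uv rR by auto
        have "s = t" using collar_point(2)[OF pq(1) st(1,2)] collar_point(2)[OF pq(2) st(3,4)] eq by simp
        then have "dist (p + s *\<^sub>R \<nu> p) q \<le> s" using eq unit[OF pq(2)] st by (simp add: dist_norm)
        then have "q = p" by (rule nearest_unique[OF pq st(1,2)])
        then show False using p q E(2) \<open>i \<noteq> j\<close> unfolding disjoint_family_on_def by blast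
      qed
    qed
    have subc: "?F j \<subseteq> collar r" for j
    proof
      fix x assume "x \<in> ?F j"
      then obtain p s where ps: "p \<in> E j" "s \<in> {?u..?v}" "x = p + s *\<^sub>R \<nu> p" unfolding bump_def by auto
      have "p \<in> frontier D" "0 < s" "s < R" "s < r" using ps E(1) uv rR by auto
      then show "x \<in> collar r" unfolding collar_def ps(3) using collar_point by auto
    qed
    have "ennreal (?v - ?u) * hausdorff_measure ?k (frontier D) \<le> ennreal (?v - ?u) * (\<Sum>j. hausdorff_measure ?k (E j))"
      unfolding E(3) by (intro mult_left_mono hausdorff_measure_UN_le) auto
    also have "\<dots> \<le> ennreal (?v - ?u) * (\<Sum>j. ennreal ((1 + \<eta>) ^ ?k) * emeasure lborel (?Q j))"
      using P by (intro mult_left_mono suminf_le) auto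
    also have "\<dots> = ennreal ((1 + \<eta>) ^ ?k) * (\<Sum>j. ennreal (?v - ?u) * emeasure lborel (?Q j))"
      by (simp add: mult_ac)
    also have "\<dots> \<le> ennreal ((1 + \<eta>) ^ ?k) * (\<Sum>j. ennreal ((1 / (1 - \<eta>)) ^ DIM('v)) * emeasure lborel (?F j))"
      using P by (intro mult_left_mono suminf_le) auto
    also have "\<dots> = ennreal ((1 + \<eta>) ^ ?k * (1 / (1 - \<eta>)) ^ DIM('v)) * (\<Sum>j. emeasure lborel (?F j))"
      using \<eta> by (simp add: ennreal_mult mult_ac)
    also have "(\<Sum>j. emeasure lborel (?F j)) = emeasure lborel (\<Union>j. ?F j)"
      using P disj by (intro suminf_emeasure) auto
    also have "ennreal ((1 + \<eta>) ^ ?k * (1 / (1 - \<eta>)) ^ DIM('v)) * emeasure lborel (\<Union>j. ?F j)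
       \<le> ennreal ((1 + \<eta>) ^ ?k * (1 / (1 - \<eta>)) ^ DIM('v)) * emeasure lborel (collar r)"
      using subc borel_collar by (intro mult_left_mono emeasure_mono) auto
    also have "?v - ?u = (1 - 2 * \<eta>) * r" by (simp add: algebra_simps)
    finally show ?thesis .
  qed
  then have "\<forall>r. 0 < r \<and> r < \<eta> * R / 4 \<longrightarrow> ?P r" by simp
  moreover have "0 < \<eta> * R / 4" using \<eta> R by simp
  ultimately show ?thesis by (intro exI[of _ "\<eta> * R / 4"] conjI)
qed

theorem collar_volume_asymptotics:
  assumes dim: "DIM('h::euclidean_space) + 1 = DIM('v)"
  shows "((\<lambda>r. measure lborel (collar r) / r) \<longlongrightarrow> enn2real (hausdorff_measure (DIM('h)) (frontier D))) (at_right 0)"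
proof -
  let ?H = "hausdorff_measure (DIM('h)) (frontier D)"
  define \<kappa> where "\<kappa> = enn2real ?H"
  let ?V = "\<lambda>r. measure lborel (collar r)"
  have V: "emeasure lborel (collar r) = ennreal (?V r)" for r
    using finite_measure_collar[of r] by (intro emeasure_eq_ennreal_measure) auto
  have fin: "?H \<noteq> \<infinity>"
  proof
    assume H: "?H = \<infinity>"
    obtain r0 where r0: "r0 > 0" "\<And>r. 0 < r \<and> r < r0 \<Longrightarrow>
     ennreal ((1 - 2 * (1 / 4)) * r) * ?H \<le> ennreal ((1 + 1 / 4) ^ DIM('h) * (1 / (1 - 1 / 4)) ^ DIM('v)) * emeasure lborel (collar r)"
      using hausdorff_le_collar[OF dim, of "1 / 4"] by auto
    from r0(2)[of "r0 / 2"] r0(1) show False unfolding H V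
      by (simp add: ennreal_mult_top ennreal_mult'[symmetric] top_unique)
  qed
  have H: "?H = ennreal \<kappa>" "0 \<le> \<kappa>" unfolding \<kappa>_def using fin by (auto simp: less_top)
  have up: "eventually (\<lambda>r. ?V r / r \<le> (1 + \<eta>) ^ DIM('v) * \<kappa>) (at_right 0)" if \<eta>: "0 < \<eta>" "\<eta> < 1" for \<eta>
  proof -
    obtain r0 where r0: "r0 > 0" "\<And>r. 0 < r \<and> r < r0 \<Longrightarrow> emeasure lborel (collar r) \<le> ennreal ((1 + \<eta>) ^ DIM('v) * r) * ?H"
      using collar_le_hausdorff[OF dim \<eta>] by auto
    have "?V r / r \<le> (1 + \<eta>) ^ DIM('v) * \<kappa>" if r: "0 < r" "r < r0" for r
    proof -
      have "ennreal (?V r) \<le> ennreal ((1 + \<eta>) ^ DIM('v) * r * \<kappa>)"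
        using r0(2)[of r] r \<eta> H unfolding V H(1) by (simp add: ennreal_mult)
      then have "?V r \<le> (1 + \<eta>) ^ DIM('v) * r * \<kappa>" using r \<eta> H by (simp add: ennreal_le_iff)
      then show ?thesis using r by (simp add: field_simps)
    qed
    then show ?thesis using r0(1) unfolding eventually_at_right_field by blast
  qed
  have lo: "eventually (\<lambda>r. (1 - 2 * \<eta>) * ((1 - \<eta>) ^ DIM('v) / (1 + \<eta>) ^ DIM('h)) * \<kappa> \<le> ?V r / r) (at_right 0)"
    if \<eta>: "0 < \<eta>" "\<eta> < 1 / 2" for \<eta>
  proof -
    let ?c = "(1 + \<eta>) ^ DIM('h) * (1 / (1 - \<eta>)) ^ DIM('v)"
    have c: "0 < ?c" using \<eta> by simp
    obtain r0 where r0: "r0 > 0" "\<And>r. 0 < r \<and> r < r0 \<Longrightarrow>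
        ennreal ((1 - 2 * \<eta>) * r) * ?H \<le> ennreal ?c * emeasure lborel (collar r)"
      using hausdorff_le_collar[OF dim \<eta>] by auto
    have "(1 - 2 * \<eta>) * ((1 - \<eta>) ^ DIM('v) / (1 + \<eta>) ^ DIM('h)) * \<kappa> \<le> ?V r / r" if r: "0 < r" "r < r0" for r
    proof -
      have "ennreal ((1 - 2 * \<eta>) * r * \<kappa>) \<le> ennreal (?c * ?V r)"
        using r0(2)[of r] r \<eta> c H unfolding V H(1) by (simp add: ennreal_mult)
      then have *: "(1 - 2 * \<eta>) * r * \<kappa> \<le> ?c * ?V r" using c by (simp add: ennreal_le_iff)
      have "(1 - 2 * \<eta>) * ((1 - \<eta>) ^ DIM('v) / (1 + \<eta>) ^ DIM('h)) * \<kappa> = ((1 - 2 * \<eta>) * r * \<kappa>) / ?c / r"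
        using r \<eta> by (simp add: power_divide field_simps)
      also have "\<dots> \<le> ?V r / r"
        using * c r by (intro divide_right_mono) (simp_all add: pos_divide_le_eq mult.commute)
      finally show ?thesis .
    qed
    then show ?thesis using r0(1) unfolding eventually_at_right_field by blast
  qed
  show ?thesis
    unfolding \<kappa>_def[symmetric]
  proof (rule order_tendstoI)
    fix a assume a: "a < \<kappa>"
    have "((\<lambda>\<eta>. (1 - 2 * \<eta>) * ((1 - \<eta>) ^ DIM('v) / (1 + \<eta>) ^ DIM('h)) * \<kappa>) \<longlongrightarrow>
        (1 - 2 * 0) * ((1 - 0) ^ DIM('v) / (1 + 0) ^ DIM('h)) * \<kappa>) (at_right 0)"
      by (intro tendsto_intros) auto
    then have "eventually (\<lambda>\<eta>. a < (1 - 2 * \<eta>) * ((1 - \<eta>) ^ DIM('v) / (1 + \<eta>) ^ DIM('h)) * \<kappa>) (at_right (0::real))"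
      using a by (intro order_tendstoD(1)) simp_all
    moreover have "eventually (\<lambda>\<eta>. \<eta> \<in> {0<..<1/2}) (at_right (0::real))"
      by (rule eventually_at_right_real) simp
    ultimately have "eventually (\<lambda>\<eta>. a < (1 - 2 * \<eta>) * ((1 - \<eta>) ^ DIM('v) / (1 + \<eta>) ^ DIM('h)) * \<kappa> \<and> \<eta> \<in> {0<..<1/2}) (at_right (0::real))"
      by eventually_elim simp
    from eventually_happens'[OF trivial_limit_at_right_real this] obtain \<eta> where \<eta>: "a < (1 - 2 * \<eta>) * ((1 - \<eta>) ^ DIM('v) / (1 + \<eta>) ^ DIM('h)) * \<kappa>" "0 < \<eta>" "\<eta> < 1 / 2"
      by auto
    show "eventually (\<lambda>r. a < ?V r / r) (at_right 0)"
      using lo[OF \<eta>(2,3)] by eventually_elim (use \<eta>(1) in linarith)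
  next
    fix a assume a: "\<kappa> < a"
    have "((\<lambda>\<eta>. (1 + \<eta>) ^ DIM('v) * \<kappa>) \<longlongrightarrow> (1 + 0) ^ DIM('v) * \<kappa>) (at_right 0)"
      by (intro tendsto_intros)
    then have "eventually (\<lambda>\<eta>. (1 + \<eta>) ^ DIM('v) * \<kappa> < a) (at_right (0::real))"
      using a by (intro order_tendstoD(2)) simp_all
    moreover have "eventually (\<lambda>\<eta>. \<eta> \<in> {0<..<1}) (at_right (0::real))"
      by (rule eventually_at_right_real) simp
    ultimately have "eventually (\<lambda>\<eta>. (1 + \<eta>) ^ DIM('v) * \<kappa> < a \<and> \<eta> \<in> {0<..<1}) (at_right (0::real))"
      by eventually_elim simp
    from eventually_happens'[OF trivial_limit_at_right_real this] obtain \<eta> where \<eta>: "(1 + \<eta>) ^ DIM('v) * \<kappa> < a" "0 < \<eta>" "\<eta> < 1"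
      by auto
    show "eventually (\<lambda>r. ?V r / r < a) (at_right 0)"
      using up[OF \<eta>(2,3)] by eventually_elim (use \<eta>(1) in linarith)
  qed
qed

end


section \<open>Smooth domains and intervals have tangent balls\<close>

text \<open>
  A finite index type with one element fewer than the standard basis, so that
  \<open>real ^ 'v axis\<close> is a Euclidean space of the dimension of the boundary. The case of
  dimension one is arbitrary and only makes the type nonempty.
\<close>

typedef (overloaded) ('v::euclidean_space) axis =
  "{b :: 'v. b \<in> Basis \<and> (DIM('v) = 1 \<or> b \<noteq> (SOME b. b \<in> Basis))}"
proof (cases "DIM('v) = 1")
  case True
  then show ?thesis using nonempty_Basis by blast
next
  case False
  then have "\<not> card (Basis :: 'v set) \<le> Suc 0" using DIM_positive[where 'a='v] by linarith
  then obtain b c :: 'v where "b \<in> Basis" "c \<in> Basis" "b \<noteq> c"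
    by (auto simp: card_le_Suc0_iff_eq)
  then show ?thesis by (cases "b = (SOME b. b \<in> Basis)") auto
qed

instance axis :: (euclidean_space) finite
proof
  have "finite (Rep_axis ` (UNIV :: 'a axis set))"
    by (rule finite_subset[OF _ finite_Basis]) (use Rep_axis in auto)
  then show "finite (UNIV :: 'a axis set)"
    by (rule finite_imageD) (simp add: inj_on_def Rep_axis_inject)
qed

lemma DIM_hyperplane_type:
  assumes "2 \<le> DIM('v::euclidean_space)"
  shows "DIM(real ^ 'v axis) + 1 = DIM('v)"
proof -
  let ?b = "SOME b. b \<in> (Basis :: 'v set)"
  have b: "?b \<in> Basis" using nonempty_Basis by (metis someI_ex ex_in_conv)
  have "bij_betw Rep_axis (UNIV :: 'v axis set) (Basis - {?b})"
    unfolding bij_betw_def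
  proof
    show "inj (Rep_axis :: 'v axis \<Rightarrow> 'v)" by (simp add: inj_on_def Rep_axis_inject)
    show "range (Rep_axis :: 'v axis \<Rightarrow> 'v) = Basis - {?b}"
      using type_definition.Rep_range[OF type_definition_axis[where 'v='v]] assms by auto
  qed
  then have "CARD('v axis) = card (Basis - {?b})" by (rule bij_betw_same_card)
  also have "\<dots> = DIM('v) - 1" using b by simp
  finally show ?thesis using assms by simp
qed

text \<open>
  The mean value inequality along the segment from 0 to \<open>x\<close>: the gradient there is at most
  \<open>\<Lambda> * norm x\<close>.
\<close>

lemma C11_chart_quadratic:
  fixes D :: "'v::euclidean_space set"
  assumes ch: "C11_chart D R \<Lambda> z \<nu> \<psi> G" and \<Lambda>: "0 < \<Lambda>" and x: "x \<bullet> \<nu> = 0"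
  shows "\<bar>\<psi> x\<bar> \<le> \<Lambda> * (norm x)\<^sup>2"
proof -
  define H where "H = {v. v \<bullet> \<nu> = 0}"
  have c: "norm \<nu> = 1" "\<And>x. x \<in> H \<Longrightarrow> (\<psi> has_derivative (\<lambda>h. G x \<bullet> h)) (at x within H)"
    "\<psi> 0 = 0" "G 0 = 0" "\<And>x y. x \<in> H \<Longrightarrow> y \<in> H \<Longrightarrow> norm (G x - G y) \<le> \<Lambda> * norm (x - y)"
    using ch unfolding C11_chart_def Let_def H_def by auto
  define S where "S = H \<inter> cball 0 (norm x)"
  have H0: "0 \<in> H" unfolding H_def by simp
  have "convex H" unfolding H_def using convex_hyperplane[of \<nu> 0] by (simp add: inner_commute)
  then have "convex S" unfolding S_def by (intro convex_Int) auto
  moreover have "(\<psi> has_derivative (\<lambda>h. G y \<bullet> h)) (at y within S)" if "y \<in> S" for y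
    by (rule has_derivative_subset[OF c(2)]) (use that in \<open>auto simp: S_def\<close>)
  moreover have "onorm (\<lambda>h. G y \<bullet> h) \<le> \<Lambda> * norm x" if y: "y \<in> S" for y
  proof (rule onorm_le)
    fix h :: 'v
    have "norm (G y) \<le> \<Lambda> * norm y" using c(5)[of y 0] c(4) y H0 unfolding S_def by simp
    also have "\<dots> \<le> \<Lambda> * norm x" using y \<Lambda> unfolding S_def by (intro mult_left_mono) auto
    finally have "norm (G y) * norm h \<le> \<Lambda> * norm x * norm h" by (intro mult_right_mono) auto
    then show "norm (G y \<bullet> h) \<le> \<Lambda> * norm x * norm h" using Cauchy_Schwarz_ineq2[of "G y" h] by simp
  qed
  moreover have "x \<in> S" "0 \<in> S" using x unfolding S_def H_def by auto
  ultimately have "norm (\<psi> x - \<psi> 0) \<le> \<Lambda> * norm x * norm (x - 0)"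
    by (rule differentiable_bound)
  then show ?thesis using c(3) by (simp add: power2_eq_square mult.assoc)
qed

text \<open>
  In a ball of radius \<open>\<rho>\<close> that touches the tangent plane at \<open>z\<close>, the height
  exceeds \<open>norm w ^ 2 / (2 * \<rho>)\<close>, which beats the quadratic bound on
  \<open>\<psi>\<close>. The sign \<open>\<sigma>\<close> treats both sides at once.
\<close>

lemma C11_chart_tangent_balls:
  fixes D :: "'v::euclidean_space set"
  assumes ch: "C11_chart D R \<Lambda> z \<nu> \<psi> G" and \<Lambda>: "0 < \<Lambda>"
    and \<rho>: "0 < \<rho>" "2 * \<rho> \<le> R" "2 * \<Lambda> * \<rho> \<le> 1"
  shows "norm \<nu> = 1" "ball (z + \<rho> *\<^sub>R \<nu>) \<rho> \<subseteq> D" "ball (z - \<rho> *\<^sub>R \<nu>) \<rho> \<inter> D = {}"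
proof -
  show n: "norm \<nu> = 1" using ch unfolding C11_chart_def Let_def by auto
  have nn: "\<nu> \<bullet> \<nu> = 1" using n by (simp add: dot_square_norm)
  have eq: "ball z R \<inter> D = {y \<in> ball z R. (y - z) \<bullet> \<nu> > \<psi> ((y - z) - ((y - z) \<bullet> \<nu>) *\<^sub>R \<nu>)}"
    using ch unfolding C11_chart_def Let_def by auto
  have main: "y \<in> ball z R \<and> \<bar>\<psi> ((y - z) - ((y - z) \<bullet> \<nu>) *\<^sub>R \<nu>)\<bar> < \<sigma> * ((y - z) \<bullet> \<nu>)"
    if y: "y \<in> ball (z + (\<sigma> * \<rho>) *\<^sub>R \<nu>) \<rho>" and \<sigma>: "\<sigma> = 1 \<or> \<sigma> = - 1" for y \<sigma>
  proof -
    let ?w = "y - z" and ?t = "(y - z) \<bullet> \<nu>"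
    let ?h = "?w - ?t *\<^sub>R \<nu>"
    have \<sigma>2: "\<sigma> * \<sigma> = 1" "\<bar>\<sigma>\<bar> = 1" using \<sigma> by auto
    have lt: "norm (?w - (\<sigma> * \<rho>) *\<^sub>R \<nu>) < \<rho>" using y by (simp add: dist_norm norm_minus_commute algebra_simps)
    then have "(norm (?w - (\<sigma> * \<rho>) *\<^sub>R \<nu>))\<^sup>2 < \<rho>\<^sup>2" by (intro power_strict_mono) auto
    moreover have "(\<sigma> * \<rho>)\<^sup>2 = \<rho>\<^sup>2" using \<sigma> by auto
    ultimately have a: "(norm ?w)\<^sup>2 < 2 * (\<sigma> * \<rho>) * ?t" unfolding norm_diff_unit_sq[OF nn] by simp
    have "norm ?w \<le> norm (?w - (\<sigma> * \<rho>) *\<^sub>R \<nu>) + norm ((\<sigma> * \<rho>) *\<^sub>R \<nu>)" by (metis add.commute norm_triangle_sub)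
    also have "\<dots> < \<rho> + \<rho>" using lt n \<sigma>2 \<rho> by (simp add: abs_mult)
    finally have yz: "y \<in> ball z R" using \<rho> by (simp add: dist_norm norm_minus_commute)
    have "(norm ?h)\<^sup>2 \<le> (norm ?w)\<^sup>2" unfolding norm_diff_unit_sq[OF nn] by (simp add: power2_eq_square)
    moreover have "?h \<bullet> \<nu> = 0" by (simp add: inner_diff_left nn)
    then have "\<bar>\<psi> ?h\<bar> \<le> \<Lambda> * (norm ?h)\<^sup>2" by (rule C11_chart_quadratic[OF ch \<Lambda>])
    ultimately have "\<bar>\<psi> ?h\<bar> \<le> \<Lambda> * (norm ?w)\<^sup>2" using \<Lambda> by (meson mult_left_mono order_trans less_imp_le)
    also have "\<dots> < \<Lambda> * (2 * (\<sigma> * \<rho>) * ?t)" using a \<Lambda> by (rule mult_strict_left_mono)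
    also have "\<dots> = (2 * \<Lambda> * \<rho>) * (\<sigma> * ?t)" by (simp add: mult_ac)
    also have "\<dots> \<le> 1 * (\<sigma> * ?t)"
    proof (rule mult_right_mono[OF \<rho>(3)])
      have "0 < \<rho> * (2 * (\<sigma> * ?t))" using order_le_less_trans[OF zero_le_power2 a] by (simp add: mult_ac)
      then show "0 \<le> \<sigma> * ?t" using \<rho>(1) by (auto simp: zero_less_mult_iff zero_le_mult_iff)
    qed
    finally show ?thesis using yz by simp
  qed
  show "ball (z + \<rho> *\<^sub>R \<nu>) \<rho> \<subseteq> D"
  proof
    fix y assume "y \<in> ball (z + \<rho> *\<^sub>R \<nu>) \<rho>"
    then have "y \<in> {y \<in> ball z R. (y - z) \<bullet> \<nu> > \<psi> ((y - z) - ((y - z) \<bullet> \<nu>) *\<^sub>R \<nu>)}" using main[of y 1] by auto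
    then show "y \<in> D" using eq by blast
  qed
  show "ball (z - \<rho> *\<^sub>R \<nu>) \<rho> \<inter> D = {}"
  proof (rule ccontr)
    assume "ball (z - \<rho> *\<^sub>R \<nu>) \<rho> \<inter> D \<noteq> {}"
    then obtain y where y: "y \<in> ball (z - \<rho> *\<^sub>R \<nu>) \<rho>" "y \<in> D" by blast
    have m: "y \<in> ball z R" "\<bar>\<psi> ((y - z) - ((y - z) \<bullet> \<nu>) *\<^sub>R \<nu>)\<bar> < - ((y - z) \<bullet> \<nu>)" using main[of y "-1"] y by auto
    then have "y \<in> {y \<in> ball z R. (y - z) \<bullet> \<nu> > \<psi> ((y - z) - ((y - z) \<bullet> \<nu>) *\<^sub>R \<nu>)}" using eq y by blast
    then show False using m by auto
  qed
qed

lemma C11_open_tangent_balls: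
  fixes D :: "'v::euclidean_space set"
  assumes "C11_open D" "bounded D"
  shows "\<exists>R \<nu>. tangent_balls D R \<nu>"
proof -
  obtain R \<Lambda> where R: "0 < R" "0 < \<Lambda>" and op: "open D"
    and ch: "\<forall>z\<in>frontier D. \<exists>\<nu> \<psi> G. C11_chart D R \<Lambda> z \<nu> \<psi> G"
    using assms(1) unfolding C11_open_def by auto
  from bchoice[OF ch] obtain \<nu> where \<nu>: "\<forall>z\<in>frontier D. \<exists>\<psi> G. C11_chart D R \<Lambda> z (\<nu> z) \<psi> G" by (rule exE)
  define \<rho> where "\<rho> = min (R / 2) (1 / (2 * \<Lambda>))"
  have \<rho>: "0 < \<rho>" "2 * \<rho> \<le> R" "2 * \<Lambda> * \<rho> \<le> 1"
    unfolding \<rho>_def using R by (auto simp: min_def field_simps)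
  have "tangent_balls D \<rho> \<nu>"
  proof
    fix p assume "p \<in> frontier D"
    then obtain \<psi> G where c: "C11_chart D R \<Lambda> p (\<nu> p) \<psi> G" using \<nu> by blast
    show "norm (\<nu> p) = 1" "ball (p + \<rho> *\<^sub>R \<nu> p) \<rho> \<subseteq> D" "ball (p - \<rho> *\<^sub>R \<nu> p) \<rho> \<inter> D = {}"
      by (rule C11_chart_tangent_balls[OF c R(2) \<rho>])+
  qed (use \<rho> op assms in auto)
  then show ?thesis by blast
qed

lemma interval_collar:
  fixes a b :: "'v::euclidean_space"
  assumes dim: "DIM('v) = 1" and ne: "box a b \<noteq> {}"
  shows "\<exists>R \<nu>. tangent_balls (box a b) R \<nu> \<and>
    (\<forall>r. 0 < r \<and> r < R \<longrightarrow> measure lborel {x \<in> box a b. infdist x (- box a b) < r} = 2 * r)"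
proof -
  obtain e :: 'v where B: "Basis = {e}" using dim by (auto simp: card_1_singleton_iff)
  have e1: "e \<in> Basis" unfolding B by (rule singletonI)
  note e = e1 norm_Basis[OF e1] inner_same_Basis[OF e1]
  have rep: "x = (x \<bullet> e) *\<^sub>R e" for x :: 'v using euclidean_representation[of x] unfolding B by simp
  have eqI: "x = y" if "x \<bullet> e = y \<bullet> e" for x y :: 'v using rep[of x] rep[of y] that by simp
  have nrm: "norm x = \<bar>x \<bullet> e\<bar>" for x :: 'v
    by (subst rep) (use e in simp)
  have ds: "dist x y = \<bar>x \<bullet> e - y \<bullet> e\<bar>" for x y :: 'v unfolding dist_norm nrm by (simp add: inner_diff_left)
  have mem: "x \<in> box u v \<longleftrightarrow> u \<bullet> e < x \<bullet> e \<and> x \<bullet> e < v \<bullet> e" for x u v :: 'v unfolding mem_box B by simp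
  have cmem: "x \<in> cbox u v \<longleftrightarrow> u \<bullet> e \<le> x \<bullet> e \<and> x \<bullet> e \<le> v \<bullet> e" for x u v :: 'v unfolding mem_box B by simp
  have ab: "a \<bullet> e < b \<bullet> e" using ne unfolding box_ne_empty B by simp
  have fr: "frontier (box a b) = {a, b}"
  proof -
    have "frontier (box a b) = cbox a b - box a b" using ne by (simp add: frontier_box)
    also have "\<dots> = {a, b}"
    proof (intro set_eqI iffI)
      fix x assume "x \<in> cbox a b - box a b"
      then have "x \<bullet> e = a \<bullet> e \<or> x \<bullet> e = b \<bullet> e" unfolding Diff_iff mem cmem by linarith
      then show "x \<in> {a, b}" using eqI by blast
    next
      fix x assume "x \<in> {a, b}" then show "x \<in> cbox a b - box a b" unfolding Diff_iff mem cmem using ab by auto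
    qed
    finally show ?thesis .
  qed
  define R where "R = (b \<bullet> e - a \<bullet> e) / 2"
  define \<nu> where "\<nu> p = (if p = a then e else - e)" for p
  have \<nu>: "\<nu> a = e" "\<nu> b = - e" unfolding \<nu>_def using ab by auto
  interpret tangent_balls "box a b" R \<nu>
  proof
    show "0 < R" unfolding R_def using ab by simp
    fix p assume "p \<in> frontier (box a b)"
    then have p: "p = a \<or> p = b" using fr by auto
    then show "norm (\<nu> p) = 1" using \<nu> e by auto
    show "ball (p + R *\<^sub>R \<nu> p) R \<subseteq> box a b"
    proof
      fix x assume "x \<in> ball (p + R *\<^sub>R \<nu> p) R"
      then show "x \<in> box a b" using p \<nu> e ab
        by (auto simp: ds mem inner_add_left inner_diff_left R_def field_simps abs_less_iff)
    qed
    show "ball (p - R *\<^sub>R \<nu> p) R \<inter> box a b = {}"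
    proof (rule ccontr)
      assume "ball (p - R *\<^sub>R \<nu> p) R \<inter> box a b \<noteq> {}"
      then obtain x where "x \<in> ball (p - R *\<^sub>R \<nu> p) R" "x \<in> box a b" by blast
      then show False using p \<nu> e ab
        by (auto simp: ds mem inner_add_left inner_diff_left R_def field_simps abs_less_iff)
    qed
  qed (auto simp: bounded_box)
  have "measure lborel {x \<in> box a b. infdist x (- box a b) < r} = 2 * r" if r: "0 < r" "r < R" for r
  proof -
    have "{x \<in> box a b. infdist x (- box a b) < r} = collar r" unfolding collar_def depth_def ..
    also have "\<dots> = box a (a + r *\<^sub>R e) \<union> box (b - r *\<^sub>R e) b"
    proof (intro set_eqI iffI)
      fix x assume "x \<in> collar r"
      then have x: "x \<in> box a b" "depth x < r" unfolding collar_def by auto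
      then obtain p where p: "p \<in> frontier (box a b)" "x = p + depth x *\<^sub>R \<nu> p" "0 < depth x"
        using nearest_frontier_point by blast
      then have "x \<bullet> e = p \<bullet> e + depth x * (\<nu> p \<bullet> e)" by (metis inner_add_left inner_scaleR_left)
      then show "x \<in> box a (a + r *\<^sub>R e) \<union> box (b - r *\<^sub>R e) b"
        using p(1,3) x(2) fr \<nu> e unfolding Un_iff mem by (auto simp: inner_add_left inner_diff_left)
    next
      fix x assume x: "x \<in> box a (a + r *\<^sub>R e) \<union> box (b - r *\<^sub>R e) b"
      show "x \<in> collar r"
      proof (cases "x \<in> box a (a + r *\<^sub>R e)")
        case True
        then have s: "0 < x \<bullet> e - a \<bullet> e" "x \<bullet> e - a \<bullet> e < r" unfolding mem by (auto simp: inner_add_left e)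
        have "x = a + (x \<bullet> e - a \<bullet> e) *\<^sub>R \<nu> a" by (rule eqI) (simp add: \<nu> inner_add_left e)
        then show ?thesis using collar_point[of a "x \<bullet> e - a \<bullet> e"] fr s r unfolding collar_def by auto
      next
        case False
        then have s: "0 < b \<bullet> e - x \<bullet> e" "b \<bullet> e - x \<bullet> e < r" using x unfolding Un_iff mem by (auto simp: inner_diff_left e)
        have "x = b + (b \<bullet> e - x \<bullet> e) *\<^sub>R \<nu> b" by (rule eqI) (simp add: \<nu> inner_diff_left e)
        then show ?thesis using collar_point[of b "b \<bullet> e - x \<bullet> e"] fr s r unfolding collar_def by auto
      qed
    qed
    also have "measure lborel \<dots> = measure lborel (box a (a + r *\<^sub>R e)) + measure lborel (box (b - r *\<^sub>R e) b)"
    proof (rule measure_Union)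
      show "box a (a + r *\<^sub>R e) \<inter> box (b - r *\<^sub>R e) b = {}"
        using r unfolding R_def by (auto simp: mem inner_add_left inner_diff_left e)
    qed (auto simp: emeasure_lborel_box_eq)
    also have "\<dots> = 2 * r" using r e unfolding measure_lborel_box_eq B by (simp add: inner_add_left inner_diff_left)
    finally show ?thesis .
  qed
  then show ?thesis using tangent_balls_axioms by (intro exI[of _ R] exI[of _ \<nu>] conjI) auto
qed

theorem smooth_domain_collar:
  fixes D :: "'v::euclidean_space set"
  assumes "(DIM('v) = 1 \<and> (\<exists>a b. D = box a b \<and> box a b \<noteq> {})) \<or>
     (DIM('v) \<ge> 2 \<and> C11_open D \<and> connected D \<and> bounded D)"
  shows "\<exists>R \<nu>. tangent_balls D R \<nu> \<and>
    ((\<lambda>r. measure lborel {x \<in> D. infdist x (- D) < r} / r) \<longlongrightarrow> boundary_measure D) (at_right 0)"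
  using assms
proof
  assume "DIM('v) = 1 \<and> (\<exists>a b. D = box a b \<and> box a b \<noteq> {})"
  then obtain a b where d: "DIM('v) = 1" "D = box a b" "box a b \<noteq> {}" by blast
  obtain R \<nu> where R: "tangent_balls D R \<nu>"
    "\<And>r. 0 < r \<Longrightarrow> r < R \<Longrightarrow> measure lborel {x \<in> D. infdist x (- D) < r} = 2 * r"
    using interval_collar[OF d(1,3)] d(2) by blast
  have "0 < R" using R(1) tangent_balls.R by blast
  have "\<forall>\<^sub>F r in at_right 0. measure lborel {x \<in> D. infdist x (- D) < r} / r = boundary_measure D"
    using eventually_at_right_real[OF \<open>0 < R\<close>]
    by eventually_elim (use R(2) d(1) in \<open>simp add: boundary_measure_def\<close>)
  from R(1) tendsto_eventually[OF this] show ?thesis by (intro exI conjI)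
next
  assume a: "DIM('v) \<ge> 2 \<and> C11_open D \<and> connected D \<and> bounded D"
  then obtain R \<nu> where R: "tangent_balls D R \<nu>" using C11_open_tangent_balls by blast
  interpret tangent_balls D R \<nu> by fact
  have "DIM(real ^ 'v axis) + 1 = DIM('v)" using a by (intro DIM_hyperplane_type) simp
  from collar_volume_asymptotics[OF this]
  have "((\<lambda>r. measure lborel (collar r) / r) \<longlongrightarrow> boundary_measure D) (at_right 0)"
    using a \<open>DIM(real ^ 'v axis) + 1 = DIM('v)\<close>[symmetric] unfolding boundary_measure_def by simp
  then have "((\<lambda>r. measure lborel {x \<in> D. infdist x (- D) < r} / r) \<longlongrightarrow> boundary_measure D) (at_right 0)"
    unfolding collar_def depth_def .
  then show ?thesis using tangent_balls_axioms by (intro exI[of _ R] exI[of _ \<nu>] conjI)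
qed


section \<open>Integrals of stable type\<close>

lemma nn_integral_powr_tail:
  assumes "0 < c" "0 < b"
  shows "(\<integral>\<^sup>+q. ennreal (q powr (- 1 - b)) * indicator {c<..} q \<partial>lborel) = ennreal (c powr (- b) / b)"
proof -
  have "(\<integral>\<^sup>+q. ennreal (q powr (- 1 - b)) * indicator {c<..} q \<partial>lborel)
      = (\<integral>\<^sup>+q. ennreal (q powr (- 1 - b)) * indicator {c..} q \<partial>lborel)"
    using AE_lborel_singleton[of c] by (intro nn_integral_cong_AE) (auto simp: indicator_def)
  also have "\<dots> = ennreal (0 - (- (c powr (- b)) / b))"
  proof (rule nn_integral_FTC_atLeast)
    show "((\<lambda>q. - (q powr (- b)) / b) has_real_derivative q powr (- 1 - b)) (at q)" if "c \<le> q" for q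
      using that assms by (auto intro!: derivative_eq_intros simp: field_simps powr_diff powr_minus)
    have "((\<lambda>q::real. q powr (- b)) \<longlongrightarrow> 0) at_top"
      using assms by (intro tendsto_neg_powr filterlim_ident) auto
    from tendsto_divide[OF tendsto_minus[OF this] tendsto_const[of b]] show "((\<lambda>q. - (q powr (- b)) / b) \<longlongrightarrow> 0) at_top"
      using assms by simp
  qed auto
  finally show ?thesis by simp
qed

lemma nn_integral_Gamma:
  assumes "0 < s"
  shows "(\<integral>\<^sup>+x. ennreal (exp (- x) * x powr (s - 1)) * indicator {0<..} x \<partial>lborel) = ennreal (Gamma s)"
proof -
  have "(\<integral>\<^sup>+x. ennreal (indicat_real {0..} x * (x powr (s - 1) / exp x)) \<partial>lborel) = ennreal (Gamma s)"
    using Gamma_integral_real[OF assms] by (intro nn_integral_has_integral_lebesgue) auto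
  moreover have "(\<integral>\<^sup>+x. ennreal (exp (- x) * x powr (s - 1)) * indicator {0<..} x \<partial>lborel)
     = (\<integral>\<^sup>+x. ennreal (indicat_real {0..} x * (x powr (s - 1) / exp x)) \<partial>lborel)"
    by (intro nn_integral_cong) (auto simp: indicator_def exp_minus field_simps)
  ultimately show ?thesis by simp
qed

lemma nn_integral_exp_segment:
  assumes "0 \<le> y"
  shows "(\<integral>\<^sup>+x. ennreal (exp (- x)) * indicator {0<..} x * (if x < y then 1 else 0) \<partial>lborel) = ennreal (1 - exp (- y))"
proof -
  have "(\<integral>\<^sup>+x. ennreal (exp (- x)) * indicator {0<..} x * (if x < y then 1 else 0) \<partial>lborel)
     = (\<integral>\<^sup>+x. ennreal (exp (- x)) * indicator {0..y} x \<partial>lborel)"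
    using AE_lborel_singleton[of 0] AE_lborel_singleton[of y]
    by (intro nn_integral_cong_AE) (auto simp: indicator_def)
  also have "\<dots> = ennreal (- exp (- y) - (- exp (- 0)))"
    using assms by (intro nn_integral_FTC_Icc) (auto intro!: derivative_eq_intros)
  finally show ?thesis by simp
qed

text \<open>
  Substituting an exponential integral for \<open>1 - exp (- t * q powr \<beta>)\<close> and
  exchanging the order of integration leaves the integral that defines the Gamma function.
\<close>

lemma stable_integral:
  assumes b: "0 < b" "b < \<beta>" and t: "0 < t"
  shows "(\<integral>\<^sup>+q. ennreal ((1 - exp (- t * q powr \<beta>)) * q powr (- 1 - b)) * indicator {0<..} q \<partial>lborel)
     = ennreal (Gamma (1 - b / \<beta>) / b * t powr (b / \<beta>))"
proof -
  let ?f = "\<lambda>q x. ennreal (exp (- x)) * indicator {0<..} x * (if x < t * q powr \<beta> then 1 else 0)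
       * (ennreal (q powr (- 1 - b)) * indicator {0<..} q)"
  have \<beta>: "0 < \<beta>" using b by simp
  have gam: "(\<integral>\<^sup>+x. ennreal (exp (- x) * x powr ((1 - b / \<beta>) - 1)) * indicator {0<..} x \<partial>lborel) = ennreal (Gamma (1 - b / \<beta>))"
    by (rule nn_integral_Gamma) (use b \<beta> in \<open>simp add: field_simps\<close>)
  have "(\<integral>\<^sup>+q. ennreal ((1 - exp (- t * q powr \<beta>)) * q powr (- 1 - b)) * indicator {0<..} q \<partial>lborel)
     = (\<integral>\<^sup>+q. \<integral>\<^sup>+x. ?f q x \<partial>lborel \<partial>lborel)"
  proof (rule nn_integral_cong)
    fix q :: real
    have "(\<integral>\<^sup>+x. ?f q x \<partial>lborel) = (\<integral>\<^sup>+x. ennreal (exp (- x)) * indicator {0<..} x * (if x < t * q powr \<beta> then 1 else 0) \<partial>lborel)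
        * (ennreal (q powr (- 1 - b)) * indicator {0<..} q)"
      by (rule nn_integral_multc) measurable
    also have "\<dots> = ennreal (1 - exp (- (t * q powr \<beta>))) * (ennreal (q powr (- 1 - b)) * indicator {0<..} q)"
      using t by (subst nn_integral_exp_segment) auto
    also have "\<dots> = ennreal ((1 - exp (- t * q powr \<beta>)) * q powr (- 1 - b)) * indicator {0<..} q"
      using t by (subst ennreal_mult) (auto simp: mult_ac)
    finally show "ennreal ((1 - exp (- t * q powr \<beta>)) * q powr (- 1 - b)) * indicator {0<..} q = (\<integral>\<^sup>+x. ?f q x \<partial>lborel)" ..
  qed
  also have "\<dots> = (\<integral>\<^sup>+x. \<integral>\<^sup>+q. ?f q x \<partial>lborel \<partial>lborel)"
    by (rule lborel_pair.Fubini') measurable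
  also have "\<dots> = (\<integral>\<^sup>+x. ennreal (t powr (b / \<beta>) / b) * (ennreal (exp (- x) * x powr ((1 - b / \<beta>) - 1)) * indicator {0<..} x) \<partial>lborel)"
  proof (rule nn_integral_cong)
    fix x :: real
    show "(\<integral>\<^sup>+q. ?f q x \<partial>lborel) = ennreal (t powr (b / \<beta>) / b) * (ennreal (exp (- x) * x powr ((1 - b / \<beta>) - 1)) * indicator {0<..} x)"
    proof (cases "0 < x")
      case True
      define c where "c = (x / t) powr (1 / \<beta>)"
      have c: "0 < c" unfolding c_def using True t by simp
      have cb: "c powr \<beta> = x / t" unfolding c_def using True t \<beta> by (simp add: powr_powr)
      have iff: "x < t * q powr \<beta> \<longleftrightarrow> c < q" if "0 < q" for q
      proof -
        have "x < t * q powr \<beta> \<longleftrightarrow> c powr \<beta> < q powr \<beta>" unfolding cb using t by (simp add: field_simps)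
        also have "\<dots> \<longleftrightarrow> c < q" using c that \<beta> by (meson linorder_not_less powr_less_mono2 powr_mono2 less_imp_le)
        finally show ?thesis .
      qed
      have "(\<integral>\<^sup>+q. ?f q x \<partial>lborel) = (\<integral>\<^sup>+q. ennreal (exp (- x)) * (ennreal (q powr (- 1 - b)) * indicator {c<..} q) \<partial>lborel)"
      proof (rule nn_integral_cong)
        fix q :: real
        show "?f q x = ennreal (exp (- x)) * (ennreal (q powr (- 1 - b)) * indicator {c<..} q)"
          using True iff[of q] c by (cases "0 < q") (auto simp: indicator_def)
      qed
      also have "\<dots> = ennreal (exp (- x)) * (\<integral>\<^sup>+q. (ennreal (q powr (- 1 - b)) * indicator {c<..} q) \<partial>lborel)"
        by (rule nn_integral_cmult) measurable
      also have "\<dots> = ennreal (exp (- x)) * ennreal (c powr (- b) / b)"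
        using nn_integral_powr_tail[OF c b(1)] by simp
      also have "c powr (- b) = x powr ((1 - b / \<beta>) - 1) * t powr (b / \<beta>)"
        unfolding c_def using True t by (simp add: powr_powr powr_divide powr_minus field_simps)
      finally show ?thesis using True b t by (simp add: ennreal_mult'[symmetric] field_simps)
    qed simp
  qed
  also have "\<dots> = ennreal (t powr (b / \<beta>) / b) * ennreal (Gamma (1 - b / \<beta>))"
    unfolding gam[symmetric] by (rule nn_integral_cmult) measurable
  also have "\<dots> = ennreal (Gamma (1 - b / \<beta>) / b * t powr (b / \<beta>))"
    using b \<beta> by (subst ennreal_mult[symmetric]) (auto simp: Gamma_real_pos less_imp_le field_simps)
  finally show ?thesis .
qed

section \<open>Laws on the half-line with stable Laplace transform\<close>

text \<open>
  The law at time \<open>t\<close> of a stable subordinator, described without reference to a process.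
\<close>

definition stable_law :: "real \<Rightarrow> real \<Rightarrow> real measure \<Rightarrow> bool" where
  "stable_law \<beta> t \<mu> \<longleftrightarrow> prob_space \<mu> \<and> sets \<mu> = sets borel \<and> (AE s in \<mu>. 0 \<le> s) \<and>
     (\<forall>q>0. (LINT s|\<mu>. exp (- q * s)) = exp (- t * q powr \<beta>))"

locale stable_law_loc =
  fixes \<beta> t :: real and \<mu> :: "real measure"
  assumes law: "stable_law \<beta> t \<mu>"
begin

sublocale prob_space \<mu> using law unfolding stable_law_def by simp

lemma sets_mu [measurable_cong]: "sets \<mu> = sets borel" using law unfolding stable_law_def by simp

lemma space_mu: "space \<mu> = UNIV" using sets_eq_imp_space_eq[OF sets_mu] by simp

lemma AE_nonneg: "AE s in \<mu>. 0 \<le> s" using law unfolding stable_law_def by simp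

lemma integrable_exp: "0 \<le> q \<Longrightarrow> integrable \<mu> (\<lambda>s. exp (- q * s))"
  using AE_nonneg by (intro integrable_const_bound[where B=1]) auto

lemma laplace: "0 < q \<Longrightarrow> (LINT s|\<mu>. exp (- q * s)) = exp (- t * q powr \<beta>)"
  using law unfolding stable_law_def by simp

lemma nn_laplace_compl:
  assumes "0 < q"
  shows "(\<integral>\<^sup>+s. ennreal (1 - exp (- q * s)) \<partial>\<mu>) = ennreal (1 - exp (- t * q powr \<beta>))"
proof -
  have i: "integrable \<mu> (\<lambda>s. exp (- q * s))" using assms by (intro integrable_exp) simp
  have "(\<integral>\<^sup>+s. ennreal (1 - exp (- q * s)) \<partial>\<mu>) = ennreal (LINT s|\<mu>. 1 - exp (- q * s))"
    using i AE_nonneg assms by (intro nn_integral_eq_integral) (auto elim!: eventually_mono)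
  also have "(LINT s|\<mu>. 1 - exp (- q * s)) = 1 - exp (- t * q powr \<beta>)"
    using i laplace[OF assms] by (simp add: prob_space)
  finally show ?thesis .
qed

text \<open>
  Fubini, with the Laplace transform of \<open>\<mu>\<close> evaluated under the integral.
\<close>

lemma nn_integral_mixture:
  assumes [measurable]: "B \<in> sets borel" and B: "B \<subseteq> {0<..}"
  shows "(\<integral>\<^sup>+s. (\<integral>\<^sup>+q. ennreal ((1 - exp (- q * s)) * q powr (- 3 / 2)) * indicator B q \<partial>lborel) \<partial>\<mu>)
     = (\<integral>\<^sup>+q. ennreal ((1 - exp (- t * q powr \<beta>)) * q powr (- 3 / 2)) * indicator B q \<partial>lborel)"
proof -
  interpret pair_sigma_finite \<mu> lborel by unfold_locales
  let ?f = "\<lambda>s q. ennreal ((1 - exp (- q * s)) * q powr (- 3 / 2)) * indicator B q"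
  have "(\<integral>\<^sup>+s. (\<integral>\<^sup>+q. ?f s q \<partial>lborel) \<partial>\<mu>) = (\<integral>\<^sup>+q. (\<integral>\<^sup>+s. ?f s q \<partial>\<mu>) \<partial>lborel)"
    by (rule Fubini'[symmetric]) measurable
  also have "\<dots> = (\<integral>\<^sup>+q. ennreal ((1 - exp (- t * q powr \<beta>)) * q powr (- 3 / 2)) * indicator B q \<partial>lborel)"
  proof (rule nn_integral_cong)
    fix q :: real
    show "(\<integral>\<^sup>+s. ?f s q \<partial>\<mu>) = ennreal ((1 - exp (- t * q powr \<beta>)) * q powr (- 3 / 2)) * indicator B q"
    proof (cases "q \<in> B")
      case True
      then have q: "0 < q" using B by auto
      have "(\<integral>\<^sup>+s. ?f s q \<partial>\<mu>) = (\<integral>\<^sup>+s. ennreal (q powr (- 3 / 2)) * ennreal (1 - exp (- q * s)) \<partial>\<mu>)"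
        using True by (intro nn_integral_cong) (simp add: ennreal_mult'' mult.commute)
      also have "\<dots> = ennreal (q powr (- 3 / 2)) * ennreal (1 - exp (- t * q powr \<beta>))"
        unfolding nn_laplace_compl[OF q, symmetric] by (rule nn_integral_cmult) measurable
      finally show ?thesis using True by (simp add: ennreal_mult'' mult.commute)
    qed simp
  qed
  finally show ?thesis .
qed

end

text \<open>
  Without the restriction to \<open>q > 1\<close> the integral would be
  \<open>2 * sqrt pi * sqrt s\<close>. The cut keeps the behaviour near 0 up to \<open>O(s)\<close>
  and makes the function bounded, so that its average is finite for all \<open>\<beta>\<close>.
\<close>

definition cut_root :: "real \<Rightarrow> real" where
  "cut_root s = enn2real (\<integral>\<^sup>+q. ennreal ((1 - exp (- q * s)) * q powr (- 3 / 2)) * indicator {1<..} q \<partial>lborel)"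

text \<open>
  The average of \<open>cut_root\<close> under the stable law of index \<open>\<beta>\<close> at time
  \<open>t\<close>, see \<open>integral_cut_root\<close>.
\<close>

definition cut_rate :: "real \<Rightarrow> real \<Rightarrow> real" where
  "cut_rate \<beta> t = enn2real (\<integral>\<^sup>+q. ennreal ((1 - exp (- t * q powr \<beta>)) * q powr (- 3 / 2)) * indicator {1<..} q \<partial>lborel)"

lemma nn_integral_split_cut:
  assumes g: "g \<in> borel_measurable borel"
  shows "(\<integral>\<^sup>+q. g q * indicator {0<..} q \<partial>lborel)
    = (\<integral>\<^sup>+q. g q * indicator {0<..1} q \<partial>lborel) + (\<integral>\<^sup>+q. g q * indicator {1<..} q \<partial>(lborel :: real measure))"
  using g by (subst nn_integral_add[symmetric]) (auto intro!: nn_integral_cong simp: indicator_def)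

lemma nn_integral_powr_unit:
  assumes "- 1 < p"
  shows "(\<integral>\<^sup>+q. ennreal (q powr p) * indicator {0<..1} q \<partial>lborel) = ennreal (1 / (p + 1))"
proof -
  have "((\<lambda>q. q powr p) has_integral (1 powr (p + 1) / (p + 1))) {0..1}"
    using assms by (intro has_integral_powr_from_0) auto
  then have "(\<integral>\<^sup>+q. ennreal (indicat_real {0..1} q * q powr p) \<partial>lborel) = ennreal (1 / (p + 1))"
    by (intro nn_integral_has_integral_lebesgue) auto
  moreover have "(\<integral>\<^sup>+q. ennreal (q powr p) * indicator {0<..1} q \<partial>lborel) = (\<integral>\<^sup>+q. ennreal (indicat_real {0..1} q * q powr p) \<partial>lborel)"
    using AE_lborel_singleton[of 0] by (intro nn_integral_cong_AE) (auto simp: indicator_def)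
  ultimately show ?thesis by simp
qed

text \<open>
  The integral over all \<open>q > 0\<close> has a closed form, and the part over
  \<open>q \<le> 1\<close> is \<open>O(t)\<close>.
\<close>

lemma cut_rate_bounds:
  assumes \<beta>: "1 / 2 < \<beta>" and t: "0 < t"
  shows "cut_rate \<beta> t \<le> 2 * Gamma (1 - 1 / (2 * \<beta>)) * t powr (1 / (2 * \<beta>))"
    and "2 * Gamma (1 - 1 / (2 * \<beta>)) * t powr (1 / (2 * \<beta>)) - t / (\<beta> - 1 / 2) \<le> cut_rate \<beta> t"
    and "(\<integral>\<^sup>+q. ennreal ((1 - exp (- t * q powr \<beta>)) * q powr (- 3 / 2)) * indicator {1<..} q \<partial>lborel) = ennreal (cut_rate \<beta> t)"
proof -
  let ?g = "\<lambda>q. ennreal ((1 - exp (- t * q powr \<beta>)) * q powr (- 3 / 2))"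
  let ?G = "2 * Gamma (1 - 1 / (2 * \<beta>)) * t powr (1 / (2 * \<beta>))"
  have pos: "0 < Gamma (1 - 1 / (2 * \<beta>))" using \<beta> by (intro Gamma_real_pos) (simp add: field_simps)
  then have Gp: "0 \<le> ?G" by simp
  have "(\<integral>\<^sup>+q. ?g q * indicator {0<..} q \<partial>lborel) = ennreal ?G"
    using stable_integral[of "1 / 2" \<beta> t] \<beta> t by (simp add: mult_ac)
  then have sum: "(\<integral>\<^sup>+q. ?g q * indicator {0<..1} q \<partial>lborel) + (\<integral>\<^sup>+q. ?g q * indicator {1<..} q \<partial>lborel) = ennreal ?G"
    by (subst (asm) nn_integral_split_cut) auto
  have bd: "(\<integral>\<^sup>+q. ?g q * indicator {1<..} q \<partial>lborel) \<le> ennreal ?G"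
    unfolding sum[symmetric] by simp
  then show e: "(\<integral>\<^sup>+q. ?g q * indicator {1<..} q \<partial>lborel) = ennreal (cut_rate \<beta> t)"
    unfolding cut_rate_def by (intro ennreal_enn2real[symmetric] le_less_trans[OF _ ennreal_less_top])
  show le: "cut_rate \<beta> t \<le> ?G" using bd[unfolded e] Gp by (subst (asm) ennreal_le_iff)
  have "(\<integral>\<^sup>+q. ?g q * indicator {0<..1} q \<partial>lborel) \<le> (\<integral>\<^sup>+q. ennreal t * (ennreal (q powr (\<beta> - 3 / 2)) * indicator {0<..1} q) \<partial>lborel)"
  proof (rule nn_integral_mono)
    fix q :: real
    have "(1 - exp (- t * q powr \<beta>)) * q powr (- 3 / 2) \<le> (t * q powr \<beta>) * q powr (- 3 / 2)"
      using exp_ge_add_one_self[of "- t * q powr \<beta>"] by (intro mult_right_mono) auto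
    also have "\<dots> = t * q powr (\<beta> + - 3 / 2)" unfolding mult.assoc powr_add ..
    also have "\<beta> + - 3 / 2 = \<beta> - 3 / 2" by simp
    finally show "?g q * indicator {0<..1} q \<le> ennreal t * (ennreal (q powr (\<beta> - 3 / 2)) * indicator {0<..1} q)"
      using t by (auto simp: indicator_def ennreal_mult'[symmetric] intro!: ennreal_leI)
  qed
  also have "\<dots> = ennreal t * ennreal (1 / (\<beta> - 3 / 2 + 1))"
    using \<beta> by (subst nn_integral_cmult) (auto simp: nn_integral_powr_unit)
  also have "\<dots> = ennreal (t / (\<beta> - 1 / 2))" using t \<beta> by (simp add: ennreal_mult'[symmetric])
  finally have "ennreal ?G \<le> ennreal (t / (\<beta> - 1 / 2)) + ennreal (cut_rate \<beta> t)"
    unfolding sum[symmetric] e by (rule add_right_mono)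
  also have "\<dots> = ennreal (t / (\<beta> - 1 / 2) + cut_rate \<beta> t)"
    using t \<beta> by (simp add: cut_rate_def ennreal_plus)
  finally have "?G \<le> t / (\<beta> - 1 / 2) + cut_rate \<beta> t"
    using t \<beta> by (subst (asm) ennreal_le_iff) (auto simp: cut_rate_def)
  then show "?G - t / (\<beta> - 1 / 2) \<le> cut_rate \<beta> t" by simp
qed

text \<open>
  Here the integrand is about \<open>t / q\<close> until \<open>q\<close> reaches
  \<open>1 / t\<^sup>2\<close>, where \<open>1 - exp (- t * sqrt q)\<close> saturates; this range
  contributes \<open>t * ln (1 / t\<^sup>2)\<close>.
\<close>

lemma cut_rate_half_bounds:
  assumes t: "0 < t" "t < 1"
  shows "cut_rate (1 / 2) t \<le> 2 * t * ln (1 / t) + 2 * t"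
    and "2 * t * ln (1 / t) - t \<le> cut_rate (1 / 2) t"
    and "(\<integral>\<^sup>+q. ennreal ((1 - exp (- t * q powr (1 / 2))) * q powr (- 3 / 2)) * indicator {1<..} q \<partial>lborel) = ennreal (cut_rate (1 / 2) t)"
proof -
  let ?g = "\<lambda>q. ennreal ((1 - exp (- t * q powr (1 / 2))) * q powr (- 3 / 2))"
  \<comment> \<open>The point where the integrand stops behaving like \<open>t / q\<close>.\<close>
  define m where "m = 1 / t\<^sup>2"
  have m: "1 < m" using t mult_strict_mono[of t 1 t 1] unfolding m_def by (simp add: power2_eq_square)
  have lnm: "ln m = 2 * ln (1 / t)" unfolding m_def using t by (simp add: ln_div ln_realpow)
  have sqm: "sqrt m = 1 / t" unfolding m_def using t by (simp add: real_sqrt_divide)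
  have split: "(\<integral>\<^sup>+q. ?g q * indicator {1<..} q \<partial>lborel)
     = (\<integral>\<^sup>+q. ?g q * indicator {1..m} q \<partial>lborel) + (\<integral>\<^sup>+q. ?g q * indicator {m<..} q \<partial>lborel)"
    using m AE_lborel_singleton[of "1::real"]
    by (subst nn_integral_add[symmetric]) (auto intro!: nn_integral_cong_AE elim!: eventually_mono simp: indicator_def)
  have p1: "q powr (1 / 2) * q powr (- 3 / 2) = 1 / q" if "0 < q" for q :: real
  proof -
    have "q powr (1 / 2) * q powr (- 3 / 2) = q powr (1 / 2 + - 3 / 2)" by (rule powr_add[symmetric])
    also have "\<dots> = q powr (- 1)" by simp
    finally show ?thesis using that by (simp add: powr_minus_divide)
  qed
  have "(\<integral>\<^sup>+q. ?g q * indicator {1..m} q \<partial>lborel) \<le> (\<integral>\<^sup>+q. ennreal (t / q) * indicator {1..m} q \<partial>lborel)"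
  proof (rule nn_integral_mono)
    fix q :: real
    have "(1 - exp (- t * q powr (1 / 2))) * q powr (- 3 / 2) \<le> (t * q powr (1 / 2)) * q powr (- 3 / 2)"
      using exp_ge_add_one_self[of "- t * q powr (1 / 2)"] by (intro mult_right_mono) auto
    then show "?g q * indicator {1..m} q \<le> ennreal (t / q) * indicator {1..m} q"
      using p1[of q] by (auto simp: indicator_def mult.assoc intro!: ennreal_leI)
  qed
  also have "\<dots> = ennreal (t * ln m - t * ln 1)"
    using m t by (intro nn_integral_FTC_Icc) (auto intro!: derivative_eq_intros)
  finally have u1: "(\<integral>\<^sup>+q. ?g q * indicator {1..m} q \<partial>lborel) \<le> ennreal (2 * t * ln (1 / t))" using lnm by (simp add: mult_ac)
  have "(\<integral>\<^sup>+q. ?g q * indicator {m<..} q \<partial>lborel) \<le> (\<integral>\<^sup>+q. ennreal (q powr (- 1 - 1 / 2)) * indicator {m<..} q \<partial>lborel)"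
    using t by (intro nn_integral_mono) (auto simp: indicator_def intro!: ennreal_leI mult_left_le_one_le)
  also have "\<dots> = ennreal (m powr (- (1 / 2)) / (1 / 2))" using m by (intro nn_integral_powr_tail) auto
  also have "m powr (- (1 / 2)) = t" using m t sqm by (simp add: powr_minus powr_half_sqrt)
  finally have u2: "(\<integral>\<^sup>+q. ?g q * indicator {m<..} q \<partial>lborel) \<le> ennreal (2 * t)" by (simp add: mult.commute)
  have lt: "0 \<le> ln (1 / t)" using t by simp
  have up: "(\<integral>\<^sup>+q. ?g q * indicator {1<..} q \<partial>lborel) \<le> ennreal (2 * t * ln (1 / t) + 2 * t)"
    unfolding split using add_mono[OF u1 u2] lt t by (simp add: ennreal_plus)
  then show e: "(\<integral>\<^sup>+q. ?g q * indicator {1<..} q \<partial>lborel) = ennreal (cut_rate (1 / 2) t)"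
    unfolding cut_rate_def by (intro ennreal_enn2real[symmetric] le_less_trans[OF _ ennreal_less_top])
  show "cut_rate (1 / 2) t \<le> 2 * t * ln (1 / t) + 2 * t"
    using up[unfolded e] lt t by (subst (asm) ennreal_le_iff) auto
  have quad: "y - y\<^sup>2 / 2 \<le> 1 - exp (- y)" if "0 \<le> y" for y :: real
  proof -
    have "(\<lambda>y. 1 - exp (- y) - (y - y\<^sup>2 / 2)) 0 \<le> (\<lambda>y. 1 - exp (- y) - (y - y\<^sup>2 / 2)) y"
    proof (rule DERIV_nonneg_imp_nondecreasing[OF that])
      fix x :: real assume "0 \<le> x" "x \<le> y"
      have "((\<lambda>y. 1 - exp (- y) - (y - y\<^sup>2 / 2)) has_real_derivative exp (- x) - (1 - x)) (at x)"
        by (auto intro!: derivative_eq_intros)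
      moreover have "0 \<le> exp (- x) - (1 - x)" using exp_ge_add_one_self[of "- x"] by simp
      ultimately show "\<exists>d. ((\<lambda>y. 1 - exp (- y) - (y - y\<^sup>2 / 2)) has_real_derivative d) (at x) \<and> 0 \<le> d" by blast
    qed
    then show ?thesis by simp
  qed
  let ?h = "\<lambda>q. t / q - t\<^sup>2 / 2 * q powr (- 1 / 2)"
  have hpos: "0 \<le> ?h q" if "1 \<le> q" "q \<le> m" for q
  proof -
    have q0: "0 < q" using that by simp
    have "sqrt q \<le> 1 / t" using that(2) sqm real_sqrt_le_mono by metis
    then have "t * sqrt q \<le> 1" using t by (simp add: field_simps)
    then have "t * (t * sqrt q) \<le> t * 1" using t by (intro mult_left_mono) auto
    then have *: "0 \<le> (t - t * (t * sqrt q) / 2) / q" using q0 t by (intro divide_nonneg_pos) linarith+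
    have "q powr (- 1 / 2) = sqrt q / q" using q0 by (simp add: powr_minus powr_half_sqrt field_simps)
    then have "?h q = (t - t * (t * sqrt q) / 2) / q" by (simp only:) (simp add: power2_eq_square diff_divide_distrib)
    then show ?thesis using * by simp
  qed
  have "ennreal ((t * ln m - t\<^sup>2 * sqrt m) - (t * ln 1 - t\<^sup>2 * sqrt 1)) = (\<integral>\<^sup>+q. ennreal (?h q) * indicator {1..m} q \<partial>lborel)"
  proof (rule nn_integral_FTC_Icc[symmetric])
    fix q assume q: "q \<in> {1..m}"
    show "((\<lambda>q. t * ln q - t\<^sup>2 * sqrt q) has_real_derivative ?h q) (at q)"
      using q by (auto intro!: derivative_eq_intros simp: powr_minus powr_half_sqrt field_simps)
    show "0 \<le> ?h q" using q hpos by auto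
  qed (use m in auto)
  also have "\<dots> \<le> (\<integral>\<^sup>+q. ?g q * indicator {1..m} q \<partial>lborel)"
  proof (rule nn_integral_mono)
    fix q :: real
    show "ennreal (?h q) * indicator {1..m} q \<le> ?g q * indicator {1..m} q"
    proof (cases "q \<in> {1..m}")
      case True
      then have q: "0 < q" by simp
      let ?y = "t * q powr (1 / 2)"
      have "(?y - ?y\<^sup>2 / 2) * q powr (- 3 / 2) = t * (q powr (1 / 2) * q powr (- 3 / 2)) - t\<^sup>2 / 2 * ((q powr (1 / 2))\<^sup>2 * q powr (- 3 / 2))"
        by (simp add: algebra_simps power_mult_distrib)
      also have "(q powr (1 / 2))\<^sup>2 * q powr (- 3 / 2) = q powr (- 1 / 2)"
        unfolding power2_eq_square powr_add[symmetric] by simp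
      also have "t * (q powr (1 / 2) * q powr (- 3 / 2)) = t / q" using p1[OF q] by simp
      finally have "?h q = (?y - ?y\<^sup>2 / 2) * q powr (- 3 / 2)" by simp
      also have "\<dots> \<le> (1 - exp (- ?y)) * q powr (- 3 / 2)"
        using quad[of ?y] t by (intro mult_right_mono) auto
      finally show ?thesis using True by (auto intro!: ennreal_leI)
    qed simp
  qed
  also have "\<dots> \<le> ennreal (cut_rate (1 / 2) t)" unfolding e[symmetric] split by simp
  finally have "ennreal (t * ln m - t\<^sup>2 * sqrt m + t\<^sup>2) \<le> ennreal (cut_rate (1 / 2) t)" by (simp add: algebra_simps)
  then have "t * ln m - t\<^sup>2 * sqrt m + t\<^sup>2 \<le> cut_rate (1 / 2) t"
    by (subst (asm) ennreal_le_iff) (auto simp: cut_rate_def)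
  then show "2 * t * ln (1 / t) - t \<le> cut_rate (1 / 2) t"
  proof -
    assume *: "t * ln m - t\<^sup>2 * sqrt m + t\<^sup>2 \<le> cut_rate (1 / 2) t"
    have "t\<^sup>2 * sqrt m = t" unfolding sqm using t by (simp add: power2_eq_square)
    moreover have "t * ln m = 2 * t * ln (1 / t)" unfolding lnm by simp
    ultimately show ?thesis using * zero_le_power2[of t] by linarith
  qed
qed

text \<open>
  The function \<open>cut_root\<close> is the case \<open>\<beta> = 1\<close> of \<open>cut_rate\<close>.
\<close>

lemma cut_root_bounds:
  assumes s: "0 \<le> s"
  shows "cut_root s \<le> 2 * sqrt pi * sqrt s" and "2 * sqrt pi * sqrt s - 2 * s \<le> cut_root s"
    and "(\<integral>\<^sup>+q. ennreal ((1 - exp (- q * s)) * q powr (- 3 / 2)) * indicator {1<..} q \<partial>lborel) = ennreal (cut_root s)"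
    and "cut_root s \<le> 2" and "0 \<le> cut_root s" and "s = 0 \<Longrightarrow> cut_root s = 0"
proof -
  have eq: "ennreal ((1 - exp (- q * s)) * q powr (- 3 / 2)) * indicator {1<..} q
      = ennreal ((1 - exp (- s * q powr 1)) * q powr (- 3 / 2)) * indicator {1<..} q" for q
    by (auto simp: indicator_def mult.commute)
  have cr: "cut_root s = cut_rate 1 s" unfolding cut_root_def cut_rate_def eq ..
  have "cut_root s \<le> 2 * sqrt pi * sqrt s \<and> 2 * sqrt pi * sqrt s - 2 * s \<le> cut_root s \<and>
    (\<integral>\<^sup>+q. ennreal ((1 - exp (- q * s)) * q powr (- 3 / 2)) * indicator {1<..} q \<partial>lborel) = ennreal (cut_root s)"
  proof (cases "s = 0")
    case False
    then have "0 < s" using s by simp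
    from cut_rate_bounds[OF _ this, of 1] show ?thesis
      unfolding eq cr[symmetric] by (simp add: Gamma_one_half_real powr_half_sqrt \<open>0 < s\<close> less_imp_le)
  qed (simp add: cut_root_def)
  then show "cut_root s \<le> 2 * sqrt pi * sqrt s" "2 * sqrt pi * sqrt s - 2 * s \<le> cut_root s"
    and e: "(\<integral>\<^sup>+q. ennreal ((1 - exp (- q * s)) * q powr (- 3 / 2)) * indicator {1<..} q \<partial>lborel) = ennreal (cut_root s)" by auto
  show "0 \<le> cut_root s" unfolding cut_root_def by simp
  show "s = 0 \<Longrightarrow> cut_root s = 0" unfolding cut_root_def by simp
  have "(\<integral>\<^sup>+q. ennreal ((1 - exp (- q * s)) * q powr (- 3 / 2)) * indicator {1<..} q \<partial>lborel)
     \<le> (\<integral>\<^sup>+q. ennreal (q powr (- 1 - 1 / 2)) * indicator {1<..} q \<partial>lborel)"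
    using s by (intro nn_integral_mono) (auto simp: indicator_def intro!: ennreal_leI mult_left_le_one_le)
  also have "\<dots> = ennreal 2" by (subst nn_integral_powr_tail) auto
  finally show "cut_root s \<le> 2" unfolding e by (subst (asm) ennreal_le_iff) auto
qed

lemma borel_measurable_cut_root [measurable]: "cut_root \<in> borel_measurable borel"
  unfolding cut_root_def by measurable


section \<open>Subordination of a function with square-root growth\<close>

context stable_law_loc
begin

lemma integral_cut_root:
  assumes e: "(\<integral>\<^sup>+q. ennreal ((1 - exp (- t * q powr \<beta>)) * q powr (- 3 / 2)) * indicator {1<..} q \<partial>lborel) = ennreal (cut_rate \<beta> t)"
  shows "has_bochner_integral \<mu> cut_root (cut_rate \<beta> t)"
proof (rule has_bochner_integral_nn_integral)
  show "AE s in \<mu>. 0 \<le> cut_root s" using AE_nonneg by eventually_elim (rule cut_root_bounds(5))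
  have "(\<integral>\<^sup>+s. ennreal (cut_root s) \<partial>\<mu>)
     = (\<integral>\<^sup>+s. (\<integral>\<^sup>+q. ennreal ((1 - exp (- q * s)) * q powr (- 3 / 2)) * indicator {1<..} q \<partial>lborel) \<partial>\<mu>)"
    by (rule nn_integral_cong_AE, rule eventually_mono[OF AE_nonneg], rule cut_root_bounds(3)[symmetric])
  also have "\<dots> = (\<integral>\<^sup>+q. ennreal ((1 - exp (- t * q powr \<beta>)) * q powr (- 3 / 2)) * indicator {1<..} q \<partial>lborel)"
    by (rule nn_integral_mixture) auto
  finally show "(\<integral>\<^sup>+s. ennreal (cut_root s) \<partial>\<mu>) = ennreal (cut_rate \<beta> t)" unfolding e .
  show "0 \<le> cut_rate \<beta> t" unfolding cut_rate_def by simp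
qed measurable

text \<open>
  By Fubini from
  \<open>sqrt s = (1 / (2 * sqrt pi)) * \<integral> (1 - exp (- q * s)) * q powr (- 3 / 2) dq\<close>.
\<close>

lemma integral_sqrt:
  assumes \<beta>: "1 / 2 < \<beta>" and t: "0 < t"
  shows "has_bochner_integral \<mu> sqrt (Gamma (1 - 1 / (2 * \<beta>)) * t powr (1 / (2 * \<beta>)) / sqrt pi)"
proof -
  let ?G = "2 * Gamma (1 - 1 / (2 * \<beta>)) * t powr (1 / (2 * \<beta>))"
  have pos: "0 < Gamma (1 - 1 / (2 * \<beta>))" using \<beta> by (intro Gamma_real_pos) (simp add: field_simps)
  have "has_bochner_integral \<mu> (\<lambda>s. 2 * sqrt pi * sqrt s) ?G"
  proof (rule has_bochner_integral_nn_integral)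
    show "AE s in \<mu>. 0 \<le> 2 * sqrt pi * sqrt s" using AE_nonneg by eventually_elim simp
    have inner: "(\<integral>\<^sup>+q. ennreal ((1 - exp (- q * s)) * q powr (- 3 / 2)) * indicator {0<..} q \<partial>lborel) = ennreal (2 * sqrt pi * sqrt s)"
      if s: "0 \<le> s" for s
    proof (cases "s = 0")
      case False
      then have s: "0 < s" using s by simp
      have "(\<integral>\<^sup>+q. ennreal ((1 - exp (- q * s)) * q powr (- 3 / 2)) * indicator {0<..} q \<partial>lborel)
        = (\<integral>\<^sup>+q. ennreal ((1 - exp (- s * q powr 1)) * q powr (- 1 - 1 / 2)) * indicator {0<..} q \<partial>lborel)"
        by (intro nn_integral_cong) (auto simp: indicator_def mult.commute)
      also have "\<dots> = ennreal (Gamma (1 - (1 / 2) / 1) / (1 / 2) * s powr ((1 / 2) / 1))"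
        by (rule stable_integral) (use s in auto)
      finally show ?thesis using s by (simp add: Gamma_one_half_real powr_half_sqrt)
    qed simp
    have "(\<integral>\<^sup>+s. ennreal (2 * sqrt pi * sqrt s) \<partial>\<mu>)
      = (\<integral>\<^sup>+s. (\<integral>\<^sup>+q. ennreal ((1 - exp (- q * s)) * q powr (- 3 / 2)) * indicator {0<..} q \<partial>lborel) \<partial>\<mu>)"
      by (rule nn_integral_cong_AE, rule eventually_mono[OF AE_nonneg], rule inner[symmetric])
    also have "\<dots> = (\<integral>\<^sup>+q. ennreal ((1 - exp (- t * q powr \<beta>)) * q powr (- 3 / 2)) * indicator {0<..} q \<partial>lborel)"
      by (rule nn_integral_mixture) auto
    also have "\<dots> = (\<integral>\<^sup>+q. ennreal ((1 - exp (- t * q powr \<beta>)) * q powr (- 1 - 1 / 2)) * indicator {0<..} q \<partial>lborel)" by simp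
    also have "\<dots> = ennreal (Gamma (1 - (1 / 2) / \<beta>) / (1 / 2) * t powr ((1 / 2) / \<beta>))"
      by (rule stable_integral) (use \<beta> t in auto)
    finally show "(\<integral>\<^sup>+s. ennreal (2 * sqrt pi * sqrt s) \<partial>\<mu>) = ennreal ?G" by (simp add: mult_ac)
    show "0 \<le> ?G" using pos by simp
  qed measurable
  from has_bochner_integral_divide_zero[OF this, of "2 * sqrt pi"] show ?thesis by simp
qed

lemma integral_exp_compl:
  shows "integrable \<mu> (\<lambda>s. 1 - exp (- s))" "(LINT s|\<mu>. 1 - exp (- s)) = 1 - exp (- t)"
proof -
  have i: "integrable \<mu> (\<lambda>s. exp (- s))" using integrable_exp[of 1] by simp
  then show "integrable \<mu> (\<lambda>s. 1 - exp (- s))" by simp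
  show "(LINT s|\<mu>. 1 - exp (- s)) = 1 - exp (- t)" using i laplace[of 1] by (simp add: prob_space)
qed

end

text \<open>
  Near 0 the two functions have the same square-root behaviour; away from 0 both are bounded and
  \<open>1 - exp (- s)\<close> is bounded below.
\<close>

lemma compare_cut_root:
  fixes H :: "real \<Rightarrow> real"
  assumes H: "\<And>s. 0 \<le> s \<Longrightarrow> 0 \<le> H s \<and> H s \<le> A" "H 0 = 0"
    and lim: "((\<lambda>s. H s / sqrt s) \<longlongrightarrow> c) (at_right 0)" and \<epsilon>: "0 < \<epsilon>"
  shows "\<exists>C\<ge>0. \<forall>s\<ge>0. \<bar>H s - c / (2 * sqrt pi) * cut_root s\<bar> \<le> \<epsilon> * cut_root s + C * (1 - exp (- s))"
proof -
  let ?c = "c / (2 * sqrt pi)"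
  have rt: "((\<lambda>s. sqrt s) \<longlongrightarrow> 0) (at_right 0)"
    by (rule tendsto_eq_intros refl filterlim_ident)+ simp
  have k: "((\<lambda>s. cut_root s / sqrt s) \<longlongrightarrow> 2 * sqrt pi) (at_right 0)"
  proof (rule tendsto_sandwich)
    show "((\<lambda>s. 2 * sqrt pi - 2 * sqrt s) \<longlongrightarrow> 2 * sqrt pi) (at_right 0)"
      using tendsto_diff[OF tendsto_const tendsto_mult[OF tendsto_const rt], of "2 * sqrt pi" 2] by simp
    show "\<forall>\<^sub>F s in at_right 0. 2 * sqrt pi - 2 * sqrt s \<le> cut_root s / sqrt s"
      using eventually_at_right_less[of "0::real"]
    proof eventually_elim
      case (elim s)
      have "(2 * sqrt pi - 2 * sqrt s) * sqrt s = 2 * sqrt pi * sqrt s - 2 * s" using elim by (simp add: algebra_simps)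
      also have "\<dots> \<le> cut_root s" using elim by (intro cut_root_bounds) simp
      finally show ?case using elim by (simp add: pos_le_divide_eq)
    qed
    show "\<forall>\<^sub>F s in at_right 0. cut_root s / sqrt s \<le> 2 * sqrt pi"
      using eventually_at_right_less[of "0::real"]
      by eventually_elim (use cut_root_bounds(1) in \<open>simp add: pos_divide_le_eq\<close>)
  qed (rule tendsto_const)
  have "((\<lambda>s. H s / sqrt s - ?c * (cut_root s / sqrt s)) \<longlongrightarrow> c - ?c * (2 * sqrt pi)) (at_right 0)"
    by (intro tendsto_intros lim k)
  then have d: "((\<lambda>s. H s / sqrt s - ?c * (cut_root s / sqrt s)) \<longlongrightarrow> 0) (at_right 0)" by simp
  have "\<forall>\<^sub>F s in at_right 0. \<bar>H s / sqrt s - ?c * (cut_root s / sqrt s)\<bar> < \<epsilon> * sqrt pi"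
    using tendstoD[OF d, of "\<epsilon> * sqrt pi"] \<epsilon> by (simp add: dist_real_def)
  moreover have "\<forall>\<^sub>F s in at_right 0. sqrt pi < cut_root s / sqrt s"
    using order_tendstoD(1)[OF k, of "sqrt pi"] by simp
  ultimately have "\<forall>\<^sub>F s in at_right 0. \<bar>H s - ?c * cut_root s\<bar> \<le> \<epsilon> * cut_root s"
    using eventually_at_right_less[of "0::real"]
  proof eventually_elim
    case (elim s)
    have "H s - ?c * cut_root s = (H s / sqrt s - ?c * (cut_root s / sqrt s)) * sqrt s" using elim by (simp add: field_simps)
    then have "\<bar>H s - ?c * cut_root s\<bar> = \<bar>H s / sqrt s - ?c * (cut_root s / sqrt s)\<bar> * sqrt s"
      using elim(3) by (simp only: abs_mult) simp
    also have "\<dots> \<le> \<epsilon> * sqrt pi * sqrt s" using elim by (intro mult_right_mono) auto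
    also have "\<dots> = \<epsilon> * (sqrt pi * sqrt s)" by simp
    also have "\<dots> \<le> \<epsilon> * cut_root s" using elim \<epsilon> by (intro mult_left_mono) (auto simp: pos_less_divide_eq)
    finally show ?case .
  qed
  then obtain s0 where s0: "0 < s0" "\<And>s. 0 < s \<Longrightarrow> s < s0 \<Longrightarrow> \<bar>H s - ?c * cut_root s\<bar> \<le> \<epsilon> * cut_root s"
    unfolding eventually_at_right_field by blast
  define C where "C = (\<bar>A\<bar> + 2 * \<bar>?c\<bar>) / (1 - exp (- s0))"
  have pos: "0 < 1 - exp (- s0)" using s0 by simp
  have C: "0 \<le> C" unfolding C_def using pos by simp
  have "\<bar>H s - ?c * cut_root s\<bar> \<le> \<epsilon> * cut_root s + C * (1 - exp (- s))" if s: "0 \<le> s" for s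
  proof -
    consider "s = 0" | "0 < s" "s < s0" | "s0 \<le> s" using s by linarith
    then show ?thesis
    proof cases
      case 1 then show ?thesis using H(2) cut_root_bounds(6)[of 0] by simp
    next
      case 2
      have "0 \<le> C * (1 - exp (- s))" using C s by simp
      then show ?thesis using s0(2)[OF 2] by linarith
    next
      case 3
      have "\<bar>?c * cut_root s\<bar> \<le> \<bar>?c\<bar> * 2" unfolding abs_mult
        using cut_root_bounds(4,5)[OF s] by (intro mult_left_mono) auto
      then have "\<bar>H s - ?c * cut_root s\<bar> \<le> \<bar>A\<bar> + 2 * \<bar>?c\<bar>" using H(1)[OF s] by linarith
      also have "\<dots> = C * (1 - exp (- s0))" unfolding C_def using pos by simp
      also have "\<dots> \<le> C * (1 - exp (- s))" using 3 C by (intro mult_left_mono) auto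
      moreover have "0 \<le> \<epsilon> * cut_root s" using \<epsilon> cut_root_bounds(5)[OF s] by simp
      ultimately show ?thesis by linarith
    qed
  qed
  then show ?thesis using C by (intro exI[of _ C]) simp
qed

text \<open>
  Averaging the comparison with \<open>cut_root\<close> gives an error of
  \<open>\<epsilon> * cut_rate \<beta> t + C * (1 - exp (- t))\<close>, and the second term is
  negligible against \<open>f t\<close>.
\<close>

theorem subordinated_limit_root:
  fixes H :: "real \<Rightarrow> real" and \<mu> :: "real \<Rightarrow> real measure"
  assumes law: "\<And>t. 0 < t \<Longrightarrow> stable_law \<beta> t (\<mu> t)"
    and Hm[measurable]: "H \<in> borel_measurable borel"
    and H: "\<And>s. 0 \<le> s \<Longrightarrow> 0 \<le> H s \<and> H s \<le> A" "H 0 = 0"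
    and lim: "((\<lambda>s. H s / sqrt s) \<longlongrightarrow> c) (at_right 0)"
    and e: "\<forall>\<^sub>F t in at_right 0. (\<integral>\<^sup>+q. ennreal ((1 - exp (- t * q powr \<beta>)) * q powr (- 3 / 2)) * indicator {1<..} q \<partial>lborel) = ennreal (cut_rate \<beta> t)"
    and f: "\<forall>\<^sub>F t in at_right 0. 0 < f t" "((\<lambda>t. cut_rate \<beta> t / f t) \<longlongrightarrow> l) (at_right 0)" "((\<lambda>t. t / f t) \<longlongrightarrow> 0) (at_right 0)"
  shows "((\<lambda>t. (LINT s|\<mu> t. H s) / f t) \<longlongrightarrow> c / (2 * sqrt pi) * l) (at_right 0)"
proof -
  let ?c = "c / (2 * sqrt pi)"
  have bnd: "\<forall>\<^sub>F t in at_right 0. \<bar>(LINT s|\<mu> t. H s) / f t - ?c * (cut_rate \<beta> t / f t)\<bar> \<le> \<epsilon> * (cut_rate \<beta> t / f t) + C * (t / f t)"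
    if C: "0 \<le> C" "\<forall>s\<ge>0. \<bar>H s - ?c * cut_root s\<bar> \<le> \<epsilon> * cut_root s + C * (1 - exp (- s))" and \<epsilon>: "0 < \<epsilon>" for C \<epsilon>
    using eventually_at_right_less[of "0::real"] e f(1)
  proof eventually_elim
    case (elim t)
    interpret stable_law_loc \<beta> t "\<mu> t" by standard (rule law[OF elim(1)])
    have k: "integrable (\<mu> t) cut_root" "(LINT s|\<mu> t. cut_root s) = cut_rate \<beta> t"
      using integral_cut_root[OF elim(2)] by (auto simp: has_bochner_integral_iff)
    have Hi: "integrable (\<mu> t) H"
    proof (rule integrable_const_bound[where B=A])
      show "AE s in \<mu> t. norm (H s) \<le> A"
      proof (rule eventually_mono[OF AE_nonneg])
        fix s :: real assume "0 \<le> s"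
        from H(1)[OF this] show "norm (H s) \<le> A" by simp
      qed
    qed measurable
    have "\<bar>(LINT s|\<mu> t. H s) - ?c * cut_rate \<beta> t\<bar> = \<bar>LINT s|\<mu> t. H s - ?c * cut_root s\<bar>"
      using k Hi by simp
    also have "\<dots> \<le> (LINT s|\<mu> t. \<bar>H s - ?c * cut_root s\<bar>)" by (rule integral_abs_bound)
    also have "\<dots> \<le> (LINT s|\<mu> t. \<epsilon> * cut_root s + C * (1 - exp (- s)))"
    proof (rule integral_mono_AE)
      show "AE s in \<mu> t. \<bar>H s - ?c * cut_root s\<bar> \<le> \<epsilon> * cut_root s + C * (1 - exp (- s))"
        by (rule eventually_mono[OF AE_nonneg]) (rule C(2)[rule_format])
      show "integrable (\<mu> t) (\<lambda>s. \<bar>H s - ?c * cut_root s\<bar>)"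
        by (intro integrable_abs Bochner_Integration.integrable_diff integrable_mult_right Hi k(1))
      show "integrable (\<mu> t) (\<lambda>s. \<epsilon> * cut_root s + C * (1 - exp (- s)))"
        by (intro Bochner_Integration.integrable_add integrable_mult_right k(1) integral_exp_compl(1))
    qed
    also have "\<dots> = \<epsilon> * cut_rate \<beta> t + C * (1 - exp (- t))"
      using k integral_exp_compl by simp
    also have "\<dots> \<le> \<epsilon> * cut_rate \<beta> t + C * t"
      using C(1) exp_ge_add_one_self[of "- t"] by (intro add_left_mono mult_left_mono) auto
    finally have m: "\<bar>(LINT s|\<mu> t. H s) - ?c * cut_rate \<beta> t\<bar> \<le> \<epsilon> * cut_rate \<beta> t + C * t" .
    have "\<bar>(LINT s|\<mu> t. H s) / f t - ?c * (cut_rate \<beta> t / f t)\<bar> = \<bar>(LINT s|\<mu> t. H s) - ?c * cut_rate \<beta> t\<bar> / f t"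
      unfolding times_divide_eq_right diff_divide_distrib[symmetric] abs_divide abs_of_pos[OF elim(3)] ..
    also have "\<dots> \<le> (\<epsilon> * cut_rate \<beta> t + C * t) / f t" using m elim(3) by (intro divide_right_mono) auto
    finally show ?case by (simp add: add_divide_distrib)
  qed
  have "((\<lambda>t. (LINT s|\<mu> t. H s) / f t - ?c * (cut_rate \<beta> t / f t)) \<longlongrightarrow> 0) (at_right 0)"
  proof (rule tendstoI)
    fix r :: real assume r: "0 < r"
    define \<epsilon> where "\<epsilon> = r / (2 * (\<bar>l\<bar> + 1))"
    have \<epsilon>: "0 < \<epsilon>" unfolding \<epsilon>_def using r by simp
    obtain C where C: "0 \<le> C" "\<forall>s\<ge>0. \<bar>H s - ?c * cut_root s\<bar> \<le> \<epsilon> * cut_root s + C * (1 - exp (- s))"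
      using compare_cut_root[OF H lim \<epsilon>] by blast
    have "((\<lambda>t. \<epsilon> * (cut_rate \<beta> t / f t) + C * (t / f t)) \<longlongrightarrow> \<epsilon> * l + C * 0) (at_right 0)"
      by (intro tendsto_intros f)
    moreover have "\<epsilon> * l + C * 0 < r"
    proof -
      have "\<epsilon> * l \<le> \<epsilon> * (\<bar>l\<bar> + 1)" using \<epsilon> by (intro mult_left_mono) auto
      also have "\<dots> = r / 2" unfolding \<epsilon>_def by (simp add: field_simps)
      finally show ?thesis using r by simp
    qed
    ultimately have "\<forall>\<^sub>F t in at_right 0. \<epsilon> * (cut_rate \<beta> t / f t) + C * (t / f t) < r"
      by (rule order_tendstoD(2))
    with bnd[OF C \<epsilon>] show "\<forall>\<^sub>F t in at_right 0. dist ((LINT s|\<mu> t. H s) / f t - ?c * (cut_rate \<beta> t / f t)) 0 < r"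
      by eventually_elim (simp add: dist_real_def)
  qed
  from tendsto_add[OF this tendsto_mult[OF tendsto_const f(2), of ?c]] show ?thesis by simp
qed

section \<open>Moments on the unit interval and weak convergence\<close>

text \<open>
  Polynomials are dense in the continuous functions on the unit interval, by the Weierstrass approximation
  theorem. The laws live on the unit interval, so no mass escapes.
\<close>

lemma moments_imp_weak_conv:
  fixes M :: "nat \<Rightarrow> real measure" and N :: "real measure"
  assumes M: "\<And>n. real_distribution (M n)" "\<And>n. AE x in M n. x \<in> {0..1}"
    and N: "real_distribution N" "AE x in N. x \<in> {0..1}"
    and mom: "\<And>j. (\<lambda>n. LINT x|M n. x ^ j) \<longlonglongrightarrow> (LINT x|N. x ^ j)"
  shows "weak_conv_m M N"
proof (rule integral_bdd_continuous_conv_imp_weak_conv[OF M(1) N(1)])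
  fix f :: "real \<Rightarrow> real" assume f: "\<And>x. isCont f x" "\<And>x. \<bar>f x\<bar> \<le> 1"
  have cf: "continuous_on UNIV f" using f(1) by (simp add: continuous_at_imp_continuous_on)
  then have fm[measurable]: "f \<in> borel_measurable borel" by (rule borel_measurable_continuous_onI)
  have close: "integrable L f \<and> (\<forall>j. integrable L (\<lambda>x. x ^ j)) \<and>
     \<bar>(LINT x|L. f x) - (LINT x|L. g x)\<bar> \<le> \<epsilon>"
    if L: "real_distribution L" "AE x in L. x \<in> {0..1}"
      and g: "\<And>x. x \<in> {0..1} \<Longrightarrow> \<bar>f x - g x\<bar> < \<epsilon>" "g = (\<lambda>x. \<Sum>i\<le>m. a i * x ^ i)" for L g \<epsilon> m and a :: "nat \<Rightarrow> real"
  proof -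
    interpret real_distribution L by (rule L)
    have fi: "integrable L f" using f by (intro integrable_const_bound[where B=1]) auto
    have ji: "integrable L (\<lambda>x. x ^ j)" for j
    proof (rule integrable_const_bound[where B=1])
      show "AE x in L. norm (x ^ j) \<le> 1"
        by (rule eventually_mono[OF L(2)]) (simp add: power_le_one)
    qed measurable
    have gi: "integrable L g" unfolding g(2) using ji by simp
    have "\<bar>(LINT x|L. f x) - (LINT x|L. g x)\<bar> = \<bar>LINT x|L. f x - g x\<bar>" using fi gi by simp
    also have "\<dots> \<le> (LINT x|L. \<bar>f x - g x\<bar>)" by (rule integral_abs_bound)
    also have "\<dots> \<le> (LINT x|L. \<epsilon>)"
    proof (rule integral_mono_AE)
      show "AE x in L. \<bar>f x - g x\<bar> \<le> \<epsilon>"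
        by (rule eventually_mono[OF L(2)]) (rule less_imp_le[OF g(1)])
    qed (use fi gi in auto)
    also have "\<dots> = \<epsilon>" using prob_space by simp
    finally show ?thesis using fi ji by simp
  qed
  show "(\<lambda>n. LINT x|M n. f x) \<longlonglongrightarrow> (LINT x|N. f x)"
  proof (rule LIMSEQ_I)
    fix r :: real assume r: "0 < r"
    obtain g where g: "real_polynomial_function g" "\<And>x. x \<in> {0..1} \<Longrightarrow> \<bar>f x - g x\<bar> < r / 4"
      using Stone_Weierstrass_real_polynomial_function[of "{0..1::real}" f "r / 4"] cf r
      by (metis compact_Icc continuous_on_subset subset_UNIV zero_less_divide_iff zero_less_numeral)
    obtain a m where gs: "g = (\<lambda>x. \<Sum>i\<le>m. a i * x ^ i)" using g(1) real_polynomial_function_iff_sum by auto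
    have cM: "integrable (M n) (\<lambda>x. x ^ j)" "\<bar>(LINT x|M n. f x) - (LINT x|M n. g x)\<bar> \<le> r / 4" for n j
      using close[OF M g(2) gs] by auto
    have cN: "integrable N (\<lambda>x. x ^ j)" "\<bar>(LINT x|N. f x) - (LINT x|N. g x)\<bar> \<le> r / 4" for j
      using close[OF N g(2) gs] by auto
    have "(\<lambda>n. \<Sum>i\<le>m. a i * (LINT x|M n. x ^ i)) \<longlonglongrightarrow> (\<Sum>i\<le>m. a i * (LINT x|N. x ^ i))"
      by (intro tendsto_intros mom)
    then have "(\<lambda>n. LINT x|M n. g x) \<longlonglongrightarrow> (LINT x|N. g x)"
      unfolding gs using cM(1) cN(1) by simp
    from LIMSEQ_D[OF this, of "r / 4"] r obtain k where "\<forall>n\<ge>k. norm ((LINT x|M n. g x) - (LINT x|N. g x)) < r / 4" by auto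
    then have gk: "norm ((LINT x|M n. g x) - (LINT x|N. g x)) < r / 4" if "n \<ge> k" for n using that by simp
    have "norm ((LINT x|M n. f x) - (LINT x|N. f x)) < r" if n: "n \<ge> k" for n
      using gk[OF n] cM(2)[of n] cN(2) r unfolding real_norm_def abs_le_iff abs_less_iff by linarith
    then show "\<exists>k. \<forall>n\<ge>k. norm ((LINT x|M n. f x) - (LINT x|N. f x)) < r" by blast
  qed
qed

lemma moments_unique:
  fixes M N :: "real measure"
  assumes "real_distribution M" "AE x in M. x \<in> {0..1}" "real_distribution N" "AE x in N. x \<in> {0..1}"
    and "\<And>j. (LINT x|M. x ^ j) = (LINT x|N. x ^ j)"
  shows "M = N"
proof (rule Levy_uniqueness[OF assms(1,3)])
  have "weak_conv_m (\<lambda>n. M) N"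
    by (rule moments_imp_weak_conv) (use assms in auto)
  then have "(\<lambda>n::nat. char M t) \<longlonglongrightarrow> char N t" for t
    by (rule levy_continuity1[OF assms(1,3)])
  then show "char M = char N" by (intro ext) (simp add: LIMSEQ_const_iff)
qed

text \<open>
  Under \<open>s \<mapsto> exp (- s)\<close> the Laplace transform at integers becomes the sequence of
  moments of a law on the unit interval.
\<close>

lemma exp_distribution:
  assumes "stable_law \<beta> t \<mu>"
  shows "real_distribution (distr \<mu> borel (\<lambda>s. exp (- s)))" "AE x in distr \<mu> borel (\<lambda>s. exp (- s)). x \<in> {0..1}"
    "(LINT x|distr \<mu> borel (\<lambda>s. exp (- s)). x ^ j) = exp (- t * real j powr \<beta>)"
proof -
  interpret stable_law_loc \<beta> t \<mu> by standard fact
  have m: "(\<lambda>s. exp (- s)) \<in> measurable \<mu> borel" by measurable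
  show "real_distribution (distr \<mu> borel (\<lambda>s. exp (- s)))" using m by (rule real_distribution_distr)
  show "AE x in distr \<mu> borel (\<lambda>s. exp (- s)). x \<in> {0..1}"
    using AE_nonneg by (subst AE_distr_iff[OF m]) auto
  have "(LINT x|distr \<mu> borel (\<lambda>s. exp (- s)). x ^ j) = (LINT s|\<mu>. exp (- s) ^ j)"
    by (rule integral_distr[OF m]) measurable
  also have "\<dots> = (LINT s|\<mu>. exp (- real j * s))" by (simp add: exp_of_nat_mult[symmetric])
  also have "\<dots> = exp (- t * real j powr \<beta>)" using laplace[of "real j"] by (cases "j = 0") (auto simp: prob_space)
  finally show "(LINT x|distr \<mu> borel (\<lambda>s. exp (- s)). x ^ j) = exp (- t * real j powr \<beta>)" .
qed

text \<open>
  The image under \<open>s \<mapsto> exp (- s)\<close> is determined by its moments, and the map is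
  injective.
\<close>

theorem stable_law_unique:
  assumes "stable_law \<beta> t \<mu>" "stable_law \<beta> t \<mu>'"
  shows "\<mu> = \<mu>'"
proof -
  let ?e = "\<lambda>s::real. exp (- s)"
  have eq: "distr \<mu> borel ?e = distr \<mu>' borel ?e"
    using exp_distribution[OF assms(1)] exp_distribution[OF assms(2)] by (intro moments_unique) auto
  have undo: "distr (distr \<nu> borel ?e) borel (\<lambda>x. - ln x) = \<nu>" if \<nu>[measurable_cong]: "sets \<nu> = sets borel" for \<nu> :: "real measure"
  proof -
    have "distr (distr \<nu> borel ?e) borel (\<lambda>x. - ln x) = distr \<nu> borel ((\<lambda>x. - ln x) \<circ> ?e)"
      by (rule distr_distr) measurable
    also have "\<dots> = distr \<nu> borel (\<lambda>s. s)" by (simp add: comp_def)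
    also have "\<dots> = \<nu>" using \<nu> by (simp add: distr_id2)
    finally show ?thesis .
  qed
  show ?thesis using undo[of \<mu>] undo[of \<mu>'] eq assms unfolding stable_law_def by metis
qed


section \<open>Convergence of short-time stable laws to the Levy measure\<close>

text \<open>
  The density of the Levy measure of the \<open>\<beta>\<close>-stable subordinator.
\<close>

definition levy_density :: "real \<Rightarrow> real \<Rightarrow> real" where
  "levy_density \<beta> s = \<beta> / Gamma (1 - \<beta>) * s powr (- 1 - \<beta>) * indicator {0<..} s"

lemma levy_density_measurable [measurable]: "levy_density \<beta> \<in> borel_measurable borel"
  unfolding levy_density_def by measurable

lemma levy_density_nonneg: "0 < \<beta> \<Longrightarrow> \<beta> < 1 \<Longrightarrow> 0 \<le> levy_density \<beta> s"
  unfolding levy_density_def by (auto intro!: mult_nonneg_nonneg divide_nonneg_nonneg simp: Gamma_real_pos less_imp_le indicator_def)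

text \<open>
  The Levy-Khintchine formula for the Laplace exponent \<open>q powr \<beta>\<close>.
\<close>

lemma levy_density_exponent:
  assumes \<beta>: "0 < \<beta>" "\<beta> < 1" and q: "0 \<le> q"
  shows "has_bochner_integral lborel (\<lambda>s. (1 - exp (- q * s)) * levy_density \<beta> s) (q powr \<beta>)"
proof (cases "q = 0")
  case False
  then have q: "0 < q" using q by simp
  have G: "0 < Gamma (1 - \<beta>)" using \<beta> by (intro Gamma_real_pos) simp
  show ?thesis
  proof (rule has_bochner_integral_nn_integral)
    show "AE s in lborel. 0 \<le> (1 - exp (- q * s)) * levy_density \<beta> s"
    proof (rule AE_I2)
      fix s :: real
      show "0 \<le> (1 - exp (- q * s)) * levy_density \<beta> s"
      proof (cases "0 < s")
        case True
        then show ?thesis using q by (intro mult_nonneg_nonneg levy_density_nonneg \<beta>) simp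
      qed (simp add: levy_density_def)
    qed
    have "(\<integral>\<^sup>+s. ennreal ((1 - exp (- q * s)) * levy_density \<beta> s) \<partial>lborel)
      = (\<integral>\<^sup>+s. ennreal (\<beta> / Gamma (1 - \<beta>)) * (ennreal ((1 - exp (- q * s powr 1)) * s powr (- 1 - \<beta>)) * indicator {0<..} s) \<partial>lborel)"
    proof (rule nn_integral_cong)
      fix s :: real
      show "ennreal ((1 - exp (- q * s)) * levy_density \<beta> s)
        = ennreal (\<beta> / Gamma (1 - \<beta>)) * (ennreal ((1 - exp (- q * s powr 1)) * s powr (- 1 - \<beta>)) * indicator {0<..} s)"
        using G \<beta> by (cases "0 < s") (auto simp: levy_density_def ennreal_mult'[symmetric] mult_ac)
    qed
    also have "\<dots> = ennreal (\<beta> / Gamma (1 - \<beta>)) * ennreal (Gamma (1 - \<beta> / 1) / \<beta> * q powr (\<beta> / 1))"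
      unfolding stable_integral[OF \<beta> q, symmetric] by (rule nn_integral_cmult) measurable
    also have "\<dots> = ennreal (q powr \<beta>)"
      using less_imp_neq[OF G] \<beta> by (simp add: ennreal_mult'[symmetric])
    finally show "(\<integral>\<^sup>+s. ennreal ((1 - exp (- q * s)) * levy_density \<beta> s) \<partial>lborel) = ennreal (q powr \<beta>)" .
  qed (auto intro!: measurable_completion)
qed (simp add: has_bochner_integral_zero)

text \<open>
  The infinite Levy measure and \<open>\<mu> / t\<close> become probability measures when weighted by
  \<open>1 - exp (- s)\<close>, up to a normalisation that tends to 1 after division by
  \<open>t\<close>. Transport to the unit interval makes the method of moments available.
\<close>

definition tilt :: "real \<Rightarrow> real measure \<Rightarrow> real measure" where
  "tilt t \<mu> = distr (density \<mu> (\<lambda>s. ennreal ((1 - exp (- s)) / (1 - exp (- t))))) borel (\<lambda>s. exp (- s))"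

definition tilt_limit :: "real \<Rightarrow> real measure" where
  "tilt_limit \<beta> = distr (density lborel (\<lambda>s. ennreal ((1 - exp (- s)) * levy_density \<beta> s))) borel (\<lambda>s. exp (- s))"

lemma tilt_limit_facts:
  assumes \<beta>: "0 < \<beta>" "\<beta> < 1"
  shows "real_distribution (tilt_limit \<beta>)" "AE x in tilt_limit \<beta>. x \<in> {0..1}"
    "(LINT x|tilt_limit \<beta>. x ^ j) = real (Suc j) powr \<beta> - real j powr \<beta>"
    "g \<in> borel_measurable borel \<Longrightarrow> (LINT x|tilt_limit \<beta>. g x) = (LINT s|lborel. (1 - exp (- s)) * levy_density \<beta> s * g (exp (- s)))"
    "emeasure (tilt_limit \<beta>) {x} = 0"
proof -
  let ?d = "\<lambda>s. (1 - exp (- s)) * levy_density \<beta> s"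
  have nn: "0 \<le> ?d s" for s
  proof (cases "0 < s")
    case True
    then show ?thesis by (intro mult_nonneg_nonneg levy_density_nonneg \<beta>) simp
  qed (simp add: levy_density_def)
  have b1: "has_bochner_integral lborel ?d 1" using levy_density_exponent[OF \<beta>, of 1] by simp
  interpret p: prob_space "density lborel (\<lambda>s. ennreal (?d s))"
  proof (rule prob_spaceI)
    have "emeasure (density lborel (\<lambda>s. ennreal (?d s))) (space (density lborel (\<lambda>s. ennreal (?d s)))) = (\<integral>\<^sup>+s. ennreal (?d s) \<partial>lborel)"
      by (subst emeasure_density) auto
    also have "\<dots> = 1" using b1 nn by (subst nn_integral_eq_integral) (auto simp: has_bochner_integral_iff)
    finally show "emeasure (density lborel (\<lambda>s. ennreal (?d s))) (space (density lborel (\<lambda>s. ennreal (?d s)))) = 1" .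
  qed
  have m: "(\<lambda>s. exp (- s)) \<in> measurable (density lborel (\<lambda>s. ennreal (?d s))) borel" by measurable
  show "real_distribution (tilt_limit \<beta>)" unfolding tilt_limit_def using m by (rule p.real_distribution_distr)
  have "AE s in lborel. 0 < ennreal (?d s) \<longrightarrow> exp (- s) \<in> {0..1}"
  proof (rule AE_I2, rule impI)
    fix s :: real assume "0 < ennreal (?d s)"
    then have "0 < s" by (cases "0 < s") (auto simp: levy_density_def)
    then show "exp (- s) \<in> {0..1}" by simp
  qed
  then show "AE x in tilt_limit \<beta>. x \<in> {0..1}" unfolding tilt_limit_def
    by (subst AE_distr_iff[OF m]) (simp_all add: AE_density)
  show int: "(LINT x|tilt_limit \<beta>. g x) = (LINT s|lborel. ?d s * g (exp (- s)))" if g[measurable]: "g \<in> borel_measurable borel" for g :: "real \<Rightarrow> real"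
    unfolding tilt_limit_def using nn
    by (subst integral_distr[OF m g]) (subst integral_density, auto)
  have "(LINT x|tilt_limit \<beta>. x ^ j) = (LINT s|lborel. ?d s * exp (- s) ^ j)"
    by (rule int) measurable
  also have "\<dots> = (LINT s|lborel. (1 - exp (- real (Suc j) * s)) * levy_density \<beta> s - (1 - exp (- real j * s)) * levy_density \<beta> s)"
  proof (rule Bochner_Integration.integral_cong[OF refl])
    fix s :: real
    have e: "exp (- s) ^ j = exp (- real j * s)" by (simp add: exp_of_nat_mult[symmetric])
    have e2: "exp (- real (Suc j) * s) = exp (- s) * exp (- real j * s)" by (simp add: exp_add[symmetric] algebra_simps)
    show "?d s * exp (- s) ^ j = (1 - exp (- real (Suc j) * s)) * levy_density \<beta> s - (1 - exp (- real j * s)) * levy_density \<beta> s"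
      unfolding e e2 by (simp add: algebra_simps)
  qed
  also have "\<dots> = real (Suc j) powr \<beta> - real j powr \<beta>"
    using levy_density_exponent[OF \<beta>, of "real (Suc j)"] levy_density_exponent[OF \<beta>, of "real j"]
    by (subst Bochner_Integration.integral_diff) (auto simp: has_bochner_integral_iff)
  finally show "(LINT x|tilt_limit \<beta>. x ^ j) = real (Suc j) powr \<beta> - real j powr \<beta>" .
  have "emeasure (tilt_limit \<beta>) {x} = (\<integral>\<^sup>+s. ennreal (?d s) * indicator ((\<lambda>s. exp (- s)) -` {x}) s \<partial>lborel)"
  proof -
    have V: "(\<lambda>s::real. exp (- s)) -` {x} \<in> sets lborel"
      using measurable_sets[of "\<lambda>s::real. exp (- s)" lborel borel "{x}"] by simp
    have "emeasure (tilt_limit \<beta>) {x} = emeasure (density lborel (\<lambda>s. ennreal (?d s))) ((\<lambda>s. exp (- s)) -` {x})"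
      unfolding tilt_limit_def by (subst emeasure_distr[OF m]) auto
    also have "\<dots> = (\<integral>\<^sup>+s. ennreal (?d s) * indicator ((\<lambda>s. exp (- s)) -` {x}) s \<partial>lborel)"
      by (rule emeasure_density[OF _ V]) measurable
    finally show ?thesis .
  qed
  also have "\<dots> = (\<integral>\<^sup>+s. 0 \<partial>(lborel :: real measure))"
    using AE_lborel_singleton[of "- ln x"]
    by (intro nn_integral_cong_AE) (auto elim!: eventually_mono simp: indicator_def)
  finally show "emeasure (tilt_limit \<beta>) {x} = 0" by simp
qed

lemma tilt_facts:
  assumes law: "stable_law \<beta> t \<mu>" and t: "0 < t"
  shows "real_distribution (tilt t \<mu>)" "AE x in tilt t \<mu>. x \<in> {0..1}"
    "(LINT x|tilt t \<mu>. x ^ j) = (exp (- t * real j powr \<beta>) - exp (- t * real (Suc j) powr \<beta>)) / (1 - exp (- t))"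
    "g \<in> borel_measurable borel \<Longrightarrow> (LINT x|tilt t \<mu>. g x) = (LINT s|\<mu>. (1 - exp (- s)) / (1 - exp (- t)) * g (exp (- s)))"
proof -
  interpret stable_law_loc \<beta> t \<mu> by standard fact
  let ?d = "\<lambda>s. (1 - exp (- s)) / (1 - exp (- t))"
  have pos: "0 < 1 - exp (- t)" using t by simp
  have nn: "AE s in \<mu>. 0 \<le> ?d s" using AE_nonneg by eventually_elim (use pos in simp)
  have dm: "(\<lambda>s. ennreal (?d s)) \<in> borel_measurable \<mu>" by measurable
  interpret p: prob_space "density \<mu> (\<lambda>s. ennreal (?d s))"
  proof (rule prob_spaceI)
    have "emeasure (density \<mu> (\<lambda>s. ennreal (?d s))) (space (density \<mu> (\<lambda>s. ennreal (?d s)))) = (\<integral>\<^sup>+s. ennreal (?d s) \<partial>\<mu>)"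
      using dm by (subst emeasure_density) (auto intro!: nn_integral_cong simp: space_mu)
    also have "\<dots> = ennreal (LINT s|\<mu>. ?d s)"
      using integral_exp_compl(1) nn by (intro nn_integral_eq_integral) auto
    also have "(LINT s|\<mu>. ?d s) = 1" using integral_exp_compl(2) pos by simp
    finally show "emeasure (density \<mu> (\<lambda>s. ennreal (?d s))) (space (density \<mu> (\<lambda>s. ennreal (?d s)))) = 1" by simp
  qed
  have m: "(\<lambda>s. exp (- s)) \<in> measurable (density \<mu> (\<lambda>s. ennreal (?d s))) borel" by measurable
  show "real_distribution (tilt t \<mu>)" unfolding tilt_def using m by (rule p.real_distribution_distr)
  have "AE s in \<mu>. 0 < ennreal (?d s) \<longrightarrow> exp (- s) \<in> {0..1}" using AE_nonneg by eventually_elim simp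
  then show "AE x in tilt t \<mu>. x \<in> {0..1}" unfolding tilt_def
    using dm by (subst AE_distr_iff[OF m]) (simp_all add: AE_density)
  show int: "(LINT x|tilt t \<mu>. g x) = (LINT s|\<mu>. ?d s * g (exp (- s)))" if g[measurable]: "g \<in> borel_measurable borel" for g :: "real \<Rightarrow> real"
    unfolding tilt_def using nn
    by (subst integral_distr[OF m g]) (subst integral_density, auto)
  have E: "(LINT s|\<mu>. exp (- real j * s)) = exp (- t * real j powr \<beta>)" for j
    using laplace[of "real j"] by (cases "j = 0") (auto simp: prob_space)
  have "(LINT x|tilt t \<mu>. x ^ j) = (LINT s|\<mu>. ?d s * exp (- s) ^ j)"
    by (rule int) measurable
  also have "\<dots> = (LINT s|\<mu>. (exp (- real j * s) - exp (- real (Suc j) * s)) / (1 - exp (- t)))"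
  proof (rule Bochner_Integration.integral_cong[OF refl])
    fix s :: real
    have e: "exp (- s) ^ j = exp (- real j * s)" by (simp add: exp_of_nat_mult[symmetric])
    have e2: "exp (- real (Suc j) * s) = exp (- s) * exp (- real j * s)" by (simp add: exp_add[symmetric] algebra_simps)
    show "?d s * exp (- s) ^ j = (exp (- real j * s) - exp (- real (Suc j) * s)) / (1 - exp (- t))"
      unfolding e e2 by (simp add: algebra_simps)
  qed
  also have "\<dots> = ((LINT s|\<mu>. exp (- real j * s)) - (LINT s|\<mu>. exp (- real (Suc j) * s))) / (1 - exp (- t))"
    using integrable_exp[of "real j"] integrable_exp[of "real (Suc j)"] by simp
  finally show "(LINT x|tilt t \<mu>. x ^ j) = (exp (- t * real j powr \<beta>) - exp (- t * real (Suc j) powr \<beta>)) / (1 - exp (- t))"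
    unfolding E .
qed

lemma one_minus_exp_ratio:
  assumes "T \<longlonglongrightarrow> 0" "\<And>n. 0 < T n"
  shows "(\<lambda>n. (1 - exp (- T n * a)) / T n) \<longlonglongrightarrow> (a::real)"
proof -
  have "((\<lambda>x. 1 - exp (- x * a)) has_real_derivative a) (at 0)"
    by (auto intro!: derivative_eq_intros)
  then have "((\<lambda>h. (1 - exp (- h * a)) / h) \<longlongrightarrow> a) (at 0)" by (simp add: DERIV_def)
  moreover have "filterlim T (at 0) sequentially"
    using assms by (intro filterlim_atI) (auto simp: less_imp_neq[symmetric])
  ultimately show ?thesis by (rule filterlim_compose)
qed

text \<open>
  The \<open>j\<close>-th moments are differences of Laplace transforms at \<open>j\<close> and
  \<open>j + 1\<close>, and these converge after division by the time.
\<close>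

lemma tilt_weak_conv:
  assumes \<beta>: "0 < \<beta>" "\<beta> < 1" and law: "\<And>n. stable_law \<beta> (T n) (\<mu> n)" and T: "T \<longlonglongrightarrow> 0" "\<And>n. 0 < T n"
  shows "weak_conv_m (\<lambda>n. tilt (T n) (\<mu> n)) (tilt_limit \<beta>)"
proof (rule moments_imp_weak_conv)
  fix j
  let ?r = "\<lambda>a n. (1 - exp (- T n * a)) / T n"
  have ne: "1 - exp (- T n) \<noteq> 0" "T n \<noteq> 0" for n using T(2)[of n] by auto
  have "(\<lambda>n. (?r (real (Suc j) powr \<beta>) n - ?r (real j powr \<beta>) n) / ?r 1 n) \<longlonglongrightarrow> (real (Suc j) powr \<beta> - real j powr \<beta>) / 1"
    by (intro tendsto_divide tendsto_diff one_minus_exp_ratio T) simp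
  moreover have "(?r (real (Suc j) powr \<beta>) n - ?r (real j powr \<beta>) n) / ?r 1 n = (LINT x|tilt (T n) (\<mu> n). x ^ j)" for n
    unfolding tilt_facts(3)[OF law T(2)] diff_divide_distrib[symmetric] using ne[of n] by (simp add: field_simps)
  ultimately show "(\<lambda>n. LINT x|tilt (T n) (\<mu> n). x ^ j) \<longlonglongrightarrow> (LINT x|tilt_limit \<beta>. x ^ j)"
    unfolding tilt_limit_facts(3)[OF \<beta>] by simp
qed (intro tilt_facts[OF law T(2)] tilt_limit_facts[OF \<beta>])+

text \<open>
  The weight \<open>1 - exp (- s)\<close> is divided out again; on a ray away from 0 its inverse is
  bounded, and its only discontinuity is at the endpoint, which the limit law does not charge.
\<close>

lemma levy_tail_limit:
  assumes \<beta>: "0 < \<beta>" "\<beta> < 1" and law: "\<And>n. stable_law \<beta> (T n) (\<mu> n)" and T: "T \<longlonglongrightarrow> 0" "\<And>n. 0 < T n"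
    and v: "0 < v" and S[measurable]: "S \<in> sets borel" and ray: "{v<..} \<subseteq> S" "S \<subseteq> {v..}"
  shows "(\<lambda>n. measure (\<mu> n) S / T n) \<longlonglongrightarrow> (LINT s|lborel. levy_density \<beta> s * indicator S s)"
proof -
  define f :: "real \<Rightarrow> real" where "f x = (if x \<le> 0 \<or> - ln x \<in> S then 1 / (1 - x) else 0)" for x
  have fm[measurable]: "f \<in> borel_measurable borel" unfolding f_def by measurable
  have v0: "exp (- v) < 1" using v by simp
  have lnx: "v \<le> - ln x \<longleftrightarrow> x \<le> exp (- v)" "v < - ln x \<longleftrightarrow> x < exp (- v)" if "0 < x" for x
    using that ln_ge_iff[of x "- v"] by (auto simp: le_minus_iff less_minus_iff ln_le_cancel_iff[symmetric] ln_less_cancel_iff[symmetric] simp del: ln_le_cancel_iff ln_less_cancel_iff)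
  have fS: "x \<le> exp (- v)" if "x \<le> 0 \<or> - ln x \<in> S" for x
  proof (cases "0 < x")
    case True
    then have "v \<le> - ln x" using that ray by auto
    then show ?thesis using lnx(1)[OF True] by simp
  qed (use exp_gt_zero[of "- v"] in linarith)
  have bd: "norm (f x) \<le> 1 / (1 - exp (- v))" for x
  proof (cases "x \<le> 0 \<or> - ln x \<in> S")
    case True
    then have "1 - exp (- v) \<le> 1 - x" using fS by simp
    then show ?thesis using True v0 unfolding f_def by (simp add: frac_le)
  qed (use v0 in \<open>simp add: f_def\<close>)
  have "isCont f x" if x: "x \<noteq> exp (- v)" for x
  proof (cases "x < exp (- v)")
    case True
    have "eventually (\<lambda>y. y < exp (- v)) (nhds x)" using True by (rule eventually_nhds_in_open[of "{..<exp (- v)}", simplified])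
    then have "eventually (\<lambda>y. f y = 1 / (1 - y)) (nhds x)"
    proof eventually_elim
      case (elim y)
      show ?case
      proof (cases "y \<le> 0")
        case False
        then have "v < - ln y" using lnx(2)[of y] elim by simp
        then show ?thesis using ray unfolding f_def by auto
      qed (simp add: f_def)
    qed
    moreover have "isCont (\<lambda>y. 1 / (1 - y)) x" using True v0 by (intro continuous_intros) auto
    ultimately show ?thesis by (simp add: isCont_cong)
  next
    case False
    then have "exp (- v) < x" using x by simp
    then have "eventually (\<lambda>y. exp (- v) < y) (nhds x)" by (rule eventually_nhds_in_open[of "{exp (- v)<..}", simplified])
    then have "eventually (\<lambda>y. f y = 0) (nhds x)"
    proof eventually_elim
      case (elim y)
      have "\<not> (y \<le> 0 \<or> - ln y \<in> S)" using fS[of y] elim by auto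
      then show ?case unfolding f_def by simp
    qed
    then show ?thesis by (simp add: isCont_cong[of f "\<lambda>_. 0"])
  qed
  then have "{x. \<not> isCont f x} \<subseteq> {exp (- v)}" by blast
  then have "emeasure (tilt_limit \<beta>) {x. \<not> isCont f x} \<le> emeasure (tilt_limit \<beta>) {exp (- v)}"
    by (rule emeasure_mono) (simp add: tilt_limit_def)
  then have disc: "emeasure (tilt_limit \<beta>) {x. \<not> isCont f x} = 0" using tilt_limit_facts(5)[OF \<beta>] by simp
  have lim: "(\<lambda>n. LINT x|tilt (T n) (\<mu> n). f x) \<longlonglongrightarrow> (LINT x|tilt_limit \<beta>. f x)"
    by (rule weak_conv_imp_bdd_ae_continuous_conv[OF tilt_facts(1)[OF law T(2)] tilt_limit_facts(1)[OF \<beta>] tilt_weak_conv[OF \<beta> law T] disc bd fm])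
  have fe: "(1 - exp (- s)) * f (exp (- s)) = indicator S s" for s
    unfolding f_def using ray v by (auto simp: indicator_def)
  have L: "(LINT x|tilt_limit \<beta>. f x) = (LINT s|lborel. levy_density \<beta> s * indicator S s)"
    unfolding tilt_limit_facts(4)[OF \<beta> fm]
    by (intro Bochner_Integration.integral_cong refl) (simp add: fe[symmetric] mult_ac)
  have M: "measure (\<mu> n) S / T n = (LINT x|tilt (T n) (\<mu> n). f x) * ((1 - exp (- T n * 1)) / T n)" for n
  proof -
    interpret stable_law_loc \<beta> "T n" "\<mu> n" by standard (rule law)
    have pos: "0 < 1 - exp (- T n)" using T(2)[of n] by simp
    have "(LINT x|tilt (T n) (\<mu> n). f x) = (LINT s|\<mu> n. indicator S s / (1 - exp (- T n)))"
      unfolding tilt_facts(4)[OF law T(2) fm]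
      by (intro Bochner_Integration.integral_cong refl) (simp add: fe[symmetric])
    also have "\<dots> = measure (\<mu> n) S / (1 - exp (- T n))" by (simp add: space_mu)
    finally show ?thesis using pos by simp
  qed
  show ?thesis unfolding M L[symmetric]
    using tendsto_mult[OF lim one_minus_exp_ratio[OF T, of 1]] by simp
qed

text \<open>
  Superlevel sets of a nondecreasing function are rays, open or closed. The square-root bound keeps them
  away from 0 by a distance of order \<open>y\<^sup>2\<close>.
\<close>

lemma superlevel_ray:
  fixes H :: "real \<Rightarrow> real"
  assumes H: "mono H" "\<And>s. s \<le> 0 \<Longrightarrow> H s = 0" "\<And>s. 0 \<le> s \<Longrightarrow> H s \<le> C * sqrt s" and C: "0 < C"
    and y: "0 < y" and ne: "{s. y < H s} \<noteq> {}"
  obtains v where "(y / C)\<^sup>2 \<le> v" "0 < v" "{v<..} \<subseteq> {s. y < H s}" "{s. y < H s} \<subseteq> {v..}"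
proof -
  let ?S = "{s. y < H s}"
  define v where "v = Inf ?S"
  have low: "(y / C)\<^sup>2 \<le> s" if "s \<in> ?S" for s
  proof -
    have s: "0 < s" using that H(2)[of s] y by (cases "s \<le> 0") auto
    have "y \<le> C * sqrt s" using that H(3)[of s] s by simp
    then have "y / C \<le> sqrt s" using C by (simp add: pos_divide_le_eq mult.commute)
    then have "(y / C)\<^sup>2 \<le> (sqrt s)\<^sup>2" using y C by (intro power_mono) auto
    then show ?thesis using s by simp
  qed
  have bb: "bdd_below ?S" using low by (rule bdd_belowI)
  have a: "(y / C)\<^sup>2 \<le> v" unfolding v_def by (rule cInf_greatest[OF ne low])
  have "0 < (y / C)\<^sup>2" using y C by simp
  then have b: "0 < v" using a by linarith
  have c: "{v<..} \<subseteq> ?S"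
  proof
    fix s assume "s \<in> {v<..}"
    then obtain s' where "s' \<in> ?S" "s' < s" using cInf_lessD[OF ne] unfolding v_def by auto
    then show "s \<in> ?S" using monoD[OF H(1), of s' s] by auto
  qed
  have d: "?S \<subseteq> {v..}" unfolding v_def using cInf_lower[OF _ bb] by auto
  show ?thesis by (rule that[OF a b c d])
qed

text \<open>
  Chebyshev's inequality for \<open>1 - exp (- q * s)\<close> with \<open>q = 1 / v\<close>.
\<close>

lemma stable_law_tail_bound:
  assumes law: "stable_law \<beta> t \<mu>" and v: "0 < v" and S: "S \<in> sets borel" "S \<subseteq> {v..}" and t: "0 < t"
  shows "measure \<mu> S / t \<le> 2 * v powr (- \<beta>)"
proof -
  interpret stable_law_loc \<beta> t \<mu> by standard fact
  have e: "1 / 2 \<le> 1 - exp (- 1 :: real)"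
    using exp_ge_add_one_self[of 1] by (simp add: exp_minus field_simps)
  have i: "integrable \<mu> (\<lambda>s. 1 - exp (- (1 / v) * s))" using integrable_exp[of "1 / v"] v by simp
  have "measure \<mu> S = (LINT s|\<mu>. indicator S s)" by (simp add: space_mu)
  also have "\<dots> \<le> (LINT s|\<mu>. 2 * (1 - exp (- (1 / v) * s)))"
  proof (rule integral_mono_AE)
    show "integrable \<mu> (indicat_real S)" using S(1) by (simp add: integrable_indicator_iff sets_mu emeasure_eq_measure)
    show "integrable \<mu> (\<lambda>s. 2 * (1 - exp (- (1 / v) * s)))" using i by (rule integrable_mult_right)
    show "AE s in \<mu>. indicat_real S s \<le> 2 * (1 - exp (- (1 / v) * s))"
    proof (rule eventually_mono[OF AE_nonneg])
      fix s :: real assume s: "0 \<le> s"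
      show "indicat_real S s \<le> 2 * (1 - exp (- (1 / v) * s))"
      proof (cases "s \<in> S")
        case True
        then have "1 \<le> (1 / v) * s" using S(2) v by (auto simp: field_simps)
        then have "exp (- (1 / v) * s) \<le> exp (- 1)" by simp
        then have "1 - exp (- 1) \<le> 1 - exp (- (1 / v) * s)" by (rule diff_left_mono)
        from mult_left_mono[OF order_trans[OF e this], of 2] show ?thesis using True by simp
      next
        case False
        have "0 \<le> (1 / v) * s" using s v by simp
        then show ?thesis using False by simp
      qed
    qed
  qed
  also have "\<dots> = 2 * (1 - exp (- t * (1 / v) powr \<beta>))"
    using laplace[of "1 / v"] v integrable_exp[of "1 / v"] prob_space by simp
  also have "\<dots> \<le> 2 * (t * (1 / v) powr \<beta>)"
    using exp_ge_add_one_self[of "- t * (1 / v) powr \<beta>"] by simp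
  also have "(1 / v) powr \<beta> = v powr (- \<beta>)" using v by (simp add: powr_minus powr_divide field_simps)
  finally show ?thesis using t by (simp add: pos_divide_le_eq mult_ac)
qed

text \<open>
  The layer-cake formula.
\<close>

lemma nn_integral_superlevel:
  fixes H :: "real \<Rightarrow> real"
  assumes [measurable]: "H \<in> borel_measurable borel" and "sigma_finite_measure M" and [measurable_cong]: "sets M = sets borel"
    and [measurable]: "w \<in> borel_measurable borel"
  shows "(\<integral>\<^sup>+s. ennreal (H s) * w s \<partial>M) = (\<integral>\<^sup>+y. (\<integral>\<^sup>+s. w s * indicator {s. y < H s} s \<partial>M) * indicator {0<..} y \<partial>lborel)"
proof -
  interpret sigma_finite_measure M by fact
  interpret pair_sigma_finite M lborel by unfold_locales
  let ?f = "\<lambda>s y. w s * (if y < H s then 1 else 0) * indicator {0<..} y"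
  have "(\<integral>\<^sup>+s. ennreal (H s) * w s \<partial>M) = (\<integral>\<^sup>+s. (\<integral>\<^sup>+y. ?f s y \<partial>lborel) \<partial>M)"
  proof (rule nn_integral_cong)
    fix s
    have "(\<integral>\<^sup>+y. ?f s y \<partial>lborel) = (\<integral>\<^sup>+y. w s * indicator {0<..<H s} y \<partial>lborel)"
      by (intro nn_integral_cong) (auto simp: indicator_def)
    also have "\<dots> = w s * emeasure lborel {0<..<H s}" by (subst nn_integral_cmult) auto
    also have "emeasure lborel {0<..<H s} = ennreal (H s)" by (cases "0 \<le> H s") (auto simp: ennreal_neg)
    finally show "ennreal (H s) * w s = (\<integral>\<^sup>+y. ?f s y \<partial>lborel)" by (simp add: mult.commute)
  qed
  also have "\<dots> = (\<integral>\<^sup>+y. (\<integral>\<^sup>+s. ?f s y \<partial>M) \<partial>lborel)"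
    by (rule Fubini'[symmetric]) measurable
  also have "\<dots> = (\<integral>\<^sup>+y. (\<integral>\<^sup>+s. w s * indicator {s. y < H s} s \<partial>M) * indicator {0<..} y \<partial>lborel)"
  proof (rule nn_integral_cong)
    fix y :: real
    have "(\<integral>\<^sup>+s. ?f s y \<partial>M) = (\<integral>\<^sup>+s. w s * (if y < H s then 1 else 0) \<partial>M) * indicator {0<..} y"
      by (rule nn_integral_multc) measurable
    also have "(\<integral>\<^sup>+s. w s * (if y < H s then 1 else 0) \<partial>M) = (\<integral>\<^sup>+s. w s * indicator {s. y < H s} s \<partial>M)"
      by (intro nn_integral_cong) (auto simp: indicator_def)
    finally show "(\<integral>\<^sup>+s. ?f s y \<partial>M) = (\<integral>\<^sup>+s. w s * indicator {s. y < H s} s \<partial>M) * indicator {0<..} y" .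
  qed
  finally show ?thesis .
qed

lemma levy_tail_finite:
  assumes \<beta>: "0 < \<beta>" "\<beta> < 1" and v: "0 < v" and S: "S \<in> sets borel" "S \<subseteq> {v..}"
  shows "integrable lborel (\<lambda>s. levy_density \<beta> s * indicator S s)"
proof -
  have c: "0 < 1 - exp (- v)" using v by simp
  have i: "integrable lborel (\<lambda>s. (1 - exp (- 1 * s)) * levy_density \<beta> s / (1 - exp (- v)))"
    using levy_density_exponent[OF \<beta>, of 1] by (intro integrable_divide) (auto simp: has_bochner_integral_iff)
  show ?thesis
  proof (rule Bochner_Integration.integrable_bound[OF i])
    show "AE s in lborel. norm (levy_density \<beta> s * indicator S s) \<le> norm ((1 - exp (- 1 * s)) * levy_density \<beta> s / (1 - exp (- v)))"
    proof (rule AE_I2)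
      fix s :: real
      show "norm (levy_density \<beta> s * indicator S s) \<le> norm ((1 - exp (- 1 * s)) * levy_density \<beta> s / (1 - exp (- v)))"
      proof (cases "s \<in> S")
        case True
        then have "v \<le> s" using S by auto
        then have "1 \<le> (1 - exp (- s)) / (1 - exp (- v))" using c by simp
        then have "\<bar>levy_density \<beta> s\<bar> * 1 \<le> \<bar>levy_density \<beta> s\<bar> * ((1 - exp (- s)) / (1 - exp (- v)))" by (intro mult_left_mono) auto
        then show ?thesis using True c \<open>v \<le> s\<close> v by (simp add: abs_mult mult.commute)
      qed simp
    qed
  qed (use S in measurable)
qed

text \<open>
  By the layer-cake formula, both sides are integrals over the level \<open>y\<close> of the measure of a
  ray that starts at a distance of at least \<open>(y / C)\<^sup>2\<close> from 0. For fixed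
  \<open>y\<close> the tails converge, and the bound \<open>2 * v powr (- \<beta>)\<close> on tails
  yields a majorant of order \<open>y powr (- 2 * \<beta>)\<close>, which is integrable near 0 exactly
  because \<open>\<beta> < 1 / 2\<close>.
\<close>

theorem subordinated_limit_levy:
  fixes H :: "real \<Rightarrow> real" and \<mu> :: "real \<Rightarrow> real measure"
  assumes \<beta>: "0 < \<beta>" "\<beta> < 1 / 2" and law: "\<And>t. 0 < t \<Longrightarrow> stable_law \<beta> t (\<mu> t)"
    and H: "mono H" "\<And>s. s \<le> 0 \<Longrightarrow> H s = 0" "\<And>s. 0 \<le> s \<Longrightarrow> H s \<le> C * sqrt s" "\<And>s. H s \<le> A" and C: "0 < C"
  shows "integrable lborel (\<lambda>s. H s * levy_density \<beta> s)"
    and "((\<lambda>t. (LINT s|\<mu> t. H s) / t) \<longlongrightarrow> (LINT s|lborel. H s * levy_density \<beta> s)) (at_right 0)"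
proof -
  have \<beta>1: "\<beta> < 1" using \<beta> by simp
  have Hm[measurable]: "H \<in> borel_measurable borel" using H(1) by (rule borel_measurable_mono)
  have H0: "0 \<le> H s" for s using H(2)[of "min s 0"] monoD[OF H(1), of "min s 0" s] by simp
  let ?S = "\<lambda>y. {s. y < H s}"
  have Sb: "?S y \<in> sets borel" for y by measurable
  \<comment> \<open>The majorant: the tail bound at the starting point of the ray; above level \<open>A\<close> the rays are empty.\<close>
  define w where "w y = 2 * ((y / C)\<^sup>2) powr (- \<beta>) * indicator {0<..A} y" for y :: real
  have w_eq: "w y = 2 * C powr (2 * \<beta>) * (y powr (- (2 * \<beta>)) * indicator {0<..A} y)" for y
  proof (cases "y \<in> {0<..A}")
    case True
    then have y: "0 < y" by simp
    have "((y / C)\<^sup>2) powr (- \<beta>) = ((y / C) powr 2) powr (- \<beta>)" using y C by simp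
    also have "\<dots> = (y / C) powr (- (2 * \<beta>))" unfolding powr_powr by simp
    also have "\<dots> = C powr (2 * \<beta>) * y powr (- (2 * \<beta>))"
    proof -
      have "(y / C) powr (2 * \<beta>) = y powr (2 * \<beta>) / C powr (2 * \<beta>)" using y C by (simp add: powr_divide)
      then show ?thesis unfolding powr_minus by (simp add: divide_inverse)
    qed
    finally show ?thesis using True unfolding w_def by simp
  qed (simp add: w_def)
  have wi: "integrable lborel w"
  proof -
    have "integrable lborel (\<lambda>y. indicat_real {0..A} y * y powr (- (2 * \<beta>)))"
    proof (cases "0 \<le> A")
      case True
      have "((\<lambda>y. y powr (- (2 * \<beta>))) has_integral (A powr (- (2 * \<beta>) + 1) / (- (2 * \<beta>) + 1))) {0..A}"
        using \<beta> True by (intro has_integral_powr_from_0) auto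
      then have "(\<integral>\<^sup>+y. ennreal (indicat_real {0..A} y * y powr (- (2 * \<beta>))) \<partial>lborel) = ennreal (A powr (- (2 * \<beta>) + 1) / (- (2 * \<beta>) + 1))"
        by (intro nn_integral_has_integral_lebesgue) auto
      then show ?thesis by (intro integrableI_nonneg) auto
    qed simp
    then have "integrable lborel (\<lambda>y. 2 * C powr (2 * \<beta>) * (indicat_real {0..A} y * y powr (- (2 * \<beta>))))"
      by (rule integrable_mult_right)
    also have "(\<lambda>y. 2 * C powr (2 * \<beta>) * (indicat_real {0..A} y * y powr (- (2 * \<beta>)))) = w"
    proof
      fix y
      show "2 * C powr (2 * \<beta>) * (indicat_real {0..A} y * y powr (- (2 * \<beta>))) = w y"
        unfolding w_eq by (cases "y = 0") (auto simp: indicator_def)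
    qed
    finally show ?thesis .
  qed
  define \<phi> where "\<phi> \<nu> y = measure \<nu> (?S y) * indicator {0<..} y" for \<nu> :: "real measure" and y
  define \<psi> where "\<psi> y = (LINT s|lborel. levy_density \<beta> s * indicator (?S y) s) * indicator {0<..} y" for y
  have seq: "integrable lborel \<psi> \<and> (\<lambda>n. (LINT s|\<mu> (T n). H s) / T n) \<longlonglongrightarrow> (LINT y|lborel. \<psi> y)"
    if T: "\<And>n. 0 < T n" "T \<longlonglongrightarrow> 0" for T :: "nat \<Rightarrow> real"
  proof -
    have lawT: "stable_law \<beta> (T n) (\<mu> (T n))" for n by (rule law[OF T(1)])
    have meas: "(\<lambda>y. \<phi> (\<mu> (T n)) y / T n) \<in> borel_measurable lborel" for n
    proof -
      interpret stable_law_loc \<beta> "T n" "\<mu> (T n)" by standard (rule lawT)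
      have eq: "(\<lambda>y. measure (\<mu> (T n)) (?S y)) = (\<lambda>y. enn2real (\<integral>\<^sup>+s. (if y < H s then 1 else 0) \<partial>\<mu> (T n)))"
      proof
        fix y
        have "(\<integral>\<^sup>+s. (if y < H s then 1 else 0) \<partial>\<mu> (T n)) = (\<integral>\<^sup>+s. indicator (?S y) s \<partial>\<mu> (T n))"
          by (intro nn_integral_cong) (auto simp: indicator_def)
        also have "\<dots> = emeasure (\<mu> (T n)) (?S y)" using Sb by (intro nn_integral_indicator) (simp add: sets_mu)
        finally show "measure (\<mu> (T n)) (?S y) = enn2real (\<integral>\<^sup>+s. (if y < H s then 1 else 0) \<partial>\<mu> (T n))"
          unfolding measure_def by simp
      qed
      have "(\<lambda>y. measure (\<mu> (T n)) (?S y)) \<in> borel_measurable lborel" unfolding eq by measurable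
      then show ?thesis unfolding \<phi>_def
        by (intro borel_measurable_divide borel_measurable_times borel_measurable_indicator borel_measurable_const) auto
    qed
    have \<psi>m: "\<psi> \<in> borel_measurable lborel"
    proof -
      have eq: "\<psi> = (\<lambda>y. (LINT s|lborel. levy_density \<beta> s * (if y < H s then 1 else 0)) * indicator {0<..} y)"
        unfolding \<psi>_def by (intro ext arg_cong2[where f="(*)"] Bochner_Integration.integral_cong refl) (auto simp: indicator_def)
      show ?thesis unfolding eq by measurable
    qed
    have conv: "(\<lambda>n. \<phi> (\<mu> (T n)) y / T n) \<longlonglongrightarrow> \<psi> y \<and> (\<forall>n. norm (\<phi> (\<mu> (T n)) y / T n) \<le> w y)" for y
    proof (cases "0 < y \<and> ?S y \<noteq> {}")
      case True
      then have y: "0 < y" by simp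
      obtain v where v: "(y / C)\<^sup>2 \<le> v" "0 < v" "{v<..} \<subseteq> ?S y" "?S y \<subseteq> {v..}"
        using superlevel_ray[OF H(1,2,3) C y] True by blast
      have yA: "y \<le> A" using True H(4) by (auto intro: less_imp_le less_le_trans)
      have "(\<lambda>n. measure (\<mu> (T n)) (?S y) / T n) \<longlonglongrightarrow> (LINT s|lborel. levy_density \<beta> s * indicator (?S y) s)"
        by (rule levy_tail_limit[OF \<beta>(1) \<beta>1 lawT T(2,1) v(2) Sb v(3,4)])
      moreover have "measure (\<mu> (T n)) (?S y) / T n \<le> w y" for n
      proof -
        have "measure (\<mu> (T n)) (?S y) / T n \<le> 2 * v powr (- \<beta>)"
          by (rule stable_law_tail_bound[OF lawT v(2) Sb v(4) T(1)])
        also have "\<dots> \<le> 2 * ((y / C)\<^sup>2) powr (- \<beta>)"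
          using v(1) y C \<beta> by (intro mult_left_mono powr_mono2') auto
        finally show ?thesis using y yA unfolding w_def by simp
      qed
      ultimately show ?thesis using y T(1) unfolding \<phi>_def \<psi>_def by (simp add: less_imp_le)
    next
      case False
      have w0: "0 \<le> w y" unfolding w_def by simp
      consider "y \<le> 0" | "?S y = {}" using False by linarith
      then show ?thesis
      proof cases
        case 1 then show ?thesis using w0 unfolding \<phi>_def \<psi>_def by simp
      next
        case 2 then show ?thesis using w0 unfolding \<phi>_def \<psi>_def 2 by simp
      qed
    qed
    have a1: "AE y in lborel. (\<lambda>n. \<phi> (\<mu> (T n)) y / T n) \<longlonglongrightarrow> \<psi> y"
      by (rule AE_I2) (rule conjunct1[OF conv])
    have a2: "AE y in lborel. norm (\<phi> (\<mu> (T n)) y / T n) \<le> w y" for n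
      by (rule AE_I2) (rule conjunct2[OF conv, rule_format])
    note int = integrable_dominated_convergence[OF \<psi>m meas wi a1 a2]
      integral_dominated_convergence[OF \<psi>m meas wi a1 a2]
    have eqn: "(LINT y|lborel. \<phi> (\<mu> (T n)) y / T n) = (LINT s|\<mu> (T n). H s) / T n" for n
    proof -
      interpret stable_law_loc \<beta> "T n" "\<mu> (T n)" by standard (rule lawT)
      have nnH: "(\<integral>\<^sup>+s. ennreal (H s) * 1 \<partial>\<mu> (T n)) = (\<integral>\<^sup>+y. (\<integral>\<^sup>+s. 1 * indicator (?S y) s \<partial>\<mu> (T n)) * indicator {0<..} y \<partial>lborel)"
        by (rule nn_integral_superlevel[OF Hm sigma_finite_measure_axioms sets_mu]) simp
      have "(\<integral>\<^sup>+s. 1 * indicator (?S y) s \<partial>\<mu> (T n)) * indicator {0<..} y = ennreal (\<phi> (\<mu> (T n)) y)" for y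
      proof -
        have "(\<integral>\<^sup>+s. 1 * indicator (?S y) s \<partial>\<mu> (T n)) = emeasure (\<mu> (T n)) (?S y)"
          using Sb[of y] by (simp add: sets_mu)
        then show ?thesis unfolding \<phi>_def by (simp add: emeasure_eq_measure indicator_def)
      qed
      then have "(\<integral>\<^sup>+s. ennreal (H s) \<partial>\<mu> (T n)) = (\<integral>\<^sup>+y. ennreal (\<phi> (\<mu> (T n)) y) \<partial>lborel)" using nnH by simp
      moreover have "(LINT s|\<mu> (T n). H s) = enn2real (\<integral>\<^sup>+s. ennreal (H s) \<partial>\<mu> (T n))"
        using H0 by (intro integral_eq_nn_integral) auto
      moreover have "(LINT y|lborel. \<phi> (\<mu> (T n)) y) = enn2real (\<integral>\<^sup>+y. ennreal (\<phi> (\<mu> (T n)) y) \<partial>lborel)"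
      proof (rule integral_eq_nn_integral)
        have "(\<lambda>y. \<phi> (\<mu> (T n)) y / T n * T n) \<in> borel_measurable lborel"
          using meas[of n] by (intro borel_measurable_times) auto
        then show "\<phi> (\<mu> (T n)) \<in> borel_measurable lborel" using T(1)[of n] by simp
      qed (auto simp: \<phi>_def)
      ultimately show ?thesis by simp
    qed
    show ?thesis using int(1) int(2)[unfolded eqn] by (rule conjI)
  qed
  define T0 where "T0 n = inverse (real (Suc n))" for n
  have "T0 \<longlonglongrightarrow> 0" unfolding T0_def by (rule LIMSEQ_inverse_real_of_nat)
  then have \<psi>i: "integrable lborel \<psi>" using seq[of T0] unfolding T0_def by simp
  have \<psi>0: "0 \<le> \<psi> y" for y
    unfolding \<psi>_def using levy_density_nonneg[OF \<beta>(1) \<beta>1] by (intro mult_nonneg_nonneg Bochner_Integration.integral_nonneg) auto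
  have nn\<psi>: "(\<integral>\<^sup>+s. ennreal (H s) * ennreal (levy_density \<beta> s) \<partial>lborel) = (\<integral>\<^sup>+y. ennreal (\<psi> y) \<partial>lborel)"
  proof -
    have "(\<integral>\<^sup>+s. ennreal (levy_density \<beta> s) * indicator (?S y) s \<partial>lborel) * indicator {0<..} y = ennreal (\<psi> y)" for y
    proof (cases "0 < y \<and> ?S y \<noteq> {}")
      case True
      then have y: "0 < y" by simp
      obtain v where v: "(y / C)\<^sup>2 \<le> v" "0 < v" "{v<..} \<subseteq> ?S y" "?S y \<subseteq> {v..}"
        using superlevel_ray[OF H(1,2,3) C y] True by blast
      have "(\<integral>\<^sup>+s. ennreal (levy_density \<beta> s) * indicator (?S y) s \<partial>lborel) = (\<integral>\<^sup>+s. ennreal (levy_density \<beta> s * indicator (?S y) s) \<partial>lborel)"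
        by (intro nn_integral_cong) (auto simp: indicator_def)
      also have "\<dots> = ennreal (LINT s|lborel. levy_density \<beta> s * indicator (?S y) s)"
        using levy_density_nonneg[OF \<beta>(1) \<beta>1]
        by (intro nn_integral_eq_integral levy_tail_finite[OF \<beta>(1) \<beta>1 v(2) Sb v(4)]) auto
      finally show ?thesis using y unfolding \<psi>_def by simp
    qed (auto simp: \<psi>_def)
    then show ?thesis
      using nn_integral_superlevel[OF Hm lborel.sigma_finite_measure_axioms, of "\<lambda>s. ennreal (levy_density \<beta> s)"] by simp
  qed
  have hb: "has_bochner_integral lborel (\<lambda>s. H s * levy_density \<beta> s) (LINT y|lborel. \<psi> y)"
  proof (rule has_bochner_integral_nn_integral)
    have "(\<integral>\<^sup>+s. ennreal (H s * levy_density \<beta> s) \<partial>lborel) = (\<integral>\<^sup>+s. ennreal (H s) * ennreal (levy_density \<beta> s) \<partial>lborel)"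
      using H0 levy_density_nonneg[OF \<beta>(1) \<beta>1] by (intro nn_integral_cong) (simp add: ennreal_mult)
    also have "\<dots> = ennreal (LINT y|lborel. \<psi> y)" unfolding nn\<psi>
      using \<psi>i \<psi>0 by (intro nn_integral_eq_integral) auto
    finally show "(\<integral>\<^sup>+s. ennreal (H s * levy_density \<beta> s) \<partial>lborel) = ennreal (LINT y|lborel. \<psi> y)" .
    show "AE s in lborel. 0 \<le> H s * levy_density \<beta> s"
      using H0 levy_density_nonneg[OF \<beta>(1) \<beta>1] by (intro AE_I2 mult_nonneg_nonneg) auto
    show "0 \<le> (LINT y|lborel. \<psi> y)" using \<psi>0 by (intro Bochner_Integration.integral_nonneg) auto
  qed measurable
  then show "integrable lborel (\<lambda>s. H s * levy_density \<beta> s)" by (simp add: has_bochner_integral_iff)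
  have eq: "(LINT s|lborel. H s * levy_density \<beta> s) = (LINT y|lborel. \<psi> y)" using hb by (simp add: has_bochner_integral_iff)
  show "((\<lambda>t. (LINT s|\<mu> t. H s) / t) \<longlongrightarrow> (LINT s|lborel. H s * levy_density \<beta> s)) (at_right 0)"
    unfolding tendsto_at_iff_sequentially eq
  proof (intro allI impI)
    fix T :: "nat \<Rightarrow> real" assume "\<forall>i. T i \<in> {0<..} - {0}" "T \<longlonglongrightarrow> 0"
    then show "((\<lambda>t. (LINT s|\<mu> t. H s) / t) \<circ> T) \<longlonglongrightarrow> (LINT y|lborel. \<psi> y)"
      using seq[of T] by (simp add: comp_def)
  qed
qed


section \<open>Gaussian vectors and their projections\<close>

text \<open>
  Linear isometries are surjective with determinant of modulus one.
\<close>

lemma lborel_distr_isometry: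
  fixes f :: "'v::euclidean_space \<Rightarrow> 'v"
  assumes f: "linear f" "\<And>x. norm (f x) = norm x"
  shows "distr lborel borel f = lborel"
proof (rule measure_eqI)
  have inj: "inj f" using f by (metis linear_injective_0 norm_eq_zero)
  then have surj: "surj f" using f(1) linear_injective_imp_surjective by blast
  have dist: "dist (f a) (f b) = dist a b" for a b
    using f by (simp add: dist_norm linear_diff[symmetric])
  have fm[measurable]: "f \<in> borel_measurable borel"
    using f(1) by (intro borel_measurable_continuous_onI linear_continuous_on linear_conv_bounded_linear[THEN iffD1])
  fix A assume "A \<in> sets (distr lborel borel f)"
  then have A: "A \<in> sets borel" by simp
  have V: "f -` A \<in> sets borel" using measurable_sets[OF fm A] by simp
  have im: "f ` (f -` A) = A" using surj by (simp add: surj_image_vimage_eq)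
  have "emeasure lborel (f ` (f -` A)) \<le> ennreal (1 ^ DIM('v)) * emeasure lborel ((\<lambda>x. x) ` (f -` A))"
    by (rule emeasure_Lipschitz_image) (use V A im dist in auto)
  moreover have "emeasure lborel ((\<lambda>x. x) ` (f -` A)) \<le> ennreal (1 ^ DIM('v)) * emeasure lborel (f ` (f -` A))"
    by (rule emeasure_Lipschitz_image) (use V A im dist in auto)
  ultimately have "emeasure lborel A = emeasure lborel (f -` A)" unfolding im by (simp add: antisym)
  then show "emeasure (distr lborel borel f) A = emeasure lborel A"
    using A by (subst emeasure_distr) auto
qed simp

text \<open>
  The reflection that exchanges the two unit vectors.
\<close>

lemma unit_vector_isometry:
  fixes e b :: "'v::euclidean_space"
  assumes "norm e = 1" "norm b = 1"
  obtains f :: "'v \<Rightarrow> 'v" where "linear f" "\<And>x. norm (f x) = norm x" "\<And>x. f x \<bullet> e = x \<bullet> b"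
proof -
  define w where "w = b - e"
  define f where "f y = y - (2 * (y \<bullet> w) / (w \<bullet> w)) *\<^sub>R w" for y :: 'v
  have lin: "linear f"
    by (rule linearI) (simp_all add: f_def inner_add_left algebra_simps add_divide_distrib)
  have ip: "f x \<bullet> f y = x \<bullet> y" for x y
  proof (cases "w = 0")
    case False
    define k p q where "k = w \<bullet> w" and "p = x \<bullet> w" and "q = y \<bullet> w"
    have k: "k \<noteq> 0" using False unfolding k_def by simp
    have "f x \<bullet> f y = x \<bullet> y - (2 * p / k) * q - (2 * q / k) * (p - (2 * p / k) * k)"
      unfolding f_def k_def p_def q_def
      by (simp only: inner_diff_left inner_diff_right inner_scaleR_left inner_scaleR_right inner_commute[of w y])
    also have "\<dots> = x \<bullet> y" using k by (simp add: field_simps)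
    finally show ?thesis .
  qed (simp add: f_def)
  have fb: "f b = e"
  proof (cases "w = 0")
    case False
    have ww: "w \<bullet> w = 2 * (b \<bullet> w)"
    proof -
      have "b \<bullet> b = 1" "e \<bullet> e = 1" using assms by (simp_all add: dot_square_norm)
      then show ?thesis unfolding w_def by (simp add: inner_diff_left inner_diff_right inner_commute)
    qed
    have w0: "w \<bullet> w \<noteq> 0" unfolding inner_eq_zero_iff by (rule False)
    have q: "2 * (b \<bullet> w) / (w \<bullet> w) = 1" unfolding ww[symmetric] by (rule divide_self[OF w0])
    have "f b = b - 1 *\<^sub>R w" unfolding f_def q ..
    then show ?thesis unfolding w_def by simp
  qed (simp add: f_def w_def)
  show ?thesis
  proof (rule that[OF lin])
    show "norm (f x) = norm x" for x using ip[of x x] by (simp add: norm_eq_sqrt_inner)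
    show "f x \<bullet> e = x \<bullet> b" for x using ip[of x b] fb by simp
  qed
qed

text \<open>
  The law at time \<open>u\<close> of a one-dimensional Brownian motion with generator the Laplacian: its
  variance is \<open>2 * u\<close>.
\<close>

definition heat_law :: "real \<Rightarrow> real measure" where
  "heat_law u = density lborel (\<lambda>z. ennreal (normal_density 0 (sqrt (2 * u)) z))"

lemma gaussian_density_prod:
  fixes y :: "'v::euclidean_space"
  assumes t: "0 < t"
  shows "(4 * pi * t) powr (- real DIM('v) / 2) * exp (- (norm y)\<^sup>2 / (4 * t))
     = (\<Prod>i\<in>Basis. normal_density 0 (sqrt (2 * t)) (y \<bullet> i))"
proof -
  have c: "(4 * pi * t) powr (- real DIM('v) / 2) = (1 / sqrt (4 * pi * t)) ^ DIM('v)"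
  proof -
    have p: "0 < 4 * pi * t" using t by simp
    have "(1 / sqrt (4 * pi * t)) ^ DIM('v) = ((4 * pi * t) powr (- 1 / 2)) ^ DIM('v)"
      using p by (simp add: powr_minus powr_half_sqrt inverse_eq_divide)
    also have "\<dots> = ((4 * pi * t) powr (- 1 / 2)) powr real DIM('v)" using p by (subst powr_realpow) auto
    also have "\<dots> = (4 * pi * t) powr (- real DIM('v) / 2)" unfolding powr_powr by simp
    finally show ?thesis ..
  qed
  have "(norm y)\<^sup>2 = (\<Sum>i\<in>Basis. (y \<bullet> i)\<^sup>2)"
    unfolding power2_norm_eq_inner by (subst euclidean_inner) (simp add: power2_eq_square)
  then have "- (norm y)\<^sup>2 / (4 * t) = (\<Sum>i\<in>Basis. - (y \<bullet> i)\<^sup>2 / (4 * t))"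
    by (simp add: sum_divide_distrib sum_negf)
  then have "exp (- (norm y)\<^sup>2 / (4 * t)) = (\<Prod>i\<in>Basis. exp (- (y \<bullet> i)\<^sup>2 / (4 * t)))"
    by (simp only: exp_sum finite_Basis)
  then show ?thesis unfolding c normal_density_def using t
    by (simp add: prod.distrib power2_eq_square mult_ac power_divide prod_dividef)
qed

text \<open>
  The density is a function of the norm, so the direction \<open>e\<close> may be rotated to a basis vector,
  for which the density is a product.
\<close>

lemma gaussian_projection:
  fixes X :: "'a \<Rightarrow> 'v::euclidean_space"
  assumes X: "distributed M lborel X (\<lambda>y. ennreal ((4 * pi * t) powr (- real DIM('v) / 2) * exp (- (norm y)\<^sup>2 / (4 * t))))"
    and t: "0 < t" and e: "norm e = 1"
  shows "distr M borel (\<lambda>\<omega>. X \<omega> \<bullet> e) = heat_law t"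
proof (rule measure_eqI)
  let ?\<phi> = "\<lambda>y::'v. ennreal ((4 * pi * t) powr (- real DIM('v) / 2) * exp (- (norm y)\<^sup>2 / (4 * t)))"
  let ?n = "normal_density 0 (sqrt (2 * t))"
  show "sets (distr M borel (\<lambda>\<omega>. X \<omega> \<bullet> e)) = sets (heat_law t)" unfolding heat_law_def by simp
  fix A assume "A \<in> sets (distr M borel (\<lambda>\<omega>. X \<omega> \<bullet> e))"
  then have A[measurable]: "A \<in> sets borel" by simp
  have Xm[measurable]: "X \<in> borel_measurable M" using distributed_measurable[OF X] by simp
  obtain b :: 'v where b: "b \<in> Basis" using nonempty_Basis by blast
  obtain f :: "'v \<Rightarrow> 'v" where f: "linear f" "\<And>x. norm (f x) = norm x" "\<And>x. f x \<bullet> e = x \<bullet> b"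
    using unit_vector_isometry[OF e norm_Basis[OF b]] by blast
  have fm[measurable]: "f \<in> borel_measurable borel"
    using f(1) by (intro borel_measurable_continuous_onI linear_continuous_on linear_conv_bounded_linear[THEN iffD1])
  have "emeasure (distr M borel (\<lambda>\<omega>. X \<omega> \<bullet> e)) A = (\<integral>\<^sup>+\<omega>. indicator A (X \<omega> \<bullet> e) \<partial>M)"
    by (subst emeasure_distr) (auto simp: nn_integral_indicator[symmetric] simp del: nn_integral_indicator intro!: nn_integral_cong split: split_indicator)
  also have "\<dots> = (\<integral>\<^sup>+y. ?\<phi> y * indicator A (y \<bullet> e) \<partial>lborel)"
    by (rule distributed_nn_integral[OF X, symmetric]) measurable
  also have "\<dots> = (\<integral>\<^sup>+y. ?\<phi> y * indicator A (y \<bullet> e) \<partial>distr lborel borel f)"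
    unfolding lborel_distr_isometry[OF f(1,2)] ..
  also have "\<dots> = (\<integral>\<^sup>+y. ?\<phi> (f y) * indicator A (f y \<bullet> e) \<partial>lborel)"
    by (subst nn_integral_distr) auto
  also have "\<dots> = (\<integral>\<^sup>+y. (\<Prod>i\<in>Basis. ennreal (?n (y \<bullet> i)) * (if i = b then indicator A (y \<bullet> i) else 1)) \<partial>lborel)"
  proof (rule nn_integral_cong)
    fix y :: 'v
    have "(\<Prod>i\<in>Basis. ennreal (?n (y \<bullet> i)) * (if i = b then indicator A (y \<bullet> i) else 1))
       = (\<Prod>i\<in>Basis. ennreal (?n (y \<bullet> i))) * (\<Prod>i\<in>Basis. if i = b then indicator A (y \<bullet> i) else 1)"
      by (rule prod.distrib)
    also have "(\<Prod>i\<in>Basis. if i = b then indicator A (y \<bullet> i) else 1) = (indicator A (y \<bullet> b) :: ennreal)"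
      using b by (subst prod.delta) auto
    also have "(\<Prod>i\<in>Basis. ennreal (?n (y \<bullet> i))) = ?\<phi> y"
      unfolding gaussian_density_prod[OF t] by (rule prod_ennreal) simp
    finally show "?\<phi> (f y) * indicator A (f y \<bullet> e) = (\<Prod>i\<in>Basis. ennreal (?n (y \<bullet> i)) * (if i = b then indicator A (y \<bullet> i) else 1))"
      by (simp add: f)
  qed
  also have "\<dots> = (\<Prod>i\<in>(Basis::'v set). (\<integral>\<^sup>+z. ennreal (?n z) * (if i = b then indicator A z else 1) \<partial>lborel))"
    by (rule nn_integral_lborel_prod) auto
  also have "\<dots> = (\<Prod>i\<in>(Basis::'v set). if i = b then (\<integral>\<^sup>+z. ennreal (?n z) * indicator A z \<partial>lborel) else 1)"
  proof (rule prod.cong[OF refl])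
    fix i :: 'v
    have "(\<integral>\<^sup>+z. ennreal (?n z) \<partial>lborel) = ennreal 1"
      using t by (subst nn_integral_eq_integral) auto
    then show "(\<integral>\<^sup>+z. ennreal (?n z) * (if i = b then indicator A z else 1) \<partial>lborel) = (if i = b then (\<integral>\<^sup>+z. ennreal (?n z) * indicator A z \<partial>lborel) else 1)"
      by simp
  qed
  also have "\<dots> = (\<integral>\<^sup>+z. ennreal (?n z) * indicator A z \<partial>lborel)"
    using b by (subst prod.delta) auto
  also have "\<dots> = emeasure (heat_law t) A" unfolding heat_law_def by (subst emeasure_density) auto
  finally show "emeasure (distr M borel (\<lambda>\<omega>. X \<omega> \<bullet> e)) A = emeasure (heat_law t) A" .
qed

section \<open>One-dimensional heat laws\<close>

locale heat_law_loc =
  fixes u :: real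
  assumes u: "0 < u"
begin

lemma sigma_pos: "0 < sqrt (2 * u)" using u by simp

sublocale prob_space "heat_law u"
  unfolding heat_law_def by (rule prob_space_normal_density[OF sigma_pos])

lemma sets_heat [measurable_cong]: "sets (heat_law u) = sets borel" unfolding heat_law_def by simp

lemma space_heat: "space (heat_law u) = UNIV" unfolding heat_law_def by simp

lemma integral_heat:
  assumes "g \<in> borel_measurable borel" and "has_bochner_integral lborel (\<lambda>z. normal_density 0 (sqrt (2 * u)) z * g z) v"
  shows "has_bochner_integral (heat_law u) g v"
  unfolding heat_law_def
  by (rule has_bochner_integral_density) (use assms in auto)

lemma heat_moment_even: "has_bochner_integral (heat_law u) (\<lambda>z. z ^ (2 * k)) (fact (2 * k) / fact k * u ^ k)"
proof -
  have s: "(sqrt (2 * u))\<^sup>2 = 2 * u" using u by simp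
  have "has_bochner_integral lborel (\<lambda>z. normal_density 0 (sqrt (2 * u)) z * (z - 0) ^ (2 * k)) (fact (2 * k) / ((2 / (sqrt (2 * u))\<^sup>2) ^ k * fact k))"
    by (rule normal_moment_even[OF sigma_pos])
  moreover have "fact (2 * k) / ((2 / (sqrt (2 * u))\<^sup>2) ^ k * fact k) = fact (2 * k) / fact k * u ^ k"
    unfolding s using u by (simp add: power_divide field_simps)
  ultimately show ?thesis by (intro integral_heat) auto
qed

lemma heat_moment_abs: "has_bochner_integral (heat_law u) (\<lambda>z. \<bar>z\<bar>) (2 * sqrt u / sqrt pi)"
proof -
  have "has_bochner_integral lborel (\<lambda>z. normal_density 0 (sqrt (2 * u)) z * \<bar>z - 0\<bar> ^ (2 * 0 + 1)) (2 ^ 0 * sqrt (2 * u) ^ (2 * 0 + 1) * fact 0 * sqrt (2 / pi))"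
    by (rule normal_moment_abs_odd[OF sigma_pos])
  moreover have "2 ^ 0 * sqrt (2 * u) ^ (2 * 0 + 1) * fact 0 * sqrt (2 / pi) = 2 * sqrt u / sqrt pi"
    by (simp add: real_sqrt_mult real_sqrt_divide)
  ultimately show ?thesis by (intro integral_heat) auto
qed

lemma heat_uminus: "distr (heat_law u) borel uminus = heat_law u"
proof (rule measure_eqI)
  fix A assume "A \<in> sets (distr (heat_law u) borel uminus)"
  then have A[measurable]: "A \<in> sets borel" by simp
  let ?n = "normal_density 0 (sqrt (2 * u))"
  have "emeasure (distr (heat_law u) borel uminus) A = (\<integral>\<^sup>+z. indicator A z \<partial>distr (heat_law u) borel uminus)"
    by simp
  also have "\<dots> = (\<integral>\<^sup>+z. indicator A (- z) \<partial>heat_law u)"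
    by (subst nn_integral_distr) auto
  also have "\<dots> = (\<integral>\<^sup>+z. ennreal (?n z) * indicator A (- z) \<partial>lborel)"
    unfolding heat_law_def by (subst nn_integral_density) auto
  also have "\<dots> = (\<integral>\<^sup>+z. ennreal (?n (- z)) * indicator A (- (- z)) \<partial>lborel)"
    by (subst nn_integral_real_affine[where c="- 1" and t=0]) auto
  also have "\<dots> = (\<integral>\<^sup>+z. ennreal (?n z) * indicator A z \<partial>lborel)"
    by (simp add: normal_density_def)
  also have "\<dots> = emeasure (heat_law u) A" unfolding heat_law_def by (subst emeasure_density) auto
  finally show "emeasure (distr (heat_law u) borel uminus) A = emeasure (heat_law u) A" .
qed (simp add: sets_heat)

lemma heat_neg: "A \<in> sets borel \<Longrightarrow> prob {z. - z \<in> A} = prob A"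
  using measure_distr[of uminus "heat_law u" borel A] heat_uminus by (simp add: space_heat vimage_def)

lemma heat_median: "prob {0<..} \<le> 1 / 2" "1 / 2 \<le> prob {0..}"
proof -
  have "prob {..<0} = prob {z. - z \<in> {0<..}}" by (rule arg_cong[where f=prob]) auto
  also have "\<dots> = prob {0<..}" by (rule heat_neg) simp
  finally have s: "prob {..<0} = prob {0<..}" .
  have "prob ({..<0} \<union> {0<..}) \<le> 1" by (rule prob_le_1)
  moreover have "prob ({..<0} \<union> {0<..}) = prob {..<0} + prob {0<..}"
    by (rule finite_measure_Union) (auto simp: sets_heat)
  ultimately show 1: "prob {0<..} \<le> 1 / 2" using s by simp
  have "prob (space (heat_law u) - {..<0}) = 1 - prob {..<0}" by (rule prob_compl) (simp add: sets_heat)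
  moreover have "space (heat_law u) - {..<0} = {0..}" by (auto simp: space_heat)
  ultimately show "1 / 2 \<le> prob {0..}" using 1 s by simp
qed

lemma heat_two_sided:
  assumes "0 \<le> c"
  shows "prob {z. c < \<bar>z\<bar>} = 2 * prob {c<..}"
proof -
  have "prob {z. - z \<in> {c<..}} = prob {c<..}" by (rule heat_neg) simp
  moreover have "{z. c < \<bar>z\<bar>} = {c<..} \<union> {z. - z \<in> {c<..}}" using assms by auto
  moreover have "prob ({c<..} \<union> {z. - z \<in> {c<..}}) = prob {c<..} + prob {z. - z \<in> {c<..}}"
    using assms by (intro finite_measure_Union) (auto simp: sets_heat)
  ultimately show ?thesis by simp
qed

text \<open>
  Markov's inequality for the moment of order \<open>2 * k\<close>.
\<close>

lemma heat_tail_even: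
  assumes "0 < c"
  shows "prob {z. c < \<bar>z\<bar>} \<le> fact (2 * k) / fact k * u ^ k / c ^ (2 * k)"
proof -
  have i: "integrable (heat_law u) (\<lambda>z. z ^ (2 * k))" "(LINT z|heat_law u. z ^ (2 * k)) = fact (2 * k) / fact k * u ^ k"
    using heat_moment_even[of k] by (auto simp: has_bochner_integral_iff)
  have S: "{z. c < \<bar>z\<bar>} \<in> sets (heat_law u)" unfolding sets_heat by measurable
  have "prob {z. c < \<bar>z\<bar>} = (LINT z|heat_law u. indicator {z. c < \<bar>z\<bar>} z)" by (simp add: space_heat)
  also have "\<dots> \<le> (LINT z|heat_law u. z ^ (2 * k) / c ^ (2 * k))"
  proof (rule integral_mono)
    show "integrable (heat_law u) (indicat_real {z. c < \<bar>z\<bar>})" using S by (simp add: integrable_indicator_iff emeasure_eq_measure)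
    show "indicat_real {z. c < \<bar>z\<bar>} z \<le> z ^ (2 * k) / c ^ (2 * k)" for z
    proof (cases "c < \<bar>z\<bar>")
      case True
      then have "c ^ (2 * k) \<le> \<bar>z\<bar> ^ (2 * k)" using assms by (intro power_mono) auto
      then show ?thesis using True assms by (simp add: power_even_abs)
    qed (simp add: power_mult)
  qed (use i in auto)
  also have "\<dots> = fact (2 * k) / fact k * u ^ k / c ^ (2 * k)" using i by simp
  finally show ?thesis .
qed

end

section \<open>Levy's inequality for first passages\<close>

text \<open>
  Split according to the first index \<open>k\<close> at which the level is passed. The future increment is
  independent of this event and at least one half of its mass lies on either side of 0, which gives the
  factor 2. For the converse inequality the overshoot at the passage must be controlled: it is at most
  \<open>\<epsilon>\<close> unless some step is larger than \<open>\<epsilon>\<close>.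
\<close>

lemma (in prob_space) first_passage_bounds:
  fixes X :: "nat \<Rightarrow> 'a \<Rightarrow> real"
  assumes X[measurable]: "\<And>k. X k \<in> borel_measurable M" and X0: "\<And>\<omega>. X 0 \<omega> = 0" and y: "0 \<le> y" and \<epsilon>: "0 \<le> \<epsilon>"
  defines "F \<equiv> \<lambda>k. {\<omega> \<in> space M. y < X k \<omega> \<and> (\<forall>j<k. X j \<omega> \<le> y)}"
  assumes ind: "\<And>k S. k \<le> n \<Longrightarrow> S \<in> sets borel \<Longrightarrow>
      prob (F k \<inter> {\<omega> \<in> space M. X n \<omega> - X k \<omega> \<in> S}) = prob (F k) * prob {\<omega> \<in> space M. X n \<omega> - X k \<omega> \<in> S}"
    and med: "\<And>k. k \<le> n \<Longrightarrow> 1 / 2 \<le> prob {\<omega> \<in> space M. X n \<omega> - X k \<omega> \<in> {0..}}"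
      "\<And>k. k \<le> n \<Longrightarrow> prob {\<omega> \<in> space M. X n \<omega> - X k \<omega> \<in> {0<..}} \<le> 1 / 2"
  shows "prob {\<omega> \<in> space M. \<exists>k\<le>n. y < X k \<omega>} \<le> 2 * prob {\<omega> \<in> space M. y < X n \<omega>}"
    and "2 * prob {\<omega> \<in> space M. y + \<epsilon> < X n \<omega>} \<le> prob {\<omega> \<in> space M. \<exists>k\<le>n. y < X k \<omega>}
        + 2 * prob {\<omega> \<in> space M. \<exists>k<n. \<epsilon> < X (Suc k) \<omega> - X k \<omega>}"
proof -
  have Fm[measurable]: "F k \<in> events" for k unfolding F_def by measurable
  have dF: "disjoint_family_on F {..n}"
    unfolding disjoint_family_on_def
  proof (intro ballI impI)
    fix i j :: nat assume "i \<noteq> j"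
    then consider "i < j" | "j < i" by linarith
    then show "F i \<inter> F j = {}"
    proof cases
      case 1
      have "\<omega> \<notin> F j" if "\<omega> \<in> F i" for \<omega> using that 1 unfolding F_def by (simp add: not_le) blast
      then show ?thesis by blast
    next
      case 2
      have "\<omega> \<notin> F i" if "\<omega> \<in> F j" for \<omega> using that 2 unfolding F_def by (simp add: not_le) blast
      then show ?thesis by blast
    qed
  qed
  have first: "\<exists>k\<le>n. \<omega> \<in> F k \<and> k \<le> m" if "\<omega> \<in> space M" "m \<le> n" "y < X m \<omega>" for \<omega> m
  proof -
    define k where "k = (LEAST k. y < X k \<omega>)"
    have "y < X k \<omega>" unfolding k_def by (rule LeastI) fact
    moreover have "X j \<omega> \<le> y" if "j < k" for j using not_less_Least[of j "\<lambda>k. y < X k \<omega>"] that unfolding k_def by simp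
    moreover have "k \<le> m" unfolding k_def by (rule Least_le) fact
    ultimately show ?thesis using that unfolding F_def by (intro exI[of _ k]) simp
  qed
  have UF: "{\<omega> \<in> space M. \<exists>k\<le>n. y < X k \<omega>} = (\<Union>k\<in>{..n}. F k)"
  proof (intro set_eqI iffI)
    fix \<omega> assume "\<omega> \<in> {\<omega> \<in> space M. \<exists>k\<le>n. y < X k \<omega>}"
    then obtain m where "\<omega> \<in> space M" "m \<le> n" "y < X m \<omega>" by blast
    from first[OF this] show "\<omega> \<in> (\<Union>k\<in>{..n}. F k)" by blast
  qed (auto simp: F_def)
  have PF: "prob {\<omega> \<in> space M. \<exists>k\<le>n. y < X k \<omega>} = (\<Sum>k\<le>n. prob (F k))"
    unfolding UF using dF by (intro finite_measure_finite_Union) auto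
  have dG: "disjoint_family_on (\<lambda>k. F k \<inter> S k) {..n}" for S
    using dF unfolding disjoint_family_on_def by blast
  let ?G = "\<lambda>S k. F k \<inter> {\<omega> \<in> space M. X n \<omega> - X k \<omega> \<in> S}"
  have Gm: "?G S k \<in> events" if "S \<in> sets borel" for S k using that by measurable
  have "(\<Sum>k\<le>n. prob (F k)) = 2 * (\<Sum>k\<le>n. prob (F k) * (1 / 2))" by (simp add: sum_distrib_left)
  also have "\<dots> \<le> 2 * (\<Sum>k\<le>n. prob (?G {0..} k))"
  proof (intro mult_left_mono sum_mono)
    fix k assume "k \<in> {..n}"
    then have k: "k \<le> n" by simp
    show "prob (F k) * (1 / 2) \<le> prob (?G {0..} k)"
      unfolding ind[OF k atLeast_borel] by (intro mult_left_mono med(1)[OF k] measure_nonneg)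
  qed simp
  also have "(\<Sum>k\<le>n. prob (?G {0..} k)) = prob (\<Union>k\<in>{..n}. ?G {0..} k)"
    using dG Gm by (intro finite_measure_finite_Union[symmetric]) auto
  also have "\<dots> \<le> prob {\<omega> \<in> space M. y < X n \<omega>}"
    by (rule finite_measure_mono) (auto simp: F_def)
  finally show "prob {\<omega> \<in> space M. \<exists>k\<le>n. y < X k \<omega>} \<le> 2 * prob {\<omega> \<in> space M. y < X n \<omega>}" unfolding PF by simp
  let ?J = "{\<omega> \<in> space M. \<exists>k<n. \<epsilon> < X (Suc k) \<omega> - X k \<omega>}"
  have Jm: "?J \<in> events" by measurable
  have sub: "{\<omega> \<in> space M. y + \<epsilon> < X n \<omega>} \<subseteq> ?J \<union> (\<Union>k\<in>{..n}. ?G {0<..} k)"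
  proof
    fix \<omega> assume "\<omega> \<in> {\<omega> \<in> space M. y + \<epsilon> < X n \<omega>}"
    then have w: "\<omega> \<in> space M" "y + \<epsilon> < X n \<omega>" by auto
    then have "y < X n \<omega>" using \<epsilon> by simp
    from first[OF w(1) order_refl this] obtain k where k: "k \<le> n" "\<omega> \<in> F k" by blast
    have "k \<noteq> 0" using k(2) X0 y unfolding F_def by (cases k) auto
    then obtain j where j: "k = Suc j" by (cases k) auto
    have Xj: "X j \<omega> \<le> y" using k(2) j unfolding F_def by auto
    show "\<omega> \<in> ?J \<union> (\<Union>k\<in>{..n}. ?G {0<..} k)"
    proof (cases "\<epsilon> < X (Suc j) \<omega> - X j \<omega>")
      case True
      then have "\<omega> \<in> ?J" using w(1) j k(1) by (intro CollectI conjI exI[of _ j]) auto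
      then show ?thesis by blast
    next
      case False
      then have "0 < X n \<omega> - X k \<omega>" using Xj w j by simp
      then have "\<omega> \<in> ?G {0<..} k" using k w by simp
      then show ?thesis using k(1) by blast
    qed
  qed
  have "prob {\<omega> \<in> space M. y + \<epsilon> < X n \<omega>} \<le> prob (?J \<union> (\<Union>k\<in>{..n}. ?G {0<..} k))"
    using Jm Gm by (intro finite_measure_mono[OF sub]) auto
  also have "\<dots> \<le> prob ?J + prob (\<Union>k\<in>{..n}. ?G {0<..} k)"
    using Jm Gm by (intro measure_Un_le) auto
  also have "prob (\<Union>k\<in>{..n}. ?G {0<..} k) = (\<Sum>k\<le>n. prob (?G {0<..} k))"
    using dG Gm by (intro finite_measure_finite_Union) auto
  also have "\<dots> \<le> (\<Sum>k\<le>n. prob (F k) * (1 / 2))"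
  proof (rule sum_mono)
    fix k assume "k \<in> {..n}"
    then have k: "k \<le> n" by simp
    show "prob (?G {0<..} k) \<le> prob (F k) * (1 / 2)"
      unfolding ind[OF k greaterThan_borel] by (intro mult_left_mono med(2)[OF k] measure_nonneg)
  qed
  also have "\<dots> = prob {\<omega> \<in> space M. \<exists>k\<le>n. y < X k \<omega>} / 2" unfolding PF by (simp add: sum_divide_distrib)
  finally show "2 * prob {\<omega> \<in> space M. y + \<epsilon> < X n \<omega>} \<le> prob {\<omega> \<in> space M. \<exists>k\<le>n. y < X k \<omega>} + 2 * prob ?J"
    by simp
qed


section \<open>Hitting times of continuous paths\<close>

lemma dyadic_hit:
  fixes p :: "real \<Rightarrow> 'v::topological_space"
  assumes "continuous_on {0..} p" "0 < u" "open G" "0 \<le> s" "s \<le> u" "p s \<in> G"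
  obtains m j :: nat where "j \<le> 2 ^ m" "p (real j * u / 2 ^ m) \<in> G"
proof -
  have "continuous (at s within {0..}) p" using assms(1,4) by (simp add: continuous_on_eq_continuous_within)
  then have "eventually (\<lambda>r. p r \<in> G) (at s within {0..})"
    unfolding continuous_within by (rule topological_tendstoD[OF _ assms(3,6)])
  then obtain d where d: "0 < d" "\<And>r. 0 \<le> r \<Longrightarrow> r \<noteq> s \<Longrightarrow> dist r s < d \<Longrightarrow> p r \<in> G"
    unfolding eventually_at by auto
  have "(\<lambda>m. u * (1 / 2) ^ m) \<longlonglongrightarrow> u * 0" by (intro tendsto_mult tendsto_const LIMSEQ_power_zero) simp
  then have "eventually (\<lambda>m. u * (1 / 2) ^ m < d) sequentially" using d(1) by (intro order_tendstoD) simp_all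
  then obtain m where m: "u * (1 / 2) ^ m < d" by (auto simp: eventually_sequentially)
  define j where "j = nat \<lfloor>s * 2 ^ m / u\<rfloor>"
  have f: "real j = of_int \<lfloor>s * 2 ^ m / u\<rfloor>" unfolding j_def using assms by simp
  have 1: "real j \<le> s * 2 ^ m / u" "s * 2 ^ m / u < real j + 1" unfolding f by linarith+
  have "s * 2 ^ m / u \<le> 2 ^ m" using assms by (simp add: field_simps)
  then have "real j \<le> 2 ^ m" using 1 by linarith
  then have jm: "j \<le> 2 ^ m" by (metis of_nat_le_iff of_nat_numeral of_nat_power)
  have "real j * u / 2 ^ m \<le> s" "s < real j * u / 2 ^ m + u * (1 / 2) ^ m"
    using 1 assms(2) by (simp_all add: field_simps power_one_over)
  then have "dist (real j * u / 2 ^ m) s < d" using m by (simp add: dist_real_def)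
  then have "p (real j * u / 2 ^ m) \<in> G"
    using d(2)[of "real j * u / 2 ^ m"] assms(2,6) by (cases "real j * u / 2 ^ m = s") auto
  with jm show ?thesis by (rule that)
qed

text \<open>
  A continuous path attains its minimal distance to \<open>F\<close> on a compact time interval.
\<close>

lemma closed_hit_iff:
  fixes p :: "real \<Rightarrow> 'v::euclidean_space"
  assumes p: "continuous_on {0..} p" and F: "closed F" "F \<noteq> {}" and "0 \<le> u"
  shows "(\<exists>s\<in>{0..u}. p s \<in> F) \<longleftrightarrow> (\<forall>m::nat. \<exists>s\<in>{0..u}. infdist (p s) F < 1 / real (Suc m))"
proof
  assume "\<exists>s\<in>{0..u}. p s \<in> F"
  then obtain s where "s \<in> {0..u}" "p s \<in> F" by blast
  then show "\<forall>m::nat. \<exists>s\<in>{0..u}. infdist (p s) F < 1 / real (Suc m)" by (intro allI bexI[of _ s]) auto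
next
  assume *: "\<forall>m::nat. \<exists>s\<in>{0..u}. infdist (p s) F < 1 / real (Suc m)"
  have "continuous_on {0..u} (\<lambda>s. infdist (p s) F)"
    using p by (intro continuous_on_infdist) (rule continuous_on_subset, auto)
  then have "\<exists>s\<in>{0..u}. \<forall>r\<in>{0..u}. infdist (p s) F \<le> infdist (p r) F"
    using assms by (intro continuous_attains_inf) auto
  then obtain s where s: "s \<in> {0..u}" "\<And>r. r \<in> {0..u} \<Longrightarrow> infdist (p s) F \<le> infdist (p r) F" by blast
  have "infdist (p s) F < 1 / real (Suc m)" for m
  proof -
    obtain r where "r \<in> {0..u}" "infdist (p r) F < 1 / real (Suc m)" using * by blast
    then show ?thesis using s(2)[of r] by simp
  qed
  then have "\<not> 0 < infdist (p s) F"
    using reals_Archimedean[of "infdist (p s) F"] unfolding inverse_eq_divide by (meson less_asym)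
  then have "infdist (p s) F = 0" using infdist_nonneg[of "p s" F] by simp
  then have "p s \<in> F" using F by (simp add: in_closed_iff_infdist_zero)
  then show "\<exists>s\<in>{0..u}. p s \<in> F" using s(1) by blast
qed

lemma hit_measurable:
  fixes X :: "real \<Rightarrow> 'a \<Rightarrow> 'v::euclidean_space"
  assumes X: "\<And>s. 0 \<le> s \<Longrightarrow> X s \<in> borel_measurable N" and cont: "\<And>\<omega>. \<omega> \<in> space N \<Longrightarrow> continuous_on {0..} (\<lambda>s. X s \<omega>)"
    and F: "closed F" and u: "0 < u"
  shows "{\<omega> \<in> space N. \<exists>s\<in>{0..u}. X s \<omega> \<in> F} \<in> sets N"
proof (cases "F = {}")
  case False
  have op: "{\<omega> \<in> space N. \<exists>s\<in>{0..u}. X s \<omega> \<in> G} \<in> sets N" if G: "open G" for G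
  proof -
    have "{\<omega> \<in> space N. X (real j * u / 2 ^ m) \<omega> \<in> G} \<in> sets N" for j m :: nat
      using measurable_sets[OF X[of "real j * u / 2 ^ m"] borel_open[OF G]] u by (simp add: vimage_def Int_def conj_commute)
    then have "(\<Union>m::nat. \<Union>j\<in>{..2 ^ m}. {\<omega> \<in> space N. X (real j * u / 2 ^ m) \<omega> \<in> G}) \<in> sets N" by blast
    also have "(\<Union>m::nat. \<Union>j\<in>{..2 ^ m}. {\<omega> \<in> space N. X (real j * u / 2 ^ m) \<omega> \<in> G}) = {\<omega> \<in> space N. \<exists>s\<in>{0..u}. X s \<omega> \<in> G}"
    proof (intro set_eqI iffI)
      fix \<omega> assume "\<omega> \<in> (\<Union>m::nat. \<Union>j\<in>{..2 ^ m}. {\<omega> \<in> space N. X (real j * u / 2 ^ m) \<omega> \<in> G})"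
      then obtain m j :: nat where j: "\<omega> \<in> space N" "j \<le> 2 ^ m" "X (real j * u / 2 ^ m) \<omega> \<in> G" by blast
      have "real j \<le> 2 ^ m" using j(2) by (metis of_nat_le_iff of_nat_numeral of_nat_power)
      then have "real j * u / 2 ^ m \<in> {0..u}" using u by (simp add: field_simps)
      then show "\<omega> \<in> {\<omega> \<in> space N. \<exists>s\<in>{0..u}. X s \<omega> \<in> G}" using j by blast
    next
      fix \<omega> assume "\<omega> \<in> {\<omega> \<in> space N. \<exists>s\<in>{0..u}. X s \<omega> \<in> G}"
      then obtain s where s: "\<omega> \<in> space N" "0 \<le> s" "s \<le> u" "X s \<omega> \<in> G" by auto
      from dyadic_hit[OF cont[OF s(1)] u G s(2-4)] obtain m j :: nat where jm: "j \<le> 2 ^ m" "X (real j * u / 2 ^ m) \<omega> \<in> G" by blast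
      then have "\<omega> \<in> (\<Union>j\<in>{..2 ^ m}. {\<omega> \<in> space N. X (real j * u / 2 ^ m) \<omega> \<in> G})" using s(1) by blast
      then show "\<omega> \<in> (\<Union>m::nat. \<Union>j\<in>{..2 ^ m}. {\<omega> \<in> space N. X (real j * u / 2 ^ m) \<omega> \<in> G})" by (rule UN_I[OF UNIV_I])
    qed
    finally show ?thesis .
  qed
  have "open {v. infdist v F < 1 / real (Suc m)}" for m
    by (intro open_Collect_less continuous_on_infdist continuous_on_id continuous_on_const)
  from op[OF this] have "{\<omega> \<in> space N. \<exists>s\<in>{0..u}. infdist (X s \<omega>) F < 1 / real (Suc m)} \<in> sets N" for m by simp
  then have "(\<Inter>m. {\<omega> \<in> space N. \<exists>s\<in>{0..u}. infdist (X s \<omega>) F < 1 / real (Suc m)}) \<in> sets N" by blast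
  also have "(\<Inter>m. {\<omega> \<in> space N. \<exists>s\<in>{0..u}. infdist (X s \<omega>) F < 1 / real (Suc m)}) = {\<omega> \<in> space N. \<exists>s\<in>{0..u}. X s \<omega> \<in> F}"
  proof (intro set_eqI iffI)
    fix \<omega> assume "\<omega> \<in> (\<Inter>m. {\<omega> \<in> space N. \<exists>s\<in>{0..u}. infdist (X s \<omega>) F < 1 / real (Suc m)})"
    then have "\<omega> \<in> space N" "\<forall>m::nat. \<exists>s\<in>{0..u}. infdist (X s \<omega>) F < 1 / real (Suc m)" by blast+
    then show "\<omega> \<in> {\<omega> \<in> space N. \<exists>s\<in>{0..u}. X s \<omega> \<in> F}" using closed_hit_iff[OF cont F False, of \<omega> u] u by simp
  next
    fix \<omega> assume "\<omega> \<in> {\<omega> \<in> space N. \<exists>s\<in>{0..u}. X s \<omega> \<in> F}"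
    then have w: "\<omega> \<in> space N" "\<exists>s\<in>{0..u}. X s \<omega> \<in> F" by blast+
    then have "\<forall>m::nat. \<exists>s\<in>{0..u}. infdist (X s \<omega>) F < 1 / real (Suc m)" using closed_hit_iff[OF cont F False, of \<omega> u] u by simp
    with w(1) show "\<omega> \<in> (\<Inter>m. {\<omega> \<in> space N. \<exists>s\<in>{0..u}. infdist (X s \<omega>) F < 1 / real (Suc m)})" by blast
  qed
  finally show ?thesis .
qed simp

lemma exit_time_less_iff: "exit_time D X \<omega> < a \<longleftrightarrow> (\<exists>t>0. ereal t < a \<and> X t \<omega> \<notin> D)"
  unfolding exit_time_def Inf_less_iff by auto

text \<open>
  For a general path the exit time looks at positive times only, so the hitting events are taken over
  intervals with positive rational endpoints.
\<close>

lemma exit_time_measurable: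
  fixes X :: "real \<Rightarrow> 'a \<Rightarrow> 'v::euclidean_space"
  assumes X: "\<And>s. 0 \<le> s \<Longrightarrow> X s \<in> borel_measurable N" and cont: "\<And>\<omega>. \<omega> \<in> space N \<Longrightarrow> continuous_on {0..} (\<lambda>s. X s \<omega>)"
    and D: "open D"
  shows "exit_time D X \<in> borel_measurable N"
  unfolding borel_measurable_ereal_iff_Iio
proof
  fix a :: ereal
  define I where "I = {(p, q). p \<in> \<rat> \<and> q \<in> \<rat> \<and> 0 < p \<and> p < q \<and> ereal q < a}"
  have "countable (\<rat> \<times> \<rat> :: (real \<times> real) set)" by (intro countable_SIGMA countable_rat)
  then have I: "countable I" by (rule countable_subset[rotated]) (auto simp: I_def)
  have hit: "{\<omega> \<in> space N. \<exists>s\<in>{p..q}. X s \<omega> \<in> - D} \<in> sets N" if "0 < p" "p < q" for p q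
  proof -
    have "{\<omega> \<in> space N. \<exists>s\<in>{0..q - p}. X (p + s) \<omega> \<in> - D} \<in> sets N"
    proof (rule hit_measurable)
      fix \<omega> assume "\<omega> \<in> space N"
      show "continuous_on {0..} (\<lambda>s. X (p + s) \<omega>)"
        by (rule continuous_on_compose2[OF cont[OF \<open>\<omega> \<in> space N\<close>]]) (use that in \<open>auto intro!: continuous_intros\<close>)
    qed (use X D that in auto)
    also have "{\<omega> \<in> space N. \<exists>s\<in>{0..q - p}. X (p + s) \<omega> \<in> - D} = {\<omega> \<in> space N. \<exists>s\<in>{p..q}. X s \<omega> \<in> - D}"
    proof -
      have "(\<exists>s\<in>{0..q - p}. X (p + s) \<omega> \<in> - D) \<longleftrightarrow> (\<exists>s\<in>{p..q}. X s \<omega> \<in> - D)" for \<omega>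
      proof
        assume "\<exists>s\<in>{0..q - p}. X (p + s) \<omega> \<in> - D"
        then obtain s where "s \<in> {0..q - p}" "X (p + s) \<omega> \<in> - D" by blast
        then show "\<exists>s\<in>{p..q}. X s \<omega> \<in> - D" by (intro bexI[of _ "p + s"]) auto
      next
        assume "\<exists>s\<in>{p..q}. X s \<omega> \<in> - D"
        then obtain s where "s \<in> {p..q}" "X s \<omega> \<in> - D" by blast
        then show "\<exists>s\<in>{0..q - p}. X (p + s) \<omega> \<in> - D" by (intro bexI[of _ "s - p"]) auto
      qed
      then show ?thesis by simp
    qed
    finally show ?thesis .
  qed
  have "exit_time D X -` {..<a} \<inter> space N = (\<Union>(p, q)\<in>I. {\<omega> \<in> space N. \<exists>s\<in>{p..q}. X s \<omega> \<in> - D})"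
  proof (intro set_eqI iffI)
    fix \<omega> assume "\<omega> \<in> exit_time D X -` {..<a} \<inter> space N"
    then obtain t where t: "\<omega> \<in> space N" "0 < t" "ereal t < a" "X t \<omega> \<notin> D" by (auto simp: exit_time_less_iff)
    obtain p where p: "p \<in> \<rat>" "0 < p" "p < t" using Rats_dense_in_real[OF t(2)] by blast
    obtain q where q: "q \<in> \<rat>" "t < q" "ereal q < a"
    proof -
      obtain c where c: "ereal t < c" "c < a" using t(3) dense by blast
      then obtain c' where c': "c = ereal c'" by (cases c) auto
      then obtain q where "q \<in> \<rat>" "t < q" "q < c'" using c Rats_dense_in_real[of t c'] by auto
      then show ?thesis using c c' that[of q] by (metis less_ereal.simps(1) less_trans)
    qed
    have "(p, q) \<in> I" unfolding I_def using p q by auto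
    moreover have "\<omega> \<in> {\<omega> \<in> space N. \<exists>s\<in>{p..q}. X s \<omega> \<in> - D}" using t p q by auto
    ultimately show "\<omega> \<in> (\<Union>(p, q)\<in>I. {\<omega> \<in> space N. \<exists>s\<in>{p..q}. X s \<omega> \<in> - D})" by blast
  next
    fix \<omega> assume "\<omega> \<in> (\<Union>(p, q)\<in>I. {\<omega> \<in> space N. \<exists>s\<in>{p..q}. X s \<omega> \<in> - D})"
    then obtain p q s where w: "\<omega> \<in> space N" "0 < p" "ereal q < a" "s \<in> {p..q}" "X s \<omega> \<notin> D" unfolding I_def by auto
    have "ereal s \<le> ereal q" using w by simp
    then have "ereal s < a" using w(3) by (rule le_less_trans)
    moreover have "0 < s" using w by simp
    ultimately have "exit_time D X \<omega> < a" unfolding exit_time_less_iff using w(5) by blast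
    then show "\<omega> \<in> exit_time D X -` {..<a} \<inter> space N" using w(1) by simp
  qed
  also have "\<dots> \<in> sets N"
    by (rule sets.countable_UN'[OF I]) (use hit in \<open>auto simp: I_def\<close>)
  finally show "exit_time D X -` {..<a} \<inter> space N \<in> sets N" .
qed

lemma exit_time_le_iff:
  fixes X :: "real \<Rightarrow> 'a \<Rightarrow> 'v::euclidean_space"
  assumes X: "continuous_on {0..} (\<lambda>s. X s \<omega>)" and D: "open D" "X 0 \<omega> \<in> D" and u: "0 \<le> u"
  shows "exit_time D X \<omega> \<le> ereal u \<longleftrightarrow> (\<exists>s\<in>{0..u}. X s \<omega> \<notin> D)"
proof
  assume "\<exists>s\<in>{0..u}. X s \<omega> \<notin> D"
  then obtain s where s: "0 \<le> s" "s \<le> u" "X s \<omega> \<notin> D" by auto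
  then have "0 < s" using D(2) by (cases "s = 0") auto
  then have "exit_time D X \<omega> \<le> ereal s" unfolding exit_time_def using s by (intro Inf_lower) auto
  also have "\<dots> \<le> ereal u" using s by simp
  finally show "exit_time D X \<omega> \<le> ereal u" .
next
  assume le: "exit_time D X \<omega> \<le> ereal u"
  show "\<exists>s\<in>{0..u}. X s \<omega> \<notin> D"
  proof (rule ccontr)
    assume n: "\<not> (\<exists>s\<in>{0..u}. X s \<omega> \<notin> D)"
    then have "X u \<omega> \<in> D" using u by auto
    have "continuous (at u within {0..}) (\<lambda>s. X s \<omega>)" using X u by (simp add: continuous_on_eq_continuous_within)
    then have "eventually (\<lambda>r. X r \<omega> \<in> D) (at u within {0..})"
      unfolding continuous_within by (rule topological_tendstoD[OF _ D(1) \<open>X u \<omega> \<in> D\<close>])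
    then obtain d where d: "0 < d" "\<And>r. 0 \<le> r \<Longrightarrow> r \<noteq> u \<Longrightarrow> dist r u < d \<Longrightarrow> X r \<omega> \<in> D"
      unfolding eventually_at by auto
    have "exit_time D X \<omega> < ereal (u + d)" by (rule le_less_trans[OF le]) (use d(1) in simp)
    then obtain t where t: "0 < t" "ereal t < ereal (u + d)" "X t \<omega> \<notin> D" unfolding exit_time_less_iff by blast
    show False
    proof (cases "t \<le> u")
      case True
      then show False using n t by auto
    next
      case False
      then show False using d(2)[of t] t by (auto simp: dist_real_def)
    qed
  qed
qed

section \<open>Brownian motion\<close>

locale brownian =
  fixes M :: "'a measure" and x :: "'v::euclidean_space" and W :: "real \<Rightarrow> 'a \<Rightarrow> 'v"
  assumes bm: "brownian_motion M x W"
begin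

lemma levy: "levy_process M (\<lambda>t \<omega>. W t \<omega> - x)" using bm unfolding brownian_motion_def by blast

sublocale prob_space M using levy unfolding levy_process_def by blast

lemma W_measurable [measurable]:
  assumes "0 \<le> t"
  shows "W t \<in> borel_measurable M"
proof -
  have "(\<lambda>\<omega>. W t \<omega> - x) \<in> borel_measurable M" using levy assms unfolding levy_process_def by blast
  then have "(\<lambda>\<omega>. (W t \<omega> - x) + x) \<in> borel_measurable M" by (intro borel_measurable_add) auto
  then show ?thesis by simp
qed

lemma W_start: "AE \<omega> in M. W 0 \<omega> = x"
proof -
  have "AE \<omega> in M. W 0 \<omega> - x = 0" using levy unfolding levy_process_def by blast
  then show ?thesis by eventually_elim simp
qed

lemma W_continuous: "\<omega> \<in> space M \<Longrightarrow> continuous_on {0..} (\<lambda>t. W t \<omega>)"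
  using bm unfolding brownian_motion_def by blast

lemma W_distributed:
  "0 < t \<Longrightarrow> distributed M lborel (\<lambda>\<omega>. W t \<omega> - x)
     (\<lambda>y. ennreal ((4 * pi * t) powr (- real DIM('v) / 2) * exp (- (norm y)\<^sup>2 / (4 * t))))"
  using bm unfolding brownian_motion_def by blast

lemma increment_law:
  assumes "0 \<le> s" "s < t"
  shows "distr M borel (\<lambda>\<omega>. W t \<omega> - W s \<omega>) = density lborel
     (\<lambda>y. ennreal ((4 * pi * (t - s)) powr (- real DIM('v) / 2) * exp (- (norm y)\<^sup>2 / (4 * (t - s)))))"
proof -
  have "\<forall>s t. 0 \<le> s \<and> s \<le> t \<longrightarrow> distr M borel (\<lambda>\<omega>. (W t \<omega> - x) - (W s \<omega> - x)) = distr M borel (\<lambda>\<omega>. W (t - s) \<omega> - x)"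
    using levy unfolding levy_process_def by blast
  then have "distr M borel (\<lambda>\<omega>. (W t \<omega> - x) - (W s \<omega> - x)) = distr M borel (\<lambda>\<omega>. W (t - s) \<omega> - x)"
    using assms by simp
  then have "distr M borel (\<lambda>\<omega>. W t \<omega> - W s \<omega>) = distr M lborel (\<lambda>\<omega>. W (t - s) \<omega> - x)"
    by (simp cong: distr_cong)
  also have "\<dots> = density lborel (\<lambda>y. ennreal ((4 * pi * (t - s)) powr (- real DIM('v) / 2) * exp (- (norm y)\<^sup>2 / (4 * (t - s)))))"
    using W_distributed[of "t - s"] assms by (intro distributed_distr_eq_density) simp
  finally show ?thesis .
qed

lemma increment_projection:
  assumes "0 \<le> s" "s < t" and e: "norm e = 1" and S: "S \<in> sets borel"
  shows "prob {\<omega> \<in> space M. (W t \<omega> - W s \<omega>) \<bullet> e \<in> S} = measure (heat_law (t - s)) S"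
proof -
  have [measurable]: "W t \<in> borel_measurable M" "W s \<in> borel_measurable M" using assms by (auto intro: W_measurable)
  have d: "distributed M lborel (\<lambda>\<omega>. W t \<omega> - W s \<omega>)
     (\<lambda>y. ennreal ((4 * pi * (t - s)) powr (- real DIM('v) / 2) * exp (- (norm y)\<^sup>2 / (4 * (t - s)))))"
    unfolding distributed_def using increment_law[OF assms(1,2)] by (auto cong: distr_cong)
  have "distr M borel (\<lambda>\<omega>. (W t \<omega> - W s \<omega>) \<bullet> e) = heat_law (t - s)"
    by (rule gaussian_projection[OF d _ e]) (use assms in simp)
  then have "measure (heat_law (t - s)) S = measure (distr M borel (\<lambda>\<omega>. (W t \<omega> - W s \<omega>) \<bullet> e)) S" by simp
  also have "\<dots> = prob {\<omega> \<in> space M. (W t \<omega> - W s \<omega>) \<bullet> e \<in> S}"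
    by (subst measure_distr) (use S in \<open>auto simp: vimage_def Int_def conj_commute\<close>)
  finally show ?thesis ..
qed

lemma increments_indep:
  fixes \<tau> :: "nat \<Rightarrow> real"
  assumes "0 \<le> \<tau> 0" "\<And>i. i < n \<Longrightarrow> \<tau> i \<le> \<tau> (Suc i)"
  shows "indep_vars (\<lambda>_. borel) (\<lambda>i \<omega>. W (\<tau> (Suc i)) \<omega> - W (\<tau> i) \<omega>) {..<n}"
proof -
  have "\<forall>n (t :: nat \<Rightarrow> real). 0 \<le> t 0 \<and> (\<forall>i<n. t i \<le> t (Suc i)) \<longrightarrow>
        indep_vars (\<lambda>_. borel) (\<lambda>i \<omega>. (W (t (Suc i)) \<omega> - x) - (W (t i) \<omega> - x)) {..<n}"
    using levy unfolding levy_process_def by blast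
  then have "indep_vars (\<lambda>_. borel) (\<lambda>i \<omega>. (W (\<tau> (Suc i)) \<omega> - x) - (W (\<tau> i) \<omega> - x)) {..<n}"
    using assms by blast
  then show ?thesis by simp
qed

text \<open>
  The increments up to grid time \<open>k\<close> and the single increment from there to the end are
  independent; the times \<open>\<tau>\<close> list the first \<open>k\<close> grid steps followed by one
  long step.
\<close>

lemma grid_first_passage_indep:
  fixes u y :: real and n k :: nat and e :: 'v
  assumes u: "0 < u" and n: "0 < n" and k: "k < n" and S: "S \<in> sets borel"
  defines "X \<equiv> \<lambda>j \<omega>. (W (real j * u / real n) \<omega> - W 0 \<omega>) \<bullet> e"
  shows "prob ({\<omega> \<in> space M. y < X k \<omega> \<and> (\<forall>j<k. X j \<omega> \<le> y)} \<inter> {\<omega> \<in> space M. X n \<omega> - X k \<omega> \<in> S})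
     = prob {\<omega> \<in> space M. y < X k \<omega> \<and> (\<forall>j<k. X j \<omega> \<le> y)} * prob {\<omega> \<in> space M. X n \<omega> - X k \<omega> \<in> S}"
proof -
  \<comment> \<open>After the first \<open>k\<close> grid times the remaining time up to \<open>u\<close> is taken in one step.\<close>
  define \<tau> where "\<tau> i = (if i \<le> k then real i * u / real n else u)" for i :: nat
  have mono: "\<tau> i \<le> \<tau> (Suc i)" if "i < Suc k" for i
    using that k u n unfolding \<tau>_def by (auto simp: field_simps)
  let ?D = "\<lambda>i \<omega>. W (\<tau> (Suc i)) \<omega> - W (\<tau> i) \<omega>"
  have ind: "indep_vars (\<lambda>_. borel) ?D {..<Suc k}"
    by (rule increments_indep) (use mono in \<open>auto simp: \<tau>_def\<close>)
  have iv: "indep_var (Pi\<^sub>M {..<k} (\<lambda>_. borel)) (\<lambda>\<omega>. restrict (\<lambda>i. ?D i \<omega>) {..<k})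
      (Pi\<^sub>M {k} (\<lambda>_. borel)) (\<lambda>\<omega>. restrict (\<lambda>i. ?D i \<omega>) {k})"
    by (rule indep_var_restrict[OF ind]) auto
  let ?A = "{d \<in> space (Pi\<^sub>M {..<k} (\<lambda>_. borel :: 'v measure)). y < (\<Sum>i<k. d i \<bullet> e) \<and> (\<forall>j<k. (\<Sum>i<j. d i \<bullet> e) \<le> y)}"
  let ?B = "{d \<in> space (Pi\<^sub>M {k} (\<lambda>_. borel :: 'v measure)). d k \<bullet> e \<in> S}"
  have comp: "(\<lambda>d. d i) \<in> borel_measurable (Pi\<^sub>M {..<k} (\<lambda>_. borel :: 'v measure))" if "i < k" for i
    using that by (intro measurable_component_singleton) auto
  have sm: "(\<lambda>d. \<Sum>i<j. d i \<bullet> e) \<in> borel_measurable (Pi\<^sub>M {..<k} (\<lambda>_. borel :: 'v measure))" if "j \<le> k" for j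
    using that by (intro borel_measurable_sum borel_measurable_inner comp borel_measurable_const) auto
  have A: "?A \<in> sets (Pi\<^sub>M {..<k} (\<lambda>_. borel))"
  proof -
    have "{d \<in> space (Pi\<^sub>M {..<k} (\<lambda>_. borel :: 'v measure)). y < (\<Sum>i<k. d i \<bullet> e)} \<in> sets (Pi\<^sub>M {..<k} (\<lambda>_. borel))"
      using sm[of k] by measurable
    moreover have "{d \<in> space (Pi\<^sub>M {..<k} (\<lambda>_. borel :: 'v measure)). \<forall>j\<in>{..<k}. (\<Sum>i<j. d i \<bullet> e) \<le> y} \<in> sets (Pi\<^sub>M {..<k} (\<lambda>_. borel))"
    proof (rule sets.sets_Collect_finite_All)
      fix j assume "j \<in> {..<k}"
      then have "(\<lambda>d. \<Sum>i<j. d i \<bullet> e) \<in> borel_measurable (Pi\<^sub>M {..<k} (\<lambda>_. borel :: 'v measure))" by (intro sm) simp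
      then show "{d \<in> space (Pi\<^sub>M {..<k} (\<lambda>_. borel :: 'v measure)). (\<Sum>i<j. d i \<bullet> e) \<le> y} \<in> sets (Pi\<^sub>M {..<k} (\<lambda>_. borel))"
        by measurable
    qed simp
    ultimately have "{d \<in> space (Pi\<^sub>M {..<k} (\<lambda>_. borel :: 'v measure)). y < (\<Sum>i<k. d i \<bullet> e)} \<inter>
       {d \<in> space (Pi\<^sub>M {..<k} (\<lambda>_. borel :: 'v measure)). \<forall>j\<in>{..<k}. (\<Sum>i<j. d i \<bullet> e) \<le> y} \<in> sets (Pi\<^sub>M {..<k} (\<lambda>_. borel))"
      by (rule sets.Int)
    also have "{d \<in> space (Pi\<^sub>M {..<k} (\<lambda>_. borel :: 'v measure)). y < (\<Sum>i<k. d i \<bullet> e)} \<inter>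
       {d \<in> space (Pi\<^sub>M {..<k} (\<lambda>_. borel :: 'v measure)). \<forall>j\<in>{..<k}. (\<Sum>i<j. d i \<bullet> e) \<le> y} = ?A" by auto
    finally show ?thesis .
  qed
  have B: "?B \<in> sets (Pi\<^sub>M {k} (\<lambda>_. borel))"
  proof -
    have [measurable]: "(\<lambda>d. d k) \<in> borel_measurable (Pi\<^sub>M {k} (\<lambda>_. borel :: 'v measure))"
      by (intro measurable_component_singleton) auto
    show ?thesis using S by measurable
  qed
  have tele: "(\<Sum>i<j. ?D i \<omega> \<bullet> e) = X j \<omega>" if "j \<le> k" for j \<omega>
  proof -
    have "(\<Sum>i<j. ?D i \<omega> \<bullet> e) = (\<Sum>i<j. W (\<tau> (Suc i)) \<omega> \<bullet> e - W (\<tau> i) \<omega> \<bullet> e)" by (simp add: inner_diff_left)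
    also have "\<dots> = W (\<tau> j) \<omega> \<bullet> e - W (\<tau> 0) \<omega> \<bullet> e" by (rule sum_lessThan_telescope)
    also have "\<dots> = X j \<omega>" using that unfolding X_def \<tau>_def by (simp add: inner_diff_left)
    finally show ?thesis .
  qed
  have Dk: "?D k \<omega> \<bullet> e = X n \<omega> - X k \<omega>" for \<omega>
    unfolding X_def \<tau>_def using n by (simp add: inner_diff_left)
  have sp1: "(restrict (\<lambda>i. ?D i \<omega>) {..<k}) \<in> ?A \<longleftrightarrow> y < X k \<omega> \<and> (\<forall>j<k. X j \<omega> \<le> y)" for \<omega>
  proof -
    have "(\<Sum>i<j. restrict (\<lambda>i. ?D i \<omega>) {..<k} i \<bullet> e) = X j \<omega>" if "j \<le> k" for j
      using that tele[OF that, of \<omega>] by (subst tele[OF that, symmetric]) (intro sum.cong, auto)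
    then show ?thesis by (auto simp: space_PiM)
  qed
  have sp2: "(restrict (\<lambda>i. ?D i \<omega>) {k}) \<in> ?B \<longleftrightarrow> X n \<omega> - X k \<omega> \<in> S" for \<omega>
    using Dk[of \<omega>] by (simp add: space_PiM)
  have "prob ((\<lambda>\<omega>. (restrict (\<lambda>i. ?D i \<omega>) {..<k}, restrict (\<lambda>i. ?D i \<omega>) {k})) -` (?A \<times> ?B) \<inter> space M)
    = prob ((\<lambda>\<omega>. restrict (\<lambda>i. ?D i \<omega>) {..<k}) -` ?A \<inter> space M) * prob ((\<lambda>\<omega>. restrict (\<lambda>i. ?D i \<omega>) {k}) -` ?B \<inter> space M)"
    by (rule indep_varD[OF iv A B])
  moreover have "(\<lambda>\<omega>. restrict (\<lambda>i. ?D i \<omega>) {..<k}) -` ?A \<inter> space M = {\<omega> \<in> space M. y < X k \<omega> \<and> (\<forall>j<k. X j \<omega> \<le> y)}"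
    unfolding vimage_def using sp1 by auto
  moreover have "(\<lambda>\<omega>. restrict (\<lambda>i. ?D i \<omega>) {k}) -` ?B \<inter> space M = {\<omega> \<in> space M. X n \<omega> - X k \<omega> \<in> S}"
    unfolding vimage_def using sp2 by auto
  moreover have "(\<lambda>\<omega>. (restrict (\<lambda>i. ?D i \<omega>) {..<k}, restrict (\<lambda>i. ?D i \<omega>) {k})) -` (?A \<times> ?B) \<inter> space M
     = {\<omega> \<in> space M. y < X k \<omega> \<and> (\<forall>j<k. X j \<omega> \<le> y)} \<inter> {\<omega> \<in> space M. X n \<omega> - X k \<omega> \<in> S}"
    unfolding vimage_def mem_Times_iff fst_conv snd_conv using sp1 sp2 by blast
  ultimately show ?thesis by simp
qed

text \<open>
  The increments of the grid walk have symmetric laws. The chance that one of the \<open>n\<close> steps of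
  duration \<open>u / n\<close> is larger than \<open>\<epsilon>\<close> is estimated by fourth moments,
  which makes it \<open>O(1 / n)\<close>.
\<close>

lemma grid_reflection:
  fixes u y \<epsilon> :: real and n :: nat and e :: 'v
  assumes u: "0 < u" and n: "0 < n" and e: "norm e = 1" and y: "0 \<le> y" and \<epsilon>: "0 < \<epsilon>"
  defines "X \<equiv> \<lambda>j \<omega>. (W (real j * u / real n) \<omega> - W 0 \<omega>) \<bullet> e"
  shows "prob {\<omega> \<in> space M. \<exists>k\<le>n. y < X k \<omega>} \<le> measure (heat_law u) {z. y < \<bar>z\<bar>}"
    and "2 * measure (heat_law u) {y + \<epsilon><..} \<le> prob {\<omega> \<in> space M. \<exists>k\<le>n. y < X k \<omega>} + 24 * u\<^sup>2 / (\<epsilon> ^ 4 * real n)"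
proof -
  have Xm[measurable]: "X j \<in> borel_measurable M" for j
  proof -
    have "0 \<le> real j * u / real n" using u by simp
    then show ?thesis unfolding X_def by (intro borel_measurable_inner borel_measurable_diff W_measurable) auto
  qed
  have X0: "X 0 \<omega> = 0" for \<omega> unfolding X_def by simp
  interpret H: heat_law_loc u by standard fact
  have diff: "prob {\<omega> \<in> space M. X j \<omega> - X k \<omega> \<in> S} = measure (heat_law (real (j - k) * u / real n)) S"
    if "k < j" "S \<in> sets borel" for j k S
  proof -
    have lt: "real k * u / real n < real j * u / real n" using that u n by (simp add: divide_strict_right_mono)
    have "X j \<omega> - X k \<omega> = (W (real j * u / real n) \<omega> - W (real k * u / real n) \<omega>) \<bullet> e" for \<omega>
      unfolding X_def by (simp add: inner_diff_left)
    moreover have "real j * u / real n - real k * u / real n = real (j - k) * u / real n"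
      using that by (simp add: of_nat_diff diff_divide_distrib algebra_simps)
    ultimately show ?thesis using increment_projection[OF _ lt e that(2)] u by simp
  qed
  have pos: "0 < real (n - k) * u / real n" if "k < n" for k using that u n by simp
  have med: "1 / 2 \<le> prob {\<omega> \<in> space M. X n \<omega> - X k \<omega> \<in> {0..}}"
    "prob {\<omega> \<in> space M. X n \<omega> - X k \<omega> \<in> {0<..}} \<le> 1 / 2" if "k \<le> n" for k
  proof -
    have "1 / 2 \<le> prob {\<omega> \<in> space M. X n \<omega> - X k \<omega> \<in> {0..}} \<and> prob {\<omega> \<in> space M. X n \<omega> - X k \<omega> \<in> {0<..}} \<le> 1 / 2"
    proof (cases "k = n")
      case True
      then show ?thesis by (simp add: prob_space)
    next
      case False
      then have "k < n" using that by simp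
      interpret K: heat_law_loc "real (n - k) * u / real n" by standard (rule pos[OF \<open>k < n\<close>])
      show ?thesis unfolding diff[OF \<open>k < n\<close> atLeast_borel] diff[OF \<open>k < n\<close> greaterThan_borel]
        using K.heat_median by blast
    qed
    then show "1 / 2 \<le> prob {\<omega> \<in> space M. X n \<omega> - X k \<omega> \<in> {0..}}"
      "prob {\<omega> \<in> space M. X n \<omega> - X k \<omega> \<in> {0<..}} \<le> 1 / 2" by auto
  qed
  have ind: "prob ({\<omega> \<in> space M. y < X k \<omega> \<and> (\<forall>j<k. X j \<omega> \<le> y)} \<inter> {\<omega> \<in> space M. X n \<omega> - X k \<omega> \<in> S})
     = prob {\<omega> \<in> space M. y < X k \<omega> \<and> (\<forall>j<k. X j \<omega> \<le> y)} * prob {\<omega> \<in> space M. X n \<omega> - X k \<omega> \<in> S}"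
    if "k \<le> n" "S \<in> sets borel" for k S
  proof (cases "k = n")
    case True
    show ?thesis
    proof (cases "(0::real) \<in> S")
      case t: True
      have "{\<omega> \<in> space M. X n \<omega> - X k \<omega> \<in> S} = space M" (is "?e = _") using True t by auto
      moreover have "{\<omega> \<in> space M. y < X k \<omega> \<and> (\<forall>j<k. X j \<omega> \<le> y)} \<inter> space M = {\<omega> \<in> space M. y < X k \<omega> \<and> (\<forall>j<k. X j \<omega> \<le> y)}" by blast
      ultimately show ?thesis by (simp add: prob_space)
    next
      case f: False
      then have e: "{\<omega> \<in> space M. X n \<omega> - X k \<omega> \<in> S} = {}" using True by auto
      show ?thesis unfolding e by simp
    qed
  next
    case False
    then have "k < n" using that by simp
    then show ?thesis unfolding X_def by (rule grid_first_passage_indep[OF u n _ that(2)])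
  qed
  note fp = first_passage_bounds[of X y \<epsilon> n, OF Xm X0 y less_imp_le[OF \<epsilon>] ind med]
  have top: "prob {\<omega> \<in> space M. c < X n \<omega>} = measure (heat_law u) {c<..}" for c
  proof -
    have "prob {\<omega> \<in> space M. X n \<omega> - X 0 \<omega> \<in> {c<..}} = measure (heat_law (real (n - 0) * u / real n)) {c<..}"
      by (rule diff[OF n greaterThan_borel])
    moreover have "real (n - 0) * u / real n = u" using n by simp
    moreover have "{\<omega> \<in> space M. X n \<omega> - X 0 \<omega> \<in> {c<..}} = {\<omega> \<in> space M. c < X n \<omega>}" unfolding X0 by simp
    ultimately show ?thesis by simp
  qed
  show "prob {\<omega> \<in> space M. \<exists>k\<le>n. y < X k \<omega>} \<le> measure (heat_law u) {z. y < \<bar>z\<bar>}"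
    unfolding H.heat_two_sided[OF y] top[symmetric] by (rule fp(1))
  have J: "prob {\<omega> \<in> space M. \<exists>k<n. \<epsilon> < X (Suc k) \<omega> - X k \<omega>} \<le> 12 * u\<^sup>2 / (\<epsilon> ^ 4 * real n)"
  proof -
    have un: "0 < u / real n" using u n by simp
    interpret N: heat_law_loc "u / real n" by standard (rule un)
    have "{\<omega> \<in> space M. \<exists>k<n. \<epsilon> < X (Suc k) \<omega> - X k \<omega>} = (\<Union>k\<in>{..<n}. {\<omega> \<in> space M. X (Suc k) \<omega> - X k \<omega> \<in> {\<epsilon><..}})"
      by auto
    then have "prob {\<omega> \<in> space M. \<exists>k<n. \<epsilon> < X (Suc k) \<omega> - X k \<omega>} \<le> (\<Sum>k<n. prob {\<omega> \<in> space M. X (Suc k) \<omega> - X k \<omega> \<in> {\<epsilon><..}})"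
      by (simp only:) (intro finite_measure_subadditive_finite, auto)
    also have "\<dots> \<le> (\<Sum>k<n. 12 * (u / real n)\<^sup>2 / \<epsilon> ^ 4)"
    proof (rule sum_mono)
      fix k
      have "prob {\<omega> \<in> space M. X (Suc k) \<omega> - X k \<omega> \<in> {\<epsilon><..}} = measure (heat_law (u / real n)) {\<epsilon><..}"
        using diff[of k "Suc k" "{\<epsilon><..}"] by simp
      also have "\<dots> \<le> measure (heat_law (u / real n)) {z. \<epsilon> < \<bar>z\<bar>}"
        by (rule N.finite_measure_mono) (auto simp: N.sets_heat)
      also have "\<dots> \<le> fact (2 * 2) / fact 2 * (u / real n) ^ 2 / \<epsilon> ^ (2 * 2)" by (rule N.heat_tail_even[OF \<epsilon>])
      also have "\<dots> = 12 * (u / real n)\<^sup>2 / \<epsilon> ^ 4" by (simp add: fact_numeral)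
      finally show "prob {\<omega> \<in> space M. X (Suc k) \<omega> - X k \<omega> \<in> {\<epsilon><..}} \<le> 12 * (u / real n)\<^sup>2 / \<epsilon> ^ 4" .
    qed
    also have "\<dots> = 12 * u\<^sup>2 / (\<epsilon> ^ 4 * real n)" using n by (simp add: power2_eq_square field_simps)
    finally show ?thesis .
  qed
  show "2 * measure (heat_law u) {y + \<epsilon><..} \<le> prob {\<omega> \<in> space M. \<exists>k\<le>n. y < X k \<omega>} + 24 * u\<^sup>2 / (\<epsilon> ^ 4 * real n)"
  proof -
    have "2 * measure (heat_law u) {y + \<epsilon><..} = 2 * prob {\<omega> \<in> space M. y + \<epsilon> < X n \<omega>}" unfolding top ..
    also have "\<dots> \<le> prob {\<omega> \<in> space M. \<exists>k\<le>n. y < X k \<omega>} + 2 * prob {\<omega> \<in> space M. \<exists>k<n. \<epsilon> < X (Suc k) \<omega> - X k \<omega>}"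
      by (rule fp(2))
    also have "\<dots> \<le> prob {\<omega> \<in> space M. \<exists>k\<le>n. y < X k \<omega>} + 2 * (12 * u\<^sup>2 / (\<epsilon> ^ 4 * real n))"
      by (intro add_left_mono mult_left_mono J) simp
    also have "2 * (12 * u\<^sup>2 / (\<epsilon> ^ 4 * real n)) = 24 * u\<^sup>2 / (\<epsilon> ^ 4 * real n)" by simp
    finally show ?thesis .
  qed
qed

definition hits :: "'v set \<Rightarrow> real \<Rightarrow> 'a set" where
  "hits G u = {\<omega> \<in> space M. \<exists>s\<in>{0..u}. W s \<omega> - W 0 \<omega> \<in> G}"

text \<open>
  By continuity of paths, an open set is hit if and only if it is hit at a dyadic fraction of
  \<open>u\<close>.
\<close>

lemma hits_grid:
  fixes G :: "'v set"
  assumes "open G" "0 < u"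
  defines "A \<equiv> \<lambda>m. {\<omega> \<in> space M. \<exists>j\<le>2 ^ m. W (real j * u / 2 ^ m) \<omega> - W 0 \<omega> \<in> G}"
  shows "hits G u \<in> events" "(\<lambda>m. prob (A m)) \<longlonglongrightarrow> prob (hits G u)"
proof -
  have Am: "A m \<in> events" for m
  proof -
    have "(\<lambda>\<omega>. W (real j * u / 2 ^ m) \<omega> - W 0 \<omega>) \<in> borel_measurable M" for j :: nat
      using assms by (intro borel_measurable_diff W_measurable) auto
    from measurable_sets[OF this borel_open[OF \<open>open G\<close>]]
    have "{\<omega> \<in> space M. W (real j * u / 2 ^ m) \<omega> - W 0 \<omega> \<in> G} \<in> events" for j :: nat
      by (simp add: vimage_def Int_def conj_commute)
    then have "(\<Union>j\<in>{..2 ^ m}. {\<omega> \<in> space M. W (real j * u / 2 ^ m) \<omega> - W 0 \<omega> \<in> G}) \<in> events" by blast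
    also have "(\<Union>j\<in>{..2 ^ m}. {\<omega> \<in> space M. W (real j * u / 2 ^ m) \<omega> - W 0 \<omega> \<in> G}) = A m" unfolding A_def by auto
    finally show ?thesis .
  qed
  have inc: "incseq A"
  proof (rule incseq_SucI, rule subsetI)
    fix m \<omega> assume "\<omega> \<in> A m"
    then obtain j where j: "\<omega> \<in> space M" "j \<le> 2 ^ m" "W (real j * u / 2 ^ m) \<omega> - W 0 \<omega> \<in> G" unfolding A_def by blast
    have "real (2 * j) * u / 2 ^ Suc m = real j * u / 2 ^ m" by simp
    then show "\<omega> \<in> A (Suc m)" using j unfolding A_def by (intro CollectI conjI exI[of _ "2 * j"]) simp_all
  qed
  have UN: "(\<Union>m. A m) = hits G u"
  proof (intro set_eqI iffI)
    fix \<omega> assume "\<omega> \<in> (\<Union>m. A m)"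
    then obtain m where "\<omega> \<in> A m" by (rule UN_E)
    then obtain j where j: "\<omega> \<in> space M" "j \<le> 2 ^ m" "W (real j * u / 2 ^ m) \<omega> - W 0 \<omega> \<in> G" unfolding A_def by blast
    have "real j \<le> 2 ^ m" using j(2) by (metis of_nat_le_iff of_nat_numeral of_nat_power)
    then have "real j * u / 2 ^ m \<in> {0..u}" using \<open>0 < u\<close> by (simp add: field_simps)
    then show "\<omega> \<in> hits G u" using j unfolding hits_def by (intro CollectI conjI bexI[of _ "real j * u / 2 ^ m"]) simp_all
  next
    fix \<omega> assume "\<omega> \<in> hits G u"
    then obtain s where s: "\<omega> \<in> space M" "0 \<le> s" "s \<le> u" "W s \<omega> - W 0 \<omega> \<in> G" unfolding hits_def by auto
    have "continuous_on {0..} (\<lambda>s. W s \<omega> - W 0 \<omega>)" by (intro continuous_on_diff W_continuous[OF s(1)] continuous_on_const)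
    from dyadic_hit[OF this assms(2,1) s(2-4)] obtain m j where jm: "j \<le> 2 ^ m" "W (real j * u / 2 ^ m) \<omega> - W 0 \<omega> \<in> G" by blast
    then have "\<omega> \<in> A m" using jm s(1) unfolding A_def by blast
    then show "\<omega> \<in> (\<Union>m. A m)" by (rule UN_I[OF UNIV_I])
  qed
  have "(\<Union>m. A m) \<in> events" using Am by blast
  then show "hits G u \<in> events" unfolding UN .
  have "(\<lambda>m. prob (A m)) \<longlonglongrightarrow> prob (\<Union>m. A m)"
    by (rule finite_Lim_measure_incseq[OF _ inc]) (use Am in blast)
  then show "(\<lambda>m. prob (A m)) \<longlonglongrightarrow> prob (hits G u)" unfolding UN .
qed

text \<open>
  The reflection principle, by letting first the mesh of the grid and then the overshoot
  \<open>\<epsilon>\<close> tend to 0.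
\<close>

lemma reflection:
  fixes e :: 'v
  assumes u: "0 < u" and e: "norm e = 1" and y: "0 \<le> y"
  shows "prob (hits {v. y < v \<bullet> e} u) = measure (heat_law u) {z. y < \<bar>z\<bar>}"
proof (rule antisym)
  interpret H: heat_law_loc u by standard fact
  let ?G = "{v. y < v \<bullet> e}"
  let ?P = "\<lambda>m. prob {\<omega> \<in> space M. \<exists>j\<le>2 ^ m. W (real j * u / 2 ^ m) \<omega> - W 0 \<omega> \<in> ?G}"
  have G: "open ?G" by (intro open_Collect_less continuous_intros)
  note lim = hits_grid(2)[OF G u]
  have P: "?P m = prob {\<omega> \<in> space M. \<exists>j\<le>2 ^ m. y < (W (real j * u / real (2 ^ m)) \<omega> - W 0 \<omega>) \<bullet> e}" for m by simp
  have n: "0 < (2::nat) ^ m" for m by simp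
  show "prob (hits ?G u) \<le> measure (heat_law u) {z. y < \<bar>z\<bar>}"
  proof (rule LIMSEQ_le_const2[OF lim], intro exI allI impI)
    fix m :: nat
    show "?P m \<le> measure (heat_law u) {z. y < \<bar>z\<bar>}" unfolding P by (rule grid_reflection(1)[OF u n e y zero_less_one])
  qed
  have low: "2 * measure (heat_law u) {y + \<epsilon><..} \<le> prob (hits ?G u)" if \<epsilon>: "0 < \<epsilon>" for \<epsilon>
  proof (rule LIMSEQ_le_const)
    have "(\<lambda>m. ?P m + 24 * u\<^sup>2 / \<epsilon> ^ 4 * (1 / 2) ^ m) \<longlonglongrightarrow> prob (hits ?G u) + 24 * u\<^sup>2 / \<epsilon> ^ 4 * 0"
      by (intro tendsto_add lim tendsto_mult tendsto_const LIMSEQ_power_zero) simp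
    then show "(\<lambda>m. ?P m + 24 * u\<^sup>2 / \<epsilon> ^ 4 * (1 / 2) ^ m) \<longlonglongrightarrow> prob (hits ?G u)" by simp
    show "\<exists>N. \<forall>m\<ge>N. 2 * measure (heat_law u) {y + \<epsilon><..} \<le> ?P m + 24 * u\<^sup>2 / \<epsilon> ^ 4 * (1 / 2) ^ m"
    proof (intro exI allI impI)
      fix m :: nat
      have "24 * u\<^sup>2 / \<epsilon> ^ 4 * (1 / 2) ^ m = 24 * u\<^sup>2 / (\<epsilon> ^ 4 * real (2 ^ m))" by (simp add: power_one_over)
      then show "2 * measure (heat_law u) {y + \<epsilon><..} \<le> ?P m + 24 * u\<^sup>2 / \<epsilon> ^ 4 * (1 / 2) ^ m"
        unfolding P using grid_reflection(2)[OF u n e y \<epsilon>, of m] by linarith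
    qed
  qed
  have UN: "(\<Union>k::nat. {y + 1 / real (Suc k)<..}) = {y<..}"
  proof (intro set_eqI iffI)
    fix z assume "z \<in> {y<..}"
    then have "0 < z - y" by simp
    then obtain k where "inverse (real (Suc k)) < z - y" using reals_Archimedean by blast
    then have "z \<in> {y + 1 / real (Suc k)<..}" by (simp add: inverse_eq_divide)
    then show "z \<in> (\<Union>k::nat. {y + 1 / real (Suc k)<..})" by (rule UN_I[OF UNIV_I])
  next
    fix z assume "z \<in> (\<Union>k::nat. {y + 1 / real (Suc k)<..})"
    then obtain k :: nat where "z \<in> {y + 1 / real (Suc k)<..}" by (rule UN_E)
    moreover have "0 < 1 / real (Suc k)" by simp
    ultimately have "y < z" unfolding greaterThan_iff by linarith
    then show "z \<in> {y<..}" by simp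
  qed
  have "incseq (\<lambda>k::nat. {y + 1 / real (Suc k)<..})"
  proof (rule incseq_SucI)
    fix k :: nat
    have "1 / real (Suc (Suc k)) \<le> 1 / real (Suc k)" by (intro divide_left_mono) auto
    then show "{y + 1 / real (Suc k)<..} \<subseteq> {y + 1 / real (Suc (Suc k))<..}" by auto
  qed
  moreover have "range (\<lambda>k::nat. {y + 1 / real (Suc k)<..}) \<subseteq> sets (heat_law u)" unfolding H.sets_heat by auto
  ultimately have "(\<lambda>k::nat. measure (heat_law u) {y + 1 / real (Suc k)<..}) \<longlonglongrightarrow> measure (heat_law u) {y<..}"
    unfolding UN[symmetric] by (intro H.finite_Lim_measure_incseq)
  then have "(\<lambda>k::nat. 2 * measure (heat_law u) {y + 1 / real (Suc k)<..}) \<longlonglongrightarrow> 2 * measure (heat_law u) {y<..}"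
    by (intro tendsto_intros)
  then have "2 * measure (heat_law u) {y<..} \<le> prob (hits ?G u)"
    by (rule LIMSEQ_le_const2) (intro exI allI impI low, simp)
  then show "measure (heat_law u) {z. y < \<bar>z\<bar>} \<le> prob (hits ?G u)" unfolding H.heat_two_sided[OF y] .
qed

text \<open>
  If the path leaves the ball of radius \<open>\<rho>\<close>, one of its coordinates exceeds
  \<open>\<rho> / d\<close> in modulus. The eighth moment supplies the power that is needed to make the
  estimate \<open>O(u)\<close> for \<open>\<rho>\<^sup>2\<close> of order \<open>u powr (3 / 4)\<close>.
\<close>

lemma sup_norm_tail:
  assumes u: "0 < u" and \<rho>: "0 < \<rho>"
  shows "prob (hits {v. \<rho> < norm v} u) \<le> 3360 * real DIM('v) ^ 9 * u ^ 4 / \<rho> ^ 8"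
proof -
  interpret H: heat_law_loc u by standard fact
  define c where "c = \<rho> / real DIM('v)"
  have c: "0 < c" unfolding c_def using \<rho> by simp
  \<comment> \<open>A coordinate is large in modulus if its value is large in one of the two directions.\<close>
  let ?B = "(Basis :: 'v set) \<union> uminus ` Basis"
  have op: "open {v. c < v \<bullet> i}" for i :: 'v by (intro open_Collect_less continuous_intros)
  have sub: "hits {v. \<rho> < norm v} u \<subseteq> (\<Union>i\<in>?B. hits {v. c < v \<bullet> i} u)"
  proof
    fix \<omega> assume "\<omega> \<in> hits {v. \<rho> < norm v} u"
    then obtain s where s: "\<omega> \<in> space M" "s \<in> {0..u}" "\<rho> < norm (W s \<omega> - W 0 \<omega>)" unfolding hits_def by blast
    let ?v = "W s \<omega> - W 0 \<omega>"
    have "\<exists>i\<in>Basis. c < \<bar>?v \<bullet> i\<bar>"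
    proof (rule ccontr)
      assume "\<not> (\<exists>i\<in>Basis. c < \<bar>?v \<bullet> i\<bar>)"
      then have "(\<Sum>i\<in>Basis. \<bar>?v \<bullet> i\<bar>) \<le> (\<Sum>i\<in>(Basis :: 'v set). c)" by (intro sum_mono) (auto simp: not_less)
      also have "\<dots> = \<rho>" unfolding c_def by simp
      finally show False using norm_le_l1[of ?v] s(3) by linarith
    qed
    then obtain i where i: "i \<in> Basis" "c < \<bar>?v \<bullet> i\<bar>" by blast
    then have "c < ?v \<bullet> i \<or> c < ?v \<bullet> (- i)" by (auto simp: abs_real_def split: if_splits)
    then have "\<exists>b\<in>?B. c < ?v \<bullet> b" using i(1) by blast
    then obtain b where b: "b \<in> ?B" "c < ?v \<bullet> b" by blast
    then have "\<omega> \<in> hits {v. c < v \<bullet> b} u" using s unfolding hits_def by blast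
    with b(1) show "\<omega> \<in> (\<Union>i\<in>?B. hits {v. c < v \<bullet> i} u)" by (rule UN_I)
  qed
  have "prob (hits {v. \<rho> < norm v} u) \<le> prob (\<Union>i\<in>?B. hits {v. c < v \<bullet> i} u)"
    using hits_grid(1)[OF op u] by (intro finite_measure_mono[OF sub]) (intro sets.finite_UN, auto)
  also have "\<dots> \<le> (\<Sum>i\<in>?B. prob (hits {v. c < v \<bullet> i} u))"
    using hits_grid(1)[OF op u] by (intro finite_measure_subadditive_finite) auto
  also have "\<dots> \<le> (\<Sum>i\<in>?B. 1680 * u ^ 4 / c ^ 8)"
  proof (rule sum_mono)
    fix i assume "i \<in> ?B"
    then have "norm i = 1" by auto
    then have "prob (hits {v. c < v \<bullet> i} u) = measure (heat_law u) {z. c < \<bar>z\<bar>}" using c by (intro reflection[OF u]) auto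
    also have "\<dots> \<le> fact (2 * 4) / fact 4 * u ^ 4 / c ^ (2 * 4)" by (rule H.heat_tail_even[OF c])
    also have "fact (2 * 4) / fact 4 = (1680::real)" by (simp add: fact_numeral)
    finally show "prob (hits {v. c < v \<bullet> i} u) \<le> 1680 * u ^ 4 / c ^ 8" by simp
  qed
  also have "\<dots> = real (card ?B) * (1680 * u ^ 4 / c ^ 8)" by simp
  also have "\<dots> \<le> (2 * real DIM('v)) * (1680 * u ^ 4 / c ^ 8)"
  proof (rule mult_right_mono)
    have "card ?B \<le> card (Basis :: 'v set) + card (uminus ` (Basis :: 'v set))" by (rule card_Un_le)
    also have "\<dots> \<le> 2 * DIM('v)" using card_image_le[of "Basis :: 'v set" uminus] by simp
    finally show "real (card ?B) \<le> 2 * real DIM('v)" by linarith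
    show "0 \<le> 1680 * u ^ 4 / c ^ 8" using u c by simp
  qed
  also have "\<dots> = 3360 * real DIM('v) ^ 9 * u ^ 4 / \<rho> ^ 8"
    unfolding c_def using \<rho> by (simp add: field_simps power_divide eval_nat_numeral)
  finally show ?thesis .
qed

end


section \<open>Independence of the starting point\<close>

definition heat_measure :: "real \<Rightarrow> 'v::euclidean_space measure" where
  "heat_measure t = density lborel (\<lambda>y. ennreal ((4 * pi * t) powr (- real DIM('v) / 2) * exp (- (norm y)\<^sup>2 / (4 * t))))"

context brownian
begin

text \<open>
  The joint law of the increments over a grid does not depend on the starting point or on the probability
  space.
\<close>

lemma grid_law:
  fixes n :: nat
  assumes u: "0 < u" and n: "0 < n"
  shows "distr M (Pi\<^sub>M {..<n} (\<lambda>_. borel)) (\<lambda>\<omega>. \<lambda>i\<in>{..<n}. W (real (Suc i) * u / real n) \<omega> - W (real i * u / real n) \<omega>)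
     = Pi\<^sub>M {..<n} (\<lambda>_. heat_measure (u / real n))"
proof -
  let ?D = "\<lambda>i \<omega>. W (real (Suc i) * u / real n) \<omega> - W (real i * u / real n) \<omega>"
  have le: "real i * u / real n \<le> real (Suc i) * u / real n" for i
    using u n by (intro divide_right_mono mult_right_mono) auto
  have rv: "?D i \<in> borel_measurable M" for i using u by (intro borel_measurable_diff W_measurable) auto
  have "indep_vars (\<lambda>_. borel) ?D {..<n}"
    using increments_indep[of "\<lambda>i. real i * u / real n" n] le by simp
  then have "distr M (Pi\<^sub>M {..<n} (\<lambda>_. borel)) (\<lambda>\<omega>. \<lambda>i\<in>{..<n}. ?D i \<omega>) = Pi\<^sub>M {..<n} (\<lambda>i. distr M borel (?D i))"
    by (subst indep_vars_iff_distr_eq_PiM[symmetric]) (use rv n in auto)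
  also have "\<dots> = Pi\<^sub>M {..<n} (\<lambda>_. heat_measure (u / real n))"
  proof (rule PiM_cong[OF refl])
    fix i
    have "real (Suc i) * u / real n - real i * u / real n = u / real n"
      by (simp add: add_divide_distrib distrib_right)
    moreover have "real i * u / real n < real (Suc i) * u / real n" using u n by (intro divide_strict_right_mono mult_strict_right_mono) auto
    ultimately show "distr M borel (?D i) = heat_measure (u / real n)"
      using increment_law[of "real i * u / real n" "real (Suc i) * u / real n"] u unfolding heat_measure_def by simp
  qed
  finally show ?thesis .
qed

lemma grid_hit_prob:
  fixes n :: nat and G :: "'v set"
  assumes u: "0 < u" and n: "0 < n" and G: "open G"
  shows "prob {\<omega> \<in> space M. \<exists>j\<le>n. W (real j * u / real n) \<omega> - W 0 \<omega> \<in> G}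
     = measure (Pi\<^sub>M {..<n} (\<lambda>_. heat_measure (u / real n)))
         {d \<in> space (Pi\<^sub>M {..<n} (\<lambda>_. borel)). \<exists>j\<in>{..n}. (\<Sum>i<j. d i) \<in> G}"
proof -
  let ?B = "{d \<in> space (Pi\<^sub>M {..<n} (\<lambda>_. borel :: 'v measure)). \<exists>j\<in>{..n}. (\<Sum>i<j. d i) \<in> G}"
  let ?D = "\<lambda>\<omega>. \<lambda>i\<in>{..<n}. W (real (Suc i) * u / real n) \<omega> - W (real i * u / real n) \<omega>"
  have B: "?B \<in> sets (Pi\<^sub>M {..<n} (\<lambda>_. borel))"
  proof (rule sets.sets_Collect_finite_Ex)
    fix j assume "j \<in> {..n}"
    then have "(\<lambda>d. \<Sum>i<j. d i) \<in> borel_measurable (Pi\<^sub>M {..<n} (\<lambda>_. borel :: 'v measure))"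
      by (intro borel_measurable_sum measurable_component_singleton) auto
    from measurable_sets[OF this borel_open[OF G]]
    show "{d \<in> space (Pi\<^sub>M {..<n} (\<lambda>_. borel :: 'v measure)). (\<Sum>i<j. d i) \<in> G} \<in> sets (Pi\<^sub>M {..<n} (\<lambda>_. borel))"
      by (simp add: vimage_def Int_def conj_commute)
  qed simp
  have rv: "?D \<in> measurable M (Pi\<^sub>M {..<n} (\<lambda>_. borel))"
    using u by (intro measurable_restrict borel_measurable_diff W_measurable) auto
  have tele: "(\<Sum>i<j. ?D \<omega> i) = W (real j * u / real n) \<omega> - W 0 \<omega>" if "j \<le> n" for j \<omega>
  proof -
    have "(\<Sum>i<j. ?D \<omega> i) = (\<Sum>i<j. W (real (Suc i) * u / real n) \<omega> - W (real i * u / real n) \<omega>)"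
      using that by (intro sum.cong) auto
    also have "\<dots> = W (real j * u / real n) \<omega> - W (real 0 * u / real n) \<omega>" by (rule sum_lessThan_telescope)
    finally show ?thesis by simp
  qed
  have "measure (Pi\<^sub>M {..<n} (\<lambda>_. heat_measure (u / real n))) ?B = prob (?D -` ?B \<inter> space M)"
    unfolding grid_law[OF u n, symmetric] by (rule measure_distr[OF rv B])
  also have "?D -` ?B \<inter> space M = {\<omega> \<in> space M. \<exists>j\<le>n. W (real j * u / real n) \<omega> - W 0 \<omega> \<in> G}"
  proof (intro set_eqI iffI)
    fix \<omega> assume "\<omega> \<in> ?D -` ?B \<inter> space M"
    then obtain j where "\<omega> \<in> space M" "j \<le> n" "(\<Sum>i<j. ?D \<omega> i) \<in> G" by blast
    then show "\<omega> \<in> {\<omega> \<in> space M. \<exists>j\<le>n. W (real j * u / real n) \<omega> - W 0 \<omega> \<in> G}" using tele by auto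
  next
    fix \<omega> assume "\<omega> \<in> {\<omega> \<in> space M. \<exists>j\<le>n. W (real j * u / real n) \<omega> - W 0 \<omega> \<in> G}"
    then obtain j where j: "\<omega> \<in> space M" "j \<le> n" "W (real j * u / real n) \<omega> - W 0 \<omega> \<in> G" by blast
    then have "(\<Sum>i<j. ?D \<omega> i) \<in> G" using tele by simp
    moreover have "?D \<omega> \<in> space (Pi\<^sub>M {..<n} (\<lambda>_. borel))" by (rule measurable_space[OF rv j(1)])
    ultimately show "\<omega> \<in> ?D -` ?B \<inter> space M" using j by blast
  qed
  finally show ?thesis ..
qed

lemma hits_closed:
  fixes F :: "'v set"
  assumes F: "closed F" "F \<noteq> {}" and u: "0 < u"
  shows "hits F u \<in> events" "(\<lambda>m. prob (hits {v. infdist v F < 1 / real (Suc m)} u)) \<longlonglongrightarrow> prob (hits F u)"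
proof -
  have op: "open {v. infdist v F < 1 / real (Suc m)}" for m
    by (intro open_Collect_less continuous_on_infdist continuous_on_id continuous_on_const)
  have ev: "hits {v. infdist v F < 1 / real (Suc m)} u \<in> events" for m by (rule hits_grid(1)[OF op u])
  have eq: "(\<Inter>m. hits {v. infdist v F < 1 / real (Suc m)} u) = hits F u"
  proof (rule set_eqI)
    fix \<omega>
    show "\<omega> \<in> (\<Inter>m. hits {v. infdist v F < 1 / real (Suc m)} u) \<longleftrightarrow> \<omega> \<in> hits F u"
    proof (cases "\<omega> \<in> space M")
      case True
      have "continuous_on {0..} (\<lambda>s. W s \<omega> - W 0 \<omega>)" by (intro continuous_on_diff W_continuous[OF True] continuous_on_const)
      from closed_hit_iff[OF this F less_imp_le[OF u]] show ?thesis using True unfolding hits_def by simp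
    qed (simp add: hits_def)
  qed
  have "decseq (\<lambda>m. hits {v. infdist v F < 1 / real (Suc m)} u)"
  proof (rule decseq_SucI)
    fix m
    have "1 / real (Suc (Suc m)) \<le> 1 / real (Suc m)" by (intro divide_left_mono) auto
    then have "infdist v F < 1 / real (Suc m)" if "infdist v F < 1 / real (Suc (Suc m))" for v using that by linarith
    then show "hits {v. infdist v F < 1 / real (Suc (Suc m))} u \<subseteq> hits {v. infdist v F < 1 / real (Suc m)} u"
      unfolding hits_def by blast
  qed
  moreover have "range (\<lambda>m. hits {v. infdist v F < 1 / real (Suc m)} u) \<subseteq> events" using ev by blast
  ultimately show "(\<lambda>m. prob (hits {v. infdist v F < 1 / real (Suc m)} u)) \<longlonglongrightarrow> prob (hits F u)"
    unfolding eq[symmetric] by (intro finite_Lim_measure_decseq)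
  have "(\<Inter>m. hits {v. infdist v F < 1 / real (Suc m)} u) \<in> events" using ev by blast
  then show "hits F u \<in> events" unfolding eq .
qed

end

text \<open>
  A closed set is approximated by its open neighbourhoods, and these are hit at grid points. Consequently
  all exit probabilities can be computed on a single probability space by translating one path, which makes
  them jointly measurable in the starting point and the time.
\<close>

lemma brownian_hits_eq:
  fixes F :: "'v::euclidean_space set"
  assumes "brownian M x W" "brownian M' x' W'" and F: "closed F" "F \<noteq> {}" and u: "0 < u"
  shows "measure M (brownian.hits M W F u) = measure M' (brownian.hits M' W' F u)"
proof -
  interpret A: brownian M x W by fact
  interpret B: brownian M' x' W' by fact
  have op: "open {v. infdist v F < 1 / real (Suc m)}" for m
    by (intro open_Collect_less continuous_on_infdist continuous_on_id continuous_on_const)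
  have eq: "A.prob (A.hits G u) = B.prob (B.hits G u)" if G: "open G" for G
  proof (rule LIMSEQ_unique[OF A.hits_grid(2)[OF G u]])
    have n: "0 < (2::nat) ^ m" for m by simp
    have "A.prob {\<omega> \<in> space M. \<exists>j\<le>2 ^ m. W (real j * u / 2 ^ m) \<omega> - W 0 \<omega> \<in> G}
       = B.prob {\<omega> \<in> space M'. \<exists>j\<le>2 ^ m. W' (real j * u / 2 ^ m) \<omega> - W' 0 \<omega> \<in> G}" for m
      using A.grid_hit_prob[OF u n G, of m] B.grid_hit_prob[OF u n G, of m] by simp
    then show "(\<lambda>m. A.prob {\<omega> \<in> space M. \<exists>j\<le>2 ^ m. W (real j * u / 2 ^ m) \<omega> - W 0 \<omega> \<in> G}) \<longlonglongrightarrow> B.prob (B.hits G u)"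
      using B.hits_grid(2)[OF G u] by simp
  qed
  show ?thesis
    by (rule LIMSEQ_unique[OF A.hits_closed(2)[OF F u]]) (use B.hits_closed(2)[OF F u] eq[OF op] in simp)
qed

section \<open>Exit times from a domain with tangent balls\<close>

locale exit_problem = brownian M x W + tangent_balls D R \<nu>
  for M :: "'a measure" and x :: "'v::euclidean_space" and W and D :: "'v set" and R \<nu>
begin

text \<open>
  The exit time of the path with the increments of \<open>W\<close> that is started at \<open>y\<close>
  instead.
\<close>

definition exits :: "'v \<Rightarrow> 'a \<Rightarrow> ereal" where
  "exits y \<omega> = exit_time D (\<lambda>s \<omega>. y + (W s \<omega> - W 0 \<omega>)) \<omega>"

lemma exits_start: "AE \<omega> in M. exit_time D W \<omega> = exits x \<omega>"
  using W_start
proof eventually_elim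
  case (elim \<omega>)
  then show ?case unfolding exits_def exit_time_def by simp
qed

lemma exits_measurable: "(\<lambda>(y, \<omega>). exits y \<omega>) \<in> borel_measurable (borel \<Otimes>\<^sub>M M)"
proof -
  have "exit_time D (\<lambda>s (y, \<omega>). y + (W s \<omega> - W 0 \<omega>)) \<in> borel_measurable (borel \<Otimes>\<^sub>M M)"
  proof (rule exit_time_measurable[OF _ _ open_D])
    fix s :: real assume "0 \<le> s"
    then have [measurable]: "W s \<in> borel_measurable M" "W 0 \<in> borel_measurable M" by (auto intro: W_measurable)
    show "(\<lambda>(y, \<omega>). y + (W s \<omega> - W 0 \<omega>)) \<in> borel_measurable (borel \<Otimes>\<^sub>M M)" by measurable
  next
    fix p :: "'v \<times> 'a" assume "p \<in> space (borel \<Otimes>\<^sub>M M)"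
    then obtain y \<omega> where p: "p = (y, \<omega>)" "\<omega> \<in> space M" by (cases p) (auto simp: space_pair_measure)
    show "continuous_on {0..} (\<lambda>s. case p of (y, \<omega>) \<Rightarrow> y + (W s \<omega> - W 0 \<omega>))"
      unfolding p(1) prod.case by (intro continuous_intros W_continuous p(2))
  qed
  also have "exit_time D (\<lambda>s (y, \<omega>). y + (W s \<omega> - W 0 \<omega>)) = (\<lambda>(y, \<omega>). exits y \<omega>)"
    unfolding exits_def exit_time_def by (auto simp: fun_eq_iff)
  finally show ?thesis .
qed

lemma exits_measurable1: "exits y \<in> borel_measurable M"
  using measurable_compose[OF measurable_Pair1' exits_measurable, of y] by simp

lemma exits_le_event: "{\<omega> \<in> space M. exits y \<omega> \<le> ereal u} \<in> events"
  using measurable_sets[OF exits_measurable1[of y], of "{..ereal u}"] by (simp add: vimage_def Int_def conj_commute)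

lemma exits_le_iff:
  assumes "y \<in> D" "\<omega> \<in> space M" "0 \<le> u"
  shows "exits y \<omega> \<le> ereal u \<longleftrightarrow> (\<exists>s\<in>{0..u}. W s \<omega> - W 0 \<omega> \<in> {v. y + v \<notin> D})"
proof -
  have "continuous_on {0..} (\<lambda>s. y + (W s \<omega> - W 0 \<omega>))" by (intro continuous_intros W_continuous assms(2))
  from exit_time_le_iff[of "\<lambda>s \<omega>. y + (W s \<omega> - W 0 \<omega>)", OF this open_D _ assms(3)] show ?thesis
    using assms(1) unfolding exits_def by simp
qed

lemma exits_pos:
  assumes "y \<in> D" "\<omega> \<in> space M"
  shows "0 < exits y \<omega>"
proof -
  have "\<not> exits y \<omega> \<le> ereal 0" using assms exits_le_iff[OF assms order_refl] by auto
  then show ?thesis by (simp add: not_le zero_ereal_def)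
qed

lemma exits_le_prob:
  assumes "y \<in> D"
  shows "0 < u \<Longrightarrow> prob {\<omega> \<in> space M. exits y \<omega> \<le> ereal u} = prob (hits {v. y + v \<notin> D} u)"
    and "u \<le> 0 \<Longrightarrow> prob {\<omega> \<in> space M. exits y \<omega> \<le> ereal u} = 0"
proof -
  assume "0 < u"
  then have "{\<omega> \<in> space M. exits y \<omega> \<le> ereal u} = hits {v. y + v \<notin> D} u"
    unfolding hits_def using exits_le_iff[OF assms _ less_imp_le] by blast
  then show "prob {\<omega> \<in> space M. exits y \<omega> \<le> ereal u} = prob (hits {v. y + v \<notin> D} u)" by simp
next
  assume "u \<le> 0"
  then have "\<not> exits y \<omega> \<le> ereal u" if "\<omega> \<in> space M" for \<omega>
    using exits_pos[OF assms that] ereal_less_eq(3)[of u 0] by (metis not_le order_trans zero_ereal_def)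
  then have e: "{\<omega> \<in> space M. exits y \<omega> \<le> ereal u} = {}" by blast
  show "prob {\<omega> \<in> space M. exits y \<omega> \<le> ereal u} = 0" unfolding e by simp
qed

lemma shifted_compl: "closed {v. y + v \<notin> D}" "{v. y + v \<notin> D} \<noteq> {}"
proof -
  have "{v. y + v \<notin> D} = (+) y -` (- D)" by auto
  then show "closed {v. y + v \<notin> D}" using closed_compl by (simp add: closed_vimage continuous_on_add continuous_on_const)
  obtain z where "z \<notin> D" using nonempty_compl by blast
  then have "z - y \<in> {v. y + v \<notin> D}" by simp
  then show "{v. y + v \<notin> D} \<noteq> {}" by blast
qed

text \<open>
  Such a point \<open>y + v\<close> is outside the inner ball at the nearest boundary point
  \<open>p\<close>. Expanding the square of the distance to its centre leaves the normal displacement and a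
  quadratic term, in which \<open>depth y \<le> norm v\<close>.
\<close>

lemma exit_implies_displacement:
  assumes y: "y \<in> D" "y = p + depth y *\<^sub>R \<nu> p" and p: "p \<in> frontier D" and v: "y + v \<notin> D" "norm v \<le> \<rho>" "\<rho>\<^sup>2 = a * R"
  shows "depth y - 2 * a \<le> v \<bullet> (- \<nu> p)"
proof -
  define \<delta> where "\<delta> = depth y"
  have nn: "\<nu> p \<bullet> \<nu> p = 1" by (rule normal_self[OF p])
  have \<delta>0: "0 \<le> \<delta>" unfolding \<delta>_def by (rule depth_nonneg)
  have "\<delta> \<le> norm v"
  proof -
    have "infdist y (- D) \<le> dist y (y + v)" by (rule infdist_le) (use v in simp)
    then show ?thesis unfolding \<delta>_def depth_def by (simp add: dist_norm)
  qed
  moreover have "norm (\<delta> *\<^sub>R \<nu> p) = \<delta>" using unit[OF p] \<delta>0 by simp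
  ultimately have "norm (v + \<delta> *\<^sub>R \<nu> p) \<le> 2 * \<rho>" using norm_triangle_ineq[of v "\<delta> *\<^sub>R \<nu> p"] v(2) by linarith
  then have "(norm (v + \<delta> *\<^sub>R \<nu> p))\<^sup>2 \<le> (2 * \<rho>)\<^sup>2" by (intro power_mono) auto
  then have 1: "(norm (v + \<delta> *\<^sub>R \<nu> p))\<^sup>2 \<le> 4 * a * R" using v(3) by (simp add: power_mult_distrib)
  have "y + v \<notin> ball (p + R *\<^sub>R \<nu> p) R" using inner_ball[OF p] v by blast
  then have "R \<le> norm (y + v - (p + R *\<^sub>R \<nu> p))" by (simp add: dist_norm norm_minus_commute)
  also have "y + v - (p + R *\<^sub>R \<nu> p) = (v + \<delta> *\<^sub>R \<nu> p) - R *\<^sub>R \<nu> p" by (subst y(2)) (simp add: \<delta>_def)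
  finally have "R\<^sup>2 \<le> (norm ((v + \<delta> *\<^sub>R \<nu> p) - R *\<^sub>R \<nu> p))\<^sup>2" using R by (intro power_mono) auto
  also have "\<dots> = (norm (v + \<delta> *\<^sub>R \<nu> p))\<^sup>2 - 2 * R * ((v + \<delta> *\<^sub>R \<nu> p) \<bullet> \<nu> p) + R\<^sup>2" by (rule norm_diff_unit_sq[OF nn])
  finally have "2 * R * ((v + \<delta> *\<^sub>R \<nu> p) \<bullet> \<nu> p) \<le> (norm (v + \<delta> *\<^sub>R \<nu> p))\<^sup>2" by simp
  also have "\<dots> \<le> 4 * a * R" by (rule 1)
  finally have "2 * R * (v \<bullet> \<nu> p + \<delta>) \<le> 4 * a * R" using nn by (simp add: inner_add_left)
  then have "R * (v \<bullet> \<nu> p + \<delta>) \<le> R * (2 * a)" by (simp add: algebra_simps)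
  then have "v \<bullet> \<nu> p + \<delta> \<le> 2 * a" using R by simp
  then show ?thesis unfolding \<delta>_def by simp
qed

text \<open>
  The same computation with the outer ball; here \<open>depth y \<le> norm v\<close> because the normal
  displacement exceeds the depth.
\<close>

lemma displacement_implies_exit:
  assumes y: "y = p + depth y *\<^sub>R \<nu> p" and p: "p \<in> frontier D" and v: "depth y + 2 * a < v \<bullet> (- \<nu> p)" "norm v \<le> \<rho>" "\<rho>\<^sup>2 = a * R" "0 \<le> a"
  shows "y + v \<notin> D"
proof
  assume "y + v \<in> D"
  define \<delta> where "\<delta> = depth y"
  have nn: "\<nu> p \<bullet> \<nu> p = 1" by (rule normal_self[OF p])
  have \<delta>0: "0 \<le> \<delta>" unfolding \<delta>_def by (rule depth_nonneg)
  have "v \<bullet> (- \<nu> p) \<le> norm v * norm (- \<nu> p)" by (rule norm_cauchy_schwarz)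
  then have "\<delta> \<le> norm v" using v unit[OF p] unfolding \<delta>_def by simp
  moreover have "norm (\<delta> *\<^sub>R \<nu> p) = \<delta>" using unit[OF p] \<delta>0 by simp
  ultimately have "norm (v + \<delta> *\<^sub>R \<nu> p) \<le> 2 * \<rho>" using norm_triangle_ineq[of v "\<delta> *\<^sub>R \<nu> p"] v(2) by linarith
  then have "(norm (v + \<delta> *\<^sub>R \<nu> p))\<^sup>2 \<le> (2 * \<rho>)\<^sup>2" by (intro power_mono) auto
  then have 1: "(norm (v + \<delta> *\<^sub>R \<nu> p))\<^sup>2 \<le> 4 * a * R" using v(3) by (simp add: power_mult_distrib)
  have "y + v \<notin> ball (p - R *\<^sub>R \<nu> p) R" using outer_ball[OF p] \<open>y + v \<in> D\<close> by blast
  then have "R \<le> norm (y + v - (p - R *\<^sub>R \<nu> p))" by (simp add: dist_norm norm_minus_commute)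
  also have "y + v - (p - R *\<^sub>R \<nu> p) = (v + \<delta> *\<^sub>R \<nu> p) - (- R) *\<^sub>R \<nu> p" by (subst y) (simp add: \<delta>_def)
  finally have "R\<^sup>2 \<le> (norm ((v + \<delta> *\<^sub>R \<nu> p) - (- R) *\<^sub>R \<nu> p))\<^sup>2" using R by (intro power_mono) auto
  also have "\<dots> = (norm (v + \<delta> *\<^sub>R \<nu> p))\<^sup>2 - 2 * (- R) * ((v + \<delta> *\<^sub>R \<nu> p) \<bullet> \<nu> p) + (- R)\<^sup>2" by (rule norm_diff_unit_sq[OF nn])
  finally have "0 \<le> 4 * a * R + 2 * R * (v \<bullet> \<nu> p + \<delta>)" using 1 nn by (simp add: inner_add_left)
  then have "0 \<le> R * (4 * a + 2 * (v \<bullet> \<nu> p + \<delta>))" by (simp add: algebra_simps)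
  then have "0 \<le> 4 * a + 2 * (v \<bullet> \<nu> p + \<delta>)" using R by (simp add: zero_le_mult_iff)
  then show False using v(1) unfolding \<delta>_def by simp
qed

definition tail_const :: real where "tail_const = 3360 * real DIM('v) ^ 9 / R ^ 4"

text \<open>
  Up to the event that the path moves farther than \<open>\<rho>\<close>, leaving \<open>D\<close> is
  equivalent, within an error of \<open>O(a)\<close>, to the normal component exceeding the depth, and the
  law of the maximum of this component is given by the reflection principle.
\<close>

lemma exit_bounds:
  assumes y: "y \<in> D" and u: "0 < u"
  defines "a \<equiv> u powr (3 / 4)"
  shows "prob {\<omega> \<in> space M. exits y \<omega> \<le> ereal u} \<le> measure (heat_law u) {z. depth y - 3 * a < \<bar>z\<bar>} + tail_const * u"
    and "measure (heat_law u) {z. depth y + 2 * a < \<bar>z\<bar>} \<le> prob {\<omega> \<in> space M. exits y \<omega> \<le> ereal u} + tail_const * u"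
proof -
  interpret H: heat_law_loc u by standard fact
  obtain p where p: "p \<in> frontier D" "y = p + depth y *\<^sub>R \<nu> p" "0 < depth y" using nearest_frontier_point[OF y] by blast
  \<comment> \<open>Quadratic errors on the ball of radius \<open>\<rho>\<close> are multiples of \<open>a\<close>, and \<open>u ^ 4 / \<rho> ^ 8 = u / R ^ 4\<close>.\<close>
  define \<rho> where "\<rho> = sqrt (a * R)"
  have a: "0 < a" unfolding a_def using u by simp
  have \<rho>: "0 < \<rho>" "\<rho>\<^sup>2 = a * R" unfolding \<rho>_def using a R by simp_all
  let ?F = "{v. y + v \<notin> D}" and ?T = "{v. \<rho> < norm v}" and ?G = "\<lambda>c. {v. c < v \<bullet> (- \<nu> p)}"
  have n1: "norm (- \<nu> p) = 1" using unit[OF p(1)] by simp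
  have opT: "open ?T" by (intro open_Collect_less continuous_intros)
  have opG: "open (?G c)" for c by (intro open_Collect_less continuous_intros)
  have a4: "a ^ 4 = u ^ 3"
  proof -
    have "a ^ 4 = a powr real 4" using a by (subst powr_realpow) auto
    also have "\<dots> = u powr real 3" unfolding a_def by (simp add: powr_powr)
    also have "\<dots> = u ^ 3" using u by (subst powr_realpow) auto
    finally show ?thesis .
  qed
  have "\<rho> ^ 8 = (\<rho>\<^sup>2) ^ 4" unfolding power_mult[symmetric] by simp
  also have "\<dots> = u ^ 3 * R ^ 4" unfolding \<rho>(2) power_mult_distrib a4 ..
  finally have "3360 * real DIM('v) ^ 9 * u ^ 4 / \<rho> ^ 8 = 3360 * real DIM('v) ^ 9 * u ^ 4 / (u ^ 3 * R ^ 4)" by simp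
  also have "\<dots> = tail_const * u" unfolding tail_const_def using u by (simp add: field_simps eval_nat_numeral)
  finally have T: "prob (hits ?T u) \<le> tail_const * u" using sup_norm_tail[OF u \<rho>(1)] by simp
  have T0: "0 \<le> tail_const * u" unfolding tail_const_def using u R by simp
  have P: "prob {\<omega> \<in> space M. exits y \<omega> \<le> ereal u} = prob (hits ?F u)" by (rule exits_le_prob(1)[OF y u])
  have evF: "hits ?F u \<in> events" by (rule hits_closed(1)[OF shifted_compl u])
  have evT: "hits ?T u \<in> events" by (rule hits_grid(1)[OF opT u])
  have evG: "hits (?G c) u \<in> events" for c by (rule hits_grid(1)[OF opG u])
  show "prob {\<omega> \<in> space M. exits y \<omega> \<le> ereal u} \<le> measure (heat_law u) {z. depth y - 3 * a < \<bar>z\<bar>} + tail_const * u"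
  proof (cases "0 \<le> depth y - 3 * a")
    case True
    have "hits ?F u \<subseteq> hits (?G (depth y - 3 * a)) u \<union> hits ?T u"
    proof
      fix \<omega> assume "\<omega> \<in> hits ?F u"
      then obtain s where s: "\<omega> \<in> space M" "s \<in> {0..u}" "y + (W s \<omega> - W 0 \<omega>) \<notin> D" unfolding hits_def by blast
      show "\<omega> \<in> hits (?G (depth y - 3 * a)) u \<union> hits ?T u"
      proof (cases "norm (W s \<omega> - W 0 \<omega>) \<le> \<rho>")
        case True
        from exit_implies_displacement[OF y p(2,1) s(3) True \<rho>(2)] a
        have "W s \<omega> - W 0 \<omega> \<in> ?G (depth y - 3 * a)" by simp
        then show ?thesis using s(1,2) unfolding hits_def by blast
      next
        case False
        then have "W s \<omega> - W 0 \<omega> \<in> ?T" by simp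
        then show ?thesis using s(1,2) unfolding hits_def by blast
      qed
    qed
    then have "prob (hits ?F u) \<le> prob (hits (?G (depth y - 3 * a)) u \<union> hits ?T u)"
      using evG evT by (intro finite_measure_mono) auto
    also have "\<dots> \<le> prob (hits (?G (depth y - 3 * a)) u) + prob (hits ?T u)" by (rule measure_Un_le[OF evG evT])
    also have "prob (hits (?G (depth y - 3 * a)) u) = measure (heat_law u) {z. depth y - 3 * a < \<bar>z\<bar>}"
      by (rule reflection[OF u n1 True])
    finally show ?thesis using T unfolding P by linarith
  next
    case False
    then have "{z. depth y - 3 * a < \<bar>z\<bar>} = space (heat_law u)" unfolding H.space_heat by auto
    then have "measure (heat_law u) {z. depth y - 3 * a < \<bar>z\<bar>} = 1" using H.prob_space by simp
    moreover have "prob {\<omega> \<in> space M. exits y \<omega> \<le> ereal u} \<le> 1" by (rule prob_le_1)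
    ultimately show ?thesis using T0 by linarith
  qed
  have c0: "0 \<le> depth y + 2 * a" using p(3) a by simp
  have "hits (?G (depth y + 2 * a)) u \<subseteq> hits ?F u \<union> hits ?T u"
  proof
    fix \<omega> assume "\<omega> \<in> hits (?G (depth y + 2 * a)) u"
    then obtain s where s: "\<omega> \<in> space M" "s \<in> {0..u}" "depth y + 2 * a < (W s \<omega> - W 0 \<omega>) \<bullet> (- \<nu> p)" unfolding hits_def by blast
    show "\<omega> \<in> hits ?F u \<union> hits ?T u"
    proof (cases "norm (W s \<omega> - W 0 \<omega>) \<le> \<rho>")
      case True
      from displacement_implies_exit[OF p(2,1) s(3) True \<rho>(2) less_imp_le[OF a]]
      have "W s \<omega> - W 0 \<omega> \<in> ?F" by simp
      then show ?thesis using s(1,2) unfolding hits_def by blast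
    next
      case False
      then have "W s \<omega> - W 0 \<omega> \<in> ?T" by simp
      then show ?thesis using s(1,2) unfolding hits_def by blast
    qed
  qed
  then have "prob (hits (?G (depth y + 2 * a)) u) \<le> prob (hits ?F u \<union> hits ?T u)"
    using evF evT by (intro finite_measure_mono) auto
  also have "\<dots> \<le> prob (hits ?F u) + prob (hits ?T u)" by (rule measure_Un_le[OF evF evT])
  finally show "measure (heat_law u) {z. depth y + 2 * a < \<bar>z\<bar>} \<le> prob {\<omega> \<in> space M. exits y \<omega> \<le> ereal u} + tail_const * u"
    using T unfolding P reflection[OF u n1 c0] by linarith
qed


lemma exit_prob_measurable:
  "(\<lambda>(y, s). prob {\<omega> \<in> space M. exits y \<omega> \<le> ereal s}) \<in> borel_measurable (borel \<Otimes>\<^sub>M borel)"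
proof -
  let ?N = "(borel :: 'v measure) \<Otimes>\<^sub>M (borel :: real measure)"
  let ?Q = "{p \<in> space (?N \<Otimes>\<^sub>M M). exits (fst (fst p)) (snd p) \<le> ereal (snd (fst p))}"
  have "(\<lambda>p. (fst (fst p), snd p)) \<in> measurable (?N \<Otimes>\<^sub>M M) (borel \<Otimes>\<^sub>M M)" by measurable
  from measurable_compose[OF this exits_measurable]
  have 1: "(\<lambda>p. exits (fst (fst p)) (snd p)) \<in> borel_measurable (?N \<Otimes>\<^sub>M M)" by simp
  have 2: "(\<lambda>p. ereal (snd (fst p))) \<in> borel_measurable (?N \<Otimes>\<^sub>M M)" by measurable
  have "?Q \<in> sets (?N \<Otimes>\<^sub>M M)" by (rule borel_measurable_le[OF 1 2])
  then have "(\<lambda>q. emeasure M (Pair q -` ?Q)) \<in> borel_measurable ?N" by (rule measurable_emeasure_Pair)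
  then have "(\<lambda>q. measure M (Pair q -` ?Q)) \<in> borel_measurable ?N" unfolding measure_def by measurable
  also have "(\<lambda>q. measure M (Pair q -` ?Q)) = (\<lambda>(y, s). prob {\<omega> \<in> space M. exits y \<omega> \<le> ereal s})"
    by (auto simp: fun_eq_iff space_pair_measure intro!: arg_cong[where f="measure M"])
  finally show ?thesis .
qed

lemma exit_prob_measurable1: "(\<lambda>y. prob {\<omega> \<in> space M. exits y \<omega> \<le> ereal s}) \<in> borel_measurable borel"
  using measurable_compose[OF measurable_Pair2' exit_prob_measurable, of s] by simp

lemma D_finite: "D \<in> sets borel" "emeasure lborel D < \<infinity>"
  using open_D emeasure_bounded_finite[OF bounded_D] by auto

lemma D_integrable:
  fixes g :: "'v \<Rightarrow> real"
  assumes "g \<in> borel_measurable borel" "\<And>y. 0 \<le> g y" "\<And>y. g y \<le> 1"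
  shows "set_integrable lborel D g"
  unfolding set_integrable_def
proof (rule Bochner_Integration.integrable_bound)
  show "integrable lborel (indicat_real D)" using D_finite by (simp add: integrable_indicator_iff)
  show "(\<lambda>y. indicat_real D y *\<^sub>R g y) \<in> borel_measurable lborel" using assms(1) D_finite by measurable
  show "AE y in lborel. norm (indicat_real D y *\<^sub>R g y) \<le> norm (indicat_real D y)"
    using assms(2,3) by (intro AE_I2) (auto split: split_indicator)
qed

definition collar_volume :: "real \<Rightarrow> real" where "collar_volume r = measure lborel (collar r)"

lemma collar_volume_props:
  shows "mono collar_volume" "0 \<le> collar_volume r" "collar_volume r \<le> measure lborel D" "r \<le> 0 \<Longrightarrow> collar_volume r = 0"
proof -
  have "measure lborel (collar r) \<le> measure lborel (collar s)" if "r \<le> s" for r s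
    using that borel_collar finite_measure_collar[of s] by (intro measure_mono_fmeasurable fmeasurableI) (auto simp: collar_def)
  then show "mono collar_volume" unfolding collar_volume_def by (rule monoI)
  show "0 \<le> collar_volume r" unfolding collar_volume_def by simp
  show "collar_volume r \<le> measure lborel D" unfolding collar_volume_def
    using D_finite borel_collar by (intro measure_mono_fmeasurable fmeasurableI) (auto simp: collar_def)
  assume "r \<le> 0"
  then have "collar r = {}" using depth_nonneg unfolding collar_def by (auto simp: not_less intro: order_trans)
  then show "collar_volume r = 0" unfolding collar_volume_def by simp
qed

lemma collar_volume_measurable [measurable]: "collar_volume \<in> borel_measurable borel"
  using collar_volume_props(1) by (rule borel_measurable_mono)

lemma depth_measurable [measurable]: "depth \<in> borel_measurable borel"
  by (rule borel_measurable_continuous_onI) (rule continuous_depth)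

text \<open>
  Fubini for the set of pairs \<open>(y, z)\<close> with \<open>depth y + b < \<bar>z\<bar>\<close>.
\<close>

lemma layer_swap:
  assumes u: "0 < u"
  shows "(\<lambda>y. measure (heat_law u) {z. depth y + b < \<bar>z\<bar>}) \<in> borel_measurable borel"
    and "(LINT y:D|lborel. measure (heat_law u) {z. depth y + b < \<bar>z\<bar>}) = (LINT z|heat_law u. collar_volume (\<bar>z\<bar> - b))"
proof -
  interpret H: heat_law_loc u by standard fact
  interpret L: pair_sigma_finite lborel "heat_law u" by standard
  have "mono (\<lambda>c. - measure (heat_law u) {z. c < \<bar>z\<bar>})"
    by (rule monoI) (auto intro!: H.finite_measure_mono simp: H.sets_heat)
  then have "(\<lambda>c. - measure (heat_law u) {z. c < \<bar>z\<bar>}) \<in> borel_measurable borel" by (rule borel_measurable_mono)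
  then have "(\<lambda>c. - (- measure (heat_law u) {z. c < \<bar>z\<bar>})) \<in> borel_measurable borel" by (rule borel_measurable_uminus)
  then have [measurable]: "(\<lambda>c. measure (heat_law u) {z. c < \<bar>z\<bar>}) \<in> borel_measurable borel" by simp
  show m: "(\<lambda>y. measure (heat_law u) {z. depth y + b < \<bar>z\<bar>}) \<in> borel_measurable borel"
    by (rule measurable_compose[of "\<lambda>y. depth y + b" borel borel "\<lambda>c. measure (heat_law u) {z. c < \<bar>z\<bar>}"]) measurable
  define Q where "Q = {(y, z). y \<in> D \<and> depth y + b < \<bar>z\<bar>}"
  have Q: "Q \<in> sets (lborel \<Otimes>\<^sub>M heat_law u)"
  proof -
    have "Measurable.pred (lborel \<Otimes>\<^sub>M heat_law u) (\<lambda>(y, z). y \<in> D \<and> depth y + b < \<bar>z\<bar>)"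
      using D_finite(1) by measurable
    then show ?thesis unfolding Q_def pred_def by (simp add: space_pair_measure H.space_heat)
  qed
  have "ennreal (LINT y:D|lborel. measure (heat_law u) {z. depth y + b < \<bar>z\<bar>})
      = (\<integral>\<^sup>+y. ennreal (indicator D y * measure (heat_law u) {z. depth y + b < \<bar>z\<bar>}) \<partial>lborel)"
    using D_integrable[OF m] unfolding set_lebesgue_integral_def set_integrable_def
    by (subst nn_integral_eq_integral) auto
  also have "\<dots> = (\<integral>\<^sup>+y. emeasure (heat_law u) (Pair y -` Q) \<partial>lborel)"
  proof (rule nn_integral_cong)
    fix y :: 'v
    have "Pair y -` Q = (if y \<in> D then {z. depth y + b < \<bar>z\<bar>} else {})" unfolding Q_def by auto
    then show "ennreal (indicator D y * measure (heat_law u) {z. depth y + b < \<bar>z\<bar>}) = emeasure (heat_law u) (Pair y -` Q)"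
      by (simp add: H.emeasure_eq_measure)
  qed
  also have "\<dots> = emeasure (lborel \<Otimes>\<^sub>M heat_law u) Q"
    by (rule H.emeasure_pair_measure_alt[OF Q, symmetric])
  also have "\<dots> = (\<integral>\<^sup>+z. emeasure lborel ((\<lambda>y. (y, z)) -` Q) \<partial>heat_law u)"
    by (rule L.emeasure_pair_measure_alt2[OF Q])
  also have "\<dots> = (\<integral>\<^sup>+z. ennreal (collar_volume (\<bar>z\<bar> - b)) \<partial>heat_law u)"
  proof (rule nn_integral_cong)
    fix z :: real
    have "(\<lambda>y. (y, z)) -` Q = collar (\<bar>z\<bar> - b)" unfolding Q_def collar_def by auto
    then show "emeasure lborel ((\<lambda>y. (y, z)) -` Q) = ennreal (collar_volume (\<bar>z\<bar> - b))"
      using finite_measure_collar[of "\<bar>z\<bar> - b"] unfolding collar_volume_def by (simp add: emeasure_eq_ennreal_measure)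
  qed
  also have "\<dots> = ennreal (LINT z|heat_law u. collar_volume (\<bar>z\<bar> - b))"
  proof (rule nn_integral_eq_integral)
    show "integrable (heat_law u) (\<lambda>z. collar_volume (\<bar>z\<bar> - b))"
      using collar_volume_props(2,3) by (intro H.integrable_const_bound[of _ "measure lborel D"] AE_I2) auto
    show "AE z in heat_law u. 0 \<le> collar_volume (\<bar>z\<bar> - b)" using collar_volume_props(2) by simp
  qed
  finally show "(LINT y:D|lborel. measure (heat_law u) {z. depth y + b < \<bar>z\<bar>}) = (LINT z|heat_law u. collar_volume (\<bar>z\<bar> - b))"
    by (subst (asm) ennreal_inj) (auto simp: set_lebesgue_integral_def collar_volume_props(2) intro!: integral_nonneg_AE)
qed

definition exit_mass :: "real \<Rightarrow> real" where
  "exit_mass u = (LINT y:D|lborel. prob {\<omega> \<in> space M. exits y \<omega> \<le> ereal u})"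

lemma exit_prob_integrable: "set_integrable lborel D (\<lambda>y. prob {\<omega> \<in> space M. exits y \<omega> \<le> ereal u})"
  by (rule D_integrable[OF exit_prob_measurable1]) auto

lemma integral_D_const: "(LINT y:D|lborel. (c::real)) = c * measure lborel D" "set_integrable lborel D (\<lambda>_. c :: real)"
proof -
  have i: "integrable lborel (indicat_real D)" using D_finite by (simp add: integrable_indicator_iff)
  then show "set_integrable lborel D (\<lambda>_. c :: real)" unfolding set_integrable_def by simp
  show "(LINT y:D|lborel. (c::real)) = c * measure lborel D" unfolding set_lebesgue_integral_def using i D_finite by simp
qed

lemma exit_mass_props:
  shows "mono exit_mass" "0 \<le> exit_mass u" "exit_mass u \<le> measure lborel D" "u \<le> 0 \<Longrightarrow> exit_mass u = 0"
proof -
  show "mono exit_mass"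
  proof (rule monoI)
    fix u v :: real assume "u \<le> v"
    then have "prob {\<omega> \<in> space M. exits y \<omega> \<le> ereal u} \<le> prob {\<omega> \<in> space M. exits y \<omega> \<le> ereal v}" for y
      using exits_le_event by (intro finite_measure_mono) (auto intro: order_trans)
    then show "exit_mass u \<le> exit_mass v" unfolding exit_mass_def by (intro set_integral_mono exit_prob_integrable)
  qed
  show "0 \<le> exit_mass u" unfolding exit_mass_def set_lebesgue_integral_def by (intro integral_nonneg_AE) auto
  have "exit_mass u \<le> (LINT y:D|lborel. (1::real))"
    unfolding exit_mass_def by (intro set_integral_mono exit_prob_integrable integral_D_const prob_le_1)
  then show "exit_mass u \<le> measure lborel D" unfolding integral_D_const by simp
  assume "u \<le> 0"
  then have "exit_mass u = (LINT y:D|lborel. (0::real))" unfolding exit_mass_def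
    using exits_le_prob(2) by (intro set_lebesgue_integral_cong) (use D_finite in auto)
  then show "exit_mass u = 0" unfolding integral_D_const by simp
qed

lemma exit_mass_bounds:
  assumes u: "0 < u"
  defines "a \<equiv> u powr (3 / 4)"
  shows "exit_mass u \<le> (LINT z|heat_law u. collar_volume (\<bar>z\<bar> - (- 3 * a))) + tail_const * measure lborel D * u"
    and "(LINT z|heat_law u. collar_volume (\<bar>z\<bar> - 2 * a)) \<le> exit_mass u + tail_const * measure lborel D * u"
proof -
  interpret H: heat_law_loc u by standard fact
  have i: "set_integrable lborel D (\<lambda>y. measure (heat_law u) {z. depth y + b < \<bar>z\<bar>})" for b
    by (rule D_integrable[OF layer_swap(1)[OF u]]) auto
  have "exit_mass u \<le> (LINT y:D|lborel. measure (heat_law u) {z. depth y + (- 3 * a) < \<bar>z\<bar>} + tail_const * u)"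
    unfolding exit_mass_def using exit_bounds(1)[OF _ u] unfolding a_def
    by (intro set_integral_mono exit_prob_integrable set_integral_add i integral_D_const) simp
  also have "\<dots> = (LINT z|heat_law u. collar_volume (\<bar>z\<bar> - (- 3 * a))) + tail_const * u * measure lborel D"
    unfolding set_integral_add(2)[OF i integral_D_const(2)] layer_swap(2)[OF u] integral_D_const(1) ..
  finally show "exit_mass u \<le> (LINT z|heat_law u. collar_volume (\<bar>z\<bar> - (- 3 * a))) + tail_const * measure lborel D * u"
    by (simp add: mult_ac)
  have "(LINT z|heat_law u. collar_volume (\<bar>z\<bar> - 2 * a)) = (LINT y:D|lborel. measure (heat_law u) {z. depth y + 2 * a < \<bar>z\<bar>})"
    by (rule layer_swap(2)[OF u, symmetric])
  also have "\<dots> \<le> (LINT y:D|lborel. prob {\<omega> \<in> space M. exits y \<omega> \<le> ereal u} + tail_const * u)"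
    using exit_bounds(2)[OF _ u] unfolding a_def
    by (intro set_integral_mono exit_prob_integrable set_integral_add i integral_D_const) simp
  also have "\<dots> = exit_mass u + tail_const * u * measure lborel D"
    unfolding set_integral_add(2)[OF exit_prob_integrable integral_D_const(2)] integral_D_const(1) exit_mass_def ..
  finally show "(LINT z|heat_law u. collar_volume (\<bar>z\<bar> - 2 * a)) \<le> exit_mass u + tail_const * measure lborel D * u"
    by (simp add: mult_ac)
qed

end


text \<open>
  The deviation of \<open>V r\<close> from \<open>\<kappa> * r\<close> is at most
  \<open>\<epsilon> * r\<close> for small \<open>r\<close> and at most a multiple of
  \<open>r\<^sup>2\<close> for the other \<open>r\<close>, and the first two absolute moments of the
  Gaussian law are known. The shift \<open>b\<close> only enters through its modulus.
\<close>

lemma heat_average_estimate: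
  fixes V :: "real \<Rightarrow> real"
  assumes mV[measurable]: "V \<in> borel_measurable borel" and V: "\<And>r. 0 \<le> V r" "\<And>r. V r \<le> A" "\<And>r. r \<le> 0 \<Longrightarrow> V r = 0"
    and lim: "((\<lambda>r. V r / r) \<longlongrightarrow> \<kappa>) (at_right 0)" and \<kappa>: "0 \<le> \<kappa>" and \<epsilon>: "0 < \<epsilon>"
  obtains C where "0 \<le> C"
    "\<And>u b. 0 < u \<Longrightarrow> \<bar>(LINT z|heat_law u. V (\<bar>z\<bar> - b)) - \<kappa> * (2 * sqrt u / sqrt pi)\<bar>
        \<le> \<kappa> * \<bar>b\<bar> + \<epsilon> * (2 * sqrt u / sqrt pi + \<bar>b\<bar>) + C * (4 * u + 2 * b\<^sup>2)"
proof -
  have "eventually (\<lambda>r. dist (V r / r) \<kappa> < \<epsilon>) (at_right 0)" using lim \<epsilon> by (rule tendstoD)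
  then obtain d where d: "0 < d" "\<And>r. 0 < r \<Longrightarrow> r < d \<Longrightarrow> \<bar>V r / r - \<kappa>\<bar> < \<epsilon>"
    unfolding eventually_at_right_field by (auto simp: dist_real_def)
  \<comment> \<open>For \<open>r \<ge> d\<close> both \<open>V r\<close> and \<open>\<kappa> * r\<close> are absorbed by a quadratic term.\<close>
  define C where "C = A / d\<^sup>2 + \<kappa> / d"
  have A: "0 \<le> A" using V(1,2)[of 0] by linarith
  have C: "0 \<le> C" unfolding C_def using A \<kappa> d by simp
  have near: "\<bar>V r - \<kappa> * max r 0\<bar> \<le> \<epsilon> * max r 0 + C * r\<^sup>2" for r
  proof -
    consider "r \<le> 0" | "0 < r" "r < d" | "d \<le> r" by linarith
    then show ?thesis
    proof cases
      case 1
      then show ?thesis using V(3)[OF 1] C by simp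
    next
      case 2
      have "\<bar>V r - \<kappa> * r\<bar> = \<bar>V r / r - \<kappa>\<bar> * r" using 2 by (simp add: field_simps abs_mult_pos)
      also have "\<dots> \<le> \<epsilon> * r" using d(2)[OF 2] 2 by (intro mult_right_mono) auto
      finally show ?thesis using 2 C by (simp add: add_increasing2)
    next
      case 3
      then have r: "0 < r" using d by simp
      have 1: "1 \<le> r / d" using 3 d by simp
      have "A * 1 \<le> A * (r / d)\<^sup>2" using A 1 by (intro mult_left_mono) (auto intro: one_le_power)
      moreover have "\<kappa> * r * 1 \<le> \<kappa> * r * (r / d)" using \<kappa> r 1 by (intro mult_left_mono) auto
      ultimately have "A + \<kappa> * r \<le> C * r\<^sup>2" unfolding C_def by (simp add: power_divide power2_eq_square field_simps)
      moreover have "0 \<le> \<kappa> * r" "0 \<le> \<epsilon> * r" using \<kappa> \<epsilon> r by simp_all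
      ultimately show ?thesis using V(1,2)[of r] r unfolding abs_le_iff max_def by auto
    qed
  qed
  show thesis
  proof (rule that[OF C])
    fix u b :: real assume u: "0 < u"
    interpret H: heat_law_loc u by standard fact
    have m1: "integrable (heat_law u) (\<lambda>z. \<bar>z\<bar>)" "(LINT z|heat_law u. \<bar>z\<bar>) = 2 * sqrt u / sqrt pi"
      using H.heat_moment_abs by (auto simp: has_bochner_integral_iff)
    have m2: "integrable (heat_law u) (\<lambda>z. z\<^sup>2)" "(LINT z|heat_law u. z\<^sup>2) = 2 * u"
      using H.heat_moment_even[of 1] by (auto simp: has_bochner_integral_iff)
    have iV: "integrable (heat_law u) (\<lambda>z. V (\<bar>z\<bar> - b))"
      using V(1,2) by (intro H.integrable_const_bound[of _ A] AE_I2) auto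
    let ?E = "\<lambda>z. \<kappa> * \<bar>b\<bar> + \<epsilon> * (\<bar>z\<bar> + \<bar>b\<bar>) + C * (2 * z\<^sup>2 + 2 * b\<^sup>2)"
    have iE: "integrable (heat_law u) ?E" using m1 m2 by simp
    have EE: "(LINT z|heat_law u. ?E z) = \<kappa> * \<bar>b\<bar> + \<epsilon> * (2 * sqrt u / sqrt pi + \<bar>b\<bar>) + C * (4 * u + 2 * b\<^sup>2)"
      using m1 m2 by (simp add: H.prob_space)
    have pt: "\<bar>V (\<bar>z\<bar> - b) - \<kappa> * \<bar>z\<bar>\<bar> \<le> ?E z" for z
    proof -
      let ?r = "\<bar>z\<bar> - b"
      have "\<bar>\<kappa> * max ?r 0 - \<kappa> * \<bar>z\<bar>\<bar> = \<kappa> * \<bar>max ?r 0 - \<bar>z\<bar>\<bar>" using \<kappa> by (simp add: abs_mult right_diff_distrib[symmetric])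
      also have "\<dots> \<le> \<kappa> * \<bar>b\<bar>" using \<kappa> by (intro mult_left_mono) auto
      finally have 1: "\<bar>\<kappa> * max ?r 0 - \<kappa> * \<bar>z\<bar>\<bar> \<le> \<kappa> * \<bar>b\<bar>" .
      have 2: "\<epsilon> * max ?r 0 \<le> \<epsilon> * (\<bar>z\<bar> + \<bar>b\<bar>)" using \<epsilon> by (intro mult_left_mono) auto
      have "0 \<le> (\<bar>z\<bar> + b)\<^sup>2" by simp
      then have "?r\<^sup>2 \<le> 2 * z\<^sup>2 + 2 * b\<^sup>2" by (simp add: power2_sum power2_diff)
      then have 3: "C * ?r\<^sup>2 \<le> C * (2 * z\<^sup>2 + 2 * b\<^sup>2)" using C by (intro mult_left_mono) auto
      have "\<bar>V ?r - \<kappa> * \<bar>z\<bar>\<bar> \<le> \<bar>V ?r - \<kappa> * max ?r 0\<bar> + \<bar>\<kappa> * max ?r 0 - \<kappa> * \<bar>z\<bar>\<bar>"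
        using abs_triangle_ineq[of "V ?r - \<kappa> * max ?r 0" "\<kappa> * max ?r 0 - \<kappa> * \<bar>z\<bar>"] by simp
      also have "\<dots> \<le> (\<epsilon> * max ?r 0 + C * ?r\<^sup>2) + \<kappa> * \<bar>b\<bar>" by (rule add_mono[OF near 1])
      also have "\<dots> \<le> (\<epsilon> * (\<bar>z\<bar> + \<bar>b\<bar>) + C * (2 * z\<^sup>2 + 2 * b\<^sup>2)) + \<kappa> * \<bar>b\<bar>" by (intro add_mono 2 3 order_refl)
      also have "\<dots> = ?E z" by (simp only: ac_simps)
      finally show ?thesis .
    qed
    have "(LINT z|heat_law u. V (\<bar>z\<bar> - b)) - \<kappa> * (2 * sqrt u / sqrt pi) = (LINT z|heat_law u. V (\<bar>z\<bar> - b) - \<kappa> * \<bar>z\<bar>)"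
      using iV m1 by simp
    also have "\<bar>\<dots>\<bar> \<le> (LINT z|heat_law u. \<bar>V (\<bar>z\<bar> - b) - \<kappa> * \<bar>z\<bar>\<bar>)" by (rule integral_abs_bound)
    also have "\<dots> \<le> (LINT z|heat_law u. ?E z)" using iV m1 iE pt by (intro integral_mono) auto
    finally show "\<bar>(LINT z|heat_law u. V (\<bar>z\<bar> - b)) - \<kappa> * (2 * sqrt u / sqrt pi)\<bar>
        \<le> \<kappa> * \<bar>b\<bar> + \<epsilon> * (2 * sqrt u / sqrt pi + \<bar>b\<bar>) + C * (4 * u + 2 * b\<^sup>2)" unfolding EE .
  qed
qed

theorem (in exit_problem) exit_mass_limit:
  assumes lim: "((\<lambda>r. measure lborel (collar r) / r) \<longlongrightarrow> \<kappa>) (at_right 0)"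
  shows "((\<lambda>u. exit_mass u / sqrt u) \<longlongrightarrow> 2 * \<kappa> / sqrt pi) (at_right 0)"
proof (rule tendstoI)
  fix e :: real assume e: "0 < e"
  have lim': "((\<lambda>r. collar_volume r / r) \<longlongrightarrow> \<kappa>) (at_right 0)" using lim unfolding collar_volume_def .
  have \<kappa>: "0 \<le> \<kappa>"
  proof (rule tendsto_lowerbound[OF lim'])
    show "\<forall>\<^sub>F r in at_right 0. 0 \<le> collar_volume r / r"
      using eventually_at_right_less[of "0::real"] by eventually_elim (simp add: collar_volume_props(2))
  qed simp
  \<comment> \<open>After division by \<open>sqrt u\<close> the error tends to \<open>2 * \<epsilon> / sqrt pi\<close>, which is less than \<open>e\<close>.\<close>
  define \<epsilon> K where "\<epsilon> = e / 4" and "K = tail_const * measure lborel D"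
  have \<epsilon>: "0 < \<epsilon>" unfolding \<epsilon>_def using e by simp
  obtain C where C: "0 \<le> C"
    "\<And>u b. 0 < u \<Longrightarrow> \<bar>(LINT z|heat_law u. collar_volume (\<bar>z\<bar> - b)) - \<kappa> * (2 * sqrt u / sqrt pi)\<bar>
        \<le> \<kappa> * \<bar>b\<bar> + \<epsilon> * (2 * sqrt u / sqrt pi + \<bar>b\<bar>) + C * (4 * u + 2 * b\<^sup>2)"
    using heat_average_estimate[OF collar_volume_measurable collar_volume_props(2,3,4) lim' \<kappa> \<epsilon>] by blast
  let ?E = "\<lambda>u. (3 * \<kappa> + 3 * \<epsilon>) * u powr (1 / 4) + 2 * \<epsilon> / sqrt pi + C * (4 * sqrt u + 18 * u) + K * sqrt u"
  have bound: "\<bar>exit_mass u / sqrt u - 2 * \<kappa> / sqrt pi\<bar> \<le> ?E u" if u: "0 < u" for u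
  proof -
    define a where "a = u powr (3 / 4)"
    have a: "0 < a" unfolding a_def using u by simp
    have s: "0 < sqrt u" using u by simp
    have p1: "a = u powr (1 / 4) * sqrt u" unfolding a_def using u by (simp add: powr_half_sqrt[symmetric] powr_add[symmetric])
    have "a\<^sup>2 = u powr (3 / 2)" unfolding a_def using u by (simp add: power2_eq_square powr_add[symmetric])
    also have "\<dots> = u powr 1 * u powr (1 / 2)" unfolding powr_add[symmetric] by simp
    finally have p2: "a\<^sup>2 = u * sqrt u" using u by (simp add: powr_half_sqrt)
    have p3: "u = sqrt u * sqrt u" using u by simp
    let ?B = "3 * \<kappa> * a + \<epsilon> * (2 * sqrt u / sqrt pi + 3 * a) + C * (4 * u + 18 * a\<^sup>2)"
    have "\<bar>exit_mass u - \<kappa> * (2 * sqrt u / sqrt pi)\<bar> \<le> ?B + K * u"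
    proof -
      have up: "\<bar>(LINT z|heat_law u. collar_volume (\<bar>z\<bar> - (- 3 * a))) - \<kappa> * (2 * sqrt u / sqrt pi)\<bar> \<le> ?B"
        using C(2)[OF u, of "- 3 * a"] a by (simp add: power_mult_distrib mult_ac)
      have "\<bar>(LINT z|heat_law u. collar_volume (\<bar>z\<bar> - 2 * a)) - \<kappa> * (2 * sqrt u / sqrt pi)\<bar>
          \<le> \<kappa> * (2 * a) + \<epsilon> * (2 * sqrt u / sqrt pi + 2 * a) + C * (4 * u + 2 * (2 * a)\<^sup>2)"
        using C(2)[OF u, of "2 * a"] a by simp
      also have "\<dots> \<le> \<kappa> * (3 * a) + \<epsilon> * (2 * sqrt u / sqrt pi + 3 * a) + C * (4 * u + 2 * (3 * a)\<^sup>2)"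
        using \<kappa> \<epsilon> C(1) a by (intro add_mono mult_left_mono power_mono order_refl) auto
      also have "\<dots> = ?B" by (simp add: power_mult_distrib)
      finally have lo: "\<bar>(LINT z|heat_law u. collar_volume (\<bar>z\<bar> - 2 * a)) - \<kappa> * (2 * sqrt u / sqrt pi)\<bar> \<le> ?B" .
      show ?thesis using up lo exit_mass_bounds[OF u] unfolding a_def[symmetric] K_def abs_le_iff by linarith
    qed
    also have "?B + K * u = ?E u * sqrt u"
    proof -
      have "?E u * sqrt u = (3 * \<kappa> + 3 * \<epsilon>) * (u powr (1 / 4) * sqrt u) + 2 * \<epsilon> * sqrt u / sqrt pi
          + C * (4 * (sqrt u * sqrt u) + 18 * (u * sqrt u)) + K * (sqrt u * sqrt u)"
        by (simp add: algebra_simps)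
      then show ?thesis unfolding p1[symmetric] p2[symmetric] p3[symmetric] by (simp add: algebra_simps)
    qed
    finally have "\<bar>exit_mass u - \<kappa> * (2 * sqrt u / sqrt pi)\<bar> / sqrt u \<le> ?E u" using s by (simp add: pos_divide_le_eq)
    moreover have "exit_mass u / sqrt u - 2 * \<kappa> / sqrt pi = (exit_mass u - \<kappa> * (2 * sqrt u / sqrt pi)) / sqrt u"
      using s by (simp add: diff_divide_distrib)
    ultimately show ?thesis using s by (simp add: abs_divide)
  qed
  have z1: "((\<lambda>u::real. u powr (1 / 4)) \<longlongrightarrow> 0) (at_right 0)"
  proof -
    have "\<forall>\<^sub>F u in at_right (0::real). 0 \<le> u" by (rule eventually_mono[OF eventually_at_right_less]) simp
    then have "((\<lambda>u::real. u powr (1 / 4)) \<longlongrightarrow> 0 powr (1 / 4)) (at_right 0)"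
      by (intro tendsto_powr' tendsto_ident_at tendsto_const) simp
    then show ?thesis by simp
  qed
  have z2: "((\<lambda>u::real. sqrt u) \<longlongrightarrow> 0) (at_right 0)"
    using tendsto_real_sqrt[OF tendsto_ident_at, of "0::real" "{0<..}"] by simp
  have z3: "((\<lambda>u::real. u) \<longlongrightarrow> 0) (at_right 0)" by (rule tendsto_ident_at)
  have "(?E \<longlongrightarrow> (3 * \<kappa> + 3 * \<epsilon>) * 0 + 2 * \<epsilon> / sqrt pi + C * (4 * 0 + 18 * 0) + K * 0) (at_right 0)"
    by (intro tendsto_add tendsto_mult tendsto_const z1 z2 z3)
  moreover have "(3 * \<kappa> + 3 * \<epsilon>) * 0 + 2 * \<epsilon> / sqrt pi + C * (4 * 0 + 18 * 0) + K * 0 < e"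
  proof -
    have "1 \<le> sqrt pi" using pi_ge_two by simp
    then have "2 * \<epsilon> / sqrt pi \<le> 2 * \<epsilon>" using \<epsilon> by (simp add: pos_divide_le_eq)
    also have "\<dots> < e" unfolding \<epsilon>_def using e by simp
    finally show ?thesis by simp
  qed
  ultimately have "\<forall>\<^sub>F u in at_right 0. ?E u < e" by (rule order_tendstoD)
  then show "\<forall>\<^sub>F u in at_right 0. dist (exit_mass u / sqrt u) (2 * \<kappa> / sqrt pi) < e"
    using eventually_at_right_less[of "0::real"]
  proof eventually_elim
    case (elim u)
    then show ?case using bound[of u] unfolding dist_real_def by linarith
  qed
qed


section \<open>Subordination of the killed motion\<close>

lemma stable_subordinator_law:
  assumes "stable_subordinator M \<beta> S" "0 \<le> t"
  shows "S t \<in> borel_measurable M" "stable_law \<beta> t (distr M borel (S t))" "\<omega> \<in> space M \<Longrightarrow> 0 \<le> S t \<omega>"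
proof -
  have levy: "levy_process M S" and path: "\<And>\<omega>. \<omega> \<in> space M \<Longrightarrow> S 0 \<omega> = 0 \<and> mono_on {0..} (\<lambda>t. S t \<omega>)"
    and lap: "\<And>q. 0 < q \<Longrightarrow> (LINT \<omega>|M. exp (- q * S t \<omega>)) = exp (- t * q powr \<beta>)"
    using assms unfolding stable_subordinator_def by auto
  show m[measurable]: "S t \<in> borel_measurable M" using levy assms(2) unfolding levy_process_def by blast
  interpret prob_space M using levy unfolding levy_process_def by blast
  show n: "0 \<le> S t \<omega>" if "\<omega> \<in> space M" for \<omega>
    using path[OF that] mono_onD[of "{0..}" "\<lambda>t. S t \<omega>" 0 t] assms(2) by auto
  have "AE s in distr M borel (S t). 0 \<le> s" by (subst AE_distr_iff) (auto intro!: AE_I2 n)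
  then show "stable_law \<beta> t (distr M borel (S t))"
    unfolding stable_law_def using lap by (auto simp: integral_distr intro!: prob_space_distr)
qed

context exit_problem
begin

text \<open>
  The exit probability under the law started at \<open>y\<close> is expressed on the probability space of
  the locale.
\<close>

lemma exit_law:
  assumes "brownian_motion M' y W'" and y: "y \<in> D"
  shows "measure M' {\<omega> \<in> space M'. exit_time D W' \<omega> \<le> ereal u} = prob {\<omega> \<in> space M. exits y \<omega> \<le> ereal u}"
proof -
  interpret B: exit_problem M' y W' D R \<nu> by standard fact
  have m: "exit_time D W' \<in> borel_measurable M'"
    by (rule exit_time_measurable[OF _ _ open_D]) (auto intro: B.W_measurable B.W_continuous)
  have "B.prob {\<omega> \<in> space M'. exit_time D W' \<omega> \<le> ereal u} = B.prob {\<omega> \<in> space M'. B.exits y \<omega> \<le> ereal u}"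
  proof (rule B.finite_measure_eq_AE)
    show "AE \<omega> in M'. (\<omega> \<in> {\<omega> \<in> space M'. exit_time D W' \<omega> \<le> ereal u}) = (\<omega> \<in> {\<omega> \<in> space M'. B.exits y \<omega> \<le> ereal u})"
      using B.exits_start by eventually_elim simp
    show "{\<omega> \<in> space M'. exit_time D W' \<omega> \<le> ereal u} \<in> B.events" using m by measurable
  qed (rule B.exits_le_event)
  also have "\<dots> = prob {\<omega> \<in> space M. exits y \<omega> \<le> ereal u}"
  proof (cases "0 < u")
    case True
    show ?thesis unfolding B.exits_le_prob(1)[OF y True] exits_le_prob(1)[OF y True]
      by (rule brownian_hits_eq[OF B.brownian_axioms brownian_axioms shifted_compl True])
  next
    case False
    then show ?thesis using B.exits_le_prob(2)[OF y] exits_le_prob(2)[OF y] by simp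
  qed
  finally show ?thesis .
qed

lemma survival_law:
  assumes "brownian_motion M' y W'" and y: "y \<in> D"
  shows "measure M' {\<omega> \<in> space M'. ereal u < exit_time D W' \<omega>} = 1 - prob {\<omega> \<in> space M. exits y \<omega> \<le> ereal u}"
proof -
  interpret B: exit_problem M' y W' D R \<nu> by standard fact
  have m: "exit_time D W' \<in> borel_measurable M'"
    by (rule exit_time_measurable[OF _ _ open_D]) (auto intro: B.W_measurable B.W_continuous)
  have "{\<omega> \<in> space M'. ereal u < exit_time D W' \<omega>} = space M' - {\<omega> \<in> space M'. exit_time D W' \<omega> \<le> ereal u}" by auto
  moreover have "{\<omega> \<in> space M'. exit_time D W' \<omega> \<le> ereal u} \<in> B.events" using m by measurable
  ultimately show ?thesis using exit_law[OF assms] by (simp add: B.prob_compl)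
qed

text \<open>
  Fubini for the starting point and the random time.
\<close>

lemma integral_survival:
  assumes \<mu>: "prob_space \<mu>" "sets \<mu> = sets borel"
  shows "(LINT y:D|lborel. LINT s|\<mu>. 1 - prob {\<omega> \<in> space M. exits y \<omega> \<le> ereal s}) = measure lborel D - (LINT s|\<mu>. exit_mass s)"
proof -
  interpret \<mu>: prob_space \<mu> by fact
  interpret L: pair_sigma_finite lborel \<mu> by standard
  note [measurable_cong] = \<mu>(2)
  let ?h = "\<lambda>y s. prob {\<omega> \<in> space M. exits y \<omega> \<le> ereal s}"
  have hm: "(\<lambda>(y, s). ?h y s) \<in> borel_measurable (lborel \<Otimes>\<^sub>M \<mu>)"
    using exit_prob_measurable by (simp add: measurable_cong_sets[OF sets_pair_measure_cong[OF sets_lborel \<mu>(2)] refl])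
  have [measurable]: "D \<in> sets lborel" using D_finite(1) unfolding sets_lborel .
  have int: "integrable (lborel \<Otimes>\<^sub>M \<mu>) (\<lambda>(y, s). indicator D y * ?h y s)"
  proof (rule Bochner_Integration.integrable_bound)
    have "emeasure (lborel \<Otimes>\<^sub>M \<mu>) (D \<times> space \<mu>) = emeasure lborel D * emeasure \<mu> (space \<mu>)"
      by (rule \<mu>.emeasure_pair_measure_Times) (use D_finite(1) in simp_all)
    also have "\<dots> < \<infinity>" using D_finite(2) by (simp add: \<mu>.emeasure_space_1)
    finally show "integrable (lborel \<Otimes>\<^sub>M \<mu>) (indicat_real (D \<times> space \<mu>))"
      using D_finite(1) by (intro integrable_real_indicator pair_measureI) auto
    have "(\<lambda>p. indicator D (fst p) * (case p of (y, s) \<Rightarrow> ?h y s)) \<in> borel_measurable (lborel \<Otimes>\<^sub>M \<mu>)"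
      using hm by measurable
    then show "(\<lambda>(y, s). indicator D y * ?h y s) \<in> borel_measurable (lborel \<Otimes>\<^sub>M \<mu>)" by (simp add: case_prod_beta)
    have "norm (indicator D y * ?h y s) \<le> norm (indicat_real (D \<times> space \<mu>) (y, s))" if "s \<in> space \<mu>" for y s
      using that by (cases "y \<in> D") simp_all
    then show "AE p in lborel \<Otimes>\<^sub>M \<mu>. norm (case p of (y, s) \<Rightarrow> indicator D y * ?h y s) \<le> norm (indicat_real (D \<times> space \<mu>) p)"
      by (intro AE_I2) (auto simp only: space_pair_measure split_paired_all prod.case mem_Times_iff fst_conv snd_conv)
  qed
  have hs: "(\<lambda>s. ?h y s) \<in> borel_measurable \<mu>" for y
    using measurable_compose[OF measurable_Pair1' hm, of y] by simp
  have hi: "integrable \<mu> (\<lambda>s. ?h y s)" for y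
    by (rule \<mu>.integrable_const_bound[of _ 1]) (auto intro!: AE_I2 hs)
  have Lm: "(\<lambda>y. LINT s|\<mu>. ?h y s) \<in> borel_measurable lborel"
    by (rule \<mu>.borel_measurable_lebesgue_integral) (rule hm)
  have Li: "set_integrable lborel D (\<lambda>y. LINT s|\<mu>. ?h y s)"
  proof (rule D_integrable)
    show "(LINT s|\<mu>. ?h y s) \<le> 1" for y
      using \<mu>.integral_le_const[OF hi[of y], of 1] by simp
  qed (use Lm in \<open>auto intro!: integral_nonneg_AE\<close>)
  have "(LINT y:D|lborel. LINT s|\<mu>. 1 - ?h y s) = (LINT y:D|lborel. 1 - (LINT s|\<mu>. ?h y s))"
    using hi by (simp add: \<mu>.prob_space)
  also have "\<dots> = measure lborel D - (LINT y:D|lborel. LINT s|\<mu>. ?h y s)"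
    using set_integral_diff(2)[OF integral_D_const(2)[of 1] Li] integral_D_const(1)[of 1] by simp
  also have "(LINT y:D|lborel. LINT s|\<mu>. ?h y s) = (LINT y|lborel. LINT s|\<mu>. indicator D y * ?h y s)"
    unfolding set_lebesgue_integral_def by simp
  also have "\<dots> = (LINT s|\<mu>. LINT y|lborel. indicator D y * ?h y s)"
    by (rule L.Fubini_integral[OF int, symmetric])
  also have "\<dots> = (LINT s|\<mu>. exit_mass s)" unfolding exit_mass_def set_lebesgue_integral_def by simp
  finally show ?thesis .
qed

text \<open>
  At a positive time before the exit time the path is in \<open>D\<close> by definition; time 0 is different
  because the exit time looks at positive times only.
\<close>

lemma subordinate_killed_iff:
  assumes "0 \<le> S t \<omega>"
  shows "subordinate (killed D W') S t \<omega> \<in> Some ` D \<longleftrightarrow> ereal (S t \<omega>) < exit_time D W' \<omega> \<and> (0 < S t \<omega> \<or> W' 0 \<omega> \<in> D)"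
proof (cases "0 < S t \<omega>")
  case True
  have "W' (S t \<omega>) \<omega> \<in> D" if "ereal (S t \<omega>) < exit_time D W' \<omega>"
  proof (rule ccontr)
    assume "W' (S t \<omega>) \<omega> \<notin> D"
    then have "exit_time D W' \<omega> \<le> ereal (S t \<omega>)" unfolding exit_time_def using True by (intro Inf_lower) auto
    then show False using that by simp
  qed
  then show ?thesis using True unfolding subordinate_def killed_def by auto
next
  case False
  then have "S t \<omega> = 0" using assms by simp
  then show ?thesis unfolding subordinate_def killed_def by auto
qed

text \<open>
  The exit time is measurable with respect to the path of \<open>W'\<close> alone, hence independent of
  \<open>S t\<close>, and the probability of \<open>S t < exit_time\<close> is computed by conditioning
  on \<open>S t\<close>. Independent random variables must have a common type, so \<open>S t\<close> is
  regarded as an extended real.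
\<close>

lemma subordinate_survival:
  assumes bm': "brownian_motion M' y W'" and y: "y \<in> D" and S: "stable_subordinator M' \<beta> S"
    and ind: "independent_processes M' W' S" and t: "0 \<le> t"
  shows "measure M' {\<omega> \<in> space M'. subordinate (killed D W') S t \<omega> \<in> Some ` D}
     = (LINT s|distr M' borel (S t). 1 - prob {\<omega> \<in> space M. exits y \<omega> \<le> ereal s})"
proof -
  interpret B: exit_problem M' y W' D R \<nu> by standard fact
  note St = stable_subordinator_law[OF S t]
  note [measurable] = St(1)
  let ?\<tau> = "exit_time D W'"
  have \<tau>m[measurable]: "?\<tau> \<in> borel_measurable M'"
    by (rule exit_time_measurable[OF _ _ open_D]) (auto intro: B.W_measurable B.W_continuous)
  define NW where "NW = vimage_algebra (space M') (\<lambda>\<omega>. \<lambda>t\<in>{0..}. W' t \<omega>) (\<Pi>\<^sub>M t\<in>{0..}. borel)"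
  define NS where "NS = vimage_algebra (space M') (\<lambda>\<omega>. \<lambda>t\<in>{0..}. S t \<omega>) (\<Pi>\<^sub>M t\<in>{0..}. borel)"
  have ind': "B.indep_set (sets NW) (sets NS)" using ind unfolding independent_processes_def NW_def NS_def .
  have spW: "space NW = space M'" and spS: "space NS = space M'" unfolding NW_def NS_def by simp_all
  have Wm: "W' s \<in> borel_measurable NW" if "0 \<le> s" for s
  proof -
    have "(\<lambda>\<omega>. \<lambda>t\<in>{0..}. W' t \<omega>) \<in> measurable NW (\<Pi>\<^sub>M t\<in>{0..}. borel)"
      unfolding NW_def by (rule measurable_vimage_algebra1) (auto simp: space_PiM)
    from measurable_compose[OF this measurable_component_singleton[of s]] show ?thesis using that by simp
  qed
  have Sm: "S t \<in> borel_measurable NS"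
  proof -
    have "(\<lambda>\<omega>. \<lambda>t\<in>{0..}. S t \<omega>) \<in> measurable NS (\<Pi>\<^sub>M t\<in>{0..}. borel)"
      unfolding NS_def by (rule measurable_vimage_algebra1) (auto simp: space_PiM)
    from measurable_compose[OF this measurable_component_singleton[of t]] show ?thesis using t by simp
  qed
  have \<tau>NW: "?\<tau> \<in> borel_measurable NW"
    by (rule exit_time_measurable[OF Wm _ open_D]) (auto simp: spW intro: B.W_continuous)
  let ?S = "\<lambda>\<omega>. ereal (S t \<omega>)"
  have SNS: "?S \<in> borel_measurable NS" using Sm by measurable
  let ?AS = "sigma_sets (space M') {?S -` A \<inter> space M' |A. A \<in> sets borel}"
  let ?AT = "sigma_sets (space M') {?\<tau> -` A \<inter> space M' |A. A \<in> sets borel}"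
  have sub: "?AS \<subseteq> sets NS" "?AT \<subseteq> sets NW"
    using sets.sigma_sets_subset[of "{?S -` A \<inter> space M' |A. A \<in> sets borel}" NS]
      sets.sigma_sets_subset[of "{?\<tau> -` A \<inter> space M' |A. A \<in> sets borel}" NW]
      measurable_sets[OF SNS] measurable_sets[OF \<tau>NW] unfolding spS spW by auto
  have "B.indep_sets (case_bool (sets NW) (sets NS)) UNIV" using ind' unfolding B.indep_set_def .
  then have "\<And>b. case_bool (sets NW) (sets NS) b \<subseteq> B.events" unfolding B.indep_sets_def by blast
  from this[of True] this[of False] have ev: "sets NW \<subseteq> B.events" "sets NS \<subseteq> B.events" by auto
  have "B.indep_set ?AS ?AT"
  proof (rule B.indep_setI)
    show "?AS \<subseteq> B.events" "?AT \<subseteq> B.events" using sub ev by auto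
    fix a b assume "a \<in> ?AS" "b \<in> ?AT"
    then have "b \<in> sets NW" "a \<in> sets NS" using sub by blast+
    from B.indep_setD[OF ind' this] show "B.prob (a \<inter> b) = B.prob a * B.prob b" by (simp add: Int_commute mult.commute)
  qed
  then have "B.indep_var borel ?S borel ?\<tau>" unfolding B.indep_var_eq using \<tau>m by simp
  then have prod: "distr M' borel ?S \<Otimes>\<^sub>M distr M' borel ?\<tau> = distr M' (borel \<Otimes>\<^sub>M borel) (\<lambda>\<omega>. (?S \<omega>, ?\<tau> \<omega>))"
    unfolding B.indep_var_distribution_eq by blast
  let ?\<mu> = "distr M' borel (S t)"
  interpret \<mu>: prob_space ?\<mu> by (rule B.prob_space_distr[OF St(1)])
  interpret T: prob_space "distr M' borel ?\<tau>" by (rule B.prob_space_distr[OF \<tau>m])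
  let ?Q = "{p \<in> space (borel \<Otimes>\<^sub>M borel). (fst p :: ereal) < snd p}"
  have Q: "?Q \<in> sets (borel \<Otimes>\<^sub>M borel)" by (rule borel_measurable_less) measurable
  have "?Q \<in> sets (borel \<Otimes>\<^sub>M distr M' borel ?\<tau>)"
    unfolding sets_pair_measure_cong[OF refl sets_distr] by (rule Q)
  then have Qm: "(\<lambda>r. emeasure (distr M' borel ?\<tau>) (Pair r -` ?Q)) \<in> borel_measurable borel"
    by (rule T.measurable_emeasure_Pair)
  let ?g = "\<lambda>s. 1 - prob {\<omega> \<in> space M. exits y \<omega> \<le> ereal s}"
  have hs: "(\<lambda>s. prob {\<omega> \<in> space M. exits y \<omega> \<le> ereal s}) \<in> borel_measurable borel"
    using measurable_compose[OF measurable_Pair1' exit_prob_measurable, of y] by simp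
  have "{\<omega> \<in> space M'. subordinate (killed D W') S t \<omega> \<in> Some ` D}
     = {\<omega> \<in> space M'. ereal (S t \<omega>) < ?\<tau> \<omega> \<and> (0 < S t \<omega> \<or> W' 0 \<omega> \<in> D)}"
    using subordinate_killed_iff[of S t _ W'] St(3) by blast
  then have "B.prob {\<omega> \<in> space M'. subordinate (killed D W') S t \<omega> \<in> Some ` D}
     = B.prob {\<omega> \<in> space M'. ereal (S t \<omega>) < ?\<tau> \<omega> \<and> (0 < S t \<omega> \<or> W' 0 \<omega> \<in> D)}" by simp
  also have "\<dots> = B.prob {\<omega> \<in> space M'. ereal (S t \<omega>) < ?\<tau> \<omega>}"
  proof (rule B.finite_measure_eq_AE)
    show "AE \<omega> in M'. (\<omega> \<in> {\<omega> \<in> space M'. ereal (S t \<omega>) < ?\<tau> \<omega> \<and> (0 < S t \<omega> \<or> W' 0 \<omega> \<in> D)}) = (\<omega> \<in> {\<omega> \<in> space M'. ereal (S t \<omega>) < ?\<tau> \<omega>})"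
      using B.W_start by eventually_elim (use y in simp)
    have [measurable]: "W' 0 \<in> borel_measurable M'" "D \<in> sets borel" using B.W_measurable[of 0] D_finite by auto
    show "{\<omega> \<in> space M'. ereal (S t \<omega>) < ?\<tau> \<omega> \<and> (0 < S t \<omega> \<or> W' 0 \<omega> \<in> D)} \<in> B.events" by measurable
    show "{\<omega> \<in> space M'. ereal (S t \<omega>) < ?\<tau> \<omega>} \<in> B.events" by measurable
  qed
  finally have eq: "B.prob {\<omega> \<in> space M'. subordinate (killed D W') S t \<omega> \<in> Some ` D} = B.prob {\<omega> \<in> space M'. ereal (S t \<omega>) < ?\<tau> \<omega>}" .
  have "ennreal (B.prob {\<omega> \<in> space M'. ereal (S t \<omega>) < ?\<tau> \<omega>}) = emeasure (distr M' (borel \<Otimes>\<^sub>M borel) (\<lambda>\<omega>. (?S \<omega>, ?\<tau> \<omega>))) ?Q"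
    by (subst emeasure_distr[OF _ Q]) (auto simp: B.emeasure_eq_measure space_pair_measure intro!: arg_cong[where f="measure M'"])
  also have "\<dots> = (\<integral>\<^sup>+r. emeasure (distr M' borel ?\<tau>) (Pair r -` ?Q) \<partial>distr M' borel ?S)"
    unfolding prod[symmetric] by (rule T.emeasure_pair_measure_alt) (use Q in simp)
  also have "distr M' borel ?S = distr ?\<mu> borel ereal" by (subst distr_distr) (auto simp: comp_def)
  also have "(\<integral>\<^sup>+r. emeasure (distr M' borel ?\<tau>) (Pair r -` ?Q) \<partial>distr ?\<mu> borel ereal)
      = (\<integral>\<^sup>+s. emeasure (distr M' borel ?\<tau>) (Pair (ereal s) -` ?Q) \<partial>?\<mu>)"
    by (rule nn_integral_distr) (use Qm in simp_all)
  also have "\<dots> = (\<integral>\<^sup>+s. ennreal (?g s) \<partial>?\<mu>)"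
  proof (rule nn_integral_cong)
    fix s :: real
    have "Pair (ereal s) -` ?Q = {ereal s<..}" by (auto simp: space_pair_measure)
    moreover have "emeasure (distr M' borel ?\<tau>) {ereal s<..} = ennreal (B.prob {\<omega> \<in> space M'. ereal s < ?\<tau> \<omega>})"
      by (subst emeasure_distr[OF \<tau>m]) (auto simp: B.emeasure_eq_measure intro!: arg_cong[where f="measure M'"])
    ultimately show "emeasure (distr M' borel ?\<tau>) (Pair (ereal s) -` ?Q) = ennreal (?g s)"
      unfolding survival_law[OF bm' y] by simp
  qed
  also have "\<dots> = ennreal (LINT s|?\<mu>. ?g s)"
  proof (rule nn_integral_eq_integral)
    show "integrable ?\<mu> ?g" using hs by (intro \<mu>.integrable_const_bound[of _ 1] AE_I2) auto
  qed simp
  finally have "ennreal (B.prob {\<omega> \<in> space M'. ereal (S t \<omega>) < ?\<tau> \<omega>}) = ennreal (LINT s|?\<mu>. ?g s)" .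
  then show ?thesis unfolding eq
    by (subst (asm) ennreal_inj) (auto intro!: integral_nonneg_AE)
qed

text \<open>
  Near 0 by the limit, elsewhere because \<open>exit_mass\<close> is bounded by the volume of
  \<open>D\<close>.
\<close>

lemma exit_mass_sqrt_bound:
  assumes "((\<lambda>u. exit_mass u / sqrt u) \<longlongrightarrow> c) (at_right 0)"
  obtains C where "0 < C" "\<And>s. 0 \<le> s \<Longrightarrow> exit_mass s \<le> C * sqrt s"
proof -
  have "eventually (\<lambda>u. dist (exit_mass u / sqrt u) c < 1) (at_right 0)" using assms by (rule tendstoD) simp
  then obtain d where d: "0 < d" "\<And>u. 0 < u \<Longrightarrow> u < d \<Longrightarrow> \<bar>exit_mass u / sqrt u - c\<bar> < 1"
    unfolding eventually_at_right_field by (auto simp: dist_real_def)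
  let ?C = "\<bar>c\<bar> + 1 + measure lborel D / sqrt d"
  show thesis
  proof (rule that[of ?C])
    show "0 < ?C" using d(1) by (simp add: add.assoc add_nonneg_pos add_pos_nonneg)
    fix s :: real assume s0: "0 \<le> s"
    consider "s = 0" | "0 < s" "s < d" | "d \<le> s" using s0 by linarith
    then show "exit_mass s \<le> ?C * sqrt s"
    proof cases
      case 1
      then show ?thesis using exit_mass_props(4)[of 0] by simp
    next
      case 2
      have "exit_mass s / sqrt s \<le> \<bar>c\<bar> + 1" using d(2)[OF 2] by linarith
      also have "\<dots> \<le> ?C" using d(1) by simp
      finally show ?thesis using 2 by (simp add: pos_divide_le_eq)
    next
      case 3
      have "exit_mass s \<le> measure lborel D * 1" using exit_mass_props(3) by simp
      also have "\<dots> \<le> measure lborel D * (sqrt s / sqrt d)" using 3 d(1) by (intro mult_left_mono) auto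
      also have "\<dots> = measure lborel D / sqrt d * sqrt s" by simp
      also have "\<dots> \<le> ?C * sqrt s" using s0 by (intro mult_right_mono) auto
      finally show ?thesis .
    qed
  qed
qed

lemma exit_mass_measurable: "exit_mass \<in> borel_measurable borel"
  using exit_mass_props(1) by (rule borel_measurable_mono)

end

section \<open>Small-time asymptotics\<close>

lemma cut_rate_limit_root:
  assumes \<alpha>: "1 < \<alpha>"
  shows "((\<lambda>t. cut_rate (\<alpha> / 2) t / t powr (1 / \<alpha>)) \<longlongrightarrow> 2 * Gamma (1 - 1 / \<alpha>)) (at_right 0)"
    and "((\<lambda>t. t / t powr (1 / \<alpha>)) \<longlongrightarrow> 0) (at_right 0)"
proof -
  have ev0: "\<forall>\<^sub>F t in at_right (0::real). 0 \<le> t" by (rule eventually_mono[OF eventually_at_right_less]) simp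
  have p: "0 < 1 - 1 / \<alpha>" using \<alpha> by simp
  have q: "t / t powr (1 / \<alpha>) = t powr (1 - 1 / \<alpha>)" if "0 < t" for t using that by (simp add: powr_diff)
  have "((\<lambda>t::real. t powr (1 - 1 / \<alpha>)) \<longlongrightarrow> 0 powr (1 - 1 / \<alpha>)) (at_right 0)"
    by (intro tendsto_powr' tendsto_ident_at tendsto_const disjI2 conjI p ev0)
  then have "((\<lambda>t::real. t powr (1 - 1 / \<alpha>)) \<longlongrightarrow> 0) (at_right 0)" by simp
  then show lim0: "((\<lambda>t. t / t powr (1 / \<alpha>)) \<longlongrightarrow> 0) (at_right 0)"
  proof (rule Lim_transform_eventually)
    show "\<forall>\<^sub>F t in at_right 0. t powr (1 - 1 / \<alpha>) = t / t powr (1 / \<alpha>)"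
      using eventually_at_right_less[of "0::real"] by eventually_elim (simp add: q)
  qed
  let ?G = "2 * Gamma (1 - 1 / \<alpha>)"
  have b: "?G * t powr (1 / \<alpha>) - t / (\<alpha> / 2 - 1 / 2) \<le> cut_rate (\<alpha> / 2) t" "cut_rate (\<alpha> / 2) t \<le> ?G * t powr (1 / \<alpha>)" if "0 < t" for t
    using cut_rate_bounds(1,2)[of "\<alpha> / 2" t] \<alpha> that by simp_all
  show "((\<lambda>t. cut_rate (\<alpha> / 2) t / t powr (1 / \<alpha>)) \<longlongrightarrow> ?G) (at_right 0)"
  proof (rule tendsto_sandwich)
    have "((\<lambda>t. ?G - 1 / (\<alpha> / 2 - 1 / 2) * (t / t powr (1 / \<alpha>))) \<longlongrightarrow> ?G - 1 / (\<alpha> / 2 - 1 / 2) * 0) (at_right 0)"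
      by (intro tendsto_diff tendsto_mult tendsto_const lim0)
    then show "((\<lambda>t. ?G - 1 / (\<alpha> / 2 - 1 / 2) * (t / t powr (1 / \<alpha>))) \<longlongrightarrow> ?G) (at_right 0)" by simp
    show "\<forall>\<^sub>F t in at_right 0. ?G - 1 / (\<alpha> / 2 - 1 / 2) * (t / t powr (1 / \<alpha>)) \<le> cut_rate (\<alpha> / 2) t / t powr (1 / \<alpha>)"
      using eventually_at_right_less[of "0::real"]
    proof eventually_elim
      case (elim t)
      then have z: "0 < t powr (1 / \<alpha>)" by simp
      have "(?G * t powr (1 / \<alpha>) - t / (\<alpha> / 2 - 1 / 2)) / t powr (1 / \<alpha>) \<le> cut_rate (\<alpha> / 2) t / t powr (1 / \<alpha>)"
        using b(1)[OF elim] z by (intro divide_right_mono) auto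
      moreover have "(?G * t powr (1 / \<alpha>) - t / (\<alpha> / 2 - 1 / 2)) / t powr (1 / \<alpha>) = ?G - 1 / (\<alpha> / 2 - 1 / 2) * (t / t powr (1 / \<alpha>))"
        using z by (simp add: diff_divide_distrib)
      ultimately show ?case by simp
    qed
    show "\<forall>\<^sub>F t in at_right 0. cut_rate (\<alpha> / 2) t / t powr (1 / \<alpha>) \<le> ?G"
      using eventually_at_right_less[of "0::real"]
      by eventually_elim (use b(2) in \<open>simp add: pos_divide_le_eq\<close>)
  qed simp
qed

lemma cut_rate_limit_log:
  shows "((\<lambda>t. cut_rate (1 / 2) t / (t * ln (1 / t))) \<longlongrightarrow> 2) (at_right 0)"
    and "((\<lambda>t::real. t / (t * ln (1 / t))) \<longlongrightarrow> 0) (at_right 0)"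
    and "\<forall>\<^sub>F t in at_right (0::real). 0 < t * ln (1 / t)"
proof -
  have unit: "\<forall>\<^sub>F t in at_right (0::real). 0 < t \<and> t < 1"
    by (rule eventually_mono[OF eventually_at_right_real[OF zero_less_one]]) simp
  have l: "0 < ln (1 / t)" if "0 < t \<and> t < 1" for t :: real using that by (simp add: ln_div)
  have top: "filterlim (\<lambda>t::real. ln (1 / t)) at_top (at_right 0)"
  proof -
    have "filterlim (\<lambda>t::real. ln (inverse t)) at_top (at_right 0)"
      by (rule filterlim_compose[OF ln_at_top filterlim_inverse_at_top_right])
    then show ?thesis by (simp add: inverse_eq_divide)
  qed
  have inv: "((\<lambda>t::real. 1 / ln (1 / t)) \<longlongrightarrow> 0) (at_right 0)"
    using tendsto_inverse_0_at_top[OF top] by (simp add: inverse_eq_divide)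
  have q: "t / (t * ln (1 / t)) = 1 / ln (1 / t)" if "0 < t \<and> t < 1" for t :: real using that by simp
  show "((\<lambda>t::real. t / (t * ln (1 / t))) \<longlongrightarrow> 0) (at_right 0)"
    using inv by (rule Lim_transform_eventually) (use unit in eventually_elim, use q in simp)
  show "\<forall>\<^sub>F t in at_right (0::real). 0 < t * ln (1 / t)"
    using unit by eventually_elim (intro mult_pos_pos l, auto)
  show "((\<lambda>t. cut_rate (1 / 2) t / (t * ln (1 / t))) \<longlongrightarrow> 2) (at_right 0)"
  proof (rule tendsto_sandwich)
    have "((\<lambda>t. 2 - 1 / ln (1 / t)) \<longlongrightarrow> 2 - 0) (at_right (0::real))" "((\<lambda>t. 2 + 2 * (1 / ln (1 / t))) \<longlongrightarrow> 2 + 2 * 0) (at_right (0::real))"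
      by (intro tendsto_add tendsto_diff tendsto_mult tendsto_const inv)+
    then show "((\<lambda>t. 2 - 1 / ln (1 / t)) \<longlongrightarrow> 2) (at_right (0::real))" "((\<lambda>t. 2 + 2 * (1 / ln (1 / t))) \<longlongrightarrow> 2) (at_right (0::real))" by simp_all
    show "\<forall>\<^sub>F t in at_right 0. 2 - 1 / ln (1 / t) \<le> cut_rate (1 / 2) t / (t * ln (1 / t))"
      using unit
    proof eventually_elim
      case (elim t)
      then have z: "0 < t * ln (1 / t)" using l by simp
      have "(2 - 1 / ln (1 / t)) * (t * ln (1 / t)) = 2 * t * ln (1 / t) - t" using l[OF elim] by (simp add: field_simps)
      also have "\<dots> \<le> cut_rate (1 / 2) t" using cut_rate_half_bounds(2) elim by blast
      finally show ?case using z by (simp add: pos_le_divide_eq)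
    qed
    show "\<forall>\<^sub>F t in at_right 0. cut_rate (1 / 2) t / (t * ln (1 / t)) \<le> 2 + 2 * (1 / ln (1 / t))"
      using unit
    proof eventually_elim
      case (elim t)
      then have z: "0 < t * ln (1 / t)" using l by simp
      have "cut_rate (1 / 2) t \<le> 2 * t * ln (1 / t) + 2 * t" using cut_rate_half_bounds(1) elim by blast
      also have "\<dots> = (2 + 2 * (1 / ln (1 / t))) * (t * ln (1 / t))" using l[OF elim] by (simp add: field_simps)
      finally show ?case using z by (simp add: pos_divide_le_eq)
    qed
  qed
qed

text \<open>
  The three cases reflect the average of the square root under the law of \<open>S t\<close>. For
  \<open>\<alpha> > 1\<close> it is finite and scales like \<open>t powr (1 / \<alpha>)\<close>, which
  also explains the second form of the constant; for \<open>\<alpha> = 1\<close> it diverges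
  logarithmically and the bounded function \<open>cut_root\<close> takes its place; for
  \<open>\<alpha> < 1\<close> the jumps of macroscopic size dominate.
\<close>

theorem theorem1p1:
  fixes \<alpha> :: real
    and D :: "'v::euclidean_space set"
    and P :: "'v \<Rightarrow> 'a measure"
    and W :: "real \<Rightarrow> 'a \<Rightarrow> 'v"
    and S :: "real \<Rightarrow> 'a \<Rightarrow> real"
  assumes "0 < \<alpha>" and "\<alpha> < 2"
    and "(DIM('v) = 1 \<and> (\<exists>a b. D = box a b \<and> box a b \<noteq> {})) \<or>
         (DIM('v) \<ge> 2 \<and> C11_open D \<and> connected D \<and> bounded D)"
    and "\<And>x. brownian_motion (P x) x W"
    and "\<And>x. stable_subordinator (P x) (\<alpha> / 2) S"
    and "\<And>x. independent_processes (P x) W S"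
  shows
    "(1 < \<alpha> \<longrightarrow>
        ((\<lambda>t. (measure lborel D - subordinate_heat_content P W S D t) / rate \<alpha> t)
           \<longlongrightarrow> 2 / pi * Gamma (1 - 1 / \<alpha>) * boundary_measure D) (at_right 0) \<and>
        (\<forall>x. integrable (P x) (\<lambda>\<omega>. sqrt (S 1 \<omega>)) \<and>
             2 / pi * Gamma (1 - 1 / \<alpha>) * boundary_measure D =
             2 * boundary_measure D / sqrt pi * (LINT \<omega>|P x. sqrt (S 1 \<omega>)))) \<and>
     (\<alpha> = 1 \<longrightarrow>
        ((\<lambda>t. (measure lborel D - subordinate_heat_content P W S D t) / rate \<alpha> t)
           \<longlongrightarrow> 2 / pi * boundary_measure D) (at_right 0)) \<and>
     (\<alpha> < 1 \<longrightarrow>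
        set_integrable lborel {0<..}
          (\<lambda>u. (measure lborel D - heat_content P W D u) *
                (\<alpha> / (2 * Gamma (1 - \<alpha> / 2))) * u powr (- 1 - \<alpha> / 2)) \<and>
        ((\<lambda>t. (measure lborel D - subordinate_heat_content P W S D t) / rate \<alpha> t)
           \<longlongrightarrow> (LINT u:{0<..}|lborel. (measure lborel D - heat_content P W D u) *
                (\<alpha> / (2 * Gamma (1 - \<alpha> / 2))) * u powr (- 1 - \<alpha> / 2))) (at_right 0))"
proof -
  define \<kappa> where "\<kappa> = boundary_measure D"
  from smooth_domain_collar[OF assms(3)] obtain R \<nu>
    where tb: "tangent_balls D R \<nu>"
      and col: "((\<lambda>r. measure lborel {x \<in> D. infdist x (- D) < r} / r) \<longlongrightarrow> \<kappa>) (at_right 0)"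
    unfolding \<kappa>_def by blast
  interpret tangent_balls D R \<nu> by (rule tb)
  interpret E: exit_problem "P 0" 0 W D R \<nu> by standard (rule assms(4))
  have "((\<lambda>r. measure lborel (collar r) / r) \<longlongrightarrow> \<kappa>) (at_right 0)" using col unfolding collar_def depth_def .
  from E.exit_mass_limit[OF this]
  have lim: "((\<lambda>u. E.exit_mass u / sqrt u) \<longlongrightarrow> 2 * \<kappa> / sqrt pi) (at_right 0)" .
  define \<mu> where "\<mu> t = distr (P 0) borel (S t)" for t
  have law: "stable_law (\<alpha> / 2) t (\<mu> t)" if "0 < t" for t
    unfolding \<mu>_def by (rule stable_subordinator_law(2)[OF assms(5)]) (use that in simp)
  have heat: "measure lborel D - heat_content P W D u = E.exit_mass u" for u
  proof -
    have "heat_content P W D u = (LINT x:D|lborel. 1 - E.prob {\<omega> \<in> space (P 0). E.exits x \<omega> \<le> ereal u})"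
      unfolding heat_content_def using E.survival_law[OF assms(4)] E.D_finite(1)
      by (intro set_lebesgue_integral_cong) auto
    also have "\<dots> = (LINT x:D|lborel. 1) - E.exit_mass u"
      unfolding E.exit_mass_def by (rule set_integral_diff(2)[OF E.integral_D_const(2) E.exit_prob_integrable])
    finally show ?thesis unfolding E.integral_D_const by simp
  qed
  have sub: "measure lborel D - subordinate_heat_content P W S D t = (LINT s|\<mu> t. E.exit_mass s)" if t: "0 < t" for t
  proof -
    \<comment> \<open>The law of \<open>S t\<close> is the same under every \<open>P x\<close>, since its Laplace transform is.\<close>
    have same: "distr (P x) borel (S t) = \<mu> t" for x
      using stable_law_unique[OF stable_subordinator_law(2)[OF assms(5)] law[OF t]] t by simp
    have "subordinate_heat_content P W S D t
        = (LINT x:D|lborel. LINT s|\<mu> t. 1 - E.prob {\<omega> \<in> space (P 0). E.exits x \<omega> \<le> ereal s})"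
      unfolding subordinate_heat_content_def
      using E.subordinate_survival[OF assms(4) _ assms(5,6)] same t E.D_finite(1)
      by (intro set_lebesgue_integral_cong) auto
    also have "\<dots> = measure lborel D - (LINT s|\<mu> t. E.exit_mass s)"
      by (rule E.integral_survival) (use law[OF t] in \<open>auto simp: stable_law_def\<close>)
    finally show ?thesis by simp
  qed
  have transfer: "((\<lambda>t. (measure lborel D - subordinate_heat_content P W S D t) / rate \<alpha> t) \<longlongrightarrow> l) (at_right 0)"
    if "((\<lambda>t. (LINT s|\<mu> t. E.exit_mass s) / f t) \<longlongrightarrow> l) (at_right 0)" "\<And>t. rate \<alpha> t = f t" for l f
    using that(1)
  proof (rule Lim_transform_eventually)
    show "\<forall>\<^sub>F t in at_right 0. (LINT s|\<mu> t. E.exit_mass s) / f t = (measure lborel D - subordinate_heat_content P W S D t) / rate \<alpha> t"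
      using eventually_at_right_less[of "0::real"] by eventually_elim (simp add: sub that(2))
  qed
  have H: "0 \<le> E.exit_mass s \<and> E.exit_mass s \<le> measure lborel D" "E.exit_mass 0 = 0" for s
    using E.exit_mass_props by auto
  have root: "((\<lambda>t. (measure lborel D - subordinate_heat_content P W S D t) / rate \<alpha> t)
      \<longlongrightarrow> 2 / pi * Gamma (1 - 1 / \<alpha>) * boundary_measure D) (at_right 0)" if \<alpha>: "1 < \<alpha>"
  proof -
    have "((\<lambda>t. (LINT s|\<mu> t. E.exit_mass s) / t powr (1 / \<alpha>))
        \<longlongrightarrow> (2 * \<kappa> / sqrt pi) / (2 * sqrt pi) * (2 * Gamma (1 - 1 / \<alpha>))) (at_right 0)"
    proof (rule subordinated_limit_root[OF law E.exit_mass_measurable H lim])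
      show "\<forall>\<^sub>F t in at_right 0. (\<integral>\<^sup>+q. ennreal ((1 - exp (- t * q powr (\<alpha> / 2))) * q powr (- 3 / 2)) * indicator {1<..} q \<partial>lborel) = ennreal (cut_rate (\<alpha> / 2) t)"
        using eventually_at_right_less[of "0::real"] by eventually_elim (rule cut_rate_bounds(3), use \<alpha> in auto)
      show "\<forall>\<^sub>F t in at_right 0. 0 < t powr (1 / \<alpha>)"
        using eventually_at_right_less[of "0::real"] by eventually_elim simp
    qed (use cut_rate_limit_root[OF \<alpha>] in auto)
    also have "(2 * \<kappa> / sqrt pi) / (2 * sqrt pi) * (2 * Gamma (1 - 1 / \<alpha>)) = 2 / pi * Gamma (1 - 1 / \<alpha>) * boundary_measure D"
      unfolding \<kappa>_def by (simp add: field_simps)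
    finally show ?thesis by (rule transfer) (simp add: rate_def \<alpha>)
  qed
  have moment: "integrable (P x) (\<lambda>\<omega>. sqrt (S 1 \<omega>)) \<and>
      2 / pi * Gamma (1 - 1 / \<alpha>) * boundary_measure D = 2 * boundary_measure D / sqrt pi * (LINT \<omega>|P x. sqrt (S 1 \<omega>))"
    if \<alpha>: "1 < \<alpha>" for x
  proof -
    note S1 = stable_subordinator_law[OF assms(5)[of x], of 1]
    note [measurable] = S1(1)[OF zero_le_one]
    interpret stable_law_loc "\<alpha> / 2" 1 "distr (P x) borel (S 1)" by standard (rule S1(2), simp)
    have "has_bochner_integral (distr (P x) borel (S 1)) sqrt (Gamma (1 - 1 / \<alpha>) / sqrt pi)"
      using integral_sqrt \<alpha> by simp
    then have "integrable (P x) (\<lambda>\<omega>. sqrt (S 1 \<omega>))" "(LINT \<omega>|P x. sqrt (S 1 \<omega>)) = Gamma (1 - 1 / \<alpha>) / sqrt pi"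
      by (auto simp: has_bochner_integral_iff integrable_distr_eq integral_distr)
    then show ?thesis by simp
  qed
  have log: "((\<lambda>t. (measure lborel D - subordinate_heat_content P W S D t) / rate \<alpha> t)
      \<longlongrightarrow> 2 / pi * boundary_measure D) (at_right 0)" if \<alpha>: "\<alpha> = 1"
  proof -
    have law1: "stable_law (1 / 2) t (\<mu> t)" if "0 < t" for t using law[OF that] \<alpha> by simp
    have "((\<lambda>t. (LINT s|\<mu> t. E.exit_mass s) / (t * ln (1 / t)))
        \<longlongrightarrow> (2 * \<kappa> / sqrt pi) / (2 * sqrt pi) * 2) (at_right 0)"
    proof (rule subordinated_limit_root[OF law1 E.exit_mass_measurable H lim])
      show "\<forall>\<^sub>F t in at_right 0. (\<integral>\<^sup>+q. ennreal ((1 - exp (- t * q powr (1 / 2))) * q powr (- 3 / 2)) * indicator {1<..} q \<partial>lborel) = ennreal (cut_rate (1 / 2) t)"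
        using eventually_at_right_real[OF zero_less_one] by eventually_elim (rule cut_rate_half_bounds(3), auto)
    qed (use cut_rate_limit_log in auto)
    also have "(2 * \<kappa> / sqrt pi) / (2 * sqrt pi) * 2 = 2 / pi * boundary_measure D"
      unfolding \<kappa>_def by (simp add: field_simps)
    finally show ?thesis by (rule transfer) (simp add: rate_def \<alpha>)
  qed
  have levy: "set_integrable lborel {0<..}
      (\<lambda>u. (measure lborel D - heat_content P W D u) * (\<alpha> / (2 * Gamma (1 - \<alpha> / 2))) * u powr (- 1 - \<alpha> / 2)) \<and>
    ((\<lambda>t. (measure lborel D - subordinate_heat_content P W S D t) / rate \<alpha> t)
      \<longlongrightarrow> (LINT u:{0<..}|lborel. (measure lborel D - heat_content P W D u) *
        (\<alpha> / (2 * Gamma (1 - \<alpha> / 2))) * u powr (- 1 - \<alpha> / 2))) (at_right 0)" if \<alpha>: "\<alpha> < 1"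
  proof -
    obtain C where C: "0 < C" "\<And>s. 0 \<le> s \<Longrightarrow> E.exit_mass s \<le> C * sqrt s"
      using E.exit_mass_sqrt_bound[OF lim] by blast
    have \<beta>: "0 < \<alpha> / 2" "\<alpha> / 2 < 1 / 2" using assms(1) \<alpha> by auto
    note L = subordinated_limit_levy[OF \<beta> law E.exit_mass_props(1,4) C(2) E.exit_mass_props(3) C(1)]
    have eq: "(\<lambda>u. indicator {0<..} u *\<^sub>R ((measure lborel D - heat_content P W D u) * (\<alpha> / (2 * Gamma (1 - \<alpha> / 2))) * u powr (- 1 - \<alpha> / 2)))
        = (\<lambda>s. E.exit_mass s * levy_density (\<alpha> / 2) s)"
      by (rule ext) (simp add: heat levy_density_def)
    show ?thesis unfolding set_integrable_def set_lebesgue_integral_def eq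
    proof (intro conjI)
      show "integrable lborel (\<lambda>s. E.exit_mass s * levy_density (\<alpha> / 2) s)" by (rule L(1))
      show "((\<lambda>t. (measure lborel D - subordinate_heat_content P W S D t) / rate \<alpha> t)
          \<longlongrightarrow> (LINT s|lborel. E.exit_mass s * levy_density (\<alpha> / 2) s)) (at_right 0)"
        by (rule transfer[OF L(2)]) (use \<alpha> in \<open>simp_all add: rate_def\<close>)
    qed
  qed
  show ?thesis by (intro conjI[OF impI[OF conjI[OF root allI[OF moment]]] conjI[OF impI[OF log] impI[OF levy]]])
qed

end
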